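(* Let $X$ be a normal algebraic variety over $k$ and let $\mathcal E$ and $\mathcal E'$ be two reflexive sheaves on $X$ with Weil decorations $\mathcal W=\mathcal W_{\mathcal E}$ and $\mathcal W'=\mathcal W_{\mathcal E'}$. (i) If $\mathcal E'$ is the kernel of a morphism $\mathcal E\to\mathcal E''$ of $\mathcal O_X$-modules with $\mathcal E''$ torsion-free, then $\mathcal W'=\mathcal W|_{\mathcal E'_\eta}$. (ii) If $\mu\colon\mathcal E\to\mathcal E'$ is a surjective morphism of $\mathcal O_X$-modules, then for every $e'\in\mathcal E'_\eta$ and every prime divisor $P$ of $X$, $$\mathcal W'(e')_P=\max_{e\in\mu_\eta^{-1}(e')}\mathcal W(e)_P .$$
   Context: Conventions: $k$ is an algebraically closed field of characteristic $0$. A normal algebraic variety over $k$ is a normal, separated, integral scheme of finite type over $k$. Let $\eta$ be the generic point and $K=K(X)$ the function field of $X$. $\mathrm{Div}(X)$ is the group of Weil divisors; $D_P$ denotes the coefficient of $D$ at a prime divisor $P$. A formal value $\infty$, larger than every divisor (respectively every integer), is adjoined. A coherent sheaf is reflexive if the natural map to its double dual is an isomorphism. For a Weil divisor $D$, $\mathcal O_X(D)\subseteq K$ is the sheaf $\mathcal O_X(D)(U)=\{f\in K^*\mid (D+\mathrm{div}(f))|_U\ge0\}\cup\{0\}$. Weil decoration of a reflexive sheaf $\mathcal E$: since $\mathcal E$ is torsion-free, it is regarded as a subsheaf of the constant sheaf given by its generic stalk $\mathcal E_\eta$ (a finite-dimensional $K$-vector space). For $0\ne e\in\mathcal E_\eta$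 let $\mathcal E(e)(U)=(K\cdot e)\cap\mathcal E(U)$; this is a reflexive rank one sheaf, and there is a unique Weil divisor $D(e)$ with $\mathcal O_X(D(e))=\frac1e\cdot\mathcal E(e)\subseteq K$. One sets $\mathcal W_{\mathcal E}(e)=D(e)$ for $e\neq0$ and $\mathcal W_{\mathcal E}(0)=\infty$. For a kernel $\mathcal E'\subseteq\mathcal E$ one regards $\mathcal E'_\eta\subseteq\mathcal E_\eta$. For a morphism $\mu\colon\mathcal E\to\mathcal E'$, $\mu_\eta\colon\mathcal E_\eta\to\mathcal E'_\eta$ is the induced $K$-linear map on generic stalks. *)

theory Defs
  imports "HOL-Analysis.Abstract_Topology" "HOL-Algebra.Algebra" "HOL-Library.Extended"
begin

section \<open>Sheaves, germs and ringed spaces\<close>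

text \<open>
  A (pre)sheaf on a topological space \<open>T\<close> is given by the sets of sections \<open>C U\<close> and the
  restriction maps \<open>r U V\<close> (from \<open>U\<close> to the smaller open set \<open>V\<close>); only their values at open
  sets matter. The empty cover is included in the gluing condition, so \<open>C {}\<close> is a singleton.
\<close>

definition sheaf_of_sets ::
    "'p topology \<Rightarrow> ('p set \<Rightarrow> 's set) \<Rightarrow> ('p set \<Rightarrow> 'p set \<Rightarrow> 's \<Rightarrow> 's) \<Rightarrow> bool" where
  "sheaf_of_sets T C r \<longleftrightarrow>
     (\<forall>U V. openin T U \<and> openin T V \<and> V \<subseteq> U \<longrightarrow> r U V \<in> C U \<rightarrow> C V) \<and>
     (\<forall>U. openin T U \<longrightarrow> (\<forall>s\<in>C U. r U U s = s)) \<and>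
     (\<forall>U V W. openin T U \<and> openin T V \<and> openin T W \<and> W \<subseteq> V \<and> V \<subseteq> U \<longrightarrow>
        (\<forall>s\<in>C U. r V W (r U V s) = r U W s)) \<and>
     (\<forall>\<U> s. (\<forall>U\<in>\<U>. openin T U \<and> s U \<in> C U) \<and>
        (\<forall>U\<in>\<U>. \<forall>V\<in>\<U>. r U (U \<inter> V) (s U) = r V (U \<inter> V) (s V)) \<longrightarrow>
        (\<exists>!t. t \<in> C (\<Union>\<U>) \<and> (\<forall>U\<in>\<U>. r (\<Union>\<U>) U t = s U)))"

text \<open>The germ at \<open>x\<close> of a section \<open>s\<close> over \<open>U\<close>, as an equivalence class of pairs.\<close>

definition germ ::
    "'p topology \<Rightarrow> ('p set \<Rightarrow> 's set) \<Rightarrow> ('p set \<Rightarrow> 'p set \<Rightarrow> 's \<Rightarrow> 's) \<Rightarrow> 'p \<Rightarrow> 'p set \<Rightarrow> 's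
      \<Rightarrow> ('p set \<times> 's) set" where
  "germ T C r x U s =
     {(V, t). openin T V \<and> x \<in> V \<and> t \<in> C V \<and>
        (\<exists>W. openin T W \<and> x \<in> W \<and> W \<subseteq> U \<inter> V \<and> r U W s = r V W t)}"

record ('p, 'a) ringed_space =
  spc :: "'p topology"
  osec :: "'p set \<Rightarrow> 'a ring"
  ores :: "'p set \<Rightarrow> 'p set \<Rightarrow> 'a \<Rightarrow> 'a"

definition is_ringed_space :: "('p, 'a) ringed_space \<Rightarrow> bool" where
  "is_ringed_space \<XX> \<longleftrightarrow>
     (\<forall>U. openin (spc \<XX>) U \<longrightarrow> cring (osec \<XX> U)) \<and>
     (\<forall>U V. openin (spc \<XX>) U \<and> openin (spc \<XX>) V \<and> V \<subseteq> U \<longrightarrow>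
        ores \<XX> U V \<in> ring_hom (osec \<XX> U) (osec \<XX> V)) \<and>
     sheaf_of_sets (spc \<XX>) (\<lambda>U. carrier (osec \<XX> U)) (ores \<XX>)"

definition open_sub :: "('p, 'a) ringed_space \<Rightarrow> 'p set \<Rightarrow> ('p, 'a) ringed_space" where
  "open_sub \<XX> U = \<XX>\<lparr>spc := subtopology (spc \<XX>) U\<rparr>"

definition ogerm :: "('p, 'a) ringed_space \<Rightarrow> 'p \<Rightarrow> 'p set \<Rightarrow> 'a \<Rightarrow> ('p set \<times> 'a) set" where
  "ogerm \<XX> = germ (spc \<XX>) (\<lambda>U. carrier (osec \<XX> U)) (ores \<XX>)"

definition stalk :: "('p, 'a) ringed_space \<Rightarrow> 'p \<Rightarrow> ('p set \<times> 'a) set ring" where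
  "stalk \<XX> x =
     \<lparr>carrier = {ogerm \<XX> x U s | U s. openin (spc \<XX>) U \<and> x \<in> U \<and> s \<in> carrier (osec \<XX> U)},
      monoid.mult = (\<lambda>A B. THE C. \<exists>U s t. openin (spc \<XX>) U \<and> x \<in> U \<and>
        s \<in> carrier (osec \<XX> U) \<and> t \<in> carrier (osec \<XX> U) \<and>
        A = ogerm \<XX> x U s \<and> B = ogerm \<XX> x U t \<and> C = ogerm \<XX> x U (s \<otimes>\<^bsub>osec \<XX> U\<^esub> t)),
      one = ogerm \<XX> x (topspace (spc \<XX>)) \<one>\<^bsub>osec \<XX> (topspace (spc \<XX>))\<^esub>,
      ring.zero = ogerm \<XX> x (topspace (spc \<XX>)) \<zero>\<^bsub>osec \<XX> (topspace (spc \<XX>))\<^esub>,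
      ring.add = (\<lambda>A B. THE C. \<exists>U s t. openin (spc \<XX>) U \<and> x \<in> U \<and>
        s \<in> carrier (osec \<XX> U) \<and> t \<in> carrier (osec \<XX> U) \<and>
        A = ogerm \<XX> x U s \<and> B = ogerm \<XX> x U t \<and> C = ogerm \<XX> x U (s \<oplus>\<^bsub>osec \<XX> U\<^esub> t))\<rparr>"

definition local_ring :: "('a, 'b) ring_scheme \<Rightarrow> bool" where
  "local_ring R \<longleftrightarrow> cring R \<and> (\<exists>!m. maximalideal m R)"

definition is_locally_ringed_space :: "('p, 'a) ringed_space \<Rightarrow> bool" where
  "is_locally_ringed_space \<XX> \<longleftrightarrow>
     is_ringed_space \<XX> \<and> (\<forall>x\<in>topspace (spc \<XX>). local_ring (stalk \<XX> x))"

text \<open>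
  A morphism from \<open>\<XX>\<close> to \<open>\<YY>\<close>: a map \<open>pmap\<close> on points and, for every open \<open>V\<close> of \<open>\<YY>\<close>, a map
  \<open>comorph V\<close> from the sections of \<open>\<YY>\<close> over \<open>V\<close> to those of \<open>\<XX>\<close> over the preimage of \<open>V\<close>.
\<close>

record ('p, 'a, 'q, 'b) morphism =
  pmap :: "'p \<Rightarrow> 'q"
  comorph :: "'q set \<Rightarrow> 'b \<Rightarrow> 'a"

definition preim :: "('p, 'a) ringed_space \<Rightarrow> ('p, 'a, 'q, 'b) morphism \<Rightarrow> 'q set \<Rightarrow> 'p set" where
  "preim \<XX> f V = {x \<in> topspace (spc \<XX>). pmap f x \<in> V}"

definition is_morphism ::
    "('p, 'a) ringed_space \<Rightarrow> ('q, 'b) ringed_space \<Rightarrow> ('p, 'a, 'q, 'b) morphism \<Rightarrow> bool" where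
  "is_morphism \<XX> \<YY> f \<longleftrightarrow>
     continuous_map (spc \<XX>) (spc \<YY>) (pmap f) \<and>
     (\<forall>V. openin (spc \<YY>) V \<longrightarrow> comorph f V \<in> ring_hom (osec \<YY> V) (osec \<XX> (preim \<XX> f V))) \<and>
     (\<forall>V W. openin (spc \<YY>) V \<and> openin (spc \<YY>) W \<and> W \<subseteq> V \<longrightarrow>
        (\<forall>s\<in>carrier (osec \<YY> V).
           comorph f W (ores \<YY> V W s) = ores \<XX> (preim \<XX> f V) (preim \<XX> f W) (comorph f V s))) \<and>
     (\<forall>x\<in>topspace (spc \<XX>). \<forall>V. openin (spc \<YY>) V \<and> pmap f x \<in> V \<longrightarrow>
        (\<forall>s\<in>carrier (osec \<YY> V).
           ogerm \<XX> x (preim \<XX> f V) (comorph f V s) \<in> Units (stalk \<XX> x) \<longrightarrow>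
           ogerm \<YY> (pmap f x) V s \<in> Units (stalk \<YY> (pmap f x))))"

definition mor_eq ::
    "('p, 'a) ringed_space \<Rightarrow> ('q, 'b) ringed_space \<Rightarrow> ('p, 'a, 'q, 'b) morphism
      \<Rightarrow> ('p, 'a, 'q, 'b) morphism \<Rightarrow> bool" where
  "mor_eq \<XX> \<YY> f g \<longleftrightarrow>
     (\<forall>x\<in>topspace (spc \<XX>). pmap f x = pmap g x) \<and>
     (\<forall>V. openin (spc \<YY>) V \<longrightarrow> (\<forall>s\<in>carrier (osec \<YY> V). comorph f V s = comorph g V s))"

definition mor_id :: "('p, 'a, 'p, 'a) morphism" where
  "mor_id = \<lparr>pmap = (\<lambda>x. x), comorph = (\<lambda>V s. s)\<rparr>"

text \<open>The composite of \<open>f\<close> (from some space to \<open>\<YY>\<close>) with \<open>g\<close> (from \<open>\<YY>\<close>).\<close>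

definition mor_comp ::
    "('q, 'b) ringed_space \<Rightarrow> ('q, 'b, 'r, 'c) morphism \<Rightarrow> ('p, 'a, 'q, 'b) morphism
      \<Rightarrow> ('p, 'a, 'r, 'c) morphism" where
  "mor_comp \<YY> g f = \<lparr>pmap = (\<lambda>x. pmap g (pmap f x)), comorph = (\<lambda>V s. comorph f (preim \<YY> g V) (comorph g V s))\<rparr>"

definition is_isomorphism ::
    "('p, 'a) ringed_space \<Rightarrow> ('q, 'b) ringed_space \<Rightarrow> ('p, 'a, 'q, 'b) morphism \<Rightarrow> bool" where
  "is_isomorphism \<XX> \<YY> f \<longleftrightarrow>
     is_morphism \<XX> \<YY> f \<and> homeomorphic_map (spc \<XX>) (spc \<YY>) (pmap f) \<and>
     (\<forall>V. openin (spc \<YY>) V \<longrightarrow>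
        bij_betw (comorph f V) (carrier (osec \<YY> V)) (carrier (osec \<XX> (preim \<XX> f V))))"


section \<open>Localization and spectra\<close>

text \<open>The fraction \<open>a / b\<close> in the localization of \<open>R\<close> at the prime ideal \<open>p\<close>.\<close>

definition fraction :: "'a ring \<Rightarrow> 'a set \<Rightarrow> 'a \<Rightarrow> 'a \<Rightarrow> ('a \<times> 'a) set" where
  "fraction R p a b =
     {(c, d). c \<in> carrier R \<and> d \<in> carrier R - p \<and>
        (\<exists>u\<in>carrier R - p. u \<otimes>\<^bsub>R\<^esub> (a \<otimes>\<^bsub>R\<^esub> d \<ominus>\<^bsub>R\<^esub> c \<otimes>\<^bsub>R\<^esub> b) = \<zero>\<^bsub>R\<^esub>)}"

definition localization :: "'a ring \<Rightarrow> 'a set \<Rightarrow> ('a \<times> 'a) set ring" where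
  "localization R p =
     \<lparr>carrier = {fraction R p a b | a b. a \<in> carrier R \<and> b \<in> carrier R - p},
      monoid.mult = (\<lambda>A B. THE C. \<exists>a b c d. a \<in> carrier R \<and> b \<in> carrier R - p \<and>
        c \<in> carrier R \<and> d \<in> carrier R - p \<and> A = fraction R p a b \<and> B = fraction R p c d \<and>
        C = fraction R p (a \<otimes>\<^bsub>R\<^esub> c) (b \<otimes>\<^bsub>R\<^esub> d)),
      one = fraction R p \<one>\<^bsub>R\<^esub> \<one>\<^bsub>R\<^esub>,
      ring.zero = fraction R p \<zero>\<^bsub>R\<^esub> \<one>\<^bsub>R\<^esub>,
      ring.add = (\<lambda>A B. THE C. \<exists>a b c d. a \<in> carrier R \<and> b \<in> carrier R - p \<and>
        c \<in> carrier R \<and> d \<in> carrier R - p \<and> A = fraction R p a b \<and> B = fraction R p c d \<and>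
        C = fraction R p (a \<otimes>\<^bsub>R\<^esub> d \<oplus>\<^bsub>R\<^esub> c \<otimes>\<^bsub>R\<^esub> b) (b \<otimes>\<^bsub>R\<^esub> d))\<rparr>"

definition zariski :: "'a ring \<Rightarrow> 'a set topology" where
  "zariski R =
     topology (\<lambda>V. \<exists>I. ideal I R \<and> V = {p. primeideal p R \<and> \<not> I \<subseteq> p})"

text \<open>
  Sections over \<open>U\<close> of the structure sheaf of the spectrum: functions \<open>s\<close> with \<open>s p\<close> in the
  localization at \<open>p\<close> that are locally given by a fraction.
\<close>

definition spec_sections :: "'a ring \<Rightarrow> 'a set set \<Rightarrow> ('a set \<Rightarrow> ('a \<times> 'a) set) set" where
  "spec_sections R U =
     {s \<in> (\<Pi>\<^sub>E p\<in>U. carrier (localization R p)).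
        \<forall>p\<in>U. \<exists>V a b. openin (zariski R) V \<and> p \<in> V \<and> V \<subseteq> U \<and>
          a \<in> carrier R \<and> b \<in> carrier R \<and> (\<forall>q\<in>V. b \<notin> q \<and> s q = fraction R q a b)}"

definition Spec :: "'a ring \<Rightarrow> ('a set, 'a set \<Rightarrow> ('a \<times> 'a) set) ringed_space" where
  "Spec R =
     \<lparr>spc = zariski R,
      osec = (\<lambda>U.
        \<lparr>carrier = spec_sections R U,
         monoid.mult = (\<lambda>s t. \<lambda>p\<in>U. s p \<otimes>\<^bsub>localization R p\<^esub> t p),
         one = (\<lambda>p\<in>U. \<one>\<^bsub>localization R p\<^esub>),
         ring.zero = (\<lambda>p\<in>U. \<zero>\<^bsub>localization R p\<^esub>),
         ring.add = (\<lambda>s t. \<lambda>p\<in>U. s p \<oplus>\<^bsub>localization R p\<^esub> t p)\<rparr>),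
      ores = (\<lambda>U V s. restrict s V)\<rparr>"


section \<open>Schemes\<close>

text \<open>
  If \<open>\<XX>\<close> is isomorphic to \<open>Spec R\<close>, then \<open>R\<close> is isomorphic to the ring of global sections of
  \<open>\<XX>\<close>; hence it is no restriction that \<open>R\<close> lives on the type of sections of \<open>\<XX>\<close>.
\<close>

definition is_affine :: "('p, 'a) ringed_space \<Rightarrow> bool" where
  "is_affine \<XX> \<longleftrightarrow> (\<exists>(R :: 'a ring) f. cring R \<and> is_isomorphism \<XX> (Spec R) f)"

definition affine_open :: "('p, 'a) ringed_space \<Rightarrow> 'p set \<Rightarrow> bool" where
  "affine_open \<XX> U \<longleftrightarrow> openin (spc \<XX>) U \<and> is_affine (open_sub \<XX> U)"

definition is_scheme :: "('p, 'a) ringed_space \<Rightarrow> bool" where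
  "is_scheme \<XX> \<longleftrightarrow>
     is_locally_ringed_space \<XX> \<and> (\<forall>x\<in>topspace (spc \<XX>). \<exists>U. x \<in> U \<and> affine_open \<XX> U)"

definition integral_scheme :: "('p, 'a) ringed_space \<Rightarrow> bool" where
  "integral_scheme \<XX> \<longleftrightarrow>
     is_scheme \<XX> \<and> topspace (spc \<XX>) \<noteq> {} \<and>
     (\<forall>U. openin (spc \<XX>) U \<and> U \<noteq> {} \<longrightarrow> domain (osec \<XX> U))"

text \<open>For a domain \<open>R\<close>, the localization at the zero ideal is the field of fractions.\<close>

definition integrally_closed_domain :: "'a ring \<Rightarrow> bool" where
  "integrally_closed_domain R \<longleftrightarrow>
     domain R \<and>
     (let Q = localization R {\<zero>\<^bsub>R\<^esub>}; \<iota> = (\<lambda>a. fraction R {\<zero>\<^bsub>R\<^esub>} a \<one>\<^bsub>R\<^esub>)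
      in \<forall>f\<in>carrier Q.
           (\<exists>(n::nat) c. n > 0 \<and> c \<in> {..<n} \<rightarrow> carrier R \<and>
              f [^]\<^bsub>Q\<^esub> n \<oplus>\<^bsub>Q\<^esub> (\<Oplus>\<^bsub>Q\<^esub>i\<in>{..<n}. \<iota> (c i) \<otimes>\<^bsub>Q\<^esub> f [^]\<^bsub>Q\<^esub> i) = \<zero>\<^bsub>Q\<^esub>) \<longrightarrow>
           f \<in> \<iota> ` carrier R)"

definition normal_scheme :: "('p, 'a) ringed_space \<Rightarrow> bool" where
  "normal_scheme \<XX> \<longleftrightarrow>
     is_scheme \<XX> \<and> (\<forall>x\<in>topspace (spc \<XX>). integrally_closed_domain (stalk \<XX> x))"

definition finite_type_morphism ::
    "('p, 'a) ringed_space \<Rightarrow> ('q, 'b) ringed_space \<Rightarrow> ('p, 'a, 'q, 'b) morphism \<Rightarrow> bool" where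
  "finite_type_morphism \<XX> \<YY> f \<longleftrightarrow>
     is_morphism \<XX> \<YY> f \<and>
     (\<exists>\<V>. (\<forall>V\<in>\<V>. affine_open \<YY> V) \<and> \<Union>\<V> = topspace (spc \<YY>) \<and>
        (\<forall>V\<in>\<V>. \<exists>\<U>. finite \<U> \<and> (\<forall>U\<in>\<U>. affine_open \<XX> U) \<and> \<Union>\<U> = preim \<XX> f V \<and>
           (\<forall>U\<in>\<U>. \<exists>S. finite S \<and> S \<subseteq> carrier (osec \<XX> U) \<and>
              generate_ring (osec \<XX> U)
                ((\<lambda>b. ores \<XX> (preim \<XX> f V) U (comorph f V b)) ` carrier (osec \<YY> V) \<union> S)
              = carrier (osec \<XX> U))))"

definition closed_immersion ::
    "('p, 'a) ringed_space \<Rightarrow> ('q, 'b) ringed_space \<Rightarrow> ('p, 'a, 'q, 'b) morphism \<Rightarrow> bool" where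
  "closed_immersion \<XX> \<YY> f \<longleftrightarrow>
     is_morphism \<XX> \<YY> f \<and>
     closedin (spc \<YY>) (pmap f ` topspace (spc \<XX>)) \<and>
     homeomorphic_map (spc \<XX>) (subtopology (spc \<YY>) (pmap f ` topspace (spc \<XX>))) (pmap f) \<and>
     (\<forall>V. openin (spc \<YY>) V \<longrightarrow> (\<forall>s\<in>carrier (osec \<XX> (preim \<XX> f V)). \<forall>y\<in>V.
        \<exists>W. openin (spc \<YY>) W \<and> y \<in> W \<and> W \<subseteq> V \<and>
          (\<exists>t\<in>carrier (osec \<YY> W). comorph f W t = ores \<XX> (preim \<XX> f V) (preim \<XX> f W) s)))"

text \<open>
  The universal property of the fibre product of \<open>f\<close> and \<open>g\<close>, tested on schemes \<open>T\<close> with the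
  same types of points and of sections as the candidate \<open>Z\<close>.
\<close>

definition is_fibre_product ::
    "('p, 'a) ringed_space \<Rightarrow> ('q, 'b) ringed_space \<Rightarrow> ('r, 'c) ringed_space
      \<Rightarrow> ('p, 'a, 'r, 'c) morphism \<Rightarrow> ('q, 'b, 'r, 'c) morphism
      \<Rightarrow> ('z, 'd) ringed_space \<Rightarrow> ('z, 'd, 'p, 'a) morphism \<Rightarrow> ('z, 'd, 'q, 'b) morphism
      \<Rightarrow> bool" where
  "is_fibre_product \<XX> \<YY> S f g Z pr\<^sub>1 pr\<^sub>2 \<longleftrightarrow>
     is_scheme Z \<and> is_morphism Z \<XX> pr\<^sub>1 \<and> is_morphism Z \<YY> pr\<^sub>2 \<and>
     mor_eq Z S (mor_comp \<XX> f pr\<^sub>1) (mor_comp \<YY> g pr\<^sub>2) \<and>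
     (\<forall>(T :: ('z, 'd) ringed_space) u v.
        is_scheme T \<and> is_morphism T \<XX> u \<and> is_morphism T \<YY> v \<and>
        mor_eq T S (mor_comp \<XX> f u) (mor_comp \<YY> g v) \<longrightarrow>
        (\<exists>h. is_morphism T Z h \<and>
           mor_eq T \<XX> (mor_comp Z pr\<^sub>1 h) u \<and> mor_eq T \<YY> (mor_comp Z pr\<^sub>2 h) v \<and>
           (\<forall>h'. is_morphism T Z h' \<and>
              mor_eq T \<XX> (mor_comp Z pr\<^sub>1 h') u \<and> mor_eq T \<YY> (mor_comp Z pr\<^sub>2 h') v \<longrightarrow>
              mor_eq T Z h' h)))"

text \<open>
  Separatedness: the diagonal into the fibre product of \<open>\<XX>\<close> with itself over \<open>\<YY>\<close> is a closed
  immersion. The types chosen for the fibre product are large enough to contain a copy of it: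
  let \<open>c\<close> be the (infinite) cardinality of \<open>'p \<times> 'a \<times> nat\<close>. A point of the fibre product is a
  pair of points of \<open>\<XX>\<close> together with a prime ideal of a tensor product of their residue fields,
  a ring with at most \<open>c\<close> elements, so there are at most \<open>2^c\<close> points; the stalks have at most
  \<open>c\<close> elements, so there are at most \<open>2^(2^c)\<close> sections. Since the true fibre product is then
  one of the test schemes, the universal property determines it up to isomorphism.
\<close>

type_synonym ('p, 'a) fp_point = "('p \<times> 'a \<times> nat) set"
type_synonym ('p, 'a) fp_section = "('p \<times> 'a \<times> nat) set set"

definition separated_morphism ::
    "('p, 'a) ringed_space \<Rightarrow> ('q, 'b) ringed_space \<Rightarrow> ('p, 'a, 'q, 'b) morphism \<Rightarrow> bool" where
  "separated_morphism \<XX> \<YY> f \<longleftrightarrow>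
     is_morphism \<XX> \<YY> f \<and>
     (\<exists>(Z :: (('p, 'a) fp_point, ('p, 'a) fp_section) ringed_space) pr\<^sub>1 pr\<^sub>2 \<delta>.
        is_fibre_product \<XX> \<XX> \<YY> f f Z pr\<^sub>1 pr\<^sub>2 \<and>
        mor_eq \<XX> \<XX> (mor_comp Z pr\<^sub>1 \<delta>) mor_id \<and> mor_eq \<XX> \<XX> (mor_comp Z pr\<^sub>2 \<delta>) mor_id \<and>
        closed_immersion \<XX> Z \<delta>)"

definition normal_variety ::
    "'k ring \<Rightarrow> ('p, 'a) ringed_space
      \<Rightarrow> ('p, 'a, 'k set, 'k set \<Rightarrow> ('k \<times> 'k) set) morphism \<Rightarrow> bool" where
  "normal_variety k \<XX> \<pi> \<longleftrightarrow>
     is_morphism \<XX> (Spec k) \<pi> \<and> normal_scheme \<XX> \<and> integral_scheme \<XX> \<and>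
     separated_morphism \<XX> (Spec k) \<pi> \<and> finite_type_morphism \<XX> (Spec k) \<pi>"

definition char_zero :: "'k ring \<Rightarrow> bool" where
  "char_zero k \<longleftrightarrow> (\<forall>n::nat. n > 0 \<longrightarrow> [n] \<cdot>\<^bsub>k\<^esub> \<one>\<^bsub>k\<^esub> \<noteq> \<zero>\<^bsub>k\<^esub>)"


section \<open>Sheaves of modules\<close>

record ('p, 'a, 'm) omodule =
  msec :: "'p set \<Rightarrow> ('a, 'm) module"
  mres :: "'p set \<Rightarrow> 'p set \<Rightarrow> 'm \<Rightarrow> 'm"

definition is_omodule :: "('p, 'a) ringed_space \<Rightarrow> ('p, 'a, 'm) omodule \<Rightarrow> bool" where
  "is_omodule \<XX> F \<longleftrightarrow>
     (\<forall>U. openin (spc \<XX>) U \<longrightarrow> module (osec \<XX> U) (msec F U)) \<and>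
     (\<forall>U V. openin (spc \<XX>) U \<and> openin (spc \<XX>) V \<and> V \<subseteq> U \<longrightarrow>
        (\<forall>s\<in>carrier (msec F U). \<forall>t\<in>carrier (msec F U).
           mres F U V (s \<oplus>\<^bsub>msec F U\<^esub> t) = mres F U V s \<oplus>\<^bsub>msec F V\<^esub> mres F U V t) \<and>
        (\<forall>a\<in>carrier (osec \<XX> U). \<forall>s\<in>carrier (msec F U).
           mres F U V (a \<odot>\<^bsub>msec F U\<^esub> s) = ores \<XX> U V a \<odot>\<^bsub>msec F V\<^esub> mres F U V s)) \<and>
     sheaf_of_sets (spc \<XX>) (\<lambda>U. carrier (msec F U)) (mres F)"

text \<open>
  The restriction of \<open>F\<close> to an open set \<open>U\<close> is \<open>F\<close> itself, regarded over \<open>open_sub \<XX> U\<close>.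
\<close>

definition omodule_hom ::
    "('p, 'a) ringed_space \<Rightarrow> ('p, 'a, 'm) omodule \<Rightarrow> ('p, 'a, 'n) omodule
      \<Rightarrow> ('p set \<Rightarrow> 'm \<Rightarrow> 'n) \<Rightarrow> bool" where
  "omodule_hom \<XX> F G \<mu> \<longleftrightarrow>
     (\<forall>U. openin (spc \<XX>) U \<longrightarrow>
        \<mu> U \<in> carrier (msec F U) \<rightarrow> carrier (msec G U) \<and>
        (\<forall>s\<in>carrier (msec F U). \<forall>t\<in>carrier (msec F U).
           \<mu> U (s \<oplus>\<^bsub>msec F U\<^esub> t) = \<mu> U s \<oplus>\<^bsub>msec G U\<^esub> \<mu> U t) \<and>
        (\<forall>a\<in>carrier (osec \<XX> U). \<forall>s\<in>carrier (msec F U).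
           \<mu> U (a \<odot>\<^bsub>msec F U\<^esub> s) = a \<odot>\<^bsub>msec G U\<^esub> \<mu> U s)) \<and>
     (\<forall>U V. openin (spc \<XX>) U \<and> openin (spc \<XX>) V \<and> V \<subseteq> U \<longrightarrow>
        (\<forall>s\<in>carrier (msec F U). \<mu> V (mres F U V s) = mres G U V (\<mu> U s)))"

definition omodule_surj ::
    "('p, 'a) ringed_space \<Rightarrow> ('p, 'a, 'm) omodule \<Rightarrow> ('p, 'a, 'n) omodule
      \<Rightarrow> ('p set \<Rightarrow> 'm \<Rightarrow> 'n) \<Rightarrow> bool" where
  "omodule_surj \<XX> F G \<mu> \<longleftrightarrow>
     (\<forall>U. openin (spc \<XX>) U \<longrightarrow> (\<forall>t\<in>carrier (msec G U). \<forall>x\<in>U.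
        \<exists>V. openin (spc \<XX>) V \<and> x \<in> V \<and> V \<subseteq> U \<and>
          (\<exists>s\<in>carrier (msec F V). \<mu> V s = mres G U V t)))"

definition kernel_omodule ::
    "('p, 'a, 'm) omodule \<Rightarrow> ('p, 'a, 'n) omodule \<Rightarrow> ('p set \<Rightarrow> 'm \<Rightarrow> 'n)
      \<Rightarrow> ('p, 'a, 'm) omodule" where
  "kernel_omodule F G \<mu> =
     F\<lparr>msec := (\<lambda>U. (msec F U)\<lparr>carrier := {s \<in> carrier (msec F U). \<mu> U s = \<zero>\<^bsub>msec G U\<^esub>}\<rparr>)\<rparr>"

text \<open>
  \<open>F'\<close>, with the inclusion \<open>\<iota>\<close> into \<open>F\<close>, is the kernel of \<open>\<phi>\<close>. Literal subsheaves are
  covered by \<open>\<iota> = (\<lambda>U s. s)\<close>.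
\<close>

definition is_kernel ::
    "('p, 'a) ringed_space \<Rightarrow> ('p, 'a, 'n) omodule \<Rightarrow> ('p set \<Rightarrow> 'n \<Rightarrow> 'm)
      \<Rightarrow> ('p, 'a, 'm) omodule \<Rightarrow> ('p, 'a, 'l) omodule \<Rightarrow> ('p set \<Rightarrow> 'm \<Rightarrow> 'l) \<Rightarrow> bool" where
  "is_kernel \<XX> F' \<iota> F G \<phi> \<longleftrightarrow>
     omodule_hom \<XX> F' F \<iota> \<and>
     (\<forall>U. openin (spc \<XX>) U \<longrightarrow>
        bij_betw (\<iota> U) (carrier (msec F' U)) (carrier (msec (kernel_omodule F G \<phi>) U)))"

text \<open>
  The multiplication and unit fields of the record type of modules carry no meaning; they are
  left unspecified where there is no natural choice.
\<close>

definition structure_omodule :: "('p, 'a) ringed_space \<Rightarrow> ('p, 'a, 'a) omodule" where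
  "structure_omodule \<XX> =
     \<lparr>msec = (\<lambda>U.
        \<lparr>carrier = carrier (osec \<XX> U),
         monoid.mult = monoid.mult (osec \<XX> U),
         one = monoid.one (osec \<XX> U),
         ring.zero = ring.zero (osec \<XX> U),
         ring.add = ring.add (osec \<XX> U),
         smult = monoid.mult (osec \<XX> U)\<rparr>),
      mres = ores \<XX>\<rparr>"

definition free_omodule :: "('p, 'a) ringed_space \<Rightarrow> nat \<Rightarrow> ('p, 'a, nat \<Rightarrow> 'a) omodule" where
  "free_omodule \<XX> n =
     \<lparr>msec = (\<lambda>U.
        \<lparr>carrier = (\<Pi>\<^sub>E i\<in>{..<n}. carrier (osec \<XX> U)),
         monoid.mult = undefined,
         one = undefined,
         ring.zero = (\<lambda>i\<in>{..<n}. \<zero>\<^bsub>osec \<XX> U\<^esub>),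
         ring.add = (\<lambda>s t. \<lambda>i\<in>{..<n}. s i \<oplus>\<^bsub>osec \<XX> U\<^esub> t i),
         smult = (\<lambda>a s. \<lambda>i\<in>{..<n}. a \<otimes>\<^bsub>osec \<XX> U\<^esub> s i)\<rparr>),
      mres = (\<lambda>U V s. \<lambda>i\<in>{..<n}. ores \<XX> U V (s i))\<rparr>"

definition finite_type_omodule ::
    "('p, 'a) ringed_space \<Rightarrow> ('p, 'a, 'm) omodule \<Rightarrow> bool" where
  "finite_type_omodule \<XX> F \<longleftrightarrow>
     (\<forall>x\<in>topspace (spc \<XX>). \<exists>U n \<mu>. openin (spc \<XX>) U \<and> x \<in> U \<and>
        omodule_hom (open_sub \<XX> U) (free_omodule \<XX> n) F \<mu> \<and>
        omodule_surj (open_sub \<XX> U) (free_omodule \<XX> n) F \<mu>)"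

definition coherent :: "('p, 'a) ringed_space \<Rightarrow> ('p, 'a, 'm) omodule \<Rightarrow> bool" where
  "coherent \<XX> F \<longleftrightarrow>
     is_omodule \<XX> F \<and> finite_type_omodule \<XX> F \<and>
     (\<forall>U n \<mu>. openin (spc \<XX>) U \<and> omodule_hom (open_sub \<XX> U) (free_omodule \<XX> n) F \<mu> \<longrightarrow>
        finite_type_omodule (open_sub \<XX> U) (kernel_omodule (free_omodule \<XX> n) F \<mu>))"

text \<open>
  The dual: its sections over \<open>U\<close> are the homomorphisms from the restriction of \<open>F\<close> to \<open>U\<close> to
  the structure sheaf on \<open>U\<close>, normalized to be \<open>undefined\<close> outside their domain.
\<close>

definition cut_hom ::
    "('p, 'a) ringed_space \<Rightarrow> ('p, 'a, 'm) omodule \<Rightarrow> 'p set \<Rightarrow> ('p set \<Rightarrow> 'm \<Rightarrow> 'n)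
      \<Rightarrow> ('p set \<Rightarrow> 'm \<Rightarrow> 'n)" where
  "cut_hom \<XX> F U \<alpha> =
     (\<lambda>V s. if openin (spc \<XX>) V \<and> V \<subseteq> U \<and> s \<in> carrier (msec F V) then \<alpha> V s else undefined)"

definition dual_omodule ::
    "('p, 'a) ringed_space \<Rightarrow> ('p, 'a, 'm) omodule \<Rightarrow> ('p, 'a, 'p set \<Rightarrow> 'm \<Rightarrow> 'a) omodule" where
  "dual_omodule \<XX> F =
     \<lparr>msec = (\<lambda>U.
        \<lparr>carrier = {\<alpha>. omodule_hom (open_sub \<XX> U) F (structure_omodule \<XX>) \<alpha> \<and>
                        cut_hom \<XX> F U \<alpha> = \<alpha>},
         monoid.mult = undefined,
         one = undefined,
         ring.zero = cut_hom \<XX> F U (\<lambda>V s. \<zero>\<^bsub>osec \<XX> V\<^esub>),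
         ring.add = (\<lambda>\<alpha> \<beta>. cut_hom \<XX> F U (\<lambda>V s. \<alpha> V s \<oplus>\<^bsub>osec \<XX> V\<^esub> \<beta> V s)),
         smult = (\<lambda>a \<alpha>. cut_hom \<XX> F U (\<lambda>V s. ores \<XX> U V a \<otimes>\<^bsub>osec \<XX> V\<^esub> \<alpha> V s))\<rparr>),
      mres = (\<lambda>U V \<alpha>. cut_hom \<XX> F V \<alpha>)\<rparr>"

definition bidual_map ::
    "('p, 'a) ringed_space \<Rightarrow> ('p, 'a, 'm) omodule \<Rightarrow> 'p set \<Rightarrow> 'm
      \<Rightarrow> ('p set \<Rightarrow> ('p set \<Rightarrow> 'm \<Rightarrow> 'a) \<Rightarrow> 'a)" where
  "bidual_map \<XX> F U s = cut_hom \<XX> (dual_omodule \<XX> F) U (\<lambda>V \<alpha>. \<alpha> V (mres F U V s))"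

definition reflexive :: "('p, 'a) ringed_space \<Rightarrow> ('p, 'a, 'm) omodule \<Rightarrow> bool" where
  "reflexive \<XX> F \<longleftrightarrow>
     coherent \<XX> F \<and>
     (\<forall>U. openin (spc \<XX>) U \<longrightarrow>
        bij_betw (bidual_map \<XX> F U) (carrier (msec F U))
          (carrier (msec (dual_omodule \<XX> (dual_omodule \<XX> F)) U)))"

text \<open>Torsion-freeness, for modules on an integral scheme.\<close>

definition torsion_free :: "('p, 'a) ringed_space \<Rightarrow> ('p, 'a, 'm) omodule \<Rightarrow> bool" where
  "torsion_free \<XX> F \<longleftrightarrow>
     (\<forall>U. openin (spc \<XX>) U \<longrightarrow> (\<forall>a\<in>carrier (osec \<XX> U). \<forall>s\<in>carrier (msec F U).
        a \<odot>\<^bsub>msec F U\<^esub> s = \<zero>\<^bsub>msec F U\<^esub> \<longrightarrow> a = \<zero>\<^bsub>osec \<XX> U\<^esub> \<or> s = \<zero>\<^bsub>msec F U\<^esub>))"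

definition mgerm ::
    "('p, 'a) ringed_space \<Rightarrow> ('p, 'a, 'm) omodule \<Rightarrow> 'p \<Rightarrow> 'p set \<Rightarrow> 'm
      \<Rightarrow> ('p set \<times> 'm) set" where
  "mgerm \<XX> F = germ (spc \<XX>) (\<lambda>U. carrier (msec F U)) (mres F)"

definition mstalk ::
    "('p, 'a) ringed_space \<Rightarrow> ('p, 'a, 'm) omodule \<Rightarrow> 'p
      \<Rightarrow> (('p set \<times> 'a) set, ('p set \<times> 'm) set) module" where
  "mstalk \<XX> F x =
     \<lparr>carrier = {mgerm \<XX> F x U s | U s. openin (spc \<XX>) U \<and> x \<in> U \<and> s \<in> carrier (msec F U)},
      monoid.mult = undefined,
      one = undefined,
      ring.zero = mgerm \<XX> F x (topspace (spc \<XX>)) \<zero>\<^bsub>msec F (topspace (spc \<XX>))\<^esub>,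
      ring.add = (\<lambda>A B. THE C. \<exists>U s t. openin (spc \<XX>) U \<and> x \<in> U \<and>
        s \<in> carrier (msec F U) \<and> t \<in> carrier (msec F U) \<and>
        A = mgerm \<XX> F x U s \<and> B = mgerm \<XX> F x U t \<and> C = mgerm \<XX> F x U (s \<oplus>\<^bsub>msec F U\<^esub> t)),
      smult = (\<lambda>A B. THE C. \<exists>U a s. openin (spc \<XX>) U \<and> x \<in> U \<and>
        a \<in> carrier (osec \<XX> U) \<and> s \<in> carrier (msec F U) \<and>
        A = ogerm \<XX> x U a \<and> B = mgerm \<XX> F x U s \<and> C = mgerm \<XX> F x U (a \<odot>\<^bsub>msec F U\<^esub> s))\<rparr>"

definition stalk_map ::
    "('p, 'a) ringed_space \<Rightarrow> ('p, 'a, 'm) omodule \<Rightarrow> ('p, 'a, 'n) omodule \<Rightarrow> 'p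
      \<Rightarrow> ('p set \<Rightarrow> 'm \<Rightarrow> 'n) \<Rightarrow> ('p set \<times> 'm) set \<Rightarrow> ('p set \<times> 'n) set" where
  "stalk_map \<XX> F G x \<mu> A =
     (THE B. \<exists>U s. openin (spc \<XX>) U \<and> x \<in> U \<and> s \<in> carrier (msec F U) \<and>
        A = mgerm \<XX> F x U s \<and> B = mgerm \<XX> G x U (\<mu> U s))"


section \<open>Weil divisors and Weil decorations\<close>

definition irreducible_closed :: "'p topology \<Rightarrow> 'p set \<Rightarrow> bool" where
  "irreducible_closed T Z \<longleftrightarrow>
     closedin T Z \<and> Z \<noteq> {} \<and>
     (\<forall>A B. closedin T A \<and> closedin T B \<and> Z = A \<union> B \<longrightarrow> Z = A \<or> Z = B)"

text \<open>
  A prime divisor, represented by its underlying set: an irreducible closed subset such that the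
  longest chains of irreducible closed subsets starting from it have length one.
\<close>

definition prime_divisor :: "('p, 'a) ringed_space \<Rightarrow> 'p set \<Rightarrow> bool" where
  "prime_divisor \<XX> P \<longleftrightarrow>
     irreducible_closed (spc \<XX>) P \<and>
     (\<exists>Z. irreducible_closed (spc \<XX>) Z \<and> P \<subset> Z) \<and>
     \<not> (\<exists>Z Z'. irreducible_closed (spc \<XX>) Z \<and> irreducible_closed (spc \<XX>) Z' \<and>
          P \<subset> Z \<and> Z \<subset> Z')"

definition generic_point_of :: "('p, 'a) ringed_space \<Rightarrow> 'p set \<Rightarrow> 'p" where
  "generic_point_of \<XX> Z = (THE x. x \<in> topspace (spc \<XX>) \<and> spc \<XX> closure_of {x} = Z)"

definition generic_point :: "('p, 'a) ringed_space \<Rightarrow> 'p" where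
  "generic_point \<XX> = generic_point_of \<XX> (topspace (spc \<XX>))"

definition function_field :: "('p, 'a) ringed_space \<Rightarrow> ('p set \<times> 'a) set ring" where
  "function_field \<XX> = stalk \<XX> (generic_point \<XX>)"

definition generic_stalk ::
    "('p, 'a) ringed_space \<Rightarrow> ('p, 'a, 'm) omodule
      \<Rightarrow> (('p set \<times> 'a) set, ('p set \<times> 'm) set) module" where
  "generic_stalk \<XX> F = mstalk \<XX> F (generic_point \<XX>)"

definition generic_map ::
    "('p, 'a) ringed_space \<Rightarrow> ('p, 'a, 'm) omodule \<Rightarrow> ('p, 'a, 'n) omodule
      \<Rightarrow> ('p set \<Rightarrow> 'm \<Rightarrow> 'n) \<Rightarrow> ('p set \<times> 'm) set \<Rightarrow> ('p set \<times> 'n) set" where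
  "generic_map \<XX> F G \<mu> = stalk_map \<XX> F G (generic_point \<XX>) \<mu>"

text \<open>The local ring at \<open>x\<close> of an integral scheme, as a subring of the function field.\<close>

definition local_subring :: "('p, 'a) ringed_space \<Rightarrow> 'p \<Rightarrow> ('p set \<times> 'a) set ring" where
  "local_subring \<XX> x =
     (function_field \<XX>)\<lparr>carrier := {ogerm \<XX> (generic_point \<XX>) U s | U s.
        openin (spc \<XX>) U \<and> x \<in> U \<and> s \<in> carrier (osec \<XX> U)}\<rparr>"

text \<open>
  The discrete valuation attached to \<open>P\<close>: writing \<open>f = u t^n\<close> with a unit \<open>u\<close> and a generator
  \<open>t\<close> of the maximal ideal of the local ring at the generic point of \<open>P\<close>, the order is \<open>n\<close>.
\<close>

definition ord_along ::
    "('p, 'a) ringed_space \<Rightarrow> 'p set \<Rightarrow> ('p set \<times> 'a) set \<Rightarrow> int" where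
  "ord_along \<XX> P f =
     (let K = function_field \<XX>; A = local_subring \<XX> (generic_point_of \<XX> P)
      in THE n. \<exists>t u. t \<in> carrier A \<and> maximalideal (PIdl\<^bsub>A\<^esub> t) A \<and> u \<in> Units A \<and>
           f = u \<otimes>\<^bsub>K\<^esub> (t [^]\<^bsub>K\<^esub> n))"

definition weil_divisors :: "('p, 'a) ringed_space \<Rightarrow> ('p set \<Rightarrow> int) set" where
  "weil_divisors \<XX> =
     {D. finite {P. D P \<noteq> 0} \<and> (\<forall>P. D P \<noteq> 0 \<longrightarrow> prime_divisor \<XX> P)}"

definition principal_divisor ::
    "('p, 'a) ringed_space \<Rightarrow> ('p set \<times> 'a) set \<Rightarrow> 'p set \<Rightarrow> int" where
  "principal_divisor \<XX> f P = (if prime_divisor \<XX> P then ord_along \<XX> P f else 0)"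

definition effective_on :: "('p, 'a) ringed_space \<Rightarrow> 'p set \<Rightarrow> ('p set \<Rightarrow> int) \<Rightarrow> bool" where
  "effective_on \<XX> U D \<longleftrightarrow> (\<forall>P. prime_divisor \<XX> P \<and> P \<inter> U \<noteq> {} \<longrightarrow> 0 \<le> D P)"

definition divisor_sheaf ::
    "('p, 'a) ringed_space \<Rightarrow> ('p set \<Rightarrow> int) \<Rightarrow> 'p set \<Rightarrow> ('p set \<times> 'a) set set" where
  "divisor_sheaf \<XX> D U =
     {f \<in> carrier (function_field \<XX>) - {\<zero>\<^bsub>function_field \<XX>\<^esub>}.
        effective_on \<XX> U (\<lambda>P. D P + principal_divisor \<XX> f P)} \<union> {\<zero>\<^bsub>function_field \<XX>\<^esub>}"

text \<open>
  The sections over \<open>U\<close> of the rank one subsheaf cut out by the line spanned by \<open>e\<close>, inside the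
  generic stalk.
\<close>

definition line_subsheaf ::
    "('p, 'a) ringed_space \<Rightarrow> ('p, 'a, 'm) omodule \<Rightarrow> ('p set \<times> 'm) set \<Rightarrow> 'p set
      \<Rightarrow> ('p set \<times> 'm) set set" where
  "line_subsheaf \<XX> F e U =
     {f \<odot>\<^bsub>generic_stalk \<XX> F\<^esub> e | f. f \<in> carrier (function_field \<XX>)} \<inter>
     mgerm \<XX> F (generic_point \<XX>) U ` carrier (msec F U)"

text \<open>
  Subsheaves of a constant sheaf are compared on nonempty open sets only, since the value of a
  sheaf on the empty set is trivial.
\<close>

definition weil_decoration ::
    "('p, 'a) ringed_space \<Rightarrow> ('p, 'a, 'm) omodule \<Rightarrow> ('p set \<times> 'm) set
      \<Rightarrow> ('p set \<Rightarrow> int) extended" where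
  "weil_decoration \<XX> F e =
     (if e = \<zero>\<^bsub>generic_stalk \<XX> F\<^esub> then Pinf
      else Fin (THE D. D \<in> weil_divisors \<XX> \<and>
        (\<forall>U. openin (spc \<XX>) U \<and> U \<noteq> {} \<longrightarrow>
           divisor_sheaf \<XX> D U =
             {f \<in> carrier (function_field \<XX>).
                f \<odot>\<^bsub>generic_stalk \<XX> F\<^esub> e \<in> line_subsheaf \<XX> F e U})))"

definition coeff_at :: "('p set \<Rightarrow> int) extended \<Rightarrow> 'p set \<Rightarrow> int extended" where
  "coeff_at w P = map_extended (\<lambda>D. D P) w"

definition is_maximum :: "'a::order \<Rightarrow> 'a set \<Rightarrow> bool" where
  "is_maximum m S \<longleftrightarrow> m \<in> S \<and> (\<forall>s\<in>S. s \<le> m)"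

end

theory Submission
  imports Defs
begin

text \<open>
  Sections are compared inside the generic stalk. Part (i) needs no property of the divisors: an
  element \<open>f e\<close> of the line spanned by \<open>e\<close> is a section of \<open>\<E>'\<close> over \<open>U\<close> iff it is a section of \<open>\<E>\<close> over
  \<open>U\<close>, because locally a nonzero multiple of such a section lies in \<open>\<E>'\<close>, hence is killed by the map to
  the torsion-free module. So both decorations are described by the same condition.

  For part (ii) the coefficient at \<open>P\<close> of the decoration of \<open>e\<close> is the largest \<open>- ord f\<close> with \<open>f e\<close> in the
  stalk at the generic point of \<open>P\<close>, and surjectivity on stalks gives the maximum. This requires
  existence and uniqueness of the decoration. The local ring at \<open>P\<close> is a discrete valuation ring; the
  coefficient is finite since the stalk is finitely generated and some local functional does not
  vanish on \<open>e\<close>; almost all coefficients vanish since \<open>X\<close> is Noetherian; and an element lying in all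
  stalks at prime divisors meeting \<open>U\<close> is a section over \<open>U\<close>, since pairing it with local functionals
  gives regular functions (Hartogs) and thus a section of the bidual.

  Both the discrete valuation rings and Hartogs' property come from one argument: in a Noetherian
  domain \<open>A\<close> a maximal ideal of denominators \<open>p = {x. x g \<in> A}\<close> is prime, and if \<open>A\<^sub>p\<close> is integrally
  closed then \<open>p A\<^sub>p\<close> is generated by \<open>1/g\<close>, so that \<open>p\<close> has height one.
\<close>

section \<open>Noetherian subrings\<close>

text \<open>Coordinate rings, ideals and localizations are kept as subsets of one field, with the
  operations of that field. Inclusions between local rings are then literal, and nothing has to be
  transported between different localizations; abstract fractions occur only where the structure
  sheaf of a spectrum or the definition of normality is unfolded. Negatives of ideal elements come
  from multiplication by \<open>-1\<close>, which every subring contains.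

  Most objects of the statement are definite descriptions: the generic point, the operations of
  stalks, the order along a divisor, the decoration. Each of them has to be shown independent of
  choices before it can be computed, and this accounts for much of the length.

  Coherent modules are not described by modules over coordinate rings. Finite local generation
  supplies denominators and bounds for functionals. Bijectivity onto the bidual supplies the rest:
  its injectivity shows that generic germs determine sections and that functionals separate
  elements, its surjectivity constructs sections.\<close>

definition sub_ideal :: "('a, 'b) ring_scheme \<Rightarrow> 'a set \<Rightarrow> 'a set \<Rightarrow> bool" where
  "sub_ideal R A I \<longleftrightarrow>
     I \<subseteq> A \<and> \<zero>\<^bsub>R\<^esub> \<in> I \<and> (\<forall>x\<in>I. \<forall>y\<in>I. x \<oplus>\<^bsub>R\<^esub> y \<in> I) \<and> (\<forall>a\<in>A. \<forall>x\<in>I. a \<otimes>\<^bsub>R\<^esub> x \<in> I)"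

definition sub_prime :: "('a, 'b) ring_scheme \<Rightarrow> 'a set \<Rightarrow> 'a set \<Rightarrow> bool" where
  "sub_prime R A p \<longleftrightarrow>
     sub_ideal R A p \<and> \<one>\<^bsub>R\<^esub> \<notin> p \<and> (\<forall>a\<in>A. \<forall>b\<in>A. a \<otimes>\<^bsub>R\<^esub> b \<in> p \<longrightarrow> a \<in> p \<or> b \<in> p)"

definition height_one :: "('a, 'b) ring_scheme \<Rightarrow> 'a set \<Rightarrow> 'a set \<Rightarrow> bool" where
  "height_one R A p \<longleftrightarrow>
     sub_prime R A p \<and> p \<noteq> {\<zero>\<^bsub>R\<^esub>} \<and>
     (\<forall>q. sub_prime R A q \<and> q \<subseteq> p \<longrightarrow> q = {\<zero>\<^bsub>R\<^esub>} \<or> q = p)"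

text \<open>Stated as a chain condition for subrings of an ambient ring, so that elements can be
  adjoined one at a time within that ring.\<close>

definition sub_noetherian :: "('a, 'b) ring_scheme \<Rightarrow> 'a set \<Rightarrow> bool" where
  "sub_noetherian R A \<longleftrightarrow>
     subring A R \<and>
     (\<forall>I :: nat \<Rightarrow> 'a set. (\<forall>n. sub_ideal R A (I n)) \<and> (\<forall>n. I n \<subseteq> I (Suc n)) \<longrightarrow>
        (\<exists>N. \<forall>n\<ge>N. I n = I N))"

lemma sub_idealD:
  assumes "sub_ideal R A I"
  shows "I \<subseteq> A" "\<zero>\<^bsub>R\<^esub> \<in> I" "\<And>x y. x \<in> I \<Longrightarrow> y \<in> I \<Longrightarrow> x \<oplus>\<^bsub>R\<^esub> y \<in> I"
    "\<And>a x. a \<in> A \<Longrightarrow> x \<in> I \<Longrightarrow> a \<otimes>\<^bsub>R\<^esub> x \<in> I"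
  using assms unfolding sub_ideal_def by auto

lemma sub_primeD:
  assumes "sub_prime R A p"
  shows "sub_ideal R A p" "\<one>\<^bsub>R\<^esub> \<notin> p"
    "\<And>a b. a \<in> A \<Longrightarrow> b \<in> A \<Longrightarrow> a \<otimes>\<^bsub>R\<^esub> b \<in> p \<Longrightarrow> a \<in> p \<or> b \<in> p"
  using assms unfolding sub_prime_def by auto

lemma sub_noetherianE:
  assumes "sub_noetherian R A" "\<And>n. sub_ideal R A (I n)" "\<And>n. I n \<subseteq> I (Suc n)"
  obtains N where "\<And>n. n \<ge> N \<Longrightarrow> I n = I N"
  using assms unfolding sub_noetherian_def by blast

text \<open>Otherwise dependent choice yields a strictly increasing chain in
  \<open>S\<close>.\<close>

lemma sub_noetherian_maximal:
  assumes "sub_noetherian R A" "I\<^sub>0 \<in> S" and S: "\<And>I. I \<in> S \<Longrightarrow> sub_ideal R A I"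
  shows "\<exists>M\<in>S. \<forall>J\<in>S. M \<subseteq> J \<longrightarrow> J = M"
proof (rule ccontr)
  assume "\<not> ?thesis"
  then have *: "\<And>M. M \<in> S \<Longrightarrow> \<exists>J\<in>S. M \<subset> J" by blast
  obtain f :: "nat \<Rightarrow> 'a set" where f: "\<And>n. f n \<in> S" "\<And>n. f n \<subset> f (Suc n)"
    using dependent_nat_choice[of "\<lambda>_ M. M \<in> S" "\<lambda>_ M J. M \<subset> J"] assms(2) * by metis
  obtain N where "\<And>n. n \<ge> N \<Longrightarrow> f n = f N"
    using sub_noetherianE[OF assms(1), of f] S f by blast
  then show False using f(2)[of N] by (metis le_Suc_eq order.refl psubset_eq)
qed

text \<open>A chain of ideals of the image is recovered from the chain of preimages in
  \<open>A\<close>, since \<open>h\<close> maps \<open>A\<close> onto the image.\<close>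

lemma sub_noetherian_image:
  assumes "ring R" "ring S" "h \<in> ring_hom R S" "sub_noetherian R A"
  shows "sub_noetherian S (h ` A)"
proof -
  interpret h: ring_hom_ring R S h using assms by (simp add: ring_hom_ringI2)
  have A: "subring A R" using assms(4) by (simp add: sub_noetherian_def)
  then have AR: "A \<subseteq> carrier R" by (rule subringE)
  have "\<exists>N. \<forall>n\<ge>N. I n = I N" if I: "\<And>n::nat. sub_ideal S (h ` A) (I n)" "\<And>n. I n \<subseteq> I (Suc n)" for I
  proof -
    define J where "J n = {a \<in> A. h a \<in> I n}" for n
    have hJ: "h ` J n = I n" for n
      using sub_idealD(1)[OF I(1)[of n]] by (auto simp: J_def)
    have "sub_ideal R A (J n)" for n
      using sub_idealD[OF I(1)[of n]] subringE[OF A] AR unfolding sub_ideal_def J_def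
      by (auto simp: subset_iff)
    moreover have "J n \<subseteq> J (Suc n)" for n using I(2) by (auto simp: J_def)
    ultimately obtain N where "\<And>n. n \<ge> N \<Longrightarrow> J n = J N" using sub_noetherianE[OF assms(4)] by metis
    then have "\<forall>n\<ge>N. I n = I N" using hJ by metis
    then show ?thesis ..
  qed
  moreover have "subring (h ` A) S" using h.img_is_subring[OF A] .
  ultimately show ?thesis unfolding sub_noetherian_def by blast
qed

section \<open>Polynomial expressions in one element, of degree below \<open>n\<close>\<close>

primrec pol :: "('a, 'b) ring_scheme \<Rightarrow> 'a set \<Rightarrow> 'a \<Rightarrow> nat \<Rightarrow> 'a set" where
  "pol R A s 0 = {\<zero>\<^bsub>R\<^esub>}"
| "pol R A s (Suc n) = {x \<oplus>\<^bsub>R\<^esub> a \<otimes>\<^bsub>R\<^esub> s [^]\<^bsub>R\<^esub> n | x a. x \<in> pol R A s n \<and> a \<in> A}"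

context cring
begin

lemma pol_carrier:
  assumes "subring A R" "s \<in> carrier R"
  shows "pol R A s n \<subseteq> carrier R"
  using subringE(1)[OF assms(1)] assms(2) by (induction n) auto

lemma pol_zero:
  assumes "subring A R" "s \<in> carrier R"
  shows "\<zero> \<in> pol R A s n"
proof (induction n)
  case (Suc n)
  have "\<zero> = \<zero> \<oplus> \<zero> \<otimes> s [^] n" using assms by simp
  then show ?case using Suc subringE(2)[OF assms(1)] by auto
qed simp

lemma pol_Suc_mono:
  assumes "subring A R" "s \<in> carrier R"
  shows "pol R A s n \<subseteq> pol R A s (Suc n)"
proof
  fix x assume x: "x \<in> pol R A s n"
  have "x = x \<oplus> \<zero> \<otimes> s [^] n" using assms(2) subsetD[OF pol_carrier[OF assms] x] by simp
  then show "x \<in> pol R A s (Suc n)" using x subringE(2)[OF assms(1)] by auto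
qed

lemma pol_mono:
  assumes "subring A R" "s \<in> carrier R" "m \<le> n"
  shows "pol R A s m \<subseteq> pol R A s n"
  using lift_Suc_mono_le[of "pol R A s", OF pol_Suc_mono[OF assms(1,2)] assms(3)] by simp

lemma pol_add:
  assumes A: "subring A R" and s: "s \<in> carrier R"
  shows "x \<in> pol R A s n \<Longrightarrow> y \<in> pol R A s n \<Longrightarrow> x \<oplus> y \<in> pol R A s n"
proof (induction n arbitrary: x y)
  case (Suc n)
  obtain x' a y' b where *: "x = x' \<oplus> a \<otimes> s [^] n" "y = y' \<oplus> b \<otimes> s [^] n"
    "x' \<in> pol R A s n" "y' \<in> pol R A s n" "a \<in> A" "b \<in> A"
    using Suc.prems by auto
  have c: "x' \<in> carrier R" "y' \<in> carrier R" "a \<in> carrier R" "b \<in> carrier R"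
    using * pol_carrier[OF A s] subringE(1)[OF A] by auto
  have "x \<oplus> y = (x' \<oplus> y') \<oplus> (a \<oplus> b) \<otimes> s [^] n"
    using c s *(1,2) by (simp add: l_distr a_ac)
  then show ?case using Suc.IH[OF *(3,4)] subringE(7)[OF A *(5,6)] by auto
qed simp

lemma pol_smult:
  assumes A: "subring A R" and s: "s \<in> carrier R" and b: "b \<in> A"
  shows "x \<in> pol R A s n \<Longrightarrow> b \<otimes> x \<in> pol R A s n"
proof (induction n arbitrary: x)
  case 0
  then show ?case using b subringE(1)[OF A] by auto
next
  case (Suc n)
  obtain x' a where *: "x = x' \<oplus> a \<otimes> s [^] n" "x' \<in> pol R A s n" "a \<in> A"
    using Suc.prems by auto
  have c: "x' \<in> carrier R" "a \<in> carrier R" "b \<in> carrier R"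
    using * b pol_carrier[OF A s] subringE(1)[OF A] by auto
  have "b \<otimes> x = b \<otimes> x' \<oplus> (b \<otimes> a) \<otimes> s [^] n"
    using c s *(1) by (simp add: r_distr m_assoc)
  then show ?case using Suc.IH[OF *(2)] subringE(6)[OF A b *(3)] by auto
qed

lemma pol_minus:
  assumes A: "subring A R" and s: "s \<in> carrier R" and x: "x \<in> pol R A s n"
  shows "\<ominus> x \<in> pol R A s n"
proof -
  have "\<ominus> x = (\<ominus> \<one>) \<otimes> x" using subsetD[OF pol_carrier[OF A s] x] by (simp add: l_minus)
  then show ?thesis using pol_smult[OF A s subringE(5)[OF A subringE(3)[OF A]] x] by simp
qed

lemma pol_shift:
  assumes A: "subring A R" and s: "s \<in> carrier R"
  shows "x \<in> pol R A s n \<Longrightarrow> s \<otimes> x \<in> pol R A s (Suc n)"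
proof (induction n arbitrary: x)
  case 0
  then show ?case using s pol_zero[OF A s, of "Suc 0"] by (simp del: pol.simps(2))
next
  case (Suc n)
  obtain x' a where *: "x = x' \<oplus> a \<otimes> s [^] n" "x' \<in> pol R A s n" "a \<in> A"
    using Suc.prems by auto
  have c: "x' \<in> carrier R" "a \<in> carrier R"
    using * pol_carrier[OF A s] subringE(1)[OF A] by auto
  have "s \<otimes> x = s \<otimes> x' \<oplus> a \<otimes> s [^] Suc n"
    using c s *(1) by (simp add: r_distr m_ac)
  then show ?case using Suc.IH[OF *(2)] *(3) pol.simps(2)[of R A s "Suc n"] by blast
qed

text \<open>Passes from the recursive description to the sum in which integral equations are
  stated.\<close>

lemma pol_coeffs:
  assumes A: "subring A R" and s: "s \<in> carrier R"
  shows "x \<in> pol R A s n \<Longrightarrow> \<exists>c\<in>{..<n} \<rightarrow> A. x = (\<Oplus>i\<in>{..<n}. c i \<otimes> s [^] i)"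
proof (induction n arbitrary: x)
  case (Suc n)
  obtain x' a where *: "x = x' \<oplus> a \<otimes> s [^] n" "x' \<in> pol R A s n" "a \<in> A"
    using Suc.prems by auto
  obtain c where c: "c \<in> {..<n} \<rightarrow> A" "x' = (\<Oplus>i\<in>{..<n}. c i \<otimes> s [^] i)"
    using Suc.IH[OF *(2)] by blast
  have A': "A \<subseteq> carrier R" by (rule subringE[OF A])
  let ?c = "c(n := a)"
  have "(\<Oplus>i\<in>{..<n}. ?c i \<otimes> s [^] i) = (\<Oplus>i\<in>{..<n}. c i \<otimes> s [^] i)"
    by (rule finsum_cong') (use c(1) A' s in auto)
  moreover have "(\<Oplus>i\<in>{..<Suc n}. ?c i \<otimes> s [^] i) = ?c n \<otimes> s [^] n \<oplus> (\<Oplus>i\<in>{..<n}. ?c i \<otimes> s [^] i)"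
    unfolding lessThan_Suc by (rule finsum_insert) (use c(1) A' s *(3) in \<open>auto simp: Pi_iff subset_iff\<close>)
  ultimately have "x = (\<Oplus>i\<in>{..<Suc n}. ?c i \<otimes> s [^] i)"
    using c *(1,3) A' s pol_carrier[OF A s] *(2) by (auto simp: a_comm subset_iff)
  moreover have "?c \<in> {..<Suc n} \<rightarrow> A" using c(1) *(3) by (auto simp: Pi_iff less_Suc_eq)
  ultimately show ?case by blast
qed auto

definition adjoin :: "'a set \<Rightarrow> 'a \<Rightarrow> 'a set" where
  "adjoin A s = (\<Union>n. pol R A s n)"

lemma adjoin_superset:
  assumes A: "subring A R" and s: "s \<in> carrier R"
  shows "A \<subseteq> adjoin A s" "s \<in> adjoin A s"
proof -
  have 1: "a \<in> pol R A s 1" if "a \<in> A" for a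
  proof -
    have "a = \<zero> \<oplus> a \<otimes> s [^] (0::nat)" using that subringE(1)[OF A] by auto
    then show ?thesis using that by auto
  qed
  then show "A \<subseteq> adjoin A s" unfolding adjoin_def by blast
  have "s \<otimes> \<one> \<in> pol R A s (Suc 1)" by (rule pol_shift[OF A s 1[OF subringE(3)[OF A]]])
  then show "s \<in> adjoin A s" unfolding adjoin_def using s by (metis UN_I UNIV_I r_one)
qed

lemma subring_adjoin:
  assumes A: "subring A R" and s: "s \<in> carrier R"
  shows "subring (adjoin A s) R"
proof (rule subringI)
  show 1: "adjoin A s \<subseteq> carrier R" using pol_carrier[OF A s] by (auto simp: adjoin_def)
  show "\<one> \<in> adjoin A s" using adjoin_superset[OF A s] subringE(3)[OF A] by blast
  show "\<ominus> h \<in> adjoin A s" if "h \<in> adjoin A s" for h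
    using that pol_minus[OF A s] by (auto simp: adjoin_def)
  show add: "h1 \<oplus> h2 \<in> adjoin A s" if h: "h1 \<in> adjoin A s" "h2 \<in> adjoin A s" for h1 h2
  proof -
    obtain m n where "h1 \<in> pol R A s m" "h2 \<in> pol R A s n" using h by (auto simp: adjoin_def)
    then have "h1 \<in> pol R A s (max m n)" "h2 \<in> pol R A s (max m n)"
      using pol_mono[OF A s, of m "max m n"] pol_mono[OF A s, of n "max m n"] by auto
    then show ?thesis using pol_add[OF A s] by (auto simp: adjoin_def)
  qed
  \<comment> \<open>With \<open>h2\<close> fixed, stability under coefficients (\<open>sm\<close>)
    and under powers of \<open>s\<close> (\<open>sh\<close>) suffices, because the first factor can
    then be handled term by term.\<close>
  show "h1 \<otimes> h2 \<in> adjoin A s" if "h1 \<in> adjoin A s" and h2: "h2 \<in> adjoin A s" for h1 h2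
  proof -
    have sm: "a \<otimes> y \<in> adjoin A s" if "a \<in> A" "y \<in> adjoin A s" for a y
      using that pol_smult[OF A s] by (auto simp: adjoin_def)
    have sh: "s [^] n \<otimes> h2 \<in> adjoin A s" for n :: nat
    proof (induction n)
      case 0
      then show ?case using h2 1 by auto
    next
      case (Suc n)
      have "s [^] Suc n \<otimes> h2 = s \<otimes> (s [^] n \<otimes> h2)" using s h2 1 by (auto simp: m_ac)
      moreover obtain k where "s [^] n \<otimes> h2 \<in> pol R A s k" using Suc by (auto simp: adjoin_def)
      ultimately have "s [^] Suc n \<otimes> h2 \<in> pol R A s (Suc k)" using pol_shift[OF A s] by simp
      then show ?case unfolding adjoin_def by blast
    qed
    have "x \<otimes> h2 \<in> adjoin A s" if "x \<in> pol R A s n" for x n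
      using that
    proof (induction n arbitrary: x)
      case 0
      then have "x \<otimes> h2 = \<zero>" using subsetD[OF 1 h2] by simp
      then show ?case using pol_zero[OF A s] by (auto simp: adjoin_def)
    next
      case (Suc n)
      obtain x' a where *: "x = x' \<oplus> a \<otimes> s [^] n" "x' \<in> pol R A s n" "a \<in> A"
        using Suc.prems by auto
      have c: "x' \<in> carrier R" "a \<in> carrier R" "h2 \<in> carrier R"
        using * 1 h2 pol_carrier[OF A s] subringE(1)[OF A] by auto
      have "x \<otimes> h2 = x' \<otimes> h2 \<oplus> a \<otimes> (s [^] n \<otimes> h2)"
        using c s *(1) by (simp add: l_distr m_assoc)
      then show ?case using add[OF Suc.IH[OF *(2)] sm[OF *(3) sh]] by simp
    qed
    then show ?thesis using that by (auto simp: adjoin_def)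
  qed
qed

section \<open>Leading coefficients and the Hilbert basis theorem\<close>

definition lead_ideal :: "'a set \<Rightarrow> 'a \<Rightarrow> 'a set \<Rightarrow> nat \<Rightarrow> 'a set" where
  "lead_ideal A s I n = {a \<in> A. \<exists>x\<in>pol R A s n. x \<oplus> a \<otimes> s [^] n \<in> I}"

lemma lead_ideal_ideal:
  assumes A: "subring A R" and s: "s \<in> carrier R" and I: "sub_ideal R (adjoin A s) I"
  shows "sub_ideal R A (lead_ideal A s I n)"
  unfolding sub_ideal_def
proof (intro conjI ballI)
  note AE = subringE[OF A]
  note pc = pol_carrier[OF A s]
  show "lead_ideal A s I n \<subseteq> A" by (auto simp: lead_ideal_def)
  have "\<zero> \<oplus> \<zero> \<otimes> s [^] n \<in> I" using sub_idealD(2)[OF I] s by simp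
  then show "\<zero> \<in> lead_ideal A s I n" unfolding lead_ideal_def using AE(2) pol_zero[OF A s] by blast
  fix a assume "a \<in> lead_ideal A s I n"
  then obtain x where x: "x \<in> pol R A s n" "x \<oplus> a \<otimes> s [^] n \<in> I" "a \<in> A" by (auto simp: lead_ideal_def)
  have xc: "x \<in> carrier R" "a \<in> carrier R" using x pc AE(1) by auto
  {
    fix b assume "b \<in> lead_ideal A s I n"
    then obtain y where y: "y \<in> pol R A s n" "y \<oplus> b \<otimes> s [^] n \<in> I" "b \<in> A" by (auto simp: lead_ideal_def)
    have yc: "y \<in> carrier R" "b \<in> carrier R" using y pc AE(1) by auto
    have "(x \<oplus> y) \<oplus> (a \<oplus> b) \<otimes> s [^] n = (x \<oplus> a \<otimes> s [^] n) \<oplus> (y \<oplus> b \<otimes> s [^] n)"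
      using xc yc s by (simp add: l_distr a_ac)
    then have "(x \<oplus> y) \<oplus> (a \<oplus> b) \<otimes> s [^] n \<in> I" using sub_idealD(3)[OF I x(2) y(2)] by simp
    then show "a \<oplus> b \<in> lead_ideal A s I n"
      unfolding lead_ideal_def using AE(7)[OF x(3) y(3)] pol_add[OF A s x(1) y(1)] by blast
  next
    fix b assume b: "b \<in> A"
    then have bc: "b \<in> carrier R" using AE(1) by auto
    have "b \<otimes> x \<oplus> (b \<otimes> a) \<otimes> s [^] n = b \<otimes> (x \<oplus> a \<otimes> s [^] n)"
      using xc bc s by (simp add: r_distr m_assoc)
    then have "b \<otimes> x \<oplus> (b \<otimes> a) \<otimes> s [^] n \<in> I"
      using sub_idealD(4)[OF I _ x(2)] adjoin_superset[OF A s] b by auto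
    then show "b \<otimes> a \<in> lead_ideal A s I n"
      unfolding lead_ideal_def using AE(6)[OF b x(3)] pol_smult[OF A s b x(1)] by blast
  }
qed

text \<open>Multiplication by \<open>s\<close> shifts the degree and keeps the leading
  coefficient.\<close>

lemma lead_ideal_Suc:
  assumes A: "subring A R" and s: "s \<in> carrier R" and I: "sub_ideal R (adjoin A s) I"
  shows "lead_ideal A s I n \<subseteq> lead_ideal A s I (Suc n)"
proof
  fix a assume "a \<in> lead_ideal A s I n"
  then obtain x where x: "x \<in> pol R A s n" "x \<oplus> a \<otimes> s [^] n \<in> I" "a \<in> A" by (auto simp: lead_ideal_def)
  have xc: "x \<in> carrier R" "a \<in> carrier R" using x pol_carrier[OF A s] subringE(1)[OF A] by auto
  have "s \<otimes> x \<oplus> a \<otimes> s [^] Suc n = s \<otimes> (x \<oplus> a \<otimes> s [^] n)"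
    using xc s by (simp add: r_distr m_ac)
  then have "s \<otimes> x \<oplus> a \<otimes> s [^] Suc n \<in> I"
    using sub_idealD(4)[OF I adjoin_superset(2)[OF A s] x(2)] by simp
  then show "a \<in> lead_ideal A s I (Suc n)"
    unfolding lead_ideal_def using x(3) pol_shift[OF A s x(1)] by blast
qed

text \<open>An element of \<open>J\<close> and an element of \<open>I\<close> with the same top
  coefficient differ by an element of \<open>J\<close> with fewer terms, which lies in
  \<open>I\<close> by induction on the number of terms.\<close>

lemma lead_ideals_determine:
  assumes A: "subring A R" and s: "s \<in> carrier R"
    and I: "sub_ideal R (adjoin A s) I" and J: "sub_ideal R (adjoin A s) J"
    and "I \<subseteq> J" and L: "\<And>n. lead_ideal A s J n \<subseteq> lead_ideal A s I n"
  shows "I = J"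
proof -
  note AE = subringE[OF A]
  have B: "subring (adjoin A s) R" by (rule subring_adjoin[OF A s])
  have "y \<in> I" if "y \<in> J" "y \<in> pol R A s n" for y n
    using that
  proof (induction n arbitrary: y)
    case 0
    then show ?case using sub_idealD(2)[OF I] by simp
  next
    case (Suc n)
    obtain x a where *: "y = x \<oplus> a \<otimes> s [^] n" "x \<in> pol R A s n" "a \<in> A"
      using Suc.prems by auto
    then have "a \<in> lead_ideal A s I n" using Suc.prems L by (auto simp: lead_ideal_def)
    then obtain z where z: "z \<in> pol R A s n" "z \<oplus> a \<otimes> s [^] n \<in> I" by (auto simp: lead_ideal_def)
    have c: "x \<in> carrier R" "z \<in> carrier R" "a \<in> carrier R"
      using * z pol_carrier[OF A s] AE(1) by auto
    have neg: "(\<ominus> \<one>) \<otimes> (z \<oplus> a \<otimes> s [^] n) \<in> J"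
      using sub_idealD(4)[OF J subringE(5)[OF B subringE(3)[OF B]]] z(2) \<open>I \<subseteq> J\<close> by blast
    define w where "w = a \<otimes> s [^] n"
    have w: "w \<in> carrier R" using c s by (simp add: w_def)
    have "x \<oplus> \<ominus> z = (x \<oplus> w) \<oplus> (\<ominus> \<one>) \<otimes> (z \<oplus> w)"
      using c w by (simp add: l_minus minus_add) algebra
    then have "x \<oplus> \<ominus> z = y \<oplus> (\<ominus> \<one>) \<otimes> (z \<oplus> a \<otimes> s [^] n)"
      using *(1) by (simp add: w_def)
    then have "x \<oplus> \<ominus> z \<in> J" using sub_idealD(3)[OF J Suc.prems(1) neg] by simp
    then have "x \<oplus> \<ominus> z \<in> I"
      using Suc.IH pol_add[OF A s *(2) pol_minus[OF A s z(1)]] by blast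
    moreover have "x \<oplus> w = (x \<oplus> \<ominus> z) \<oplus> (z \<oplus> w)"
      using c w by (simp add: a_assoc r_neg1)
    then have "y = (x \<oplus> \<ominus> z) \<oplus> (z \<oplus> a \<otimes> s [^] n)"
      using *(1) by (simp add: w_def)
    ultimately show ?case using sub_idealD(3)[OF I _ z(2)] by simp
  qed
  then show ?thesis using \<open>I \<subseteq> J\<close> sub_idealD(1)[OF J] by (auto simp: adjoin_def)
qed

text \<open>The Hilbert basis theorem. No polynomial ring is needed: leading coefficients are taken of
  polynomial expressions in \<open>s\<close>, which need not be unique.\<close>

lemma sub_noetherian_adjoin:
  assumes noeth: "sub_noetherian R A" and s: "s \<in> carrier R"
  shows "sub_noetherian R (adjoin A s)"
proof -
  have A: "subring A R" using noeth by (simp add: sub_noetherian_def)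
  have "\<exists>N. \<forall>n\<ge>N. I n = I N"
    if I: "\<And>n::nat. sub_ideal R (adjoin A s) (I n)" "\<And>n. I n \<subseteq> I (Suc n)" for I
  proof -
    define L where "L j n = lead_ideal A s (I j) n" for j n
    have Imono: "I i \<subseteq> I j" if "i \<le> j" for i j using lift_Suc_mono_le[of I, OF I(2) that] .
    have Lid: "sub_ideal R A (L j n)" for j n using lead_ideal_ideal[OF A s I(1)] by (simp add: L_def)
    have L1: "L i n \<subseteq> L j n" if "i \<le> j" for i j n
      using Imono[OF that] by (auto simp: L_def lead_ideal_def)
    have L2: "L j m \<subseteq> L j n" if "m \<le> n" for j m n
      using lift_Suc_mono_le[of "L j", OF _ that] lead_ideal_Suc[OF A s I(1)] by (simp add: L_def)
    \<comment> \<open>The diagonal controls all degrees \<open>n \<ge> N\<close> at once. Each of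
      the finitely many lower degrees stabilizes by itself, and \<open>Q\<close> lies beyond all of
      these points.\<close>
    obtain N where N: "\<And>n. n \<ge> N \<Longrightarrow> L n n = L N N"
      using sub_noetherianE[OF noeth, of "\<lambda>n. L n n"] Lid L1 L2 by (meson dual_order.trans le_SucI order.refl)
    have "\<exists>M. \<forall>j\<ge>M. L j n = L M n" for n
      using sub_noetherianE[OF noeth, of "\<lambda>j. L j n"] Lid L1 by (metis le_SucI order.refl)
    then obtain M where M: "\<And>n j. j \<ge> M n \<Longrightarrow> L j n = L (M n) n" by metis
    define Q where "Q = Max (insert N (M ` {..<N}))"
    have Q: "Q \<ge> N" "\<And>n. n < N \<Longrightarrow> Q \<ge> M n" unfolding Q_def by (auto intro: Max_ge)
    have "I j = I Q" if "j \<ge> Q" for j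
    proof -
      have "L j n \<subseteq> L Q n" for n
      proof (cases "n < N")
        case True
        then show ?thesis using M[of n j] M[of n Q] Q(2)[of n] that by simp
      next
        case False
        \<comment> \<open>In a degree \<open>n \<ge> N\<close> every leading ideal lies below a
          diagonal term, which equals \<open>L N N\<close> and hence is contained in
          \<open>L Q n\<close>.\<close>
        have "L j n \<subseteq> L (max j n) (max j n)" using L1[of j "max j n" n] L2[of n "max j n"] by fastforce
        also have "\<dots> = L N N" using N[of "max j n"] False by simp
        also have "\<dots> \<subseteq> L Q n" using L1[of N Q N] L2[of N n Q] Q(1) False by fastforce
        finally show ?thesis .
      qed
      then have "I Q = I j"
        using lead_ideals_determine[OF A s I(1) I(1) Imono[OF that]] by (simp add: L_def)
      then show ?thesis ..
    qed
    then show ?thesis by blast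
  qed
  then show ?thesis using subring_adjoin[OF A s] unfolding sub_noetherian_def by blast
qed

text \<open>The generators are adjoined one after the other; the Noetherian ring obtained contains
  everything that \<open>generate_ring\<close> produces.\<close>

lemma sub_noetherian_generate:
  assumes "sub_noetherian R A" "finite S" "S \<subseteq> carrier R" "generate_ring R (A \<union> S) = carrier R"
  shows "sub_noetherian R (carrier R)"
proof -
  have "\<exists>B. sub_noetherian R B \<and> A \<union> S \<subseteq> B"
    using assms(2,3)
  proof (induction S)
    case empty
    then show ?case using assms(1) by auto
  next
    case (insert s S)
    then obtain B where "sub_noetherian R B" "A \<union> S \<subseteq> B" by auto
    moreover from this have "subring B R" by (simp add: sub_noetherian_def)
    ultimately show ?case
      using sub_noetherian_adjoin[of B s] adjoin_superset[of B s] insert.prems by blast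
  qed
  then obtain B where B: "sub_noetherian R B" "A \<union> S \<subseteq> B" by blast
  then have sB: "subring B R" by (simp add: sub_noetherian_def)
  have "x \<in> B" if "x \<in> generate_ring R (A \<union> S)" for x
    using that by induction (use B(2) subringE[OF sB] in auto)
  then have "B = carrier R" using assms(4) subringE(1)[OF sB] by blast
  then show ?thesis using B(1) by simp
qed

text \<open>Such a subring has only the zero ideal and itself as ideals. Applied to the ground
  field, this is where the Hilbert basis theorem starts.\<close>

lemma sub_noetherian_division:
  assumes A: "subring A R" and div: "\<And>x. x \<in> A \<Longrightarrow> x \<noteq> \<zero> \<Longrightarrow> \<exists>y\<in>A. y \<otimes> x = \<one>"
  shows "sub_noetherian R A"
proof -
  have *: "I = {\<zero>} \<or> I = A" if I: "sub_ideal R A I" for I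
  proof (cases "I = {\<zero>}")
    case False
    then obtain x where x: "x \<in> I" "x \<noteq> \<zero>" using sub_idealD(2)[OF I] by blast
    then obtain y where "y \<in> A" "y \<otimes> x = \<one>" using div sub_idealD(1)[OF I] by blast
    then have "\<one> \<in> I" using sub_idealD(4)[OF I] x by metis
    then have "a \<in> I" if "a \<in> A" for a
      using sub_idealD(4)[OF I that] that subringE(1)[OF A] by (metis r_one subsetD)
    then show ?thesis using sub_idealD(1)[OF I] by blast
  qed simp
  have "\<exists>N. \<forall>n\<ge>N. I n = I N" if I: "\<And>n::nat. sub_ideal R A (I n)" "\<And>n. I n \<subseteq> I (Suc n)" for I
  proof (cases "\<exists>N. I N = A")
    case True
    then obtain N where N: "I N = A" by blast
    have "I n = I N" if "n \<ge> N" for n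
      using lift_Suc_mono_le[of I, OF I(2) that] N sub_idealD(1)[OF I(1)[of n]] by blast
    then show ?thesis by blast
  next
    case False
    then have "\<And>n. I n = {\<zero>}" using * I(1) by blast
    then show ?thesis by blast
  qed
  then show ?thesis using A unfolding sub_noetherian_def by blast
qed

end

section \<open>Denominators and discrete valuation rings\<close>

text \<open>\<open>loc K A p\<close> is the localization of \<open>A\<close> at \<open>p\<close> as a subset of \<open>K\<close>, described through denominators
  so that no inverses occur.\<close>

definition loc :: "('a, 'b) ring_scheme \<Rightarrow> 'a set \<Rightarrow> 'a set \<Rightarrow> 'a set" where
  "loc K A p = {x \<in> carrier K. \<exists>b\<in>A - p. b \<otimes>\<^bsub>K\<^esub> x \<in> A}"

text \<open>The annihilator of the class of \<open>f\<close> modulo \<open>A\<close>. It lies in a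
  prime \<open>p\<close> exactly if \<open>f\<close> is outside the localization at \<open>p\<close>
  (\<open>loc_iff_den\<close>).\<close>

definition den :: "('a, 'b) ring_scheme \<Rightarrow> 'a set \<Rightarrow> 'a \<Rightarrow> 'a set" where
  "den K A f = {x \<in> A. x \<otimes>\<^bsub>K\<^esub> f \<in> A}"

text \<open>The condition of \<open>integrally_closed_domain\<close>, with the given field in place
  of an abstract fraction field.\<close>

definition integrally_closed_in :: "('a, 'b) ring_scheme \<Rightarrow> 'a set \<Rightarrow> bool" where
  "integrally_closed_in K B \<longleftrightarrow>
     (\<forall>f\<in>carrier K. (\<exists>(n::nat) c. n > 0 \<and> c \<in> {..<n} \<rightarrow> B \<and>
         f [^]\<^bsub>K\<^esub> n \<oplus>\<^bsub>K\<^esub> (\<Oplus>\<^bsub>K\<^esub>i\<in>{..<n}. c i \<otimes>\<^bsub>K\<^esub> f [^]\<^bsub>K\<^esub> i) = \<zero>\<^bsub>K\<^esub>) \<longrightarrow> f \<in> B)"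

text \<open>A discrete valuation ring with uniformizer \<open>t\<close>, given by its
  factorizations. Being a unit of \<open>B\<close> is expressed through the inverse in
  \<open>K\<close>, and \<open>inv t \<notin> B\<close> keeps \<open>t\<close> from being a unit.
  The last clause makes \<open>K\<close> the fraction field of \<open>B\<close>.\<close>

definition dvr_in :: "('a, 'b) ring_scheme \<Rightarrow> 'a set \<Rightarrow> 'a \<Rightarrow> bool" where
  "dvr_in K B t \<longleftrightarrow>
     subring B K \<and> t \<in> B \<and> t \<noteq> \<zero>\<^bsub>K\<^esub> \<and> inv\<^bsub>K\<^esub> t \<notin> B \<and>
     (\<forall>b\<in>B - {\<zero>\<^bsub>K\<^esub>}. \<exists>(n::nat) u. u \<in> B \<and> u \<noteq> \<zero>\<^bsub>K\<^esub> \<and> inv\<^bsub>K\<^esub> u \<in> B \<and> b = u \<otimes>\<^bsub>K\<^esub> t [^]\<^bsub>K\<^esub> n) \<and>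
     (\<forall>f\<in>carrier K. \<exists>b\<in>B - {\<zero>\<^bsub>K\<^esub>}. b \<otimes>\<^bsub>K\<^esub> f \<in> B)"

lemma locI: "x \<in> carrier K \<Longrightarrow> b \<in> A \<Longrightarrow> b \<notin> p \<Longrightarrow> b \<otimes>\<^bsub>K\<^esub> x \<in> A \<Longrightarrow> x \<in> loc K A p"
  by (auto simp: loc_def)

context cring
begin

lemma sub_ideal_den:
  assumes A: "subring A R" and f: "f \<in> carrier R"
  shows "sub_ideal R A (den R A f)"
  using subringE[OF A] f unfolding sub_ideal_def den_def
  by (auto simp: l_distr m_assoc subset_iff)

lemma loc_iff_den: "f \<in> carrier R \<Longrightarrow> f \<in> loc R A p \<longleftrightarrow> \<not> den R A f \<subseteq> p"
  by (auto simp: loc_def den_def)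

lemma loc_superset:
  assumes A: "subring A R" and p: "sub_prime R A p"
  shows "A \<subseteq> loc R A p"
  using subringE[OF A] sub_primeD[OF p] by (fastforce simp: loc_def)

lemma subring_loc:
  assumes A: "subring A R" and p: "sub_prime R A p"
  shows "subring (loc R A p) R"
proof (rule subringI)
  note AE = subringE[OF A]
  show "loc R A p \<subseteq> carrier R" by (auto simp: loc_def)
  show "\<one> \<in> loc R A p" using loc_superset[OF A p] AE(3) by blast
  fix x assume "x \<in> loc R A p"
  then obtain b where b: "x \<in> carrier R" "b \<in> A" "b \<notin> p" "b \<otimes> x \<in> A" by (auto simp: loc_def)
  have bc: "b \<in> carrier R" using b AE(1) by blast
  have "b \<otimes> \<ominus> x = \<ominus> (b \<otimes> x)" using b bc by (simp add: r_minus)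
  then have "b \<otimes> \<ominus> x \<in> A" using AE(5)[OF b(4)] by simp
  then show "\<ominus> x \<in> loc R A p" using b unfolding loc_def by blast
  fix y assume "y \<in> loc R A p"
  then obtain c where c: "y \<in> carrier R" "c \<in> A" "c \<notin> p" "c \<otimes> y \<in> A" by (auto simp: loc_def)
  have cc: "c \<in> carrier R" using c AE(1) by blast
  have bc': "b \<otimes> c \<in> A - p" using AE(6) b c sub_primeD(3)[OF p] by blast
  have "(b \<otimes> c) \<otimes> (x \<otimes> y) = (b \<otimes> x) \<otimes> (c \<otimes> y)" using b c bc cc by (simp add: m_ac)
  then have "(b \<otimes> c) \<otimes> (x \<otimes> y) \<in> A" using AE(6)[OF b(4) c(4)] by simp
  then show "x \<otimes> y \<in> loc R A p" using b c bc' by (intro locI[of _ R "b \<otimes> c"]) auto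
  have "(b \<otimes> c) \<otimes> (x \<oplus> y) = c \<otimes> (b \<otimes> x) \<oplus> b \<otimes> (c \<otimes> y)"
    using b c bc cc by (simp add: r_distr m_ac)
  then have "(b \<otimes> c) \<otimes> (x \<oplus> y) \<in> A" using AE(7)[OF AE(6)[OF c(2) b(4)] AE(6)[OF b(2) c(4)]] by simp
  then show "x \<oplus> y \<in> loc R A p" using b c bc' by (intro locI[of _ R "b \<otimes> c"]) auto
qed

text \<open>The associated prime argument, relative to \<open>q\<close>: among the denominator
  ideals of multiples \<open>x f\<close> that stay inside \<open>q\<close>, a maximal one is prime.
  Staying inside \<open>q\<close> replaces a localization at \<open>q\<close>.\<close>

lemma exists_prime_den:
  assumes noeth: "sub_noetherian R A" and q: "sub_prime R A q" and f: "f \<in> carrier R"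
    and fq: "den R A f \<subseteq> q"
  shows "\<exists>g\<in>carrier R. sub_prime R A (den R A g) \<and> den R A f \<subseteq> den R A g \<and> den R A g \<subseteq> q"
proof -
  have A: "subring A R" using noeth by (simp add: sub_noetherian_def)
  note AE = subringE[OF A]
  define S where "S = {den R A (x \<otimes> f) | x. x \<in> A \<and> den R A (x \<otimes> f) \<subseteq> q}"
  have inS: "den R A (x \<otimes> f) \<in> S" if "x \<in> A" "den R A (x \<otimes> f) \<subseteq> q" for x
    using that by (auto simp: S_def)
  have "den R A (\<one> \<otimes> f) \<in> S" by (rule inS) (use AE(3) f fq in auto)
  moreover have "sub_ideal R A I" if "I \<in> S" for I
    using that sub_ideal_den[OF A] f AE(1) by (auto simp: S_def)
  ultimately obtain M where M: "M \<in> S" "\<And>J. J \<in> S \<Longrightarrow> M \<subseteq> J \<Longrightarrow> J = M"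
    using sub_noetherian_maximal[OF noeth] by metis
  then obtain x where x: "x \<in> A" "M = den R A (x \<otimes> f)" "M \<subseteq> q" by (auto simp: S_def)
  have xc: "x \<in> carrier R" using x AE(1) by blast
  have bigger: "den R A (x \<otimes> f) \<subseteq> den R A ((y \<otimes> x) \<otimes> f)" if y: "y \<in> A" for y
  proof
    fix z assume z: "z \<in> den R A (x \<otimes> f)"
    have "y \<in> carrier R" "z \<in> carrier R" using y z AE(1) by (auto simp: den_def)
    then have "z \<otimes> ((y \<otimes> x) \<otimes> f) = y \<otimes> (z \<otimes> (x \<otimes> f))" using xc f by (simp add: m_ac)
    then show "z \<in> den R A ((y \<otimes> x) \<otimes> f)" using z y AE(6) by (auto simp: den_def)
  qed
  have prime: "sub_prime R A M"
    unfolding sub_prime_def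
  proof (intro conjI ballI impI)
    show "sub_ideal R A M" using sub_ideal_den[OF A] f xc x(2) by auto
    show "\<one> \<notin> M" using x(3) sub_primeD(2)[OF q] by blast
    fix y z assume y: "y \<in> A" and z: "z \<in> A" and yz: "y \<otimes> z \<in> M"
    have yc: "y \<in> carrier R" and zc: "z \<in> carrier R" using y z AE(1) by auto
    have "z \<in> M" if ynM: "y \<notin> M"
    \<comment> \<open>If the denominators of \<open>y x f\<close> stay inside \<open>q\<close>,
      maximality identifies them with \<open>M\<close>, and \<open>z\<close> is one of them.\<close>
    proof (cases "den R A ((y \<otimes> x) \<otimes> f) \<subseteq> q")
      case True
      then have dM: "den R A ((y \<otimes> x) \<otimes> f) = M"
        using M(2)[OF inS[OF AE(6)[OF y x(1)]]] bigger[OF y, folded x(2)] by simp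
      have "z \<otimes> ((y \<otimes> x) \<otimes> f) = (y \<otimes> z) \<otimes> (x \<otimes> f)" using yc zc xc f by (simp add: m_ac)
      then have "z \<in> den R A ((y \<otimes> x) \<otimes> f)" using yz[unfolded x(2)] z by (simp add: den_def)
      then show ?thesis using dM by simp
    next
      case False
      \<comment> \<open>Now \<open>s\<close> outside \<open>q\<close> is a denominator of
        \<open>y x f\<close>, so \<open>y\<close> is a denominator of \<open>s x f\<close>. The two
        cases below contradict \<open>y \<notin> M\<close> and \<open>M \<subseteq> q\<close>,
        respectively.\<close>
      then obtain s where s: "s \<in> A" "s \<otimes> ((y \<otimes> x) \<otimes> f) \<in> A" "s \<notin> q" by (auto simp: den_def)
      have sc: "s \<in> carrier R" using s AE(1) by blast
      have "y \<otimes> ((s \<otimes> x) \<otimes> f) = s \<otimes> ((y \<otimes> x) \<otimes> f)" using yc sc xc f by (simp add: m_ac)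
      then have ysM: "y \<in> den R A ((s \<otimes> x) \<otimes> f)" using s(2) y by (simp add: den_def)
      show ?thesis
      proof (cases "den R A ((s \<otimes> x) \<otimes> f) \<subseteq> q")
        case True
        then have "den R A ((s \<otimes> x) \<otimes> f) = M"
          using M(2)[OF inS[OF AE(6)[OF s(1) x(1)]]] bigger[OF s(1), folded x(2)] by simp
        then show ?thesis using ysM ynM by simp
      next
        case False
        then obtain r where r: "r \<in> A" "r \<otimes> ((s \<otimes> x) \<otimes> f) \<in> A" "r \<notin> q" by (auto simp: den_def)
        have rc: "r \<in> carrier R" using r AE(1) by blast
        have "(r \<otimes> s) \<otimes> (x \<otimes> f) = r \<otimes> ((s \<otimes> x) \<otimes> f)" using rc sc xc f by (simp add: m_ac)
        then have "r \<otimes> s \<in> M" unfolding x(2) using r s AE(6) by (simp add: den_def)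
        then show ?thesis using sub_primeD(3)[OF q r(1) s(1)] x(3) r s by blast
      qed
    qed
    then show "y \<in> M \<or> z \<in> M" by blast
  qed
  have "den R A f \<subseteq> M"
  proof
    fix z assume "z \<in> den R A f"
    then have z: "z \<in> A" "z \<otimes> f \<in> A" by (auto simp: den_def)
    then have "z \<in> carrier R" using AE(1) by blast
    then have "z \<otimes> (x \<otimes> f) = x \<otimes> (z \<otimes> f)" using xc f by (simp add: m_lcomm)
    then show "z \<in> M" using z AE(6)[OF x(1)] unfolding x(2) den_def by simp
  qed
  then show ?thesis using prime x xc f by (intro bexI[of _ "x \<otimes> f"]) auto
qed

text \<open>Noetherian induction on \<open>J\<close>: a maximal counterexample would be a prime ideal.\<close>

lemma finite_height_one_above:
  assumes noeth: "sub_noetherian R A" and J: "sub_ideal R A J" "J \<noteq> {\<zero>}"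
  shows "finite {p. height_one R A p \<and> J \<subseteq> p}"
proof (rule ccontr)
  assume inf: "infinite {p. height_one R A p \<and> J \<subseteq> p}"
  have A: "subring A R" using noeth by (simp add: sub_noetherian_def)
  note AE = subringE[OF A]
  define S where "S = {I. sub_ideal R A I \<and> I \<noteq> {\<zero>} \<and> infinite {p. height_one R A p \<and> I \<subseteq> p}}"
  have "J \<in> S" using J inf by (simp add: S_def)
  then have "\<exists>M\<in>S. \<forall>I\<in>S. M \<subseteq> I \<longrightarrow> I = M"
    by (rule sub_noetherian_maximal[OF noeth]) (simp add: S_def)
  then obtain M where M: "M \<in> S" "\<And>I. I \<in> S \<Longrightarrow> M \<subseteq> I \<Longrightarrow> I = M" by blast
  have Mi: "sub_ideal R A M" and Mn: "M \<noteq> {\<zero>}" and Minf: "infinite {p. height_one R A p \<and> M \<subseteq> p}"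
    using M(1) by (auto simp: S_def)
  \<comment> \<open>A height-one prime that contains the nonzero prime \<open>M\<close> is equal to
    it, so there would be at most one.\<close>
  have "\<not> sub_prime R A M"
  proof
    assume "sub_prime R A M"
    then have "{p. height_one R A p \<and> M \<subseteq> p} \<subseteq> {M}" using Mn by (auto simp: height_one_def)
    then show False using Minf finite_subset by blast
  qed
  moreover have "\<one> \<notin> M"
  proof
    assume "\<one> \<in> M"
    then have "{p. height_one R A p \<and> M \<subseteq> p} = {}" by (auto simp: height_one_def sub_prime_def)
    then show False using Minf by (metis finite.emptyI)
  qed
  ultimately obtain a b where ab: "a \<in> A" "b \<in> A" "a \<otimes> b \<in> M" "a \<notin> M" "b \<notin> M"
    using Mi by (auto simp: sub_prime_def)
  \<comment> \<open>\<open>ext c\<close> is the ideal generated by \<open>M\<close> and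
    \<open>c\<close>. For \<open>c \<notin> M\<close> it is larger than \<open>M\<close>, so
    maximality leaves only finitely many height-one primes above it.\<close>
  define ext where "ext c = {m \<oplus> r \<otimes> c | m r. m \<in> M \<and> r \<in> A}" for c
  have fin: "finite {p. height_one R A p \<and> ext c \<subseteq> p}" if c: "c \<in> A" "c \<notin> M" for c
  proof -
    have cc: "c \<in> carrier R" using c AE(1) by blast
    have MA: "M \<subseteq> A" by (rule sub_idealD[OF Mi])
    have "sub_ideal R A (ext c)"
      unfolding sub_ideal_def
    proof (intro conjI ballI)
      show "ext c \<subseteq> A" using MA AE(6,7) c by (auto simp: ext_def)
      have "\<zero> = \<zero> \<oplus> \<zero> \<otimes> c" using cc by simp
      then show "\<zero> \<in> ext c" using sub_idealD(2)[OF Mi] AE(2) unfolding ext_def by blast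
      fix x assume "x \<in> ext c"
      then obtain m r where x: "x = m \<oplus> r \<otimes> c" "m \<in> M" "r \<in> A" by (auto simp: ext_def)
      have xc: "m \<in> carrier R" "r \<in> carrier R" using x MA AE(1) by auto
      { fix y assume "y \<in> ext c"
        then obtain m' r' where y: "y = m' \<oplus> r' \<otimes> c" "m' \<in> M" "r' \<in> A" by (auto simp: ext_def)
        have yc: "m' \<in> carrier R" "r' \<in> carrier R" using y MA AE(1) by auto
        have "x \<oplus> y = (m \<oplus> m') \<oplus> (r \<oplus> r') \<otimes> c" using x y xc yc cc by (simp add: l_distr a_ac)
        then show "x \<oplus> y \<in> ext c" using sub_idealD(3)[OF Mi] x y AE(7) unfolding ext_def by blast
      next
        fix y assume y: "y \<in> A"
        then have yc: "y \<in> carrier R" using AE(1) by blast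
        have "y \<otimes> x = y \<otimes> m \<oplus> (y \<otimes> r) \<otimes> c" using x xc yc cc by (simp add: r_distr m_assoc)
        then show "y \<otimes> x \<in> ext c" using sub_idealD(4)[OF Mi y] x y AE(6) unfolding ext_def by blast
      }
    qed
    moreover have sub: "M \<subseteq> ext c"
    proof
      fix m assume "m \<in> M"
      moreover have "m = m \<oplus> \<zero> \<otimes> c" using \<open>m \<in> M\<close> MA AE(1) cc by auto
      ultimately show "m \<in> ext c" using AE(2) unfolding ext_def by blast
    qed
    moreover have "c \<in> ext c"
    proof -
      have "c = \<zero> \<oplus> \<one> \<otimes> c" using cc by simp
      then show ?thesis using sub_idealD(2)[OF Mi] AE(3) unfolding ext_def by blast
    qed
    moreover have "ext c \<noteq> {\<zero>}" using sub Mn sub_idealD(2)[OF Mi] by blast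
    ultimately have "infinite {p. height_one R A p \<and> ext c \<subseteq> p} \<Longrightarrow> False"
      using M(2)[of "ext c"] c unfolding S_def by blast
    then show ?thesis by blast
  qed
  \<comment> \<open>A prime above \<open>M\<close> contains \<open>a b\<close>, hence one of the
    factors.\<close>
  have "{p. height_one R A p \<and> M \<subseteq> p} \<subseteq>
      {p. height_one R A p \<and> ext a \<subseteq> p} \<union> {p. height_one R A p \<and> ext b \<subseteq> p}"
  proof
    fix p assume "p \<in> {p. height_one R A p \<and> M \<subseteq> p}"
    then have p: "height_one R A p" "M \<subseteq> p" "sub_prime R A p" by (auto simp: height_one_def)
    have "ext c \<subseteq> p" if "c \<in> p" for c
      using p(2) that sub_idealD[OF sub_primeD(1)[OF p(3)]] by (auto simp: ext_def)
    moreover have "a \<in> p \<or> b \<in> p" using sub_primeD(3)[OF p(3) ab(1,2)] ab(3) p(2) by blast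
    ultimately show "p \<in> {p. height_one R A p \<and> ext a \<subseteq> p} \<union> {p. height_one R A p \<and> ext b \<subseteq> p}"
      using p(1) by blast
  qed
  from finite_subset[OF this finite_UnI[OF fin[OF ab(1,4)] fin[OF ab(2,5)]]] show False
    using Minf by simp
qed

end

section \<open>Integer powers in a field, and valuation rings from prime denominator ideals\<close>

context field
begin

lemma nonzero_inv:
  assumes "x \<in> carrier R" "x \<noteq> \<zero>"
  shows "inv x \<in> carrier R" "inv x \<noteq> \<zero>" "x \<otimes> inv x = \<one>" "inv x \<otimes> x = \<one>"
proof -
  have x: "x \<in> Units R" using assms field_Units by blast
  show "inv x \<in> carrier R" "x \<otimes> inv x = \<one>" "inv x \<otimes> x = \<one>" using x by auto
  then show "inv x \<noteq> \<zero>" using assms by (metis one_not_zero r_null)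
qed

text \<open>Reduces integer powers to the group of units, whose laws for exponents then
  apply.\<close>

lemma int_pow_units_of:
  assumes "t \<in> carrier R" "t \<noteq> \<zero>"
  shows "t [^]\<^bsub>units_of R\<^esub> (k::int) = t [^] k"
proof -
  have t: "t \<in> Units R" using assms field_Units by blast
  have n: "t [^]\<^bsub>units_of R\<^esub> (k::nat) = t [^] k" for k
    by (simp add: nat_pow_def units_of_one units_of_mult)
  show ?thesis
    unfolding int_pow_def2 n units_of_inv[OF Units_pow_closed[OF t]] ..
qed

lemma int_pow_add:
  assumes "t \<in> carrier R" "t \<noteq> \<zero>"
  shows "t [^] (i + j :: int) = t [^] i \<otimes> t [^] j"
proof -
  interpret U: comm_group "units_of R" by (rule units_comm_group)
  have t: "t \<in> Units R" using assms field_Units by blast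
  show ?thesis
    using U.int_pow_mult[of t i j] t int_pow_units_of[OF assms] by (simp add: units_of_carrier units_of_mult)
qed

lemma nonzero_nat_pow:
  assumes "t \<in> carrier R" "t \<noteq> \<zero>" shows "t [^] (n::nat) \<in> carrier R" "t [^] (n::nat) \<noteq> \<zero>"
proof -
  show "t [^] n \<in> carrier R" using assms by simp
  show "t [^] n \<noteq> \<zero>" using assms by (induction n) (auto simp: integral_iff)
qed

lemma nonzero_int_pow:
  assumes "t \<in> carrier R" "t \<noteq> \<zero>" shows "t [^] (n::int) \<in> carrier R" "t [^] (n::int) \<noteq> \<zero>"
proof -
  have "t [^] n \<in> carrier R \<and> t [^] n \<noteq> \<zero>"
    unfolding int_pow_def2
    using nonzero_nat_pow[OF assms] nonzero_inv(1,2)[OF nonzero_nat_pow[OF assms]] by presburger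
  then show "t [^] n \<in> carrier R" "t [^] n \<noteq> \<zero>" by auto
qed

text \<open>If \<open>g\<close> multiplied \<open>p\<close> into itself, it would be integral over
  the localization \<open>B\<close> and thus lie in it. So some \<open>y g\<close> with
  \<open>y \<in> p\<close> is a unit of \<open>B\<close>, and the inverse \<open>t\<close> of
  \<open>g\<close> is an element of \<open>B\<close> that divides all nonunits. The chain condition
  bounds the power of \<open>t\<close> that divides a given element.\<close>

lemma dvr_of_prime_den:
  assumes noeth: "sub_noetherian R A" and g: "g \<in> carrier R" and p: "sub_prime R A (den R A g)"
    and pn: "den R A g \<noteq> {\<zero>}" and cl: "integrally_closed_in R (loc R A (den R A g))"
    and frac: "\<And>f. f \<in> carrier R \<Longrightarrow> \<exists>b\<in>A - {\<zero>}. b \<otimes> f \<in> A"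
  shows "dvr_in R (loc R A (den R A g)) (inv g)" and "height_one R A (den R A g)"
proof -
  define p where "p = den R A g"
  define B where "B = loc R A p"
  note pr = p[folded p_def] and pn = pn[folded p_def] and cl = cl[folded p_def, folded B_def]
  note pI = sub_idealD[OF sub_primeD(1)[OF pr]]
  have A: "subring A R" using noeth by (simp add: sub_noetherian_def)
  note AE = subringE[OF A]
  have B: "subring B R" unfolding B_def by (rule subring_loc[OF A pr])
  note BE = subringE[OF B]
  have AB: "A \<subseteq> B" unfolding B_def by (rule loc_superset[OF A pr])
  have gB: "g \<notin> B" using loc_iff_den[OF g, of A p] by (simp add: B_def p_def)
  have g0: "g \<noteq> \<zero>" using gB BE(2) by blast
  have pg: "x \<otimes> g \<in> A" if "x \<in> p" for x using that by (simp add: p_def den_def)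
  have "\<exists>y\<in>p. y \<otimes> g \<notin> p"
  proof (rule ccontr)
    assume "\<not> ?thesis"
    then have stable: "\<And>y. y \<in> p \<Longrightarrow> y \<otimes> g \<in> p" by blast
    \<comment> \<open>A nonzero \<open>c \<in> p\<close> multiplies every polynomial expression in
      \<open>g\<close> into \<open>A\<close>. The ideals \<open>I n\<close> below therefore
      stabilize, and cancelling \<open>c\<close> gives an integral equation without
      determinants.\<close>
    obtain c where c: "c \<in> p" "c \<noteq> \<zero>" using pn pI(2) by blast
    have cc: "c \<in> carrier R" using c pI(1) AE(1) by blast
    have cpow: "c \<otimes> g [^] n \<in> p" for n :: nat
    proof (induction n)
      case 0
      then show ?case using c cc by simp
    next
      case (Suc n)
      have "c \<otimes> g [^] Suc n = (c \<otimes> g [^] n) \<otimes> g" using cc g by (simp add: m_assoc)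
      then show ?case using stable[OF Suc] by simp
    qed
    define I where "I n = (\<lambda>x. c \<otimes> x) ` pol R A g n" for n
    have pc: "x \<in> carrier R" if "x \<in> pol R A g n" for x n using that pol_carrier[OF A g] by blast
    have IA: "c \<otimes> x \<in> A" if "x \<in> pol R A g n" for x n
      using that
    proof (induction n arbitrary: x)
      case 0
      then show ?case using cc AE(2) by simp
    next
      case (Suc n)
      obtain x' a where *: "x = x' \<oplus> a \<otimes> g [^] n" "x' \<in> pol R A g n" "a \<in> A"
        using Suc.prems by auto
      have ac: "a \<in> carrier R" using * AE(1) by blast
      have "c \<otimes> x = c \<otimes> x' \<oplus> a \<otimes> (c \<otimes> g [^] n)"
        using *(1) pc[OF *(2)] ac cc g by (simp add: r_distr m_ac)
      moreover have "c \<otimes> g [^] n \<in> A" using cpow pI(1) by blast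
      ultimately show ?case using AE(7)[OF Suc.IH[OF *(2)] AE(6)[OF *(3)]] by simp
    qed
    have "sub_ideal R A (I n)" for n
      unfolding sub_ideal_def
    proof (intro conjI ballI)
      show "I n \<subseteq> A" using IA by (auto simp: I_def)
      have "c \<otimes> \<zero> \<in> I n" unfolding I_def using pol_zero[OF A g] by blast
      then show "\<zero> \<in> I n" using cc by simp
      fix x assume "x \<in> I n"
      then obtain x' where x': "x = c \<otimes> x'" "x' \<in> pol R A g n" by (auto simp: I_def)
      { fix y assume "y \<in> I n"
        then obtain y' where y': "y = c \<otimes> y'" "y' \<in> pol R A g n" by (auto simp: I_def)
        have "x \<oplus> y = c \<otimes> (x' \<oplus> y')" using x' y' pc cc by (simp add: r_distr)
        then show "x \<oplus> y \<in> I n" unfolding I_def using pol_add[OF A g x'(2) y'(2)] by blast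
      next
        fix a assume a: "a \<in> A"
        then have "a \<in> carrier R" using AE(1) by blast
        then have "a \<otimes> x = c \<otimes> (a \<otimes> x')" using x' pc cc by (simp add: m_ac)
        then show "a \<otimes> x \<in> I n" unfolding I_def using pol_smult[OF A g a x'(2)] by blast
      }
    qed
    moreover have "I n \<subseteq> I (Suc n)" for n unfolding I_def using pol_Suc_mono[OF A g, of n] by (rule image_mono)
    ultimately obtain N where N: "\<And>n. n \<ge> N \<Longrightarrow> I n = I N" using sub_noetherianE[OF noeth] by metis
    \<comment> \<open>The power \<open>g [^] Suc N\<close> is the top term of an element of
      \<open>pol R A g (Suc (Suc N))\<close>; stabilization rewrites it as an expression of degree
      at most \<open>N\<close>.\<close>
    have "g [^] Suc N \<in> pol R A g (Suc (Suc N))"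
    proof -
      have "g [^] Suc N = \<zero> \<oplus> \<one> \<otimes> g [^] Suc N" using g by simp
      then show ?thesis using pol_zero[OF A g, of "Suc N"] AE(3) pol.simps(2)[of R A g "Suc N"] by blast
    qed
    then have "c \<otimes> g [^] Suc N \<in> I (Suc (Suc N))" unfolding I_def by blast
    also have "I (Suc (Suc N)) = I (Suc N)" using N[of "Suc N"] N[of "Suc (Suc N)"] by simp
    finally obtain z where z: "z \<in> pol R A g (Suc N)" "c \<otimes> g [^] Suc N = c \<otimes> z" by (auto simp: I_def)
    then have "g [^] Suc N = z" using m_lcancel[OF c(2) cc _ pc[OF z(1)]] g by simp
    then have "\<ominus> (g [^] Suc N) \<in> pol R A g (Suc N)" using pol_minus[OF A g z(1)] by simp
    then obtain d where d: "d \<in> {..<Suc N} \<rightarrow> A" "\<ominus> (g [^] Suc N) = (\<Oplus>i\<in>{..<Suc N}. d i \<otimes> g [^] i)"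
      using pol_coeffs[OF A g] by blast
    have "g [^] Suc N \<oplus> (\<Oplus>i\<in>{..<Suc N}. d i \<otimes> g [^] i) = \<zero>"
      unfolding d(2)[symmetric] by (rule r_neg) (use g in simp)
    moreover have "d \<in> {..<Suc N} \<rightarrow> B" using d(1) AB by blast
    ultimately have "g \<in> B" using cl g unfolding integrally_closed_in_def by (metis zero_less_Suc)
    then show False using gB by simp
  qed
  then obtain y where y: "y \<in> p" "y \<otimes> g \<notin> p" by blast
  \<comment> \<open>\<open>v\<close> lies in \<open>A\<close> outside \<open>p\<close> and is thus a
    unit of \<open>B\<close>; hence \<open>t = y / v\<close> lies in \<open>B\<close>.\<close>
  define v where "v = y \<otimes> g"
  have vA: "v \<in> A" and vp: "v \<notin> p" using y pg by (auto simp: v_def)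
  have yc: "y \<in> carrier R" and vc: "v \<in> carrier R" using y pI(1) AE(1) vA by auto
  define t where "t = inv g"
  have t: "t \<in> carrier R" "t \<noteq> \<zero>" "g \<otimes> t = \<one>" "t \<otimes> g = \<one>" using nonzero_inv[OF g g0] by (auto simp: t_def)
  have it: "inv t = g" using t g by (metis comm_inv_char)
  have vt: "v \<otimes> t = y" using t yc g by (simp add: v_def m_assoc)
  then have tB: "t \<in> B" using t vA vp y(1) pI(1) unfolding B_def loc_def by blast
  have notp: "inv s \<in> B" "s \<noteq> \<zero>" if "s \<in> A" "s \<notin> p" for s
  proof -
    show "s \<noteq> \<zero>" using that pI(2) by blast
    then have "inv s \<in> carrier R" "s \<otimes> inv s = \<one>" using nonzero_inv that AE(1) by auto
    then show "inv s \<in> B" unfolding B_def using locI[of "inv s" R s A p] that AE(3) by simp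
  qed
  \<comment> \<open>A numerator \<open>s c\<close> of a nonunit \<open>c\<close> lies in
    \<open>p\<close>, since otherwise \<open>s / (s c)\<close> would be an inverse of
    \<open>c\<close> in \<open>B\<close>. Then \<open>g\<close> multiplies it into
    \<open>A\<close>.\<close>
  have nonunit: "g \<otimes> c \<in> B" if c: "c \<in> B" "c \<noteq> \<zero>" "inv c \<notin> B" for c
  proof -
    obtain s where s: "s \<in> A" "s \<notin> p" "s \<otimes> c \<in> A" using c(1) by (auto simp: B_def loc_def)
    have cc: "c \<in> carrier R" and sc: "s \<in> carrier R" using c(1) BE(1) s(1) AE(1) by auto
    have ic: "inv c \<in> carrier R" "c \<otimes> inv c = \<one>" using nonzero_inv[OF cc c(2)] by auto
    have "(s \<otimes> c) \<otimes> inv c = s" using ic cc sc by (simp add: m_assoc)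
    then have "s \<otimes> c \<in> p" using c(3) locI[of "inv c" R "s \<otimes> c" A p] ic s unfolding B_def by auto
    then have "(s \<otimes> c) \<otimes> g \<in> A" by (rule pg)
    then have "s \<otimes> (g \<otimes> c) \<in> A" using cc sc g by (simp add: m_ac)
    then show ?thesis unfolding B_def loc_def using s cc g by auto
  qed
  have tpow: "t [^] (n::nat) \<in> B" for n by (induction n) (use BE tB in auto)
  have fact: "\<exists>(n::nat) u. u \<in> B \<and> u \<noteq> \<zero> \<and> inv u \<in> B \<and> b = u \<otimes> t [^] n" if b: "b \<in> B" "b \<noteq> \<zero>" for b
  proof -
    have bc: "b \<in> carrier R" using b BE(1) by blast
    have "\<exists>n. \<not> (\<exists>c\<in>B. b = c \<otimes> t [^] (n::nat))"
    proof (rule ccontr)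
      assume "\<not> ?thesis"
      then have div: "\<And>n::nat. \<exists>c\<in>B. b = c \<otimes> t [^] n" by blast
      \<comment> \<open>If every power of \<open>t\<close> divided \<open>b\<close>, the ideals of
        those \<open>a\<close> with \<open>a t^n \<in> b B\<close> would stabilize. Applied to a
        numerator of \<open>b / t^(N+1)\<close>, this makes some \<open>s\<close> outside
        \<open>p\<close> divisible by \<open>t\<close>, and puts \<open>g\<close> into
        \<open>B\<close>.\<close>
      define I where "I n = {a \<in> A. \<exists>c\<in>B. a \<otimes> t [^] n = b \<otimes> c}" for n :: nat
      have "sub_ideal R A (I n)" for n
        unfolding sub_ideal_def
      proof (intro conjI ballI)
        show "I n \<subseteq> A" by (auto simp: I_def)
        have "\<zero> \<otimes> t [^] n = b \<otimes> \<zero>" using t bc by simp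
        then show "\<zero> \<in> I n" unfolding I_def using AE(2) BE(2) by blast
        fix x assume "x \<in> I n"
        then obtain c where c: "x \<in> A" "c \<in> B" "x \<otimes> t [^] n = b \<otimes> c" by (auto simp: I_def)
        have xc: "x \<in> carrier R" "c \<in> carrier R" using c AE(1) BE(1) by auto
        { fix z assume "z \<in> I n"
          then obtain d where d: "z \<in> A" "d \<in> B" "z \<otimes> t [^] n = b \<otimes> d" by (auto simp: I_def)
          have zc: "z \<in> carrier R" "d \<in> carrier R" using d AE(1) BE(1) by auto
          have "(x \<oplus> z) \<otimes> t [^] n = b \<otimes> (c \<oplus> d)" using xc zc t bc c d by (simp add: l_distr r_distr)
          then show "x \<oplus> z \<in> I n" unfolding I_def using c d AE(7) BE(7) by blast
        next
          fix z assume z: "z \<in> A"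
          then have zc: "z \<in> carrier R" using AE(1) by blast
          have "(z \<otimes> x) \<otimes> t [^] n = b \<otimes> (z \<otimes> c)" using xc zc t bc c by (simp add: m_assoc m_lcomm)
          then show "z \<otimes> x \<in> I n" unfolding I_def using c z AE(6) BE(6) AB by blast
        }
      qed
      moreover have "I n \<subseteq> I (Suc n)" for n
      proof
        fix x assume "x \<in> I n"
        then obtain c where c: "x \<in> A" "c \<in> B" "x \<otimes> t [^] n = b \<otimes> c" by (auto simp: I_def)
        have xc: "x \<in> carrier R" "c \<in> carrier R" using c AE(1) BE(1) by auto
        have "x \<otimes> t [^] Suc n = (x \<otimes> t [^] n) \<otimes> t" using xc t by (simp add: m_assoc)
        also have "\<dots> = b \<otimes> (c \<otimes> t)" using c(3) xc bc t by (simp add: m_assoc)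
        finally show "x \<in> I (Suc n)" unfolding I_def using c(1) BE(6)[OF c(2) tB] by blast
      qed
      ultimately obtain N where N: "\<And>n. n \<ge> N \<Longrightarrow> I n = I N" using sub_noetherianE[OF noeth] by metis
      obtain c where c: "c \<in> B" "b = c \<otimes> t [^] Suc N" using div by blast
      obtain s where s: "s \<in> A" "s \<notin> p" "s \<otimes> c \<in> A" using c(1) by (auto simp: B_def loc_def)
      have cc: "c \<in> carrier R" "s \<in> carrier R" using c BE(1) s AE(1) by auto
      have "(s \<otimes> c) \<otimes> t [^] Suc N = b \<otimes> s" using c(2) cc t by (simp add: m_ac)
      then have "s \<otimes> c \<in> I (Suc N)" unfolding I_def using s AB by blast
      then have "s \<otimes> c \<in> I N" using N[of "Suc N"] by simp
      then obtain d where d: "d \<in> B" "(s \<otimes> c) \<otimes> t [^] N = b \<otimes> d" by (auto simp: I_def)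
      have dc: "d \<in> carrier R" using d BE(1) by blast
      have cn: "c \<noteq> \<zero>" using c(2) b(2) t by (auto)
      have "(c \<otimes> t [^] N) \<otimes> s = (c \<otimes> t [^] N) \<otimes> (t \<otimes> d)"
        using d(2) c(2) cc dc t by (simp add: m_ac)
      moreover have "c \<otimes> t [^] N \<noteq> \<zero>" using cn cc t nonzero_nat_pow[OF t(1,2)] by (simp add: integral_iff)
      ultimately have s_eq: "s = t \<otimes> d" using m_lcancel[of "c \<otimes> t [^] N" s "t \<otimes> d"] cc dc t by simp
      have isB: "inv s \<in> B" "s \<noteq> \<zero>" using notp s by auto
      have "g \<otimes> s = d" using s_eq t g dc by (simp add: m_assoc[symmetric])
      then have "(inv s) \<otimes> (g \<otimes> s) \<in> B" using BE(6) isB d by simp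
      moreover have "(inv s) \<otimes> (g \<otimes> s) = g" using nonzero_inv[OF cc(2) isB(2)] g cc by (simp add: m_lcomm)
      ultimately show False using gB by simp
    qed
    \<comment> \<open>\<open>n\<close> is the least exponent such that \<open>t^n\<close> does not
      divide \<open>b\<close>. The quotient of \<open>b\<close> by the preceding power is a unit, as
      \<open>nonunit\<close> would split off one more factor \<open>t\<close>.\<close>
    then obtain n :: nat where n: "\<not> (\<exists>c\<in>B. b = c \<otimes> t [^] n)" "\<And>m. m < n \<Longrightarrow> \<exists>c\<in>B. b = c \<otimes> t [^] m"
      unfolding exists_least_iff[of "\<lambda>n. \<not> (\<exists>c\<in>B. b = c \<otimes> t [^] (n::nat))"] by blast
    have "n \<noteq> 0"
    proof
      assume "n = 0"
      then have "b = b \<otimes> t [^] n" using bc by simp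
      then show False using n(1) b(1) by blast
    qed
    then obtain m where m: "n = Suc m" using not0_implies_Suc by blast
    then obtain c where c: "c \<in> B" "b = c \<otimes> t [^] m" using n(2) by blast
    have cc: "c \<in> carrier R" using c BE(1) by blast
    have cn: "c \<noteq> \<zero>" using c(2) b(2) t by auto
    have "inv c \<in> B"
    proof (rule ccontr)
      assume "inv c \<notin> B"
      then have "g \<otimes> c \<in> B" using nonunit c cn by blast
      moreover have "b = (g \<otimes> c) \<otimes> t [^] n"
      proof -
        have "(g \<otimes> c) \<otimes> t [^] n = (g \<otimes> t) \<otimes> (c \<otimes> t [^] m)" using m g cc t(1) by (simp add: m_ac)
        then show ?thesis using c(2) t bc by simp
      qed
      ultimately show False using n(1) by blast
    qed
    then show ?thesis using c cn by blast
  qed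
  have frac': "\<exists>b\<in>B - {\<zero>}. b \<otimes> f \<in> B" if "f \<in> carrier R" for f using frac[OF that] AB by blast
  show "dvr_in R (loc R A (den R A g)) (inv g)"
    using B tB t gB it fact frac' unfolding dvr_in_def t_def B_def p_def by auto
  \<comment> \<open>Write a nonzero element of \<open>q\<close> as \<open>u t^n\<close>. Clearing
    \<open>u\<close> and multiplying by \<open>v^n\<close> gives \<open>s y^n \<in> q\<close> with
    \<open>s\<close> outside \<open>p\<close>, hence \<open>y \<in> q\<close>. Then
    \<open>v z = (z g) y\<close> puts every \<open>z \<in> p\<close> into \<open>q\<close>.\<close>
  have "q = p" if q: "sub_prime R A q" "q \<subseteq> p" "q \<noteq> {\<zero>}" for q
  proof -
    note qI = sub_idealD[OF sub_primeD(1)[OF q(1)]]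
    obtain x where x: "x \<in> q" "x \<noteq> \<zero>" using q(3) qI(2) by blast
    have xA: "x \<in> A" "x \<in> p" using x qI(1) q(2) by auto
    have xc: "x \<in> carrier R" using xA AE(1) by blast
    obtain n u where u: "u \<in> B" "u \<noteq> \<zero>" "inv u \<in> B" "x = u \<otimes> t [^] (n::nat)" using fact xA AB x(2) by blast
    have uc: "u \<in> carrier R" using u BE(1) by blast
    obtain s where s: "s \<in> A" "s \<notin> p" "s \<otimes> inv u \<in> A" using u(3) by (auto simp: B_def loc_def)
    have sc: "s \<in> carrier R" and iu: "inv u \<in> carrier R" "u \<otimes> inv u = \<one>" "inv u \<otimes> u = \<one>"
      using s AE(1) nonzero_inv[OF uc u(2)] by auto
    have vty: "v [^] n \<otimes> t [^] n = y [^] n" using vt vc t by (simp add: nat_pow_distrib[symmetric])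
    have "t [^] n = inv u \<otimes> x" using u(4) uc iu t by (simp add: m_assoc[symmetric])
    then have "s \<otimes> y [^] n = (s \<otimes> inv u \<otimes> v [^] n) \<otimes> x"
      unfolding vty[symmetric] using sc iu xc vc by (simp add: m_ac)
    moreover have "v [^] n \<in> A" by (induction n) (use AE vA in auto)
    moreover have vn: "y [^] n \<in> A" by (induction n) (use AE subsetD[OF pI(1) y(1)] in auto)
    ultimately have "s \<otimes> y [^] n \<in> q" using qI(4)[OF AE(6)[OF s(3)] x(1)] by simp
    then have "y [^] n \<in> q" using sub_primeD(3)[OF q(1) s(1)] vn s q(2) by blast
    moreover have "y \<in> q" if "y [^] k \<in> q" for k :: nat using that
    proof (induction k)
      case 0
      then show ?case using sub_primeD(2)[OF q(1)] by simp
    next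
      case (Suc k)
      have "y [^] k \<in> A" by (induction k) (use AE y pI(1) in auto)
      then show ?case using Suc sub_primeD(3)[OF q(1), of "y [^] k" y] y pI(1) by auto
    qed
    ultimately have yq: "y \<in> q" by blast
    have "z \<in> q" if z: "z \<in> p" for z
    proof -
      have zc: "z \<in> carrier R" using z pI(1) AE(1) by blast
      have "v \<otimes> z = (z \<otimes> g) \<otimes> y" using zc g yc by (simp add: v_def m_ac)
      then have "v \<otimes> z \<in> q" using qI(4)[OF pg[OF z] yq] by simp
      then show ?thesis using sub_primeD(3)[OF q(1) vA] z pI(1) vp q(2) by blast
    qed
    then show ?thesis using q(2) by blast
  qed
  then show "height_one R A (den R A g)" using pr pn unfolding height_one_def p_def by blast
qed

end

section \<open>The valuation of a discrete valuation ring\<close>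

definition valuation_in :: "('a, 'b) ring_scheme \<Rightarrow> 'a set \<Rightarrow> ('a \<Rightarrow> int) \<Rightarrow> bool" where
  "valuation_in K B v \<longleftrightarrow>
     (\<forall>f\<in>carrier K - {\<zero>\<^bsub>K\<^esub>}. \<forall>g\<in>carrier K - {\<zero>\<^bsub>K\<^esub>}. v (f \<otimes>\<^bsub>K\<^esub> g) = v f + v g) \<and>
     (\<forall>f\<in>carrier K - {\<zero>\<^bsub>K\<^esub>}. f \<in> B \<longleftrightarrow> 0 \<le> v f) \<and>
     (\<forall>n. \<exists>f\<in>carrier K - {\<zero>\<^bsub>K\<^esub>}. v f = n)"

context field
begin

lemma int_pow_mult_nonzero:
  assumes "x \<in> carrier R" "x \<noteq> \<zero>" "y \<in> carrier R" "y \<noteq> \<zero>"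
  shows "(x \<otimes> y) [^] (k::int) = x [^] k \<otimes> y [^] k"
proof -
  interpret U: comm_group "units_of R" by (rule units_comm_group)
  have "x \<in> carrier (units_of R)" "y \<in> carrier (units_of R)"
    using assms field_Units by (auto simp: units_of_carrier)
  from U.int_pow_distrib[OF this, of k] show ?thesis
    using assms int_pow_units_of[of x] int_pow_units_of[of y] int_pow_units_of[of "x \<otimes> y"]
    by (simp add: units_of_mult integral_iff)
qed

text \<open>The value is the description used in \<open>ord_along\<close>, where the generator
  \<open>s\<close> of the maximal ideal is arbitrary. Every such \<open>s\<close> is a unit times
  \<open>t\<close>, so it yields the same exponent as \<open>t\<close>.\<close>

lemma dvr_valuation:
  assumes dvr: "dvr_in R B t"
  defines "A \<equiv> R\<lparr>carrier := B\<rparr>"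
  shows "valuation_in R B (\<lambda>f. THE n::int. \<exists>s u. s \<in> carrier A \<and> maximalideal (PIdl\<^bsub>A\<^esub> s) A \<and>
           u \<in> Units A \<and> f = u \<otimes> s [^] n)"
proof -
  have B: "subring B R" and tB: "t \<in> B" and t0: "t \<noteq> \<zero>" and tn: "inv t \<notin> B"
    and dec: "\<And>b. b \<in> B \<Longrightarrow> b \<noteq> \<zero> \<Longrightarrow>
      \<exists>(n::nat) u. u \<in> B \<and> u \<noteq> \<zero> \<and> inv u \<in> B \<and> b = u \<otimes> t [^] n"
    and frac: "\<And>f. f \<in> carrier R \<Longrightarrow> \<exists>b\<in>B - {\<zero>}. b \<otimes> f \<in> B"
    using dvr unfolding dvr_in_def by blast+
  note BE = subringE[OF B]
  have tc: "t \<in> carrier R" using tB BE(1) by blast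
  define U where "U = {u \<in> B. u \<noteq> \<zero> \<and> inv u \<in> B}"
  have UD: "u \<in> B" "u \<noteq> \<zero>" "inv u \<in> B" "u \<in> carrier R" "inv u \<in> carrier R" "u \<otimes> inv u = \<one>" "inv u \<otimes> u = \<one>"
    "inv u \<noteq> \<zero>" if "u \<in> U" for u
    using that BE(1) nonzero_inv[of u] by (auto simp: U_def)
  have UI: "u \<in> U" if "u \<in> B" "w \<in> B" "u \<otimes> w = \<one>" for u w
  proof -
    have "u \<in> carrier R" "w \<in> carrier R" using that BE(1) by auto
    moreover from this have "inv u = w" using that(3) by (metis comm_inv_char)
    moreover have "u \<noteq> \<zero>" using that(3) \<open>w \<in> carrier R\<close> by auto
    ultimately show ?thesis using that by (simp add: U_def)
  qed
  have UA: "Units A = U"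
  proof
    show "Units A \<subseteq> U" using UI by (auto simp: Units_def A_def)
    show "U \<subseteq> Units A"
    proof
      fix u assume "u \<in> U"
      from UD[OF this] show "u \<in> Units A" unfolding Units_def A_def by auto
    qed
  qed
  have Umult: "u \<otimes> w \<in> U" if "u \<in> U" "w \<in> U" for u w
  proof (rule UI)
    show "u \<otimes> w \<in> B" "inv u \<otimes> inv w \<in> B" using BE(6) UD that by auto
    have "(u \<otimes> w) \<otimes> (inv u \<otimes> inv w) = (u \<otimes> inv u) \<otimes> (w \<otimes> inv w)"
      using UD[OF that(1)] UD[OF that(2)] by (simp add: m_ac del: nonzero_inv)
    then show "(u \<otimes> w) \<otimes> (inv u \<otimes> inv w) = \<one>" using UD that by simp
  qed
  have Uinv: "inv u \<in> U" if "u \<in> U" for u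
    by (rule UI[of _ u]) (use UD[OF that] in auto)
  have one: "\<one> \<in> U" by (rule UI[of _ \<one>]) (use BE in auto)
  have Upow: "u [^] (n::nat) \<in> U" if "u \<in> U" for u n
    by (induction n) (use one Umult that in auto)
  have Uipow: "u [^] (n::int) \<in> U" if "u \<in> U" for u n
  proof (cases "n < 0")
    case True
    show ?thesis unfolding int_pow_def2 if_P[OF True] by (rule Uinv[OF Upow[OF that]])
  next
    case False
    show ?thesis unfolding int_pow_def2 if_not_P[OF False] by (rule Upow[OF that])
  qed
  have tp: "t [^] (n::int) \<in> carrier R" "t [^] (n::int) \<noteq> \<zero>" for n using nonzero_int_pow[OF tc t0] by auto
  have tpB: "t [^] (n::nat) \<in> B" for n by (induction n) (use BE tB in auto)
  have tpBi: "t [^] n \<in> B" if "0 \<le> n" for n :: int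
    unfolding int_pow_def2 using tpB that by presburger
  \<comment> \<open>A larger exponent on the left would make \<open>t\<close> a divisor of a
    unit.\<close>
  have uniq1: "\<not> n > m" if "u \<in> U" "w \<in> U" "u \<otimes> t [^] n = w \<otimes> t [^] m" for u w and n m :: int
  proof
    assume nm: "n > m"
    have "n = (n - m - 1) + 1 + m" by simp
    then have "t [^] n = t [^] (n - m - 1) \<otimes> t [^] (1::int) \<otimes> t [^] m" using int_pow_add[OF tc t0] by metis
    moreover have "t [^] (1::int) = t" using tc by (simp add: int_pow_def2)
    ultimately have tn': "t [^] n = (t [^] (n - m - 1) \<otimes> t) \<otimes> t [^] m" by simp
    let ?x = "t [^] (n - m - 1)"
    have "(u \<otimes> (?x \<otimes> t)) \<otimes> t [^] m = w \<otimes> t [^] m"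
      using that(3) tn' UD(4)[OF that(1)] tp tc by (simp add: m_assoc)
    then have "u \<otimes> (?x \<otimes> t) = w"
      using m_rcancel[OF tp(2) tp(1)] UD(4)[OF that(1)] UD(4)[OF that(2)] tp tc by simp
    then have "inv w \<otimes> (u \<otimes> (?x \<otimes> t)) = \<one>" using UD[OF that(2)] by simp
    then have "t \<otimes> (inv w \<otimes> u \<otimes> ?x) = \<one>"
      using UD[OF that(1)] UD[OF that(2)] tp(1)[of "n - m - 1"] tc by (simp add: m_ac)
    moreover have "inv w \<otimes> u \<otimes> ?x \<in> B"
      using BE(6) UD(3)[OF that(2)] UD(1)[OF that(1)] tpBi[of "n - m - 1"] nm by simp
    ultimately have "t \<in> U" using UI tB by blast
    then show False using tn UD(3) by blast
  qed
  have uniq: "n = m" if "u \<in> U" "w \<in> U" "u \<otimes> t [^] n = w \<otimes> t [^] m" for u w and n m :: int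
    using uniq1[OF that] uniq1[OF that(2,1) that(3)[symmetric]] by simp
  \<comment> \<open>Both \<open>b\<close> and \<open>b f\<close> lie in the ring; the exponent of
    \<open>f\<close> is the difference of theirs and may be negative.\<close>
  have ex: "\<exists>u\<in>U. \<exists>n::int. f = u \<otimes> t [^] n" if f: "f \<in> carrier R" "f \<noteq> \<zero>" for f
  proof -
    obtain b where b: "b \<in> B" "b \<noteq> \<zero>" "b \<otimes> f \<in> B" using frac[OF f(1)] by blast
    have bc: "b \<in> carrier R" using b BE(1) by blast
    have "b \<otimes> f \<noteq> \<zero>" using b(2) f bc by (simp add: integral_iff)
    then obtain n u where u: "u \<in> U" "b \<otimes> f = u \<otimes> t [^] (n::nat)" using dec[OF b(3)] by (auto simp: U_def)
    obtain m w where w: "w \<in> U" "b = w \<otimes> t [^] (m::nat)" using dec[OF b(1,2)] by (auto simp: U_def)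
    have "int n = int m + (int n - int m)" by simp
    then have tnm: "t [^] int n = t [^] int m \<otimes> t [^] (int n - int m)" using int_pow_add[OF tc t0] by metis
    let ?g = "(inv w \<otimes> u) \<otimes> t [^] (int n - int m)"
    have "b \<otimes> ?g = (w \<otimes> inv w) \<otimes> u \<otimes> (t [^] int m \<otimes> t [^] (int n - int m))"
      using w(2) UD(4,5)[OF w(1)] UD(4)[OF u(1)] tp tc by (simp add: m_ac int_pow_int)
    also have "\<dots> = b \<otimes> f" using UD[OF w(1)] UD[OF u(1)] u(2) tnm[symmetric] by (simp add: int_pow_int)
    finally have "?g = f" using m_lcancel[OF b(2) bc] f(1) UD(5)[OF w(1)] UD(4)[OF u(1)] tp by simp
    then show ?thesis using Umult[OF Uinv[OF w(1)] u(1)] by blast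
  qed
  interpret A: domain A unfolding A_def by (rule subring_is_domain[OF B])
  have PI: "PIdl\<^bsub>A\<^esub> s = {x \<otimes> s | x. x \<in> B}" for s by (simp add: cgenideal_def A_def)
  \<comment> \<open>An ideal strictly above that of \<open>t\<close> contains an element with
    exponent zero, which is a unit.\<close>
  have tmax: "maximalideal (PIdl\<^bsub>A\<^esub> t) A"
  proof (rule maximalidealI)
    show "ideal (PIdl\<^bsub>A\<^esub> t) A" by (rule A.cgenideal_ideal) (simp add: A_def tB)
    show "carrier A \<noteq> PIdl\<^bsub>A\<^esub> t"
    proof
      assume "carrier A = PIdl\<^bsub>A\<^esub> t"
      then obtain x where x: "x \<in> B" "\<one> = x \<otimes> t" using BE(3) unfolding PI by (auto simp: A_def)
      then have "t \<otimes> x = \<one>" using tc BE(1) m_comm by auto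
      then have "t \<in> U" using UI[OF tB x(1)] by simp
      then show False using tn UD(3) by blast
    qed
    fix J assume J: "ideal J A" "PIdl\<^bsub>A\<^esub> t \<subseteq> J" "J \<subseteq> carrier A"
    interpret J: ideal J A by fact
    show "J = PIdl\<^bsub>A\<^esub> t \<or> J = carrier A"
    proof (cases "J \<subseteq> PIdl\<^bsub>A\<^esub> t")
      case False
      then obtain b where b: "b \<in> J" "b \<notin> PIdl\<^bsub>A\<^esub> t" by blast
      have bB: "b \<in> B" using b J(3) by (auto simp: A_def)
      have "\<zero> = \<zero> \<otimes> t" using tc by simp
      then have "\<zero> \<in> PIdl\<^bsub>A\<^esub> t" using BE(2) unfolding PI by blast
      then have "b \<noteq> \<zero>" using b by blast
      then obtain n u where u: "u \<in> U" "b = u \<otimes> t [^] (n::nat)" using dec[OF bB] by (auto simp: U_def)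
      have "n = 0"
      proof (rule ccontr)
        assume "n \<noteq> 0"
        then obtain m where "n = Suc m" using not0_implies_Suc by blast
        then have "b = (u \<otimes> t [^] m) \<otimes> t" using u UD(4)[OF u(1)] tc by (simp add: m_assoc)
        then show False using b(2) BE(6)[OF UD(1)[OF u(1)] tpB] unfolding PI by blast
      qed
      then have "b = u" using u UD(4) by simp
      then have "inv u \<otimes> u \<in> J" using J.I_l_closed[OF b(1), of "inv u"] UD(3)[OF u(1)] by (simp add: A_def)
      then have "\<one>\<^bsub>A\<^esub> \<in> J" using UD(7)[OF u(1)] by (simp add: A_def)
      then show ?thesis using J.one_imp_carrier by blast
    qed (use J in blast)
  qed
  \<comment> \<open>Nonunits, zero included, are multiples of \<open>t\<close>, so the ideal of
    \<open>s\<close> is contained in that of \<open>t\<close>. Maximality gives equality, and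
    cancelling \<open>t\<close> shows that the quotient of the generators is a unit.\<close>
  have gen: "\<exists>y\<in>U. s = y \<otimes> t" if s: "s \<in> carrier A" "maximalideal (PIdl\<^bsub>A\<^esub> s) A" for s
  proof -
    interpret M: maximalideal "PIdl\<^bsub>A\<^esub> s" A by fact
    have sB: "s \<in> B" using s by (simp add: A_def)
    have sc: "s \<in> carrier R" using sB BE(1) by blast
    have sn: "s \<notin> U"
    proof
      assume sU: "s \<in> U"
      have "x \<in> PIdl\<^bsub>A\<^esub> s" if "x \<in> B" for x
      proof -
        have "x = (x \<otimes> inv s) \<otimes> s" using that BE(1) UD[OF sU] by (auto simp: m_assoc)
        then show ?thesis using BE(6)[OF that UD(3)[OF sU]] unfolding PI by blast
      qed
      then have "carrier A = PIdl\<^bsub>A\<^esub> s" using M.a_subset by (auto simp: A_def)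
      then show False using M.I_notcarr by simp
    qed
    have "\<exists>y\<in>B. s = y \<otimes> t"
    proof (cases "s = \<zero>")
      case True
      then show ?thesis using tc BE(2) by (intro bexI[of _ \<zero>]) auto
    next
      case False
      then obtain n u where u: "u \<in> U" "s = u \<otimes> t [^] (n::nat)" using dec[OF sB] by (auto simp: U_def)
      have "n \<noteq> 0" using u sn UD(4) by (metis nat_pow_0 r_one)
      then obtain m where "n = Suc m" using not0_implies_Suc by blast
      then have "s = (u \<otimes> t [^] m) \<otimes> t" using u UD(4)[OF u(1)] tc by (simp add: m_assoc)
      then show ?thesis using BE(6)[OF UD(1)[OF u(1)] tpB] by blast
    qed
    then obtain y where y: "y \<in> B" "s = y \<otimes> t" by blast
    have yc: "y \<in> carrier R" using y BE(1) by blast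
    have "PIdl\<^bsub>A\<^esub> s \<subseteq> PIdl\<^bsub>A\<^esub> t"
    proof
      fix z assume "z \<in> PIdl\<^bsub>A\<^esub> s"
      then obtain x where x: "x \<in> B" "z = x \<otimes> s" unfolding PI by blast
      then have "z = (x \<otimes> y) \<otimes> t" using y yc tc BE(1) by (auto simp: m_assoc)
      then show "z \<in> PIdl\<^bsub>A\<^esub> t" using BE(6)[OF x(1) y(1)] unfolding PI by blast
    qed
    moreover have tid: "ideal (PIdl\<^bsub>A\<^esub> t) A" using maximalideal.axioms(1)[OF tmax] .
    ultimately have "PIdl\<^bsub>A\<^esub> t = PIdl\<^bsub>A\<^esub> s \<or> PIdl\<^bsub>A\<^esub> t = carrier A"
      using M.I_maximal[OF tid] ideal.Icarr[OF tid] by blast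
    moreover have "PIdl\<^bsub>A\<^esub> t \<noteq> carrier A" using maximalideal.I_notcarr[OF tmax] by simp
    ultimately have "t \<in> PIdl\<^bsub>A\<^esub> s" using A.cgenideal_self[of t] tB by (simp add: A_def)
    then obtain x where x: "x \<in> B" "t = x \<otimes> s" unfolding PI by blast
    have xc: "x \<in> carrier R" using x BE(1) by blast
    have "\<one> \<otimes> t = (y \<otimes> x) \<otimes> t" using x(2) y(2) xc yc tc by (simp add: m_ac)
    then have "y \<otimes> x = \<one>" using m_rcancel[OF t0 tc, of \<one> "y \<otimes> x"] xc yc by simp
    then show ?thesis using UI[OF y(1) x(1)] y(2) by blast
  qed
  define v where "v f = (THE n::int. \<exists>s u. s \<in> carrier A \<and> maximalideal (PIdl\<^bsub>A\<^esub> s) A \<and>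
           u \<in> Units A \<and> f = u \<otimes> s [^] n)" for f
  have v: "v (u \<otimes> t [^] n) = n" if u: "u \<in> U" for u and n :: int
    unfolding v_def
  proof (rule the_equality)
    show "\<exists>s w. s \<in> carrier A \<and> maximalideal (PIdl\<^bsub>A\<^esub> s) A \<and> w \<in> Units A \<and> u \<otimes> t [^] n = w \<otimes> s [^] n"
      using tmax tB u UA by (auto simp: A_def)
    fix m :: int assume "\<exists>s w. s \<in> carrier A \<and> maximalideal (PIdl\<^bsub>A\<^esub> s) A \<and> w \<in> Units A \<and> u \<otimes> t [^] n = w \<otimes> s [^] m"
    then obtain s w where s: "s \<in> carrier A" "maximalideal (PIdl\<^bsub>A\<^esub> s) A" "w \<in> U" "u \<otimes> t [^] n = w \<otimes> s [^] m"
      using UA by blast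
    obtain y where y: "y \<in> U" "s = y \<otimes> t" using gen[OF s(1,2)] by blast
    have "s [^] m = y [^] m \<otimes> t [^] m" unfolding y(2) by (rule int_pow_mult_nonzero) (use UD y tc t0 in auto)
    then have "u \<otimes> t [^] n = (w \<otimes> y [^] m) \<otimes> t [^] m"
      using s(4) UD(4)[OF s(3)] UD(4)[OF Uipow[OF y(1)]] tp by (simp add: m_assoc)
    then show "m = n" using uniq[OF u Umult[OF s(3) Uipow[OF y(1), of m]], of n m] by simp
  qed
  show ?thesis
    unfolding valuation_in_def v_def[symmetric]
  proof (intro conjI ballI allI)
    fix f assume f: "f \<in> carrier R - {\<zero>}"
    then obtain u n where u: "u \<in> U" "f = u \<otimes> t [^] (n::int)" using ex by blast
    show "f \<in> B \<longleftrightarrow> 0 \<le> v f"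
    proof
      assume fB: "f \<in> B"
      obtain w m where w: "w \<in> U" "f = w \<otimes> t [^] (m::nat)" using dec[OF fB] f by (auto simp: U_def)
      then have "f = w \<otimes> t [^] int m" by (simp add: int_pow_int)
      then show "0 \<le> v f" using v[OF w(1)] by simp
    next
      assume "0 \<le> v f"
      then have "0 \<le> n" using v u by simp
      then show "f \<in> B" using u(2) BE(6)[OF UD(1)[OF u(1)] tpBi] by simp
    qed
    fix g assume "g \<in> carrier R - {\<zero>}"
    then obtain w m where w: "w \<in> U" "g = w \<otimes> t [^] (m::int)" using ex by blast
    have "f \<otimes> g = (u \<otimes> w) \<otimes> t [^] (n + m)"
      unfolding int_pow_add[OF tc t0] using u(2) w(2) UD(4)[OF u(1)] UD(4)[OF w(1)] tp by (simp add: m_ac)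
    then show "v (f \<otimes> g) = v f + v g" using v[OF Umult[OF u(1) w(1)]] v[OF u(1)] v[OF w(1)] u(2) w(2) by simp
  next
    fix n :: int
    have "v (t [^] n) = n" using v[OF one, of n] tp by simp
    then show "\<exists>f\<in>carrier R - {\<zero>}. v f = n" using tp by blast
  qed
qed

end

section \<open>Germs and stalks\<close>

lemma sheafD:
  assumes "sheaf_of_sets T C r"
  shows "openin T U \<Longrightarrow> openin T V \<Longrightarrow> V \<subseteq> U \<Longrightarrow> s \<in> C U \<Longrightarrow> r U V s \<in> C V"
    and "openin T U \<Longrightarrow> s \<in> C U \<Longrightarrow> r U U s = s"
    and "openin T U \<Longrightarrow> openin T V \<Longrightarrow> openin T W \<Longrightarrow> W \<subseteq> V \<Longrightarrow> V \<subseteq> U \<Longrightarrow> s \<in> C U \<Longrightarrow>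
           r V W (r U V s) = r U W s"
proof -
  have 1: "\<forall>U V. openin T U \<and> openin T V \<and> V \<subseteq> U \<longrightarrow> r U V \<in> C U \<rightarrow> C V"
    using assms unfolding sheaf_of_sets_def by (elim conjE)
  have 2: "\<forall>U. openin T U \<longrightarrow> (\<forall>s\<in>C U. r U U s = s)"
    using assms unfolding sheaf_of_sets_def by (elim conjE)
  have 3: "\<forall>U V W. openin T U \<and> openin T V \<and> openin T W \<and> W \<subseteq> V \<and> V \<subseteq> U \<longrightarrow>
        (\<forall>s\<in>C U. r V W (r U V s) = r U W s)"
    using assms unfolding sheaf_of_sets_def by (elim conjE)
  show "openin T U \<Longrightarrow> openin T V \<Longrightarrow> V \<subseteq> U \<Longrightarrow> s \<in> C U \<Longrightarrow> r U V s \<in> C V"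
    using 1 by blast
  show "openin T U \<Longrightarrow> s \<in> C U \<Longrightarrow> r U U s = s" using 2 by blast
  show "openin T U \<Longrightarrow> openin T V \<Longrightarrow> openin T W \<Longrightarrow> W \<subseteq> V \<Longrightarrow> V \<subseteq> U \<Longrightarrow> s \<in> C U \<Longrightarrow>
           r V W (r U V s) = r U W s" using 3 by blast
qed

lemma sheaf_gluing:
  assumes "sheaf_of_sets T C r" "\<And>U. U \<in> \<U> \<Longrightarrow> openin T U" "\<And>U. U \<in> \<U> \<Longrightarrow> s U \<in> C U"
    "\<And>U V. U \<in> \<U> \<Longrightarrow> V \<in> \<U> \<Longrightarrow> r U (U \<inter> V) (s U) = r V (U \<inter> V) (s V)"
  shows "\<exists>!t. t \<in> C (\<Union>\<U>) \<and> (\<forall>U\<in>\<U>. r (\<Union>\<U>) U t = s U)"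
proof -
  have *: "\<forall>\<U> s. (\<forall>U\<in>\<U>. openin T U \<and> s U \<in> C U) \<and>
        (\<forall>U\<in>\<U>. \<forall>V\<in>\<U>. r U (U \<inter> V) (s U) = r V (U \<inter> V) (s V)) \<longrightarrow>
        (\<exists>!t. t \<in> C (\<Union>\<U>) \<and> (\<forall>U\<in>\<U>. r (\<Union>\<U>) U t = s U))"
    using assms(1) unfolding sheaf_of_sets_def by (elim conjE)
  show ?thesis by (rule *[rule_format]) (intro conjI ballI, use assms(2-4) in auto)
qed

text \<open>The restrictions of \<open>t\<close> form a compatible family, and both \<open>t\<close>
  and \<open>t'\<close> glue it.\<close>

lemma sheaf_separated:
  assumes sh: "sheaf_of_sets T C r" and op: "\<And>U. U \<in> \<U> \<Longrightarrow> openin T U"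
    and t: "t \<in> C (\<Union>\<U>)" "t' \<in> C (\<Union>\<U>)" and eq: "\<And>U. U \<in> \<U> \<Longrightarrow> r (\<Union>\<U>) U t = r (\<Union>\<U>) U t'"
  shows "t = t'"
proof -
  let ?s = "\<lambda>U. r (\<Union>\<U>) U t"
  have o: "openin T (\<Union>\<U>)" using op by blast
  have "\<exists>!t. t \<in> C (\<Union>\<U>) \<and> (\<forall>U\<in>\<U>. r (\<Union>\<U>) U t = ?s U)"
  proof (rule sheaf_gluing[OF sh])
    fix U assume U: "U \<in> \<U>"
    show "openin T U" using op U .
    show "?s U \<in> C U" by (rule sheafD(1)[OF sh o op[OF U] _ t(1)]) (use U in blast)
    fix V assume V: "V \<in> \<U>"
    have oi: "openin T (U \<inter> V)" using op U V by blast
    show "r U (U \<inter> V) (?s U) = r V (U \<inter> V) (?s V)"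
      using sheafD(3)[OF sh o op[OF U] oi Int_lower1 Union_upper[OF U] t(1)]
        sheafD(3)[OF sh o op[OF V] oi Int_lower2 Union_upper[OF V] t(1)] by simp
  qed
  then show ?thesis using t eq by metis
qed

text \<open>The gluing axiom for the empty cover.\<close>

lemma sheaf_empty_section:
  assumes "sheaf_of_sets T C r" "s \<in> C {}" "t \<in> C {}"
  shows "s = t"
  using sheaf_separated[OF assms(1), of "{}" s t] assms by simp

text \<open>A germ is the set of all pairs that agree with the given one near \<open>x\<close>, so
  equality as sets needs transitivity, which holds on the intersection of the two
  neighbourhoods.\<close>

lemma germ_eq_iff:
  assumes sh: "sheaf_of_sets T C r" and U: "openin T U" "x \<in> U" "s \<in> C U"
    and V: "openin T V" "x \<in> V" "t \<in> C V"
  shows "germ T C r x U s = germ T C r x V t \<longleftrightarrow>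
    (\<exists>W. openin T W \<and> x \<in> W \<and> W \<subseteq> U \<inter> V \<and> r U W s = r V W t)"
    (is "?L = ?R")
proof
  assume ?L
  have "(V, t) \<in> germ T C r x V t" unfolding germ_def using V by auto
  then have "(V, t) \<in> germ T C r x U s" using \<open>?L\<close> by simp
  then show ?R unfolding germ_def by simp
next
  have imp: "germ T C r x U s \<subseteq> germ T C r x V t"
    if U: "openin T U" "x \<in> U" "s \<in> C U" and V: "openin T V" "x \<in> V" "t \<in> C V"
      and W: "openin T W" "x \<in> W" "W \<subseteq> U \<inter> V" "r U W s = r V W t" for U V W s t
  proof
    fix y assume "y \<in> germ T C r x U s"
    then obtain V' t' W' where y: "y = (V', t')" "openin T V'" "x \<in> V'" "t' \<in> C V'" and
      W': "openin T W'" "x \<in> W'" "W' \<subseteq> U \<inter> V'" "r U W' s = r V' W' t'" unfolding germ_def by blast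
    let ?N = "W \<inter> W'"
    have N: "openin T ?N" using W W' by auto
    have sub: "W \<subseteq> U" "W \<subseteq> V" "W' \<subseteq> U" "W' \<subseteq> V'" using W W' by auto
    have "r V ?N t = r W ?N (r V W t)"
      using sheafD(3)[OF sh V(1) W(1) N Int_lower1 sub(2) V(3)] by simp
    also have "\<dots> = r U ?N s"
      unfolding W(4)[symmetric] by (rule sheafD(3)[OF sh U(1) W(1) N Int_lower1 sub(1) U(3)])
    also have "\<dots> = r W' ?N (r U W' s)"
      using sheafD(3)[OF sh U(1) W'(1) N Int_lower2 sub(3) U(3)] by simp
    also have "\<dots> = r V' ?N t'"
      unfolding W'(4) by (rule sheafD(3)[OF sh y(2) W'(1) N Int_lower2 sub(4) y(4)])
    finally show "y \<in> germ T C r x V t" unfolding germ_def y(1)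
      using y(2-4) N W W' by (auto intro!: exI[of _ ?N])
  qed
  assume ?R
  then obtain W where W: "openin T W" "x \<in> W" "W \<subseteq> U \<inter> V" "r U W s = r V W t" by blast
  show ?L using imp[OF U V W] imp[OF V U W(1,2) _ W(4)[symmetric]] W(3) by blast
qed

lemma germ_res:
  assumes sh: "sheaf_of_sets T C r" and U: "openin T U" "s \<in> C U" and V: "openin T V" "x \<in> V" "V \<subseteq> U"
  shows "germ T C r x V (r U V s) = germ T C r x U s"
proof -
  have "r U V s \<in> C V" using sheafD(1)[OF sh U(1) V(1,3) U(2)] .
  moreover have "r V V (r U V s) = r U V s" using sheafD(3)[OF sh U(1) V(1) V(1)] V U by auto
  ultimately show ?thesis using germ_eq_iff[OF sh V(1,2) _ U(1) _ U(2)] V by blast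
qed

section \<open>Stalks of a ringed space\<close>

locale ringed =
  fixes \<XX> :: "('p, 'a) ringed_space"
  assumes rs: "is_ringed_space \<XX>"
begin

abbreviation opn where "opn U \<equiv> openin (spc \<XX>) U"
abbreviation Oc where "Oc U \<equiv> carrier (osec \<XX> U)"

lemma osec_cring: "opn U \<Longrightarrow> cring (osec \<XX> U)"
  using rs by (simp add: is_ringed_space_def)

lemma ores_hom: "opn U \<Longrightarrow> opn V \<Longrightarrow> V \<subseteq> U \<Longrightarrow> ores \<XX> U V \<in> ring_hom (osec \<XX> U) (osec \<XX> V)"
  using rs by (simp add: is_ringed_space_def)

lemma osheaf: "sheaf_of_sets (spc \<XX>) (\<lambda>U. Oc U) (ores \<XX>)"
  using rs by (simp add: is_ringed_space_def)

lemmas ores_closed = sheafD(1)[OF osheaf]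
lemmas ores_trans = sheafD(3)[OF osheaf]

lemma ores_ring_hom_cring:
  assumes "opn U" "opn V" "V \<subseteq> U" shows "ring_hom_cring (osec \<XX> U) (osec \<XX> V) (ores \<XX> U V)"
  using assms osec_cring ores_hom by (simp add: ring_hom_cring_def ring_hom_cring_axioms_def)

lemma ogerm_eq_iff:
  assumes "opn U" "x \<in> U" "s \<in> Oc U" "opn V" "x \<in> V" "t \<in> Oc V"
  shows "ogerm \<XX> x U s = ogerm \<XX> x V t \<longleftrightarrow>
    (\<exists>W. opn W \<and> x \<in> W \<and> W \<subseteq> U \<inter> V \<and> ores \<XX> U W s = ores \<XX> V W t)"
  unfolding ogerm_def by (rule germ_eq_iff[OF osheaf]) (use assms in auto)

lemma ogerm_res:
  assumes "opn U" "s \<in> Oc U" "opn V" "x \<in> V" "V \<subseteq> U"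
  shows "ogerm \<XX> x V (ores \<XX> U V s) = ogerm \<XX> x U s"
  unfolding ogerm_def by (rule germ_res[OF osheaf]) (use assms in auto)

lemma ogerm_closed:
  "opn U \<Longrightarrow> x \<in> U \<Longrightarrow> s \<in> Oc U \<Longrightarrow> ogerm \<XX> x U s \<in> carrier (stalk \<XX> x)"
  by (auto simp: stalk_def)

lemma stalk_cases:
  assumes "f \<in> carrier (stalk \<XX> x)"
  obtains U s where "opn U" "x \<in> U" "s \<in> Oc U" "f = ogerm \<XX> x U s"
  using assms by (auto simp: stalk_def)

lemma stalk_cases2:
  assumes "f \<in> carrier (stalk \<XX> x)" "g \<in> carrier (stalk \<XX> x)"
  obtains U s t where "opn U" "x \<in> U" "s \<in> Oc U" "t \<in> Oc U" "f = ogerm \<XX> x U s" "g = ogerm \<XX> x U t"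
proof -
  obtain U s where U: "opn U" "x \<in> U" "s \<in> Oc U" "f = ogerm \<XX> x U s" by (rule stalk_cases[OF assms(1)])
  obtain V t where V: "opn V" "x \<in> V" "t \<in> Oc V" "g = ogerm \<XX> x V t" by (rule stalk_cases[OF assms(2)])
  have W: "opn (U \<inter> V)" "x \<in> U \<inter> V" using U V by auto
  show thesis
    by (rule that[OF W, of "ores \<XX> U (U \<inter> V) s" "ores \<XX> V (U \<inter> V) t"])
      (use U V W ogerm_res ores_closed in auto)
qed

lemma stalk_cases3:
  assumes "f \<in> carrier (stalk \<XX> x)" "g \<in> carrier (stalk \<XX> x)" "h \<in> carrier (stalk \<XX> x)"
  obtains U s t u where "opn U" "x \<in> U" "s \<in> Oc U" "t \<in> Oc U" "u \<in> Oc U"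
    "f = ogerm \<XX> x U s" "g = ogerm \<XX> x U t" "h = ogerm \<XX> x U u"
proof -
  obtain U s s' where U: "opn U" "x \<in> U" "s \<in> Oc U" "s' \<in> Oc U" "f = ogerm \<XX> x U s" "g = ogerm \<XX> x U s'"
    by (rule stalk_cases2[OF assms(1,2)])
  obtain V t where V: "opn V" "x \<in> V" "t \<in> Oc V" "h = ogerm \<XX> x V t" by (rule stalk_cases[OF assms(3)])
  have W: "opn (U \<inter> V)" "x \<in> U \<inter> V" using U V by auto
  show thesis
    by (rule that[OF W, of "ores \<XX> U (U \<inter> V) s" "ores \<XX> U (U \<inter> V) s'" "ores \<XX> V (U \<inter> V) t"])
      (use U V W ogerm_res ores_closed in auto)
qed

text \<open>The stalk operations are definite descriptions over representatives. Independence of the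
  choice is shown here for addition and multiplication together.\<close>

lemma ogerm_binop:
  assumes U: "opn U" "x \<in> U" "s \<in> Oc U" "t \<in> Oc U"
    and cl: "\<And>U s t. opn U \<Longrightarrow> s \<in> Oc U \<Longrightarrow> t \<in> Oc U \<Longrightarrow> f U s t \<in> Oc U"
    and res: "\<And>U V s t. opn U \<Longrightarrow> opn V \<Longrightarrow> V \<subseteq> U \<Longrightarrow> s \<in> Oc U \<Longrightarrow> t \<in> Oc U \<Longrightarrow>
      ores \<XX> U V (f U s t) = f V (ores \<XX> U V s) (ores \<XX> U V t)"
  shows "(THE C. \<exists>V a b. opn V \<and> x \<in> V \<and> a \<in> Oc V \<and> b \<in> Oc V \<and>
     ogerm \<XX> x U s = ogerm \<XX> x V a \<and> ogerm \<XX> x U t = ogerm \<XX> x V b \<and> C = ogerm \<XX> x V (f V a b))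
     = ogerm \<XX> x U (f U s t)"
proof (rule the_equality)
  show "\<exists>V a b. opn V \<and> x \<in> V \<and> a \<in> Oc V \<and> b \<in> Oc V \<and>
     ogerm \<XX> x U s = ogerm \<XX> x V a \<and> ogerm \<XX> x U t = ogerm \<XX> x V b \<and> ogerm \<XX> x U (f U s t) = ogerm \<XX> x V (f V a b)"
    using U by blast
  fix C assume "\<exists>V a b. opn V \<and> x \<in> V \<and> a \<in> Oc V \<and> b \<in> Oc V \<and>
     ogerm \<XX> x U s = ogerm \<XX> x V a \<and> ogerm \<XX> x U t = ogerm \<XX> x V b \<and> C = ogerm \<XX> x V (f V a b)"
  then obtain V a b where V: "opn V" "x \<in> V" "a \<in> Oc V" "b \<in> Oc V"
    and eq: "ogerm \<XX> x U s = ogerm \<XX> x V a" "ogerm \<XX> x U t = ogerm \<XX> x V b" and C: "C = ogerm \<XX> x V (f V a b)"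
    by blast
  obtain W1 where W1: "opn W1" "x \<in> W1" "W1 \<subseteq> U \<inter> V" "ores \<XX> U W1 s = ores \<XX> V W1 a"
    using eq(1) ogerm_eq_iff[OF U(1,2,3) V(1,2,3)] by blast
  obtain W2 where W2: "opn W2" "x \<in> W2" "W2 \<subseteq> U \<inter> V" "ores \<XX> U W2 t = ores \<XX> V W2 b"
    using eq(2) ogerm_eq_iff[OF U(1,2,4) V(1,2,4)] by blast
  let ?W = "W1 \<inter> W2"
  have W: "opn ?W" "x \<in> ?W" "?W \<subseteq> U" "?W \<subseteq> V" using W1 W2 by auto
  have "ores \<XX> U ?W s = ores \<XX> V ?W a"
    using ores_trans[OF U(1) W1(1) W(1) _ _ U(3)] ores_trans[OF V(1) W1(1) W(1) _ _ V(3)] W1 by auto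
  moreover have "ores \<XX> U ?W t = ores \<XX> V ?W b"
    using ores_trans[OF U(1) W2(1) W(1) _ _ U(4)] ores_trans[OF V(1) W2(1) W(1) _ _ V(4)] W2 by auto
  ultimately have "ores \<XX> U ?W (f U s t) = ores \<XX> V ?W (f V a b)"
    using res[OF U(1) W(1,3) U(3,4)] res[OF V(1) W(1,4) V(3,4)] by simp
  then show "C = ogerm \<XX> x U (f U s t)"
    unfolding C using ogerm_eq_iff[OF V(1,2) cl[OF V(1,3,4)] U(1,2) cl[OF U(1,3,4)]] W by (metis Int_subset_iff)
qed

lemma ogerm_mult:
  assumes "opn U" "x \<in> U" "s \<in> Oc U" "t \<in> Oc U"
  shows "ogerm \<XX> x U s \<otimes>\<^bsub>stalk \<XX> x\<^esub> ogerm \<XX> x U t = ogerm \<XX> x U (s \<otimes>\<^bsub>osec \<XX> U\<^esub> t)"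
proof -
  have "s \<otimes>\<^bsub>osec \<XX> U\<^esub> t \<in> Oc U" if "opn U" "s \<in> Oc U" "t \<in> Oc U" for U s t
    using that osec_cring[of U] by (simp add: cring_def ring_def monoid.m_closed)
  then show ?thesis
    unfolding stalk_def
    using ogerm_binop[OF assms, of "\<lambda>U. monoid.mult (osec \<XX> U)"] ring_hom_mult[OF ores_hom] by simp
qed

lemma ogerm_add:
  assumes "opn U" "x \<in> U" "s \<in> Oc U" "t \<in> Oc U"
  shows "ogerm \<XX> x U s \<oplus>\<^bsub>stalk \<XX> x\<^esub> ogerm \<XX> x U t = ogerm \<XX> x U (s \<oplus>\<^bsub>osec \<XX> U\<^esub> t)"
proof -
  have "s \<oplus>\<^bsub>osec \<XX> U\<^esub> t \<in> Oc U" if "opn U" "s \<in> Oc U" "t \<in> Oc U" for U s t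
    using that osec_cring[of U] ring.ring_simprules(1)[of "osec \<XX> U"] by (simp add: cring_def)
  then show ?thesis
    unfolding stalk_def
    using ogerm_binop[OF assms, of "\<lambda>U. ring.add (osec \<XX> U)"] ring_hom_add[OF ores_hom] by simp
qed

lemma openin_top: "opn U \<Longrightarrow> U \<subseteq> topspace (spc \<XX>)" by (rule openin_subset)

lemma ogerm_one:
  assumes "opn U" "x \<in> U"
  shows "ogerm \<XX> x U \<one>\<^bsub>osec \<XX> U\<^esub> = \<one>\<^bsub>stalk \<XX> x\<^esub>"
proof -
  let ?T = "topspace (spc \<XX>)"
  interpret T: cring "osec \<XX> ?T" by (rule osec_cring) simp
  have "ores \<XX> ?T U \<one>\<^bsub>osec \<XX> ?T\<^esub> = \<one>\<^bsub>osec \<XX> U\<^esub>"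
    by (rule ring_hom_one[OF ores_hom]) (use assms openin_top in auto)
  then show ?thesis
    using ogerm_res[of ?T "\<one>\<^bsub>osec \<XX> ?T\<^esub>" U x] assms openin_top by (simp add: stalk_def)
qed

lemma ogerm_zero:
  assumes "opn U" "x \<in> U"
  shows "ogerm \<XX> x U \<zero>\<^bsub>osec \<XX> U\<^esub> = \<zero>\<^bsub>stalk \<XX> x\<^esub>"
proof -
  let ?T = "topspace (spc \<XX>)"
  interpret T: ring_hom_cring "osec \<XX> ?T" "osec \<XX> U" "ores \<XX> ?T U"
    by (rule ores_ring_hom_cring) (use assms openin_top in auto)
  show ?thesis
    using ogerm_res[of ?T "\<zero>\<^bsub>osec \<XX> ?T\<^esub>" U x] assms openin_top by (simp add: stalk_def)
qed

text \<open>Each law is checked on representatives over a common open set.\<close>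

lemma stalk_cring:
  assumes x: "x \<in> topspace (spc \<XX>)"
  shows "cring (stalk \<XX> x)"
proof -
  let ?S = "stalk \<XX> x"
  let ?T = "topspace (spc \<XX>)"
  have T: "opn ?T" by simp
  interpret T: cring "osec \<XX> ?T" by (rule osec_cring[OF T])
  have o: "\<one>\<^bsub>?S\<^esub> = ogerm \<XX> x ?T \<one>\<^bsub>osec \<XX> ?T\<^esub>" "\<zero>\<^bsub>?S\<^esub> = ogerm \<XX> x ?T \<zero>\<^bsub>osec \<XX> ?T\<^esub>"
    by (simp_all add: stalk_def)
  have oc: "\<one>\<^bsub>?S\<^esub> \<in> carrier ?S" "\<zero>\<^bsub>?S\<^esub> \<in> carrier ?S"
    unfolding o using x by (auto intro: ogerm_closed)
  have ab: "abelian_group ?S"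
  proof (rule abelian_groupI)
    fix f g assume fg: "f \<in> carrier ?S" "g \<in> carrier ?S"
    obtain U s t where U: "opn U" "x \<in> U" "s \<in> Oc U" "t \<in> Oc U" "f = ogerm \<XX> x U s" "g = ogerm \<XX> x U t"
      by (rule stalk_cases2[OF fg])
    interpret U: cring "osec \<XX> U" by (rule osec_cring[OF U(1)])
    show "f \<oplus>\<^bsub>?S\<^esub> g \<in> carrier ?S" using U by (simp add: ogerm_add ogerm_closed)
    show "f \<oplus>\<^bsub>?S\<^esub> g = g \<oplus>\<^bsub>?S\<^esub> f" using U by (simp add: ogerm_add U.a_comm)
    fix h assume h: "h \<in> carrier ?S"
    obtain V a b c where V: "opn V" "x \<in> V" "a \<in> Oc V" "b \<in> Oc V" "c \<in> Oc V"
      "f = ogerm \<XX> x V a" "g = ogerm \<XX> x V b" "h = ogerm \<XX> x V c"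
      by (rule stalk_cases3[OF fg h])
    interpret V: cring "osec \<XX> V" by (rule osec_cring[OF V(1)])
    show "(f \<oplus>\<^bsub>?S\<^esub> g) \<oplus>\<^bsub>?S\<^esub> h = f \<oplus>\<^bsub>?S\<^esub> (g \<oplus>\<^bsub>?S\<^esub> h)" using V by (simp add: ogerm_add V.a_assoc)
  next
    fix f assume f: "f \<in> carrier ?S"
    obtain U s where U: "opn U" "x \<in> U" "s \<in> Oc U" "f = ogerm \<XX> x U s" by (rule stalk_cases[OF f])
    interpret U: cring "osec \<XX> U" by (rule osec_cring[OF U(1)])
    show "\<zero>\<^bsub>?S\<^esub> \<oplus>\<^bsub>?S\<^esub> f = f" unfolding ogerm_zero[OF U(1,2), symmetric] using U by (simp add: ogerm_add)
    show "\<exists>y\<in>carrier ?S. y \<oplus>\<^bsub>?S\<^esub> f = \<zero>\<^bsub>?S\<^esub>"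
    proof
      show "ogerm \<XX> x U (\<ominus>\<^bsub>osec \<XX> U\<^esub> s) \<in> carrier ?S" using U by (simp add: ogerm_closed)
      show "ogerm \<XX> x U (\<ominus>\<^bsub>osec \<XX> U\<^esub> s) \<oplus>\<^bsub>?S\<^esub> f = \<zero>\<^bsub>?S\<^esub>"
        unfolding ogerm_zero[OF U(1,2), symmetric] using U by (simp add: ogerm_add U.l_neg)
    qed
  qed (rule oc)
  have cm: "comm_monoid ?S"
  proof (rule comm_monoidI)
    fix f g assume fg: "f \<in> carrier ?S" "g \<in> carrier ?S"
    obtain U s t where U: "opn U" "x \<in> U" "s \<in> Oc U" "t \<in> Oc U" "f = ogerm \<XX> x U s" "g = ogerm \<XX> x U t"
      by (rule stalk_cases2[OF fg])
    interpret U: cring "osec \<XX> U" by (rule osec_cring[OF U(1)])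
    show "f \<otimes>\<^bsub>?S\<^esub> g \<in> carrier ?S" using U by (simp add: ogerm_mult ogerm_closed)
    show "f \<otimes>\<^bsub>?S\<^esub> g = g \<otimes>\<^bsub>?S\<^esub> f" using U by (simp add: ogerm_mult U.m_comm)
    fix h assume h: "h \<in> carrier ?S"
    obtain V a b c where V: "opn V" "x \<in> V" "a \<in> Oc V" "b \<in> Oc V" "c \<in> Oc V"
      "f = ogerm \<XX> x V a" "g = ogerm \<XX> x V b" "h = ogerm \<XX> x V c"
      by (rule stalk_cases3[OF fg h])
    interpret V: cring "osec \<XX> V" by (rule osec_cring[OF V(1)])
    show "(f \<otimes>\<^bsub>?S\<^esub> g) \<otimes>\<^bsub>?S\<^esub> h = f \<otimes>\<^bsub>?S\<^esub> (g \<otimes>\<^bsub>?S\<^esub> h)" using V by (simp add: ogerm_mult V.m_assoc)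
  next
    fix f assume f: "f \<in> carrier ?S"
    obtain U s where U: "opn U" "x \<in> U" "s \<in> Oc U" "f = ogerm \<XX> x U s" by (rule stalk_cases[OF f])
    interpret U: cring "osec \<XX> U" by (rule osec_cring[OF U(1)])
    show "\<one>\<^bsub>?S\<^esub> \<otimes>\<^bsub>?S\<^esub> f = f" unfolding ogerm_one[OF U(1,2), symmetric] using U by (simp add: ogerm_mult)
  qed (rule oc)
  show ?thesis
  proof (rule cringI[OF ab cm])
    fix f g h assume fgh: "f \<in> carrier ?S" "g \<in> carrier ?S" "h \<in> carrier ?S"
    obtain V a b c where V: "opn V" "x \<in> V" "a \<in> Oc V" "b \<in> Oc V" "c \<in> Oc V"
      "f = ogerm \<XX> x V a" "g = ogerm \<XX> x V b" "h = ogerm \<XX> x V c"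
      by (rule stalk_cases3[OF fgh])
    interpret V: cring "osec \<XX> V" by (rule osec_cring[OF V(1)])
    show "(f \<oplus>\<^bsub>?S\<^esub> g) \<otimes>\<^bsub>?S\<^esub> h = f \<otimes>\<^bsub>?S\<^esub> h \<oplus>\<^bsub>?S\<^esub> g \<otimes>\<^bsub>?S\<^esub> h"
      using V by (simp add: ogerm_mult ogerm_add V.l_distr)
  qed
qed

lemma ogerm_hom:
  assumes "opn U" "x \<in> U"
  shows "ogerm \<XX> x U \<in> ring_hom (osec \<XX> U) (stalk \<XX> x)"
  by (rule ring_hom_memI) (use assms ogerm_closed ogerm_mult ogerm_add ogerm_one in auto)

end

section \<open>Affine charts\<close>

text \<open>Zorn's lemma for ideals avoiding the unit; a maximal ideal is prime.\<close>

lemma (in cring) exists_prime_above: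
  assumes "ideal I R" "I \<noteq> carrier R"
  obtains p where "primeideal p R" "I \<subseteq> p"
proof -
  define S where "S = {J. ideal J R \<and> I \<subseteq> J \<and> \<one> \<notin> J}"
  have one: "\<one> \<notin> J" if "ideal J R" "J \<noteq> carrier R" for J
    using that ideal.one_imp_carrier by blast
  have "\<exists>M\<in>S. \<forall>J\<in>S. M \<subseteq> J \<longrightarrow> J = M"
  proof (rule subset_Zorn_nonempty)
    show "S \<noteq> {}" using assms one[OF assms] by (auto simp: S_def)
    fix C assume C: "C \<noteq> {}" "subset.chain S C"
    then have "subset.chain {I. ideal I R} C" by (auto simp: S_def subset_chain_def)
    then have "ideal (\<Union>C) R" using chain_Union_is_ideal[of C] C(1) by simp
    moreover have "C \<subseteq> S" using C(2) by (auto simp: subset_chain_def)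
    ultimately show "\<Union>C \<in> S" using C(1) by (fastforce simp: S_def)
  qed
  then obtain M where M: "M \<in> S" "\<And>J. J \<in> S \<Longrightarrow> M \<subseteq> J \<Longrightarrow> J = M" by blast
  have "maximalideal M R"
  proof (rule maximalidealI)
    show "ideal M R" using M by (simp add: S_def)
    show "carrier R \<noteq> M" using M by (auto simp: S_def)
    fix J assume "ideal J R" "M \<subseteq> J" "J \<subseteq> carrier R"
    moreover have "I \<subseteq> M" using M(1) by (simp add: S_def)
    ultimately show "J = M \<or> J = carrier R" using M(2)[of J] one[of J] unfolding S_def by blast
  qed
  then show thesis using that maximalideal_prime M(1) by (auto simp: S_def)
qed

lemma (in cring) primeideal_compl:
  assumes "primeideal p R"
  shows "\<one> \<notin> p" "\<zero> \<in> p" "p \<subseteq> carrier R"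
    "a \<in> carrier R \<Longrightarrow> b \<in> carrier R \<Longrightarrow> a \<otimes> b \<in> p \<longleftrightarrow> a \<in> p \<or> b \<in> p"
proof -
  interpret p: primeideal p R by fact
  show "\<one> \<notin> p" using p.one_imp_carrier p.I_notcarr by blast
  show "\<zero> \<in> p" "p \<subseteq> carrier R" using p.zero_closed p.a_subset by auto
  show "a \<in> carrier R \<Longrightarrow> b \<in> carrier R \<Longrightarrow> a \<otimes> b \<in> p \<longleftrightarrow> a \<in> p \<or> b \<in> p"
    using p.I_prime p.I_l_closed p.I_r_closed by blast
qed

section \<open>Fractions at a prime ideal\<close>

context
  fixes R :: "'a ring" and p :: "'a set"
  assumes R: "cring R" and p: "primeideal p R"
begin

interpretation cring R by (rule R)

lemma fraction_alt:
  assumes "a \<in> carrier R" "b \<in> carrier R"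
  shows "fraction R p a b = {(c, d). c \<in> carrier R \<and> d \<in> carrier R - p \<and>
     (\<exists>u\<in>carrier R - p. u \<otimes>\<^bsub>R\<^esub> (a \<otimes>\<^bsub>R\<^esub> d) = u \<otimes>\<^bsub>R\<^esub> (c \<otimes>\<^bsub>R\<^esub> b))}"
proof -
  have "u \<otimes>\<^bsub>R\<^esub> (x \<ominus>\<^bsub>R\<^esub> y) = \<zero>\<^bsub>R\<^esub> \<longleftrightarrow> u \<otimes>\<^bsub>R\<^esub> x = u \<otimes>\<^bsub>R\<^esub> y"
    if "u \<in> carrier R" "x \<in> carrier R" "y \<in> carrier R" for u x y
  proof -
    have "u \<otimes>\<^bsub>R\<^esub> (x \<ominus>\<^bsub>R\<^esub> y) = u \<otimes>\<^bsub>R\<^esub> x \<ominus>\<^bsub>R\<^esub> u \<otimes>\<^bsub>R\<^esub> y"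
      using that by (simp add: minus_eq r_distr r_minus)
    then show ?thesis using that by simp
  qed
  then show ?thesis unfolding fraction_def using assms by auto
qed

text \<open>As for germs, fractions are equivalence classes written as sets, so the content is
  transitivity.\<close>

lemma fraction_eq_iff:
  assumes "a \<in> carrier R" "b \<in> carrier R - p" "c \<in> carrier R" "d \<in> carrier R - p"
  shows "fraction R p a b = fraction R p c d \<longleftrightarrow>
    (\<exists>u\<in>carrier R - p. u \<otimes>\<^bsub>R\<^esub> (a \<otimes>\<^bsub>R\<^esub> d) = u \<otimes>\<^bsub>R\<^esub> (c \<otimes>\<^bsub>R\<^esub> b))" (is "?L = ?R")
proof
  assume ?L
  have "(c, d) \<in> fraction R p c d"
    using assms primeideal_compl(1)[OF p] by (subst fraction_alt) auto
  then have "(c, d) \<in> fraction R p a b" using \<open>?L\<close> by simp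
  then show ?R using assms by (subst (asm) fraction_alt) auto
next
  have imp: "fraction R p a b \<subseteq> fraction R p c d"
    if abcd: "a \<in> carrier R" "b \<in> carrier R - p" "c \<in> carrier R" "d \<in> carrier R - p"
      and u: "u \<in> carrier R - p" "u \<otimes>\<^bsub>R\<^esub> (a \<otimes>\<^bsub>R\<^esub> d) = u \<otimes>\<^bsub>R\<^esub> (c \<otimes>\<^bsub>R\<^esub> b)" for a b c d u
  proof
    fix z assume "z \<in> fraction R p a b"
    then obtain e f v where z: "z = (e, f)" "e \<in> carrier R" "f \<in> carrier R - p" and
      v: "v \<in> carrier R - p" "v \<otimes>\<^bsub>R\<^esub> (a \<otimes>\<^bsub>R\<^esub> f) = v \<otimes>\<^bsub>R\<^esub> (e \<otimes>\<^bsub>R\<^esub> b)"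
      using abcd by (subst (asm) fraction_alt) auto
    have c: "a \<in> carrier R" "b \<in> carrier R" "c \<in> carrier R" "d \<in> carrier R" "u \<in> carrier R" "v \<in> carrier R"
      "e \<in> carrier R" "f \<in> carrier R" using abcd u v z by auto
    \<comment> \<open>\<open>R\<close> may have zero divisors, so the denominator \<open>b\<close>
      that links the two equations is put into the multiplier instead of being cancelled.\<close>
    let ?w = "u \<otimes>\<^bsub>R\<^esub> v \<otimes>\<^bsub>R\<^esub> b"
    have "?w \<otimes>\<^bsub>R\<^esub> (c \<otimes>\<^bsub>R\<^esub> f) = (v \<otimes>\<^bsub>R\<^esub> f) \<otimes>\<^bsub>R\<^esub> (u \<otimes>\<^bsub>R\<^esub> (c \<otimes>\<^bsub>R\<^esub> b))" using c by (simp add: m_ac)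
    also have "\<dots> = (u \<otimes>\<^bsub>R\<^esub> d) \<otimes>\<^bsub>R\<^esub> (v \<otimes>\<^bsub>R\<^esub> (a \<otimes>\<^bsub>R\<^esub> f))" unfolding u(2)[symmetric] using c by (simp add: m_ac)
    also have "\<dots> = ?w \<otimes>\<^bsub>R\<^esub> (e \<otimes>\<^bsub>R\<^esub> d)" unfolding v(2) using c by (simp add: m_ac)
    finally have "?w \<otimes>\<^bsub>R\<^esub> (c \<otimes>\<^bsub>R\<^esub> f) = ?w \<otimes>\<^bsub>R\<^esub> (e \<otimes>\<^bsub>R\<^esub> d)" .
    moreover have "?w \<in> carrier R - p" using c u v abcd primeideal_compl(4)[OF p] by auto
    ultimately show "z \<in> fraction R p c d" using z abcd by (subst fraction_alt) auto
  qed
  assume ?R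
  then obtain u where u: "u \<in> carrier R - p" "u \<otimes>\<^bsub>R\<^esub> (a \<otimes>\<^bsub>R\<^esub> d) = u \<otimes>\<^bsub>R\<^esub> (c \<otimes>\<^bsub>R\<^esub> b)" by blast
  show ?L using imp[OF assms u] imp[OF assms(3,4,1,2) u(1) u(2)[symmetric]] by blast
qed

lemma fraction_mult:
  assumes "a \<in> carrier R" "b \<in> carrier R - p" "c \<in> carrier R" "d \<in> carrier R - p"
  shows "fraction R p a b \<otimes>\<^bsub>localization R p\<^esub> fraction R p c d = fraction R p (a \<otimes>\<^bsub>R\<^esub> c) (b \<otimes>\<^bsub>R\<^esub> d)"
  unfolding localization_def monoid.simps
proof (rule the_equality)
  show "\<exists>a' b' c' d'. a' \<in> carrier R \<and> b' \<in> carrier R - p \<and> c' \<in> carrier R \<and> d' \<in> carrier R - p \<and>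
     fraction R p a b = fraction R p a' b' \<and> fraction R p c d = fraction R p c' d' \<and>
     fraction R p (a \<otimes>\<^bsub>R\<^esub> c) (b \<otimes>\<^bsub>R\<^esub> d) = fraction R p (a' \<otimes>\<^bsub>R\<^esub> c') (b' \<otimes>\<^bsub>R\<^esub> d')"
    using assms by blast
  fix C assume "\<exists>a' b' c' d'. a' \<in> carrier R \<and> b' \<in> carrier R - p \<and> c' \<in> carrier R \<and> d' \<in> carrier R - p \<and>
     fraction R p a b = fraction R p a' b' \<and> fraction R p c d = fraction R p c' d' \<and>
     C = fraction R p (a' \<otimes>\<^bsub>R\<^esub> c') (b' \<otimes>\<^bsub>R\<^esub> d')"
  then obtain a' b' c' d' where *: "a' \<in> carrier R" "b' \<in> carrier R - p" "c' \<in> carrier R" "d' \<in> carrier R - p"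
     "fraction R p a b = fraction R p a' b'" "fraction R p c d = fraction R p c' d'"
     and C: "C = fraction R p (a' \<otimes>\<^bsub>R\<^esub> c') (b' \<otimes>\<^bsub>R\<^esub> d')" by blast
  obtain u where u: "u \<in> carrier R - p" "u \<otimes>\<^bsub>R\<^esub> (a \<otimes>\<^bsub>R\<^esub> b') = u \<otimes>\<^bsub>R\<^esub> (a' \<otimes>\<^bsub>R\<^esub> b)"
    using *(5) fraction_eq_iff[OF assms(1,2) *(1,2)] by blast
  obtain v where v: "v \<in> carrier R - p" "v \<otimes>\<^bsub>R\<^esub> (c \<otimes>\<^bsub>R\<^esub> d') = v \<otimes>\<^bsub>R\<^esub> (c' \<otimes>\<^bsub>R\<^esub> d)"
    using *(6) fraction_eq_iff[OF assms(3,4) *(3,4)] by blast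
  have c: "a \<in> carrier R" "b \<in> carrier R" "c \<in> carrier R" "d \<in> carrier R" "u \<in> carrier R" "v \<in> carrier R"
    "a' \<in> carrier R" "b' \<in> carrier R" "c' \<in> carrier R" "d' \<in> carrier R" using assms u v * by auto
  have "(u \<otimes>\<^bsub>R\<^esub> v) \<otimes>\<^bsub>R\<^esub> ((a' \<otimes>\<^bsub>R\<^esub> c') \<otimes>\<^bsub>R\<^esub> (b \<otimes>\<^bsub>R\<^esub> d)) =
      (u \<otimes>\<^bsub>R\<^esub> (a' \<otimes>\<^bsub>R\<^esub> b)) \<otimes>\<^bsub>R\<^esub> (v \<otimes>\<^bsub>R\<^esub> (c' \<otimes>\<^bsub>R\<^esub> d))" using c by (simp add: m_ac)
  also have "\<dots> = (u \<otimes>\<^bsub>R\<^esub> v) \<otimes>\<^bsub>R\<^esub> ((a \<otimes>\<^bsub>R\<^esub> c) \<otimes>\<^bsub>R\<^esub> (b' \<otimes>\<^bsub>R\<^esub> d'))"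
    unfolding u(2)[symmetric] v(2)[symmetric] using c by (simp add: m_ac)
  finally have eq: "(u \<otimes>\<^bsub>R\<^esub> v) \<otimes>\<^bsub>R\<^esub> ((a' \<otimes>\<^bsub>R\<^esub> c') \<otimes>\<^bsub>R\<^esub> (b \<otimes>\<^bsub>R\<^esub> d)) =
    (u \<otimes>\<^bsub>R\<^esub> v) \<otimes>\<^bsub>R\<^esub> ((a \<otimes>\<^bsub>R\<^esub> c) \<otimes>\<^bsub>R\<^esub> (b' \<otimes>\<^bsub>R\<^esub> d'))" .
  have m: "u \<otimes>\<^bsub>R\<^esub> v \<in> carrier R - p" "b \<otimes>\<^bsub>R\<^esub> d \<in> carrier R - p" "b' \<otimes>\<^bsub>R\<^esub> d' \<in> carrier R - p"
    using primeideal_compl(4)[OF p] c u v assms * by auto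
  have "fraction R p (a' \<otimes>\<^bsub>R\<^esub> c') (b' \<otimes>\<^bsub>R\<^esub> d') = fraction R p (a \<otimes>\<^bsub>R\<^esub> c) (b \<otimes>\<^bsub>R\<^esub> d)"
    by (subst fraction_eq_iff[OF _ m(3) _ m(2)]) (use eq m(1) c in auto)
  then show "C = fraction R p (a \<otimes>\<^bsub>R\<^esub> c) (b \<otimes>\<^bsub>R\<^esub> d)" using C by simp
qed

lemma fraction_add:
  assumes "a \<in> carrier R" "b \<in> carrier R - p" "c \<in> carrier R" "d \<in> carrier R - p"
  shows "fraction R p a b \<oplus>\<^bsub>localization R p\<^esub> fraction R p c d =
    fraction R p (a \<otimes>\<^bsub>R\<^esub> d \<oplus>\<^bsub>R\<^esub> c \<otimes>\<^bsub>R\<^esub> b) (b \<otimes>\<^bsub>R\<^esub> d)"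
  unfolding localization_def ring.simps
proof (rule the_equality)
  show "\<exists>a' b' c' d'. a' \<in> carrier R \<and> b' \<in> carrier R - p \<and> c' \<in> carrier R \<and> d' \<in> carrier R - p \<and>
     fraction R p a b = fraction R p a' b' \<and> fraction R p c d = fraction R p c' d' \<and>
     fraction R p (a \<otimes>\<^bsub>R\<^esub> d \<oplus>\<^bsub>R\<^esub> c \<otimes>\<^bsub>R\<^esub> b) (b \<otimes>\<^bsub>R\<^esub> d) = fraction R p (a' \<otimes>\<^bsub>R\<^esub> d' \<oplus>\<^bsub>R\<^esub> c' \<otimes>\<^bsub>R\<^esub> b') (b' \<otimes>\<^bsub>R\<^esub> d')"
    using assms by blast
  fix C assume "\<exists>a' b' c' d'. a' \<in> carrier R \<and> b' \<in> carrier R - p \<and> c' \<in> carrier R \<and> d' \<in> carrier R - p \<and>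
     fraction R p a b = fraction R p a' b' \<and> fraction R p c d = fraction R p c' d' \<and>
     C = fraction R p (a' \<otimes>\<^bsub>R\<^esub> d' \<oplus>\<^bsub>R\<^esub> c' \<otimes>\<^bsub>R\<^esub> b') (b' \<otimes>\<^bsub>R\<^esub> d')"
  then obtain a' b' c' d' where *: "a' \<in> carrier R" "b' \<in> carrier R - p" "c' \<in> carrier R" "d' \<in> carrier R - p"
     "fraction R p a b = fraction R p a' b'" "fraction R p c d = fraction R p c' d'"
     and C: "C = fraction R p (a' \<otimes>\<^bsub>R\<^esub> d' \<oplus>\<^bsub>R\<^esub> c' \<otimes>\<^bsub>R\<^esub> b') (b' \<otimes>\<^bsub>R\<^esub> d')" by blast
  obtain u where u: "u \<in> carrier R - p" "u \<otimes>\<^bsub>R\<^esub> (a \<otimes>\<^bsub>R\<^esub> b') = u \<otimes>\<^bsub>R\<^esub> (a' \<otimes>\<^bsub>R\<^esub> b)"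
    using *(5) fraction_eq_iff[OF assms(1,2) *(1,2)] by blast
  obtain v where v: "v \<in> carrier R - p" "v \<otimes>\<^bsub>R\<^esub> (c \<otimes>\<^bsub>R\<^esub> d') = v \<otimes>\<^bsub>R\<^esub> (c' \<otimes>\<^bsub>R\<^esub> d)"
    using *(6) fraction_eq_iff[OF assms(3,4) *(3,4)] by blast
  have c: "a \<in> carrier R" "b \<in> carrier R" "c \<in> carrier R" "d \<in> carrier R" "u \<in> carrier R" "v \<in> carrier R"
    "a' \<in> carrier R" "b' \<in> carrier R" "c' \<in> carrier R" "d' \<in> carrier R" using assms u v * by auto
  have "(u \<otimes>\<^bsub>R\<^esub> v) \<otimes>\<^bsub>R\<^esub> ((a' \<otimes>\<^bsub>R\<^esub> d' \<oplus>\<^bsub>R\<^esub> c' \<otimes>\<^bsub>R\<^esub> b') \<otimes>\<^bsub>R\<^esub> (b \<otimes>\<^bsub>R\<^esub> d)) =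
      (v \<otimes>\<^bsub>R\<^esub> d \<otimes>\<^bsub>R\<^esub> d') \<otimes>\<^bsub>R\<^esub> (u \<otimes>\<^bsub>R\<^esub> (a' \<otimes>\<^bsub>R\<^esub> b)) \<oplus>\<^bsub>R\<^esub> (u \<otimes>\<^bsub>R\<^esub> b \<otimes>\<^bsub>R\<^esub> b') \<otimes>\<^bsub>R\<^esub> (v \<otimes>\<^bsub>R\<^esub> (c' \<otimes>\<^bsub>R\<^esub> d))"
    using c by (simp add: l_distr r_distr m_ac)
  also have "\<dots> = (u \<otimes>\<^bsub>R\<^esub> v) \<otimes>\<^bsub>R\<^esub> ((a \<otimes>\<^bsub>R\<^esub> d \<oplus>\<^bsub>R\<^esub> c \<otimes>\<^bsub>R\<^esub> b) \<otimes>\<^bsub>R\<^esub> (b' \<otimes>\<^bsub>R\<^esub> d'))"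
    unfolding u(2)[symmetric] v(2)[symmetric] using c by (simp add: l_distr r_distr m_ac)
  finally have eq: "(u \<otimes>\<^bsub>R\<^esub> v) \<otimes>\<^bsub>R\<^esub> ((a' \<otimes>\<^bsub>R\<^esub> d' \<oplus>\<^bsub>R\<^esub> c' \<otimes>\<^bsub>R\<^esub> b') \<otimes>\<^bsub>R\<^esub> (b \<otimes>\<^bsub>R\<^esub> d)) =
    (u \<otimes>\<^bsub>R\<^esub> v) \<otimes>\<^bsub>R\<^esub> ((a \<otimes>\<^bsub>R\<^esub> d \<oplus>\<^bsub>R\<^esub> c \<otimes>\<^bsub>R\<^esub> b) \<otimes>\<^bsub>R\<^esub> (b' \<otimes>\<^bsub>R\<^esub> d'))" .
  have m: "u \<otimes>\<^bsub>R\<^esub> v \<in> carrier R - p" "b \<otimes>\<^bsub>R\<^esub> d \<in> carrier R - p" "b' \<otimes>\<^bsub>R\<^esub> d' \<in> carrier R - p"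
    using primeideal_compl(4)[OF p] c u v assms * by auto
  have "fraction R p (a' \<otimes>\<^bsub>R\<^esub> d' \<oplus>\<^bsub>R\<^esub> c' \<otimes>\<^bsub>R\<^esub> b') (b' \<otimes>\<^bsub>R\<^esub> d') =
      fraction R p (a \<otimes>\<^bsub>R\<^esub> d \<oplus>\<^bsub>R\<^esub> c \<otimes>\<^bsub>R\<^esub> b) (b \<otimes>\<^bsub>R\<^esub> d)"
    by (subst fraction_eq_iff[OF _ m(3) _ m(2)]) (use eq m(1) c in auto)
  then show "C = fraction R p (a \<otimes>\<^bsub>R\<^esub> d \<oplus>\<^bsub>R\<^esub> c \<otimes>\<^bsub>R\<^esub> b) (b \<otimes>\<^bsub>R\<^esub> d)" using C by simp
qed

end

section \<open>The Zariski topology\<close>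

lemma openin_zariski:
  assumes R: "cring R"
  shows "openin (zariski R) V \<longleftrightarrow> (\<exists>I. ideal I R \<and> V = {p. primeideal p R \<and> \<not> I \<subseteq> p})"
proof -
  interpret cring R by fact
  let ?D = "\<lambda>I. {p. primeideal p R \<and> \<not> I \<subseteq> p}"
  \<comment> \<open>The constructor \<open>topology\<close> is meaningful only for a family that
    satisfies the axioms. Intersections come from intersections of ideals, unions from the ideal
    generated by the union.\<close>
  have "istopology (\<lambda>V. \<exists>I. ideal I R \<and> V = ?D I)"
    unfolding istopology_def
  proof (intro conjI allI impI)
    fix S T assume "\<exists>I. ideal I R \<and> S = ?D I" "\<exists>I. ideal I R \<and> T = ?D I"
    then obtain I J where I: "ideal I R" "S = ?D I" and J: "ideal J R" "T = ?D J" by blast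
    interpret I: ideal I R by fact
    interpret J: ideal J R by fact
    have "S \<inter> T = ?D (I \<inter> J)"
    proof (intro equalityI subsetI)
      fix p assume "p \<in> S \<inter> T"
      then obtain a b where p: "primeideal p R" and ab: "a \<in> I" "a \<notin> p" "b \<in> J" "b \<notin> p"
        using I(2) J(2) by blast
      have c: "a \<in> carrier R" "b \<in> carrier R" using ab by auto
      have "a \<otimes>\<^bsub>R\<^esub> b \<in> I \<inter> J" using ab c I.I_r_closed J.I_l_closed by blast
      moreover have "a \<otimes>\<^bsub>R\<^esub> b \<notin> p" using primeideal_compl(4)[OF p c] ab by blast
      ultimately show "p \<in> ?D (I \<inter> J)" using p by blast
    qed (use I(2) J(2) in blast)
    then show "\<exists>K. ideal K R \<and> S \<inter> T = ?D K" using i_intersect[OF I(1) J(1)] by blast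
  next
    fix \<K> assume "\<forall>K\<in>\<K>. \<exists>I. ideal I R \<and> K = ?D I"
    then have "\<forall>K\<in>\<K>. \<exists>I. ideal I R \<and> (\<forall>p. p \<in> K \<longleftrightarrow> primeideal p R \<and> \<not> I \<subseteq> p)" by auto
    from bchoice[OF this] obtain f where
      f': "\<forall>K\<in>\<K>. ideal (f K) R \<and> (\<forall>p. p \<in> K \<longleftrightarrow> primeideal p R \<and> \<not> f K \<subseteq> p)" ..
    have f: "ideal (f K) R" "p \<in> K \<longleftrightarrow> primeideal p R \<and> \<not> f K \<subseteq> p" if "K \<in> \<K>" for K p
      using bspec[OF f' that] by (simp_all only:)
    let ?I = "\<Union>(f ` \<K>)"
    have IR: "?I \<subseteq> carrier R"
    proof
      fix x assume "x \<in> ?I"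
      then obtain K where K: "K \<in> \<K>" "x \<in> f K" by blast
      show "x \<in> carrier R" by (rule ideal.Icarr[OF f(1)[OF K(1)] K(2)])
    qed
    have "\<Union>\<K> = ?D (Idl\<^bsub>R\<^esub> ?I)"
    proof (intro equalityI subsetI)
      fix p assume "p \<in> \<Union>\<K>"
      then obtain K where K: "K \<in> \<K>" "p \<in> K" by blast
      then have "primeideal p R" "\<not> f K \<subseteq> p" using f(2)[OF K(1)] by auto
      then show "p \<in> ?D (Idl\<^bsub>R\<^esub> ?I)" using genideal_self[OF IR] K by blast
    next
      fix p assume p: "p \<in> ?D (Idl\<^bsub>R\<^esub> ?I)"
      then have "\<not> ?I \<subseteq> p" using genideal_minimal[of p ?I] primeideal.axioms(1)[of p R] by blast
      then obtain K where "K \<in> \<K>" "\<not> f K \<subseteq> p" by blast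
      then show "p \<in> \<Union>\<K>" using f(2)[of K p] p by blast
    qed
    then show "\<exists>I. ideal I R \<and> \<Union>\<K> = ?D I" using genideal_ideal[OF IR] by blast
  qed
  then show ?thesis unfolding zariski_def by (simp add: topology_inverse')
qed

lemma zariski_basic:
  assumes R: "cring R" and b: "b \<in> carrier R"
  shows "openin (zariski R) {p. primeideal p R \<and> b \<notin> p}"
proof -
  interpret cring R by fact
  have "b \<notin> p \<longleftrightarrow> \<not> PIdl\<^bsub>R\<^esub> b \<subseteq> p" if "primeideal p R" for p
    using cgenideal_self[OF b] cgenideal_minimal[of p b] primeideal.axioms(1)[OF that] by blast
  then have "{p. primeideal p R \<and> b \<notin> p} = {p. primeideal p R \<and> \<not> PIdl\<^bsub>R\<^esub> b \<subseteq> p}" by blast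
  then show ?thesis unfolding openin_zariski[OF R] using cgenideal_ideal[OF b] by blast
qed

lemma zariski_nbhd:
  assumes R: "cring R" and V: "openin (zariski R) V" "p \<in> V"
  obtains b where "b \<in> carrier R" "b \<notin> p" "\<And>q. primeideal q R \<Longrightarrow> b \<notin> q \<Longrightarrow> q \<in> V"
proof -
  obtain I where I: "ideal I R" "V = {p. primeideal p R \<and> \<not> I \<subseteq> p}" using V openin_zariski[OF R] by blast
  then obtain b where "b \<in> I" "b \<notin> p" using V(2) by blast
  then show thesis using that[of b] I ideal.Icarr[OF I(1)] by blast
qed

lemma zariski_prime: "cring R \<Longrightarrow> openin (zariski R) V \<Longrightarrow> p \<in> V \<Longrightarrow> primeideal p R"
  using openin_zariski by blast

lemma topspace_zariski:
  assumes R: "cring R"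
  shows "topspace (zariski R) = {p. primeideal p R}"
proof
  interpret cring R by fact
  show "topspace (zariski R) \<subseteq> {p. primeideal p R}"
    using zariski_prime[OF R openin_topspace] by blast
  have "openin (zariski R) {p. primeideal p R \<and> \<one>\<^bsub>R\<^esub> \<notin> p}" by (rule zariski_basic[OF R]) simp
  moreover have "{p. primeideal p R \<and> \<one>\<^bsub>R\<^esub> \<notin> p} = {p. primeideal p R}" using primeideal_compl(1) by blast
  ultimately show "{p. primeideal p R} \<subseteq> topspace (zariski R)" using openin_subset by metis
qed

section \<open>Sections of the spectrum given by one fraction\<close>

definition frac_section :: "'a ring \<Rightarrow> 'a set set \<Rightarrow> 'a \<Rightarrow> 'a \<Rightarrow> 'a set \<Rightarrow> ('a \<times> 'a) set" where
  "frac_section R V a b = (\<lambda>q\<in>V. fraction R q a b)"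

context
  fixes R :: "'a ring"
  assumes R: "cring R"
begin

interpretation cring R by (rule R)

lemma frac_section_closed:
  assumes V: "openin (zariski R) V" and "a \<in> carrier R" "b \<in> carrier R" "\<And>q. q \<in> V \<Longrightarrow> b \<notin> q"
  shows "frac_section R V a b \<in> carrier (osec (Spec R) V)"
proof -
  have "frac_section R V a b \<in> spec_sections R V"
    unfolding spec_sections_def
  proof (rule CollectI, intro conjI ballI)
    have "fraction R p a b \<in> carrier (localization R p)" if "p \<in> V" for p
      using assms that by (auto simp: localization_def)
    then show "frac_section R V a b \<in> (\<Pi>\<^sub>E p\<in>V. carrier (localization R p))"
      by (simp add: frac_section_def)
    fix p assume "p \<in> V"
    moreover have "\<forall>q\<in>V. b \<notin> q \<and> frac_section R V a b q = fraction R q a b"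
      using assms(4) by (simp add: frac_section_def)
    ultimately show "\<exists>W c d. openin (zariski R) W \<and> p \<in> W \<and> W \<subseteq> V \<and> c \<in> carrier R \<and> d \<in> carrier R \<and>
        (\<forall>q\<in>W. d \<notin> q \<and> frac_section R V a b q = fraction R q c d)"
      using V assms(2,3) by blast
  qed
  then show ?thesis by (simp add: Spec_def)
qed

lemma frac_section_mult:
  assumes V: "openin (zariski R) V" and "a \<in> carrier R" "b \<in> carrier R" "\<And>q. q \<in> V \<Longrightarrow> b \<notin> q"
    and "c \<in> carrier R" "d \<in> carrier R" "\<And>q. q \<in> V \<Longrightarrow> d \<notin> q"
  shows "frac_section R V a b \<otimes>\<^bsub>osec (Spec R) V\<^esub> frac_section R V c d = frac_section R V (a \<otimes>\<^bsub>R\<^esub> c) (b \<otimes>\<^bsub>R\<^esub> d)"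
  using assms fraction_mult[OF R zariski_prime[OF R V]]
  by (auto simp: Spec_def frac_section_def restrict_def fun_eq_iff)

lemma frac_section_add:
  assumes V: "openin (zariski R) V" and "a \<in> carrier R" "b \<in> carrier R" "\<And>q. q \<in> V \<Longrightarrow> b \<notin> q"
    and "c \<in> carrier R" "d \<in> carrier R" "\<And>q. q \<in> V \<Longrightarrow> d \<notin> q"
  shows "frac_section R V a b \<oplus>\<^bsub>osec (Spec R) V\<^esub> frac_section R V c d =
    frac_section R V (a \<otimes>\<^bsub>R\<^esub> d \<oplus>\<^bsub>R\<^esub> c \<otimes>\<^bsub>R\<^esub> b) (b \<otimes>\<^bsub>R\<^esub> d)"
  using assms fraction_add[OF R zariski_prime[OF R V]]
  by (auto simp: Spec_def frac_section_def restrict_def fun_eq_iff)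

lemma frac_section_one: "frac_section R V \<one>\<^bsub>R\<^esub> \<one>\<^bsub>R\<^esub> = \<one>\<^bsub>osec (Spec R) V\<^esub>"
  by (auto simp: Spec_def frac_section_def restrict_def localization_def fun_eq_iff)

lemma frac_section_res: "W \<subseteq> V \<Longrightarrow> ores (Spec R) V W (frac_section R V a b) = frac_section R W a b"
  by (auto simp: Spec_def frac_section_def restrict_def fun_eq_iff)

lemma frac_section_cong:
  assumes V: "openin (zariski R) V" and "a \<in> carrier R" "b \<in> carrier R" "\<And>q. q \<in> V \<Longrightarrow> b \<notin> q"
    and "c \<in> carrier R" "d \<in> carrier R" "\<And>q. q \<in> V \<Longrightarrow> d \<notin> q" and eq: "a \<otimes>\<^bsub>R\<^esub> d = c \<otimes>\<^bsub>R\<^esub> b"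
  shows "frac_section R V a b = frac_section R V c d"
proof -
  have "fraction R q a b = fraction R q c d" if "q \<in> V" for q
    by (subst fraction_eq_iff[OF R zariski_prime[OF R V that]])
      (use assms that primeideal_compl(1)[OF zariski_prime[OF R V that]] in auto)
  then show ?thesis by (auto simp: frac_section_def restrict_def fun_eq_iff)
qed

lemma spec_section_local:
  assumes "g \<in> carrier (osec (Spec R) V)" "p \<in> V"
  obtains W a b where "openin (zariski R) W" "p \<in> W" "W \<subseteq> V" "a \<in> carrier R" "b \<in> carrier R"
    "\<And>q. q \<in> W \<Longrightarrow> b \<notin> q" "ores (Spec R) V W g = frac_section R W a b"
proof -
  have "g \<in> spec_sections R V" using assms(1) by (simp add: Spec_def)
  then obtain W a b where W: "openin (zariski R) W" "p \<in> W" "W \<subseteq> V" "a \<in> carrier R" "b \<in> carrier R"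
    "\<forall>q\<in>W. b \<notin> q \<and> g q = fraction R q a b" using assms(2) by (auto simp: spec_sections_def)
  have "ores (Spec R) V W g = frac_section R W a b"
    using W(6) by (auto simp: Spec_def frac_section_def restrict_def fun_eq_iff)
  then show thesis using that W by blast
qed

text \<open>Composes the map from \<open>a\<close> to \<open>a/1\<close> with a homomorphism. It
  serves both the coordinate ring of an affine open set and the structure map from the ground
  field.\<close>

lemma frac_section_hom:
  assumes V: "openin (zariski R) V" and S: "ring S" and h: "h \<in> ring_hom (osec (Spec R) V) S"
  shows "(\<lambda>a. h (frac_section R V a \<one>\<^bsub>R\<^esub>)) \<in> ring_hom R S"
proof (rule ring_hom_memI)
  have one: "\<And>q. q \<in> V \<Longrightarrow> \<one>\<^bsub>R\<^esub> \<notin> q" using primeideal_compl(1) zariski_prime[OF R V] by blast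
  have cl: "frac_section R V a \<one>\<^bsub>R\<^esub> \<in> carrier (osec (Spec R) V)" if "a \<in> carrier R" for a
    using frac_section_closed[OF V that _ one] by simp
  fix a b assume a: "a \<in> carrier R"
  show "h (frac_section R V a \<one>\<^bsub>R\<^esub>) \<in> carrier S" by (rule ring_hom_closed[OF h cl[OF a]])
  assume b: "b \<in> carrier R"
  show "h (frac_section R V (a \<otimes>\<^bsub>R\<^esub> b) \<one>\<^bsub>R\<^esub>) = h (frac_section R V a \<one>\<^bsub>R\<^esub>) \<otimes>\<^bsub>S\<^esub> h (frac_section R V b \<one>\<^bsub>R\<^esub>)"
    unfolding ring_hom_mult[OF h cl[OF a] cl[OF b], symmetric]
    using frac_section_mult[OF V a _ one b _ one] by simp
  show "h (frac_section R V (a \<oplus>\<^bsub>R\<^esub> b) \<one>\<^bsub>R\<^esub>) = h (frac_section R V a \<one>\<^bsub>R\<^esub>) \<oplus>\<^bsub>S\<^esub> h (frac_section R V b \<one>\<^bsub>R\<^esub>)"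
    unfolding ring_hom_add[OF h cl[OF a] cl[OF b], symmetric]
    using frac_section_add[OF V a _ one b _ one] a b by simp
next
  show "h (frac_section R V \<one>\<^bsub>R\<^esub> \<one>\<^bsub>R\<^esub>) = \<one>\<^bsub>S\<^esub>" using ring_hom_one[OF h] frac_section_one by simp
qed

end

section \<open>Integral spaces\<close>

locale integral_space = ringed \<XX> for \<XX> :: "('p, 'a) ringed_space" +
  assumes nonempty: "topspace (spc \<XX>) \<noteq> {}"
    and osec_domain: "openin (spc \<XX>) U \<Longrightarrow> U \<noteq> {} \<Longrightarrow> domain (osec \<XX> U)"
begin

abbreviation \<eta> where "\<eta> \<equiv> generic_point \<XX>"
abbreviation KK where "KK \<equiv> stalk \<XX> \<eta>"
abbreviation gm where "gm \<equiv> ogerm \<XX> \<eta>"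

text \<open>The local ring at \<open>y\<close>, inside the function field.\<close>

definition stk :: "'p \<Rightarrow> ('p set \<times> 'a) set set" where
  "stk y = {gm W s | W s. opn W \<and> y \<in> W \<and> s \<in> Oc W}"

text \<open>What is used of an affine open set \<open>U\<close>, in terms of the function field: \<open>A\<close> is its coordinate ring and
  \<open>\<pp> y\<close> the prime ideal of the point \<open>y\<close>.\<close>

definition chart :: "'p set \<Rightarrow> ('p set \<times> 'a) set set \<Rightarrow> ('p \<Rightarrow> ('p set \<times> 'a) set set) \<Rightarrow> bool" where
  "chart U A \<pp> \<longleftrightarrow>
     opn U \<and> A = gm U ` Oc U \<and> \<eta> \<in> U \<and> \<pp> \<eta> = {\<zero>\<^bsub>KK\<^esub>} \<and> subring A KK \<and>
     bij_betw \<pp> U {p. sub_prime KK A p} \<and> (\<forall>y\<in>U. stk y = loc KK A (\<pp> y)) \<and>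
     (\<forall>W y. opn W \<and> y \<in> W \<and> y \<in> U \<longrightarrow> (\<exists>b\<in>A - \<pp> y. \<forall>z\<in>U. b \<notin> \<pp> z \<longrightarrow> z \<in> W)) \<and>
     (\<forall>b\<in>A. opn {z \<in> U. b \<notin> \<pp> z}) \<and>
     (\<forall>f\<in>carrier KK. \<exists>b\<in>A - {\<zero>\<^bsub>KK\<^esub>}. b \<otimes>\<^bsub>KK\<^esub> f \<in> A)"

text \<open>Over a disjoint union, the sections glued from one and zero and from zero and one are
  zero divisors, which a domain excludes.\<close>

lemma opens_meet:
  assumes U: "opn U" "U \<noteq> {}" and V: "opn V" "V \<noteq> {}"
  shows "U \<inter> V \<noteq> {}"
proof
  assume dis: "U \<inter> V = {}"
  let ?F = "{U, V}"
  let ?W = "\<Union>?F"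
  have W: "opn ?W" "?W \<noteq> {}" using U V by auto
  interpret U: domain "osec \<XX> U" by (rule osec_domain[OF U])
  interpret V: domain "osec \<XX> V" by (rule osec_domain[OF V])
  interpret W: domain "osec \<XX> ?W" by (rule osec_domain[OF W])
  interpret WU: ring_hom_cring "osec \<XX> ?W" "osec \<XX> U" "ores \<XX> ?W U"
    by (rule ores_ring_hom_cring) (use U W in auto)
  interpret WV: ring_hom_cring "osec \<XX> ?W" "osec \<XX> V" "ores \<XX> ?W V"
    by (rule ores_ring_hom_cring) (use V W in auto)
  have UV: "U \<noteq> V" using dis U by auto
  \<comment> \<open>Over the empty intersection there is only one section, so any two sections are
    compatible.\<close>
  have glue: "\<exists>s\<in>Oc ?W. ores \<XX> ?W U s = a \<and> ores \<XX> ?W V s = b" if a: "a \<in> Oc U" and b: "b \<in> Oc V" for a b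
  proof -
    define s where "s T = (if T = U then a else b)" for T
    have op: "\<And>T. T \<in> ?F \<Longrightarrow> opn T" and sc: "\<And>T. T \<in> ?F \<Longrightarrow> s T \<in> Oc T"
      using U V a b by (auto simp: s_def)
    have comp: "ores \<XX> A (A \<inter> B) (s A) = ores \<XX> B (A \<inter> B) (s B)" if AB: "A \<in> ?F" "B \<in> ?F" for A B
    proof (cases "A = B")
      case False
      then have e: "A \<inter> B = {}" using AB dis by auto
      show ?thesis unfolding e
        by (rule sheaf_empty_section[OF osheaf]; rule ores_closed) (use op sc AB in auto)
    qed simp
    have "\<exists>t. t \<in> Oc ?W \<and> (\<forall>T\<in>?F. ores \<XX> ?W T t = s T)"
      by (rule ex1_implies_ex[OF sheaf_gluing[OF osheaf op sc comp]])
    then obtain t where "t \<in> Oc ?W" "\<forall>T\<in>?F. ores \<XX> ?W T t = s T" by blast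
    then show ?thesis using UV by (intro bexI[of _ t]) (auto simp: s_def)
  qed
  obtain s where s: "s \<in> Oc ?W" "ores \<XX> ?W U s = \<one>\<^bsub>osec \<XX> U\<^esub>" "ores \<XX> ?W V s = \<zero>\<^bsub>osec \<XX> V\<^esub>"
    using glue[OF U.one_closed V.zero_closed] by blast
  obtain t where t: "t \<in> Oc ?W" "ores \<XX> ?W U t = \<zero>\<^bsub>osec \<XX> U\<^esub>" "ores \<XX> ?W V t = \<one>\<^bsub>osec \<XX> V\<^esub>"
    using glue[OF U.zero_closed V.one_closed] by blast
  have "s \<otimes>\<^bsub>osec \<XX> ?W\<^esub> t = \<zero>\<^bsub>osec \<XX> ?W\<^esub>"
  proof (rule sheaf_separated[OF osheaf, of ?F])
    show "\<And>T. T \<in> ?F \<Longrightarrow> opn T" using U V by auto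
    show "s \<otimes>\<^bsub>osec \<XX> ?W\<^esub> t \<in> Oc ?W" by (rule W.m_closed[OF s(1) t(1)])
    show "\<zero>\<^bsub>osec \<XX> ?W\<^esub> \<in> Oc ?W" by (rule W.zero_closed)
    fix T assume "T \<in> ?F"
    then consider "T = U" | "T = V" by blast
    then show "ores \<XX> ?W T (s \<otimes>\<^bsub>osec \<XX> ?W\<^esub> t) = ores \<XX> ?W T \<zero>\<^bsub>osec \<XX> ?W\<^esub>"
    proof cases
      case 1
      show ?thesis unfolding 1 WU.hom_mult[OF s(1) t(1)] WU.hom_zero s(2) t(2)
        by (rule U.r_null[OF U.one_closed])
    next
      case 2
      show ?thesis unfolding 2 WV.hom_mult[OF s(1) t(1)] WV.hom_zero s(3) t(3)
        by (rule V.l_null[OF V.one_closed])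
    qed
  qed
  then consider "s = \<zero>\<^bsub>osec \<XX> ?W\<^esub>" | "t = \<zero>\<^bsub>osec \<XX> ?W\<^esub>" using W.integral[of s t] s(1) t(1) by blast
  then show False
  proof cases
    case 1
    then have "\<one>\<^bsub>osec \<XX> U\<^esub> = \<zero>\<^bsub>osec \<XX> U\<^esub>" using s(2) WU.hom_zero by simp
    then show ?thesis using U.one_not_zero by simp
  next
    case 2
    then have "\<one>\<^bsub>osec \<XX> V\<^esub> = \<zero>\<^bsub>osec \<XX> V\<^esub>" using t(3) WV.hom_zero by simp
    then show ?thesis using V.one_not_zero by simp
  qed
qed

section \<open>One affine open set and its coordinate ring inside the function field\<close>

context
  fixes U :: "'p set" and R :: "'a ring" and f
  assumes U: "opn U" "U \<noteq> {}" and R: "cring R" and iso: "is_isomorphism (open_sub \<XX> U) (Spec R) f"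
begin

interpretation R: cring R by (rule R)

definition pre :: "'a set set \<Rightarrow> 'p set" where "pre V = {x \<in> U. pmap f x \<in> V}"

lemma topspace_sub: "topspace (subtopology (spc \<XX>) U) = U"
  using openin_subset[OF U(1)] by (simp add: Int_absorb1)

lemma preim_pre: "preim (open_sub \<XX> U) f V = pre V"
  using topspace_sub by (simp add: preim_def pre_def open_sub_def)

lemma pmap_homeo: "homeomorphic_map (subtopology (spc \<XX>) U) (zariski R) (pmap f)"
  using iso by (simp add: is_isomorphism_def open_sub_def Spec_def)

lemma pmap_bij: "bij_betw (pmap f) U {p. primeideal p R}"
  using homeomorphic_imp_injective_map[OF pmap_homeo] homeomorphic_imp_surjective_map[OF pmap_homeo]
  unfolding topspace_sub topspace_zariski[OF R] bij_betw_def by simp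

lemma pmap_prime: "y \<in> U \<Longrightarrow> primeideal (pmap f y) R"
  using pmap_bij by (auto simp: bij_betw_def)

lemma pre_open:
  assumes "openin (zariski R) V" shows "opn (pre V)" "pre V \<subseteq> U"
proof -
  have "continuous_map (subtopology (spc \<XX>) U) (zariski R) (pmap f)"
    by (rule homeomorphic_imp_continuous_map[OF pmap_homeo])
  from openin_continuous_map_preimage[OF this assms]
  have "openin (subtopology (spc \<XX>) U) (pre V)" unfolding topspace_sub pre_def .
  then show "opn (pre V)" "pre V \<subseteq> U" using openin_open_subtopology[OF U(1)] by auto
qed

lemma image_open:
  assumes "opn W" "W \<subseteq> U"
  shows "openin (zariski R) (pmap f ` W)" "pre (pmap f ` W) = W"
proof -
  have "openin (subtopology (spc \<XX>) U) W" using assms openin_open_subtopology[OF U(1)] by auto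
  then show "openin (zariski R) (pmap f ` W)"
    using homeomorphic_map_openness[OF pmap_homeo, unfolded topspace_sub, OF assms(2)] by simp
  show "pre (pmap f ` W) = W"
    using pmap_bij assms(2) by (auto simp: pre_def bij_betw_def inj_on_def)
qed

lemma comorph_facts:
  assumes V: "openin (zariski R) V"
  shows "comorph f V \<in> ring_hom (osec (Spec R) V) (osec \<XX> (pre V))"
    and "bij_betw (comorph f V) (carrier (osec (Spec R) V)) (Oc (pre V))"
    and "openin (zariski R) W \<Longrightarrow> W \<subseteq> V \<Longrightarrow> g \<in> carrier (osec (Spec R) V) \<Longrightarrow>
      comorph f W (ores (Spec R) V W g) = ores \<XX> (pre V) (pre W) (comorph f V g)"
proof -
  have sp: "spc (Spec R) = zariski R" by (simp add: Spec_def)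
  have os: "osec (open_sub \<XX> U) = osec \<XX>" "ores (open_sub \<XX> U) = ores \<XX>" by (simp_all add: open_sub_def)
  have mor: "is_morphism (open_sub \<XX> U) (Spec R) f"
    using iso unfolding is_isomorphism_def by (elim conjE)
  have bij: "\<forall>V. openin (spc (Spec R)) V \<longrightarrow>
        bij_betw (comorph f V) (carrier (osec (Spec R) V)) (carrier (osec (open_sub \<XX> U) (preim (open_sub \<XX> U) f V)))"
    using iso unfolding is_isomorphism_def by (elim conjE)
  have hom: "\<forall>V. openin (spc (Spec R)) V \<longrightarrow>
      comorph f V \<in> ring_hom (osec (Spec R) V) (osec (open_sub \<XX> U) (preim (open_sub \<XX> U) f V))"
    using mor unfolding is_morphism_def by (elim conjE)
  have nat: "\<forall>V W. openin (spc (Spec R)) V \<and> openin (spc (Spec R)) W \<and> W \<subseteq> V \<longrightarrow>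
        (\<forall>s\<in>carrier (osec (Spec R) V).
           comorph f W (ores (Spec R) V W s) =
             ores (open_sub \<XX> U) (preim (open_sub \<XX> U) f V) (preim (open_sub \<XX> U) f W) (comorph f V s))"
    using mor unfolding is_morphism_def by (elim conjE)
  show "comorph f V \<in> ring_hom (osec (Spec R) V) (osec \<XX> (pre V))"
    using hom V by (simp add: sp os preim_pre)
  show "bij_betw (comorph f V) (carrier (osec (Spec R) V)) (Oc (pre V))"
    using bij V by (simp add: sp os preim_pre)
  show "openin (zariski R) W \<Longrightarrow> W \<subseteq> V \<Longrightarrow> g \<in> carrier (osec (Spec R) V) \<Longrightarrow>
      comorph f W (ores (Spec R) V W g) = ores \<XX> (pre V) (pre W) (comorph f V g)"
    using nat V by (simp add: sp os preim_pre)
qed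

definition sec :: "'a set set \<Rightarrow> 'a \<Rightarrow> 'a \<Rightarrow> 'a" where
  "sec V a b = comorph f V (frac_section R V a b)"

lemma one_notin: "openin (zariski R) V \<Longrightarrow> q \<in> V \<Longrightarrow> \<one>\<^bsub>R\<^esub> \<notin> q"
  using R.primeideal_compl(1) zariski_prime[OF R] by blast

lemma sec_closed:
  assumes "openin (zariski R) V" "a \<in> carrier R" "b \<in> carrier R" "\<And>q. q \<in> V \<Longrightarrow> b \<notin> q"
  shows "sec V a b \<in> Oc (pre V)"
  unfolding sec_def by (rule ring_hom_closed[OF comorph_facts(1) frac_section_closed[OF R]]) (use assms in auto)

lemma sec_mult:
  assumes V: "openin (zariski R) V" and a: "a \<in> carrier R" "b \<in> carrier R" "\<And>q. q \<in> V \<Longrightarrow> b \<notin> q"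
    and c: "c \<in> carrier R" "d \<in> carrier R" "\<And>q. q \<in> V \<Longrightarrow> d \<notin> q"
  shows "sec V a b \<otimes>\<^bsub>osec \<XX> (pre V)\<^esub> sec V c d = sec V (a \<otimes>\<^bsub>R\<^esub> c) (b \<otimes>\<^bsub>R\<^esub> d)"
  using ring_hom_mult[OF comorph_facts(1)[OF V] frac_section_closed[OF R V a] frac_section_closed[OF R V c]]
    frac_section_mult[OF R V a c] by (simp add: sec_def)

lemma sec_res:
  assumes V: "openin (zariski R) V" and W: "openin (zariski R) W" "W \<subseteq> V"
    and a: "a \<in> carrier R" "b \<in> carrier R" "\<And>q. q \<in> V \<Longrightarrow> b \<notin> q"
  shows "ores \<XX> (pre V) (pre W) (sec V a b) = sec W a b"
  using comorph_facts(3)[OF V W frac_section_closed[OF R V a]] frac_section_res[OF R W(2), of a b]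
  by (simp add: sec_def)

lemma sec_cancel:
  assumes V: "openin (zariski R) V" and a: "a \<in> carrier R" and b: "b \<in> carrier R" "\<And>q. q \<in> V \<Longrightarrow> b \<notin> q"
  shows "sec V (a \<otimes>\<^bsub>R\<^esub> b) (b \<otimes>\<^bsub>R\<^esub> \<one>\<^bsub>R\<^esub>) = sec V a \<one>\<^bsub>R\<^esub>"
proof -
  have "frac_section R V (a \<otimes>\<^bsub>R\<^esub> b) b = frac_section R V a \<one>\<^bsub>R\<^esub>"
    by (rule frac_section_cong[OF R V _ b a R.one_closed one_notin[OF V]]) (use a b in auto)
  then show ?thesis using b(1) by (simp add: sec_def)
qed

lemma sec_hom:
  assumes V: "openin (zariski R) V"
  shows "(\<lambda>a. sec V a \<one>\<^bsub>R\<^esub>) \<in> ring_hom R (osec \<XX> (pre V))"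
proof -
  interpret V: cring "osec \<XX> (pre V)" by (rule osec_cring[OF pre_open(1)[OF V]])
  show ?thesis unfolding sec_def by (rule frac_section_hom[OF R V V.ring_axioms comorph_facts(1)[OF V]])
qed

lemma sec_inj:
  assumes V: "openin (zariski R) V" and a: "a \<in> carrier R" "c \<in> carrier R"
    and eq: "sec V a \<one>\<^bsub>R\<^esub> = sec V c \<one>\<^bsub>R\<^esub>" and q: "q \<in> V"
  shows "\<exists>u\<in>carrier R - q. u \<otimes>\<^bsub>R\<^esub> a = u \<otimes>\<^bsub>R\<^esub> c"
proof -
  have cl: "frac_section R V a \<one>\<^bsub>R\<^esub> \<in> carrier (osec (Spec R) V)"
    "frac_section R V c \<one>\<^bsub>R\<^esub> \<in> carrier (osec (Spec R) V)"
    using frac_section_closed[OF R V] a one_notin[OF V] by auto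
  have "frac_section R V a \<one>\<^bsub>R\<^esub> = frac_section R V c \<one>\<^bsub>R\<^esub>"
    using comorph_facts(2)[OF V] eq cl unfolding bij_betw_def inj_on_def sec_def by blast
  then have "fraction R q a \<one>\<^bsub>R\<^esub> = fraction R q c \<one>\<^bsub>R\<^esub>" using q by (metis frac_section_def restrict_apply')
  then show ?thesis
    using fraction_eq_iff[OF R zariski_prime[OF R V q] a(1) _ a(2), of "\<one>\<^bsub>R\<^esub>" "\<one>\<^bsub>R\<^esub>"] a one_notin[OF V q] by auto
qed

definition Spt where "Spt = topspace (zariski R)"

lemma Spt: "openin (zariski R) Spt" "q \<in> Spt \<longleftrightarrow> primeideal q R" "pre Spt = U"
proof -
  show "openin (zariski R) Spt" unfolding Spt_def by (rule openin_topspace)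
  show "q \<in> Spt \<longleftrightarrow> primeideal q R" "pre Spt = U"
    using topspace_zariski[OF R] pmap_prime by (auto simp: Spt_def pre_def)
qed

text \<open>If \<open>a\<close> is nonzero, its annihilator is a proper ideal and lies in some
  prime, contrary to the element outside that prime which kills \<open>a\<close>.\<close>

lemma ann_trivial:
  assumes a: "a \<in> carrier R" and ann: "\<And>q. primeideal q R \<Longrightarrow> \<exists>u\<in>carrier R - q. u \<otimes>\<^bsub>R\<^esub> a = \<zero>\<^bsub>R\<^esub>"
  shows "a = \<zero>\<^bsub>R\<^esub>"
proof (rule ccontr)
  assume ne: "a \<noteq> \<zero>\<^bsub>R\<^esub>"
  let ?I = "{u \<in> carrier R. u \<otimes>\<^bsub>R\<^esub> a = \<zero>\<^bsub>R\<^esub>}"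
  have "ideal ?I R"
  proof (rule idealI)
    show "subgroup ?I (add_monoid R)"
    proof (rule R.add.subgroupI)
      have "\<zero>\<^bsub>R\<^esub> \<in> ?I" using a by simp
      then show "?I \<noteq> {}" by blast
      fix u assume u: "u \<in> ?I"
      then show "\<ominus>\<^bsub>R\<^esub> u \<in> ?I" using a by (simp add: R.l_minus)
      fix v assume "v \<in> ?I"
      then show "u \<oplus>\<^bsub>R\<^esub> v \<in> ?I" using u a by (simp add: R.l_distr)
    qed auto
    fix u x assume u: "u \<in> ?I" and x: "x \<in> carrier R"
    show "x \<otimes>\<^bsub>R\<^esub> u \<in> ?I" using u x a by (simp add: R.m_assoc)
    then show "u \<otimes>\<^bsub>R\<^esub> x \<in> ?I" using R.m_comm[OF x, of u] u by simp
  qed (rule R.ring_axioms)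
  moreover have "?I \<noteq> carrier R"
  proof
    assume "?I = carrier R"
    then have "\<one>\<^bsub>R\<^esub> \<otimes>\<^bsub>R\<^esub> a = \<zero>\<^bsub>R\<^esub>" using R.one_closed by blast
    then show False using ne a by simp
  qed
  ultimately obtain q where "primeideal q R" "?I \<subseteq> q" by (rule R.exists_prime_above)
  then show False using ann by blast
qed

text \<open>The map from \<open>a\<close> to \<open>a/1\<close> into the domain of sections over
  \<open>U\<close> has trivial kernel, because at each prime an element of the kernel is killed by
  something outside that prime.\<close>

lemma coordinate_domain: "domain R"
  unfolding domain_def domain_axioms_def
proof (intro conjI allI impI)
  obtain y where "y \<in> U" using U by blast
  from R.primeideal_compl(1,2)[OF pmap_prime[OF this]] show "\<one>\<^bsub>R\<^esub> \<noteq> \<zero>\<^bsub>R\<^esub>" by metis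
  fix a b assume ab: "a \<otimes>\<^bsub>R\<^esub> b = \<zero>\<^bsub>R\<^esub>" and a: "a \<in> carrier R" and b: "b \<in> carrier R"
  interpret O: domain "osec \<XX> U" by (rule osec_domain[OF U])
  have hom: "(\<lambda>a. sec Spt a \<one>\<^bsub>R\<^esub>) \<in> ring_hom R (osec \<XX> U)" using sec_hom[OF Spt(1)] Spt(3) by simp
  interpret h: ring_hom_cring R "osec \<XX> U" "\<lambda>a. sec Spt a \<one>\<^bsub>R\<^esub>"
    by (intro ring_hom_cring.intro ring_hom_cring_axioms.intro R O.is_cring hom)
  have z: "c = \<zero>\<^bsub>R\<^esub>" if c: "c \<in> carrier R" and eq: "sec Spt c \<one>\<^bsub>R\<^esub> = \<zero>\<^bsub>osec \<XX> U\<^esub>" for c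
  proof (rule ann_trivial[OF c])
    fix q assume "primeideal q R"
    then have "\<exists>u\<in>carrier R - q. u \<otimes>\<^bsub>R\<^esub> c = u \<otimes>\<^bsub>R\<^esub> \<zero>\<^bsub>R\<^esub>"
      using sec_inj[OF Spt(1) c R.zero_closed] eq h.hom_zero Spt(2) by auto
    then show "\<exists>u\<in>carrier R - q. u \<otimes>\<^bsub>R\<^esub> c = \<zero>\<^bsub>R\<^esub>" by auto
  qed
  have "sec Spt a \<one>\<^bsub>R\<^esub> \<otimes>\<^bsub>osec \<XX> U\<^esub> sec Spt b \<one>\<^bsub>R\<^esub> = \<zero>\<^bsub>osec \<XX> U\<^esub>"
    using h.hom_mult[OF a b] h.hom_zero ab by simp
  then have "sec Spt a \<one>\<^bsub>R\<^esub> = \<zero>\<^bsub>osec \<XX> U\<^esub> \<or> sec Spt b \<one>\<^bsub>R\<^esub> = \<zero>\<^bsub>osec \<XX> U\<^esub>"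
    using O.integral h.hom_closed a b by blast
  then show "a = \<zero>\<^bsub>R\<^esub> \<or> b = \<zero>\<^bsub>R\<^esub>" using z a b by blast
qed (rule R)

interpretation R: domain R by (rule coordinate_domain)

lemma zero_in_open:
  assumes "openin (zariski R) V" "V \<noteq> {}" shows "{\<zero>\<^bsub>R\<^esub>} \<in> V"
proof -
  obtain p where p: "p \<in> V" using assms by blast
  obtain b where b: "b \<in> carrier R" "b \<notin> p" "\<And>q. primeideal q R \<Longrightarrow> b \<notin> q \<Longrightarrow> q \<in> V"
    by (rule zariski_nbhd[OF R assms(1) p]) blast
  have "b \<noteq> \<zero>\<^bsub>R\<^esub>" using b R.primeideal_compl(2)[OF zariski_prime[OF R assms(1) p]] by metis
  then show ?thesis using b(3)[OF R.zeroprimeideal] by blast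
qed

text \<open>The point of the zero ideal lies in every nonempty open subset of \<open>U\<close>, and
  by \<open>opens_meet\<close> in every nonempty open set of the space. It is the only point with
  this property, so the definite description of \<open>generic_point\<close> selects it.\<close>

lemma generic_point_chart: "\<eta> \<in> U" "pmap f \<eta> = {\<zero>\<^bsub>R\<^esub>}" "opn W \<Longrightarrow> W \<noteq> {} \<Longrightarrow> \<eta> \<in> W"
proof -
  have "{\<zero>\<^bsub>R\<^esub>} \<in> pmap f ` U" using pmap_bij R.zeroprimeideal by (auto simp: bij_betw_def)
  then obtain x where x: "x \<in> U" "pmap f x = {\<zero>\<^bsub>R\<^esub>}" by blast
  have all: "x \<in> W" if W: "opn W" "W \<noteq> {}" for W
  proof -
    have "W \<inter> U \<noteq> {}" "opn (W \<inter> U)" using opens_meet[OF W U] W(1) U(1) by auto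
    then have "{\<zero>\<^bsub>R\<^esub>} \<in> pmap f ` (W \<inter> U)"
      using zero_in_open[OF image_open(1)[of "W \<inter> U"]] by blast
    then obtain z where z: "z \<in> W" "z \<in> U" "pmap f z = {\<zero>\<^bsub>R\<^esub>}" by auto
    then have "z = x" using x inj_onD[OF bij_betw_imp_inj_on[OF pmap_bij], of z x] by simp
    then show ?thesis using z(1) by simp
  qed
  have "\<eta> = x"
    unfolding generic_point_def generic_point_of_def
  proof (rule the_equality)
    show "x \<in> topspace (spc \<XX>) \<and> spc \<XX> closure_of {x} = topspace (spc \<XX>)"
    proof
      show "x \<in> topspace (spc \<XX>)" using x openin_subset[OF U(1)] by blast
      have "z \<in> spc \<XX> closure_of {x}" if "z \<in> topspace (spc \<XX>)" for z
        unfolding in_closure_of using that all by blast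
      then show "spc \<XX> closure_of {x} = topspace (spc \<XX>)" using closure_of_subset_topspace[of "spc \<XX>" "{x}"] by blast
    qed
    fix y assume y: "y \<in> topspace (spc \<XX>) \<and> spc \<XX> closure_of {y} = topspace (spc \<XX>)"
    have yall: "y \<in> W" if W: "opn W" "W \<noteq> {}" for W
    proof -
      obtain z where z: "z \<in> W" using W by blast
      then have "z \<in> spc \<XX> closure_of {y}" using y openin_subset[OF W(1)] by blast
      then show ?thesis using z W(1) by (auto simp: in_closure_of)
    qed
    have yU: "y \<in> U" by (rule yall[OF U])
    \<comment> \<open>A nonzero \<open>b\<close> in the prime of \<open>y\<close> would define a
      nonempty open set, the locus where \<open>b\<close> does not vanish, that misses
      \<open>y\<close>.\<close>
    have "pmap f y \<subseteq> {\<zero>\<^bsub>R\<^esub>}"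
    proof
      fix b assume b: "b \<in> pmap f y"
      show "b \<in> {\<zero>\<^bsub>R\<^esub>}"
      proof (rule ccontr)
        assume nb: "b \<notin> {\<zero>\<^bsub>R\<^esub>}"
        have bc: "b \<in> carrier R" using b R.primeideal_compl(3)[OF pmap_prime[OF yU]] by blast
        let ?D = "{p. primeideal p R \<and> b \<notin> p}"
        have "x \<in> pre ?D" using x nb R.zeroprimeideal by (simp add: pre_def)
        then have "y \<in> pre ?D" using yall[OF pre_open(1)[OF zariski_basic[OF R bc]]] by blast
        then show False using b by (simp add: pre_def)
      qed
    qed
    then have "pmap f y = {\<zero>\<^bsub>R\<^esub>}" using R.primeideal_compl(2)[OF pmap_prime[OF yU]] by blast
    then show "y = x" using x yU inj_onD[OF bij_betw_imp_inj_on[OF pmap_bij], of y x] by simp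
  qed
  then show "\<eta> \<in> U" "pmap f \<eta> = {\<zero>\<^bsub>R\<^esub>}" "opn W \<Longrightarrow> W \<noteq> {} \<Longrightarrow> \<eta> \<in> W" using x all by auto
qed

lemma eta_pre: "openin (zariski R) V \<Longrightarrow> V \<noteq> {} \<Longrightarrow> \<eta> \<in> pre V"
  using generic_point_chart zero_in_open by (simp add: pre_def)

lemma eta_top: "\<eta> \<in> topspace (spc \<XX>)" using generic_point_chart(1) openin_subset[OF U(1)] by blast

interpretation K: cring KK by (rule stalk_cring[OF eta_top])

text \<open>The embedding of the coordinate ring \<open>R\<close> into the function field.\<close>

definition hh :: "'a \<Rightarrow> ('p set \<times> 'a) set" where "hh a = gm U (sec Spt a \<one>\<^bsub>R\<^esub>)"

lemma hh_alt:
  assumes V: "openin (zariski R) V" "V \<noteq> {}" and a: "a \<in> carrier R"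
  shows "gm (pre V) (sec V a \<one>\<^bsub>R\<^esub>) = hh a"
proof -
  have sub: "V \<subseteq> Spt" using openin_subset[OF V(1)] by (simp add: Spt_def)
  have "sec V a \<one>\<^bsub>R\<^esub> = ores \<XX> U (pre V) (sec Spt a \<one>\<^bsub>R\<^esub>)"
    using sec_res[OF Spt(1) V(1) sub a R.one_closed one_notin[OF Spt(1)]] Spt(3) by simp
  then show ?thesis unfolding hh_def
    using ogerm_res[OF U(1) _ pre_open(1)[OF V(1)] eta_pre[OF V] pre_open(2)[OF V(1)]]
      sec_closed[OF Spt(1) a R.one_closed one_notin[OF Spt(1)]] Spt(3) by simp
qed

lemma hh_hom: "hh \<in> ring_hom R KK"
proof -
  have "(\<lambda>a. sec Spt a \<one>\<^bsub>R\<^esub>) \<in> ring_hom R (osec \<XX> U)" using sec_hom[OF Spt(1)] Spt(3) by simp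
  from ring_hom_trans[OF this ogerm_hom[OF U(1) generic_point_chart(1)]]
  have "gm U \<circ> (\<lambda>a. sec Spt a \<one>\<^bsub>R\<^esub>) \<in> ring_hom R KK" .
  moreover have "hh = gm U \<circ> (\<lambda>a. sec Spt a \<one>\<^bsub>R\<^esub>)" by (auto simp: hh_def)
  ultimately show ?thesis by simp
qed

interpretation h: ring_hom_cring R KK hh
  by (intro ring_hom_cring.intro ring_hom_cring_axioms.intro R K.is_cring hh_hom)

text \<open>Equal germs agree on a nonempty open set, which contains the zero ideal. There the
  multiplier in the equality of fractions is merely nonzero and can be cancelled.\<close>

lemma hh_inj: "inj_on hh (carrier R)"
proof (rule inj_onI)
  fix a c assume a: "a \<in> carrier R" and c: "c \<in> carrier R" and eq: "hh a = hh c"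
  have cl: "sec Spt a \<one>\<^bsub>R\<^esub> \<in> Oc U" "sec Spt c \<one>\<^bsub>R\<^esub> \<in> Oc U"
    using sec_closed[OF Spt(1) _ R.one_closed one_notin[OF Spt(1)]] a c Spt(3) by auto
  obtain W where W: "opn W" "\<eta> \<in> W" "W \<subseteq> U" "ores \<XX> U W (sec Spt a \<one>\<^bsub>R\<^esub>) = ores \<XX> U W (sec Spt c \<one>\<^bsub>R\<^esub>)"
    using eq ogerm_eq_iff[OF U(1) generic_point_chart(1) cl(1) U(1) generic_point_chart(1) cl(2)]
    unfolding hh_def by blast
  let ?V = "pmap f ` W"
  have V: "openin (zariski R) ?V" "pre ?V = W" using image_open[OF W(1,3)] by auto
  have sub: "?V \<subseteq> Spt" using openin_subset[OF V(1)] by (simp add: Spt_def)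
  have "sec ?V a \<one>\<^bsub>R\<^esub> = sec ?V c \<one>\<^bsub>R\<^esub>"
    using sec_res[OF Spt(1) V(1) sub a R.one_closed one_notin[OF Spt(1)]]
      sec_res[OF Spt(1) V(1) sub c R.one_closed one_notin[OF Spt(1)]] W(4) V(2) Spt(3) by simp
  moreover have "{\<zero>\<^bsub>R\<^esub>} \<in> ?V" using zero_in_open[OF V(1)] W(2) by blast
  ultimately obtain u where u: "u \<in> carrier R - {\<zero>\<^bsub>R\<^esub>}" "u \<otimes>\<^bsub>R\<^esub> a = u \<otimes>\<^bsub>R\<^esub> c"
    using sec_inj[OF V(1) a c] by blast
  then show "a = c" using R.m_lcancel[of u a c] a c by blast
qed

text \<open>The germ \<open>a/b\<close> is characterized by its product with \<open>hh b\<close>,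
  because inverses in the function field are obtained only afterwards, from this lemma.\<close>

lemma hh_recip:
  assumes b: "b \<in> carrier R" and a: "a \<in> carrier R" and y: "y \<in> U" "b \<notin> pmap f y"
  shows "\<exists>g\<in>stk y. g \<in> carrier KK \<and> g \<otimes>\<^bsub>KK\<^esub> hh b = hh a"
proof -
  let ?D = "{p. primeideal p R \<and> b \<notin> p}"
  have D: "openin (zariski R) ?D" by (rule zariski_basic[OF R b])
  have yD: "y \<in> pre ?D" using y pmap_prime by (simp add: pre_def)
  then have ne: "?D \<noteq> {}" by (auto simp: pre_def)
  have bD: "\<And>q. q \<in> ?D \<Longrightarrow> b \<notin> q" by blast
  note eD = eta_pre[OF D ne] and oD = pre_open(1)[OF D]
  have cl: "sec ?D a b \<in> Oc (pre ?D)" "sec ?D b \<one>\<^bsub>R\<^esub> \<in> Oc (pre ?D)"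
    using sec_closed[OF D a b bD] sec_closed[OF D b R.one_closed one_notin[OF D]] by auto
  have "gm (pre ?D) (sec ?D a b) \<otimes>\<^bsub>KK\<^esub> hh b = gm (pre ?D) (sec ?D a b \<otimes>\<^bsub>osec \<XX> (pre ?D)\<^esub> sec ?D b \<one>\<^bsub>R\<^esub>)"
    unfolding hh_alt[OF D ne b, symmetric] by (rule ogerm_mult[OF oD eD cl])
  also have "sec ?D a b \<otimes>\<^bsub>osec \<XX> (pre ?D)\<^esub> sec ?D b \<one>\<^bsub>R\<^esub> = sec ?D (a \<otimes>\<^bsub>R\<^esub> b) (b \<otimes>\<^bsub>R\<^esub> \<one>\<^bsub>R\<^esub>)"
    by (rule sec_mult[OF D a b bD b R.one_closed one_notin[OF D]])
  also have "\<dots> = sec ?D a \<one>\<^bsub>R\<^esub>"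
    by (rule sec_cancel[OF D a b bD])
  also have "gm (pre ?D) (sec ?D a \<one>\<^bsub>R\<^esub>) = hh a" by (rule hh_alt[OF D ne a])
  finally have "gm (pre ?D) (sec ?D a b) \<otimes>\<^bsub>KK\<^esub> hh b = hh a" .
  moreover have "gm (pre ?D) (sec ?D a b) \<in> stk y" unfolding stk_def using oD yD cl by blast
  moreover have "gm (pre ?D) (sec ?D a b) \<in> carrier KK" by (rule ogerm_closed[OF oD eD cl(1)])
  ultimately show ?thesis by blast
qed

text \<open>Near \<open>y\<close> a section is a single fraction, and the same pair
  \<open>a\<close>, \<open>b\<close> describes its generic germ. The neighbourhood is kept because
  \<open>germ_determines_locally\<close> compares two such fractions on it.\<close>

lemma hh_section:
  assumes y: "y \<in> U" and W: "opn W" "y \<in> W" "s \<in> Oc W"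
  shows "gm W s \<in> carrier KK"
    "\<exists>N. \<exists>a\<in>carrier R. \<exists>b\<in>carrier R. openin (zariski R) N \<and> pmap f y \<in> N \<and> pre N \<subseteq> W \<and>
       (\<forall>q\<in>N. b \<notin> q) \<and> ores \<XX> W (pre N) s = sec N a b \<and> gm W s \<otimes>\<^bsub>KK\<^esub> hh b = hh a"
proof -
  define g where "g = gm W s"
  note W = W g_def
  have eW: "\<eta> \<in> W" using generic_point_chart(3)[OF W(1)] W(2) by blast
  show "gm W s \<in> carrier KK" by (rule ogerm_closed[OF W(1) eW W(3)])
  let ?W = "W \<inter> U"
  let ?V = "pmap f ` ?W"
  have oW: "opn ?W" using W(1) U(1) by auto
  have V: "openin (zariski R) ?V" "pre ?V = ?W" using image_open[OF oW] by auto
  have sW: "ores \<XX> W ?W s \<in> Oc ?W" by (rule ores_closed[OF W(1) oW Int_lower1 W(3)])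
  have "Oc ?W = comorph f ?V ` carrier (osec (Spec R) ?V)"
    using bij_betw_imp_surj_on[OF comorph_facts(2)[OF V(1)]] V(2) by simp
  then have "ores \<XX> W ?W s \<in> comorph f ?V ` carrier (osec (Spec R) ?V)" using sW by simp
  then obtain r where r: "r \<in> carrier (osec (Spec R) ?V)" "comorph f ?V r = ores \<XX> W ?W s"
    by (elim imageE) simp
  have yV: "pmap f y \<in> ?V" using W(2) y by blast
  obtain N a b where N: "openin (zariski R) N" "pmap f y \<in> N" "N \<subseteq> ?V" "a \<in> carrier R" "b \<in> carrier R"
    "\<And>q. q \<in> N \<Longrightarrow> b \<notin> q" "ores (Spec R) ?V N r = frac_section R N a b"
    by (rule spec_section_local[OF R r(1) yV]) blast
  have Nne: "N \<noteq> {}" using N(2) by blast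
  have preN: "opn (pre N)" "\<eta> \<in> pre N" "pre N \<subseteq> W"
    using pre_open[OF N(1)] eta_pre[OF N(1) Nne] N(3) V(2) by (auto simp: pre_def)
  have preN': "pre N \<subseteq> ?W" using preN(3) pre_open(2)[OF N(1)] by blast
  have "sec N a b = ores \<XX> ?W (pre N) (ores \<XX> W ?W s)"
    unfolding sec_def N(7)[symmetric] comorph_facts(3)[OF V(1) N(1,3) r(1)] r(2) V(2) ..
  also have "\<dots> = ores \<XX> W (pre N) s" by (rule ores_trans[OF W(1) oW preN(1) preN' Int_lower1 W(3)])
  finally have sN: "sec N a b = ores \<XX> W (pre N) s" .
  then have gN: "gm (pre N) (sec N a b) = g"
    using ogerm_res[OF W(1,3) preN(1,2,3)] W(4) by simp
  have cl: "sec N a b \<in> Oc (pre N)" "sec N b \<one>\<^bsub>R\<^esub> \<in> Oc (pre N)"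
    using sec_closed[OF N(1) N(4,5,6)] sec_closed[OF N(1) N(5) R.one_closed one_notin[OF N(1)]] by auto
  have "g \<otimes>\<^bsub>KK\<^esub> hh b = gm (pre N) (sec N a b \<otimes>\<^bsub>osec \<XX> (pre N)\<^esub> sec N b \<one>\<^bsub>R\<^esub>)"
    unfolding hh_alt[OF N(1) Nne N(5), symmetric] gN[symmetric] by (rule ogerm_mult[OF preN(1,2) cl])
  also have "sec N a b \<otimes>\<^bsub>osec \<XX> (pre N)\<^esub> sec N b \<one>\<^bsub>R\<^esub> = sec N (a \<otimes>\<^bsub>R\<^esub> b) (b \<otimes>\<^bsub>R\<^esub> \<one>\<^bsub>R\<^esub>)"
    by (rule sec_mult[OF N(1) N(4,5,6) N(5) R.one_closed one_notin[OF N(1)]])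
  also have "\<dots> = sec N a \<one>\<^bsub>R\<^esub>"
    by (rule sec_cancel[OF N(1) N(4,5,6)])
  also have "gm (pre N) (sec N a \<one>\<^bsub>R\<^esub>) = hh a" by (rule hh_alt[OF N(1) Nne N(4)])
  finally have "g \<otimes>\<^bsub>KK\<^esub> hh b = hh a" .
  then show "\<exists>N. \<exists>a\<in>carrier R. \<exists>b\<in>carrier R. openin (zariski R) N \<and> pmap f y \<in> N \<and> pre N \<subseteq> W \<and>
       (\<forall>q\<in>N. b \<notin> q) \<and> ores \<XX> W (pre N) s = sec N a b \<and> gm W s \<otimes>\<^bsub>KK\<^esub> hh b = hh a"
    unfolding g_def using N(1,2,4,5,6) preN(3) sN[symmetric] by blast
qed

lemma hh_local:
  assumes y: "y \<in> U" and g: "g \<in> stk y"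
  shows "g \<in> carrier KK" "\<exists>a\<in>carrier R. \<exists>b\<in>carrier R - pmap f y. g \<otimes>\<^bsub>KK\<^esub> hh b = hh a"
proof -
  obtain W s where W: "opn W" "y \<in> W" "s \<in> Oc W" "g = gm W s" using g by (auto simp: stk_def)
  show "g \<in> carrier KK" using hh_section(1)[OF y W(1-3)] W(4) by simp
  show "\<exists>a\<in>carrier R. \<exists>b\<in>carrier R - pmap f y. g \<otimes>\<^bsub>KK\<^esub> hh b = hh a"
    using hh_section(2)[OF y W(1-3)] W(4) by blast
qed

text \<open>Near \<open>y\<close> the sections are fractions \<open>a/b\<close> and
  \<open>c/d\<close>. Equal generic germs give \<open>a d = c b\<close> in \<open>R\<close> by
  injectivity of \<open>hh\<close>, so the fractions agree near \<open>y\<close> and not only near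
  the generic point.\<close>

lemma germ_determines_locally:
  assumes y: "y \<in> U" and W: "opn W" "y \<in> W" "s \<in> Oc W" "t \<in> Oc W" and eq: "gm W s = gm W t"
  shows "\<exists>N. opn N \<and> y \<in> N \<and> N \<subseteq> W \<and> ores \<XX> W N s = ores \<XX> W N t"
proof -
  obtain N a b where N: "a \<in> carrier R" "b \<in> carrier R" "openin (zariski R) N" "pmap f y \<in> N" "pre N \<subseteq> W"
    "\<And>q. q \<in> N \<Longrightarrow> b \<notin> q" "ores \<XX> W (pre N) s = sec N a b" "gm W s \<otimes>\<^bsub>KK\<^esub> hh b = hh a"
    using hh_section(2)[OF y W(1-3)] by blast
  obtain M c d where M: "c \<in> carrier R" "d \<in> carrier R" "openin (zariski R) M" "pmap f y \<in> M" "pre M \<subseteq> W"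
    "\<And>q. q \<in> M \<Longrightarrow> d \<notin> q" "ores \<XX> W (pre M) t = sec M c d" "gm W t \<otimes>\<^bsub>KK\<^esub> hh d = hh c"
    using hh_section(2)[OF y W(1,2,4)] by blast
  have gc: "gm W s \<in> carrier KK" by (rule hh_section(1)[OF y W(1-3)])
  have "hh (a \<otimes>\<^bsub>R\<^esub> d) = (gm W s \<otimes>\<^bsub>KK\<^esub> hh b) \<otimes>\<^bsub>KK\<^esub> hh d" using N(1,8) M(2) by simp
  also have "\<dots> = (gm W t \<otimes>\<^bsub>KK\<^esub> hh d) \<otimes>\<^bsub>KK\<^esub> hh b"
    unfolding eq[symmetric] using gc N(2) M(2) by (simp add: K.m_ac)
  also have "\<dots> = hh (c \<otimes>\<^bsub>R\<^esub> b)" using M(1,8) N(2) by simp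
  finally have ad: "a \<otimes>\<^bsub>R\<^esub> d = c \<otimes>\<^bsub>R\<^esub> b"
    by (rule inj_onD[OF hh_inj]) (use N(1,2) M(1,2) in auto)
  let ?Q = "N \<inter> M"
  have Q: "openin (zariski R) ?Q" using N(3) M(3) by (rule openin_Int)
  have "sec ?Q a b = sec ?Q c d"
    unfolding sec_def by (rule arg_cong[OF frac_section_cong[OF R Q N(1,2) _ M(1,2) _ ad]]) (use N(6) M(6) in auto)
  moreover have sub: "pre ?Q \<subseteq> pre N" "pre ?Q \<subseteq> pre M" by (auto simp: pre_def)
  have "ores \<XX> W (pre ?Q) s = sec ?Q a b"
    using sec_res[OF N(3) Q Int_lower1 N(1,2,6)] N(7)
      ores_trans[OF W(1) pre_open(1)[OF N(3)] pre_open(1)[OF Q] sub(1) N(5) W(3)] by simp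
  moreover have "ores \<XX> W (pre ?Q) t = sec ?Q c d"
    using sec_res[OF M(3) Q Int_lower2 M(1,2,6)] M(7)
      ores_trans[OF W(1) pre_open(1)[OF M(3)] pre_open(1)[OF Q] sub(2) M(5) W(4)] by simp
  moreover have "y \<in> pre ?Q" "pre ?Q \<subseteq> W" using y N(4,5) M(4) by (auto simp: pre_def)
  ultimately show ?thesis using pre_open(1)[OF Q] by auto
qed

lemma stk_eta: "stk \<eta> = carrier KK"
  by (auto simp: stk_def stalk_def)

text \<open>A germ is a fraction \<open>a/b\<close> at the zero ideal. If it is nonzero then so is
  \<open>a\<close>, and \<open>b/a\<close> is its inverse.\<close>

lemma function_field_field: "field KK"
proof (rule K.cring_fieldI2)
  have "hh \<one>\<^bsub>R\<^esub> \<noteq> hh \<zero>\<^bsub>R\<^esub>" using hh_inj R.one_not_zero unfolding inj_on_def by blast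
  then show "\<zero>\<^bsub>KK\<^esub> \<noteq> \<one>\<^bsub>KK\<^esub>" using h.hom_one h.hom_zero by metis
  fix g assume g: "g \<in> carrier KK" "g \<noteq> \<zero>\<^bsub>KK\<^esub>"
  obtain a b where ab: "a \<in> carrier R" "b \<in> carrier R" "b \<notin> pmap f \<eta>" "g \<otimes>\<^bsub>KK\<^esub> hh b = hh a"
    using hh_local(2)[OF generic_point_chart(1)] g(1) stk_eta by blast
  obtain c where c: "c \<in> carrier KK" "c \<otimes>\<^bsub>KK\<^esub> hh b = hh \<one>\<^bsub>R\<^esub>"
    using hh_recip[OF ab(2) R.one_closed generic_point_chart(1) ab(3)] by blast
  have "a \<noteq> \<zero>\<^bsub>R\<^esub>"
  proof
    assume "a = \<zero>\<^bsub>R\<^esub>"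
    then have "(g \<otimes>\<^bsub>KK\<^esub> hh b) \<otimes>\<^bsub>KK\<^esub> c = \<zero>\<^bsub>KK\<^esub>" using ab(4) h.hom_zero c(1) by simp
    moreover have "(g \<otimes>\<^bsub>KK\<^esub> hh b) \<otimes>\<^bsub>KK\<^esub> c = g \<otimes>\<^bsub>KK\<^esub> (c \<otimes>\<^bsub>KK\<^esub> hh b)"
      using g(1) c(1) ab(2) by (simp add: K.m_ac)
    ultimately show False using c(2) g h.hom_one by simp
  qed
  then obtain d where d: "d \<in> carrier KK" "d \<otimes>\<^bsub>KK\<^esub> hh a = hh \<one>\<^bsub>R\<^esub>"
    using hh_recip[OF ab(1) R.one_closed generic_point_chart(1)] generic_point_chart(2) by auto
  have "g \<otimes>\<^bsub>KK\<^esub> (hh b \<otimes>\<^bsub>KK\<^esub> d) = d \<otimes>\<^bsub>KK\<^esub> (g \<otimes>\<^bsub>KK\<^esub> hh b)"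
    using g(1) d(1) ab(2) by (simp add: K.m_ac)
  also have "\<dots> = \<one>\<^bsub>KK\<^esub>" using d ab(4) h.hom_one by simp
  finally show "\<exists>b\<in>carrier KK. g \<otimes>\<^bsub>KK\<^esub> b = \<one>\<^bsub>KK\<^esub>"
    by (rule bexI) (use d(1) ab(2) in simp)
qed

text \<open>The elements \<open>b\<close> of \<open>R\<close> whose product with \<open>g\<close>
  lies in \<open>R\<close> form an ideal. Since \<open>g\<close> is a fraction at every point, no
  prime contains this ideal, so it contains the unit.\<close>

lemma hh_image: "hh ` carrier R = gm U ` Oc U"
proof
  show "hh ` carrier R \<subseteq> gm U ` Oc U"
    using sec_closed[OF Spt(1) _ R.one_closed one_notin[OF Spt(1)]] Spt(3) by (auto simp: hh_def)
  show "gm U ` Oc U \<subseteq> hh ` carrier R"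
  proof
    fix g assume "g \<in> gm U ` Oc U"
    then have gy: "\<And>y. y \<in> U \<Longrightarrow> g \<in> stk y" using U(1) by (auto simp: stk_def)
    have gc: "g \<in> carrier KK" by (rule hh_local(1)[OF generic_point_chart(1) gy[OF generic_point_chart(1)]])
    let ?I = "{b \<in> carrier R. g \<otimes>\<^bsub>KK\<^esub> hh b \<in> hh ` carrier R}"
    have "ideal ?I R"
    proof (rule idealI)
      show "subgroup ?I (add_monoid R)"
      proof (rule R.add.subgroupI)
        have "g \<otimes>\<^bsub>KK\<^esub> hh \<zero>\<^bsub>R\<^esub> = hh \<zero>\<^bsub>R\<^esub>" using gc by simp
        then have "g \<otimes>\<^bsub>KK\<^esub> hh \<zero>\<^bsub>R\<^esub> \<in> hh ` carrier R" by (metis R.zero_closed imageI)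
        then show "?I \<noteq> {}" using R.zero_closed by blast
        fix b assume "b \<in> ?I"
        then obtain c where b: "b \<in> carrier R" "c \<in> carrier R" "g \<otimes>\<^bsub>KK\<^esub> hh b = hh c" by blast
        have eq: "g \<otimes>\<^bsub>KK\<^esub> hh (\<ominus>\<^bsub>R\<^esub> b) = hh (\<ominus>\<^bsub>R\<^esub> c)" using b gc by (simp add: K.r_minus)
        have "g \<otimes>\<^bsub>KK\<^esub> hh (\<ominus>\<^bsub>R\<^esub> b) \<in> hh ` carrier R" unfolding eq by (rule imageI) (use b in simp)
        then show "\<ominus>\<^bsub>R\<^esub> b \<in> ?I" using R.a_inv_closed[OF b(1)] by blast
        fix b' assume "b' \<in> ?I"
        then obtain c' where b': "b' \<in> carrier R" "c' \<in> carrier R" "g \<otimes>\<^bsub>KK\<^esub> hh b' = hh c'" by blast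
        have eq': "g \<otimes>\<^bsub>KK\<^esub> hh (b \<oplus>\<^bsub>R\<^esub> b') = hh (c \<oplus>\<^bsub>R\<^esub> c')" using b b' gc by (simp add: K.r_distr)
        have "g \<otimes>\<^bsub>KK\<^esub> hh (b \<oplus>\<^bsub>R\<^esub> b') \<in> hh ` carrier R" unfolding eq' by (rule imageI) (use b b' in simp)
        then have "b \<oplus>\<^bsub>R\<^esub> b' \<in> ?I" using R.a_closed[OF b(1) b'(1)] by blast
        then show "b \<oplus>\<^bsub>R\<^esub> b' \<in> ?I" by simp
      qed auto
      fix b x assume "b \<in> ?I" and x: "x \<in> carrier R"
      then obtain c where b: "b \<in> carrier R" "c \<in> carrier R" "g \<otimes>\<^bsub>KK\<^esub> hh b = hh c" by blast
      have "g \<otimes>\<^bsub>KK\<^esub> hh (x \<otimes>\<^bsub>R\<^esub> b) = hh x \<otimes>\<^bsub>KK\<^esub> (g \<otimes>\<^bsub>KK\<^esub> hh b)" using b(1) gc x by (simp add: K.m_lcomm)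
      also have "\<dots> = hh (x \<otimes>\<^bsub>R\<^esub> c)" using b x by simp
      finally have eq: "g \<otimes>\<^bsub>KK\<^esub> hh (x \<otimes>\<^bsub>R\<^esub> b) = hh (x \<otimes>\<^bsub>R\<^esub> c)" .
      have "g \<otimes>\<^bsub>KK\<^esub> hh (x \<otimes>\<^bsub>R\<^esub> b) \<in> hh ` carrier R" unfolding eq by (rule imageI) (use b x in simp)
      then show "x \<otimes>\<^bsub>R\<^esub> b \<in> ?I" using R.m_closed[OF x b(1)] by blast
      then show "b \<otimes>\<^bsub>R\<^esub> x \<in> ?I" using R.m_comm[OF b(1) x] by simp
    qed (rule R.ring_axioms)
    moreover have "\<not> ?I \<subseteq> q" if q: "primeideal q R" for q
    proof -
      have "q \<in> pmap f ` U" using q bij_betw_imp_surj_on[OF pmap_bij] by simp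
      then obtain y where y: "y \<in> U" "pmap f y = q" by blast
      show ?thesis using hh_local(2)[OF y(1) gy[OF y(1)]] y(2) by blast
    qed
    ultimately have IR: "?I = carrier R" by (meson R.exists_prime_above)
    then have "g \<otimes>\<^bsub>KK\<^esub> hh \<one>\<^bsub>R\<^esub> \<in> hh ` carrier R" using R.one_closed by blast
    then show "g \<in> hh ` carrier R" using gc by simp
  qed
qed

text \<open>Injectivity of \<open>hh\<close> carries the primes of \<open>R\<close> and the
  fractions over it to subsets of the function field.\<close>

lemma chart_affine: "\<exists>\<pp>. chart U (gm U ` Oc U) \<pp>"
proof -
  let ?A = "hh ` carrier R"
  define \<pp> where "\<pp> y = hh ` pmap f y" for y
  have A: "subring ?A KK"
    by (rule ring_hom_ring.img_is_subring[OF ring_hom_ringI2[OF R.ring_axioms K.ring_axioms hh_hom] R.carrier_is_subring])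
  have mem: "hh b \<in> hh ` p \<longleftrightarrow> b \<in> p" if "primeideal p R" "b \<in> carrier R" for b p
    using inj_on_image_mem_iff[OF hh_inj] that R.primeideal_compl(3) by blast
  have bij: "bij_betw \<pp> U {p. sub_prime KK ?A p}"
    unfolding bij_betw_def
  proof
    show "inj_on \<pp> U"
    proof (rule inj_onI)
      fix x y assume xy: "x \<in> U" "y \<in> U" "\<pp> x = \<pp> y"
      have "pmap f x = pmap f y"
        using xy(3) unfolding \<pp>_def
          inj_on_image_eq_iff[OF hh_inj R.primeideal_compl(3)[OF pmap_prime[OF xy(1)]]
            R.primeideal_compl(3)[OF pmap_prime[OF xy(2)]]] .
      then show "x = y" using pmap_bij xy unfolding bij_betw_def inj_on_def by blast
    qed
    show "\<pp> ` U = {p. sub_prime KK ?A p}"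
    proof (intro equalityI subsetI)
      fix P assume "P \<in> \<pp> ` U"
      then obtain y where y: "y \<in> U" "P = hh ` pmap f y" by (auto simp: \<pp>_def)
      note pr = pmap_prime[OF y(1)]
      interpret p: primeideal "pmap f y" R by (rule pr)
      note pc = R.primeideal_compl[OF pr]
      have "sub_ideal KK ?A P"
        unfolding sub_ideal_def y(2)
      proof (intro conjI ballI)
        show "hh ` pmap f y \<subseteq> ?A" using pc(3) by blast
        show "\<zero>\<^bsub>KK\<^esub> \<in> hh ` pmap f y" using pc(2) h.hom_zero by (metis imageI)
        fix u assume "u \<in> hh ` pmap f y"
        then obtain a where a: "a \<in> pmap f y" "u = hh a" by blast
        { fix v assume "v \<in> hh ` pmap f y"
          then obtain b where b: "b \<in> pmap f y" "v = hh b" by blast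
          have "u \<oplus>\<^bsub>KK\<^esub> v = hh (a \<oplus>\<^bsub>R\<^esub> b)" using a b by simp
          then show "u \<oplus>\<^bsub>KK\<^esub> v \<in> hh ` pmap f y" using p.a_closed[OF a(1) b(1)] by blast
        next
          fix v assume "v \<in> ?A"
          then obtain b where b: "b \<in> carrier R" "v = hh b" by blast
          have "v \<otimes>\<^bsub>KK\<^esub> u = hh (b \<otimes>\<^bsub>R\<^esub> a)" using a b by simp
          then show "v \<otimes>\<^bsub>KK\<^esub> u \<in> hh ` pmap f y" using p.I_l_closed[OF a(1) b(1)] by blast
        }
      qed
      moreover have "\<one>\<^bsub>KK\<^esub> \<notin> P" using mem[OF pr R.one_closed] pc(1) h.hom_one y(2) by simp
      moreover have "u \<in> P \<or> v \<in> P" if uv: "u \<in> ?A" "v \<in> ?A" "u \<otimes>\<^bsub>KK\<^esub> v \<in> P" for u v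
      proof -
        obtain a b where ab: "a \<in> carrier R" "b \<in> carrier R" "u = hh a" "v = hh b" using uv by blast
        have "hh (a \<otimes>\<^bsub>R\<^esub> b) \<in> hh ` pmap f y" using uv(3) ab y(2) by simp
        then have "a \<otimes>\<^bsub>R\<^esub> b \<in> pmap f y" using mem[OF pr R.m_closed[OF ab(1,2)]] by blast
        then show ?thesis using pc(4) ab y(2) by blast
      qed
      ultimately show "P \<in> {p. sub_prime KK ?A p}" by (simp add: sub_prime_def)
    next
      fix P assume "P \<in> {p. sub_prime KK ?A p}"
      then have P: "sub_prime KK ?A P" by simp
      note PI = sub_idealD[OF sub_primeD(1)[OF P]]
      \<comment> \<open>The preimage of \<open>P\<close> under \<open>hh\<close> is a prime ideal of
        \<open>R\<close>, hence the prime of a point of \<open>U\<close>.\<close>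
      let ?p = "{a \<in> carrier R. hh a \<in> P}"
      have "ideal ?p R"
      proof (rule idealI)
        show "subgroup ?p (add_monoid R)"
        proof (rule R.add.subgroupI)
          have "\<zero>\<^bsub>R\<^esub> \<in> ?p" using PI(2) by simp
          then show "?p \<noteq> {}" by blast
          fix a assume a: "a \<in> ?p"
          have "hh (\<ominus>\<^bsub>R\<^esub> \<one>\<^bsub>R\<^esub>) \<in> ?A" by (rule imageI) simp
          then have "hh (\<ominus>\<^bsub>R\<^esub> \<one>\<^bsub>R\<^esub>) \<otimes>\<^bsub>KK\<^esub> hh a \<in> P" using PI(4) a by blast
          moreover have "hh (\<ominus>\<^bsub>R\<^esub> \<one>\<^bsub>R\<^esub>) \<otimes>\<^bsub>KK\<^esub> hh a = hh (\<ominus>\<^bsub>R\<^esub> a)" using a by (simp add: K.l_minus)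
          ultimately show "\<ominus>\<^bsub>R\<^esub> a \<in> ?p" using a by simp
          fix b assume "b \<in> ?p"
          then show "a \<oplus>\<^bsub>R\<^esub> b \<in> ?p" using a PI(3) by simp
        qed auto
        fix a x assume a: "a \<in> ?p" and x: "x \<in> carrier R"
        have "hh x \<otimes>\<^bsub>KK\<^esub> hh a \<in> P" by (rule PI(4)) (use a x in auto)
        then show "x \<otimes>\<^bsub>R\<^esub> a \<in> ?p" using a x by simp
        then show "a \<otimes>\<^bsub>R\<^esub> x \<in> ?p" using R.m_comm[OF x, of a] a by simp
      qed (rule R.ring_axioms)
      then have pp: "primeideal ?p R"
      proof (rule primeidealI)
        show "cring R" by (rule R)
        have "\<one>\<^bsub>R\<^esub> \<notin> ?p" using sub_primeD(2)[OF P] by simp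
        then show "carrier R \<noteq> ?p" using R.one_closed by blast
        fix a b assume ab: "a \<in> carrier R" "b \<in> carrier R" "a \<otimes>\<^bsub>R\<^esub> b \<in> ?p"
        then show "a \<in> ?p \<or> b \<in> ?p" using sub_primeD(3)[OF P, of "hh a" "hh b"] by auto
      qed
      have "hh ` ?p = P" using PI(1) by blast
      have "?p \<in> pmap f ` U" using pp bij_betw_imp_surj_on[OF pmap_bij] by simp
      then obtain y where y: "y \<in> U" "?p = pmap f y" by blast
      then have "\<pp> y = P" using \<open>hh ` ?p = P\<close> by (simp add: \<pp>_def)
      then show "P \<in> \<pp> ` U" using y(1) by blast
    qed
  qed
  \<comment> \<open>\<open>hh_local\<close> gives a germ a denominator that does not vanish at
    \<open>y\<close>; conversely \<open>hh_recip\<close> turns such a fraction into a germ, which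
    equals \<open>g\<close> by cancellation.\<close>
  have loc: "stk y = loc KK ?A (\<pp> y)" if y: "y \<in> U" for y
  proof (intro equalityI subsetI)
    fix g assume g: "g \<in> stk y"
    obtain a b where ab: "a \<in> carrier R" "b \<in> carrier R" "b \<notin> pmap f y" "g \<otimes>\<^bsub>KK\<^esub> hh b = hh a"
      using hh_local(2)[OF y g] by blast
    have gc: "g \<in> carrier KK" by (rule hh_local(1)[OF y g])
    show "g \<in> loc KK ?A (\<pp> y)"
    proof (rule locI[OF gc])
      show "hh b \<in> ?A" using ab(2) by blast
      show "hh b \<notin> \<pp> y" unfolding \<pp>_def using mem[OF pmap_prime[OF y] ab(2)] ab(3) by simp
      show "hh b \<otimes>\<^bsub>KK\<^esub> g \<in> ?A" using K.m_comm[of g "hh b"] gc ab by (metis h.hom_closed imageI)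
    qed
  next
    fix g assume "g \<in> loc KK ?A (\<pp> y)"
    then obtain u where u: "g \<in> carrier KK" "u \<in> ?A" "u \<notin> \<pp> y" "u \<otimes>\<^bsub>KK\<^esub> g \<in> ?A" unfolding loc_def by blast
    then obtain a b where ab: "a \<in> carrier R" "b \<in> carrier R" "u = hh b" "u \<otimes>\<^bsub>KK\<^esub> g = hh a" by blast
    have nb: "b \<notin> pmap f y" using u(3) ab(3) by (auto simp: \<pp>_def)
    obtain k where k: "k \<in> stk y" "k \<in> carrier KK" "k \<otimes>\<^bsub>KK\<^esub> hh b = hh a"
      using hh_recip[OF ab(2,1) y nb] by blast
    interpret F: field KK by (rule function_field_field)
    have "hh b \<noteq> \<zero>\<^bsub>KK\<^esub>"
    proof
      assume "hh b = \<zero>\<^bsub>KK\<^esub>"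
      then have "b = \<zero>\<^bsub>R\<^esub>" using hh_inj ab(2) h.hom_zero R.zero_closed unfolding inj_on_def by metis
      then show False using nb R.primeideal_compl(2)[OF pmap_prime[OF y]] by simp
    qed
    moreover have "hh b \<otimes>\<^bsub>KK\<^esub> g = hh b \<otimes>\<^bsub>KK\<^esub> k" using ab k K.m_comm[of k "hh b"] by simp
    ultimately have "g = k" using F.m_lcancel[of "hh b" g k] u(1) k(2) ab(2) by simp
    then show "g \<in> stk y" using k(1) by simp
  qed
  have nb: "\<exists>b\<in>?A - \<pp> y. \<forall>z\<in>U. b \<notin> \<pp> z \<longrightarrow> z \<in> W" if W: "opn W" "y \<in> W" "y \<in> U" for W y
  proof -
    have oW: "opn (W \<inter> U)" using W(1) U(1) by auto
    note V = image_open[OF oW Int_lower2]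
    have "pmap f y \<in> pmap f ` (W \<inter> U)" using W by blast
    then obtain b where b: "b \<in> carrier R" "b \<notin> pmap f y"
      "\<And>q. primeideal q R \<Longrightarrow> b \<notin> q \<Longrightarrow> q \<in> pmap f ` (W \<inter> U)" by (rule zariski_nbhd[OF R V(1)]) blast
    have "hh b \<in> ?A - \<pp> y" using b mem[OF pmap_prime[OF W(3)] b(1)] by (auto simp: \<pp>_def)
    moreover have "z \<in> W" if z: "z \<in> U" "hh b \<notin> \<pp> z" for z
    proof -
      have "b \<notin> pmap f z" using z mem[OF pmap_prime[OF z(1)] b(1)] by (simp add: \<pp>_def)
      then have "z \<in> pre (pmap f ` (W \<inter> U))" using b(3)[OF pmap_prime[OF z(1)]] z(1) by (simp add: pre_def)
      then show ?thesis using V(2) by blast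
    qed
    ultimately show ?thesis by blast
  qed
  have op: "opn {z \<in> U. b \<notin> \<pp> z}" if b: "b \<in> ?A" for b
  proof -
    obtain a where a: "a \<in> carrier R" "b = hh a" using b by blast
    have "{z \<in> U. b \<notin> \<pp> z} = pre {p. primeideal p R \<and> a \<notin> p}"
      using mem[OF pmap_prime a(1)] pmap_prime a(2) by (auto simp: pre_def \<pp>_def)
    then show ?thesis using pre_open(1)[OF zariski_basic[OF R a(1)]] by simp
  qed
  have pe: "\<pp> \<eta> = {\<zero>\<^bsub>KK\<^esub>}" using generic_point_chart(2) h.hom_zero by (simp add: \<pp>_def)
  \<comment> \<open>At the generic point the localization is the whole function field, so every
    element has a denominator.\<close>
  have fr: "\<exists>b\<in>?A - {\<zero>\<^bsub>KK\<^esub>}. b \<otimes>\<^bsub>KK\<^esub> g \<in> ?A" if "g \<in> carrier KK" for g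
    using that loc[OF generic_point_chart(1)] unfolding pe stk_eta loc_def by blast
  have "chart U ?A \<pp>"
    unfolding chart_def
  proof (intro conjI ballI allI impI)
    show "opn U" "?A = gm U ` Oc U" "\<eta> \<in> U" "\<pp> \<eta> = {\<zero>\<^bsub>KK\<^esub>}" "subring ?A KK"
      "bij_betw \<pp> U {p. sub_prime KK ?A p}"
      by (rule U(1), rule hh_image, rule generic_point_chart(1), rule pe, rule A, rule bij)
    show "stk y = loc KK ?A (\<pp> y)" if "y \<in> U" for y by (rule loc[OF that])
    show "\<exists>b\<in>?A - \<pp> y. \<forall>z\<in>U. b \<notin> \<pp> z \<longrightarrow> z \<in> W" if "opn W \<and> y \<in> W \<and> y \<in> U" for W y
      using nb that by blast
    show "opn {z \<in> U. b \<notin> \<pp> z}" if "b \<in> ?A" for b by (rule op[OF that])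
    show "\<exists>b\<in>?A - {\<zero>\<^bsub>KK\<^esub>}. b \<otimes>\<^bsub>KK\<^esub> g \<in> ?A" if "g \<in> carrier KK" for g by (rule fr[OF that])
  qed
  then show ?thesis using hh_image by auto
qed

end

end

text \<open>Adds the affine neighbourhoods to \<open>integral_space\<close>, in which a single
  affine open set was a hypothesis.\<close>

locale integral_sch =
  fixes \<XX> :: "('p, 'a) ringed_space"
  assumes integral: "integral_scheme \<XX>"

sublocale integral_sch \<subseteq> integral_space
proof (intro integral_space.intro ringed.intro integral_space_axioms.intro)
  show "is_ringed_space \<XX>"
    using integral unfolding integral_scheme_def is_scheme_def is_locally_ringed_space_def by blast
  show "topspace (spc \<XX>) \<noteq> {}" using integral unfolding integral_scheme_def by blast
  show "openin (spc \<XX>) U \<Longrightarrow> U \<noteq> {} \<Longrightarrow> domain (osec \<XX> U)" for U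
    using integral unfolding integral_scheme_def by blast
qed

context integral_sch
begin

lemma affine_nbhd:
  assumes "y \<in> topspace (spc \<XX>)"
  obtains U where "y \<in> U" "affine_open \<XX> U"
  using integral assms unfolding integral_scheme_def is_scheme_def by blast

lemma affine_openE:
  assumes "affine_open \<XX> U"
  obtains R :: "'a ring" and f where "opn U" "cring R" "is_isomorphism (open_sub \<XX> U) (Spec R) f"
  using assms unfolding affine_open_def is_affine_def by blast

lemma chart_exists:
  assumes "affine_open \<XX> U" "U \<noteq> {}"
  shows "\<exists>\<pp>. chart U (gm U ` Oc U) \<pp>"
proof -
  obtain R :: "'a ring" and f where "opn U" "cring R" "is_isomorphism (open_sub \<XX> U) (Spec R) f"
    by (rule affine_openE[OF assms(1)])
  then show ?thesis using chart_affine assms(2) by blast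
qed

lemma some_affine:
  obtains U and R :: "'a ring" and f
  where "opn U" "U \<noteq> {}" "cring R" "is_isomorphism (open_sub \<XX> U) (Spec R) f"
proof -
  obtain y where "y \<in> topspace (spc \<XX>)" using nonempty by blast
  then obtain U where U: "y \<in> U" "affine_open \<XX> U" by (rule affine_nbhd)
  obtain R :: "'a ring" and f where "opn U" "cring R" "is_isomorphism (open_sub \<XX> U) (Spec R) f"
    by (rule affine_openE[OF U(2)])
  then show thesis using that[of U R f] U(1) by blast
qed

lemma eta_in: "opn W \<Longrightarrow> W \<noteq> {} \<Longrightarrow> \<eta> \<in> W"
  by (rule some_affine) (rule generic_point_chart(3))

lemma eta_topspace: "\<eta> \<in> topspace (spc \<XX>)"
  by (rule eta_in[OF openin_topspace nonempty])

lemma KK_field: "field KK"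
  by (rule some_affine) (rule function_field_field)

text \<open>The two sections agree near every point by \<open>germ_determines_locally\<close>, hence
  everywhere by the sheaf property.\<close>

lemma gm_inj:
  assumes W: "opn W" "s \<in> Oc W" "t \<in> Oc W" and eq: "gm W s = gm W t"
  shows "s = t"
proof -
  have loc: "\<exists>N. opn N \<and> y \<in> N \<and> N \<subseteq> W \<and> ores \<XX> W N s = ores \<XX> W N t" if y: "y \<in> W" for y
  proof -
    obtain U where U: "y \<in> U" "affine_open \<XX> U"
      by (rule affine_nbhd) (use y openin_subset[OF W(1)] in blast)+
    obtain R :: "'a ring" and f where R: "opn U" "cring R" "is_isomorphism (open_sub \<XX> U) (Spec R) f"
      by (rule affine_openE[OF U(2)])
    have "U \<noteq> {}" using U(1) by blast
    from germ_determines_locally[OF R(1) this R(2,3) U(1) W(1) y W(2,3) eq] show ?thesis .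
  qed
  let ?F = "{N. opn N \<and> N \<subseteq> W \<and> ores \<XX> W N s = ores \<XX> W N t}"
  have UF: "\<Union>?F = W" using loc by blast
  show ?thesis
    by (rule sheaf_separated[OF osheaf, of ?F]) (use UF W in auto)
qed

end

section \<open>Prime divisors on a normal Noetherian integral scheme\<close>

text \<open>Otherwise \<open>Z\<close> is the union of the proper closed subsets
  \<open>Z - U\<close> and \<open>Z - V\<close>.\<close>

lemma irreducible_meet:
  assumes Z: "irreducible_closed T Z" and U: "openin T U" "U \<inter> Z \<noteq> {}" and V: "openin T V" "V \<inter> Z \<noteq> {}"
  shows "U \<inter> V \<inter> Z \<noteq> {}"
proof
  assume e: "U \<inter> V \<inter> Z = {}"
  have c: "closedin T Z" using Z by (simp add: irreducible_closed_def)
  have "closedin T (Z - U)" "closedin T (Z - V)" using closedin_diff[OF c] U(1) V(1) by auto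
  moreover have "Z = (Z - U) \<union> (Z - V)" using e by blast
  ultimately have "Z = Z - U \<or> Z = Z - V" using Z unfolding irreducible_closed_def by blast
  then show False using U(2) V(2) by blast
qed

lemma irreducible_closure_point:
  assumes x: "x \<in> topspace T"
  shows "irreducible_closed T (T closure_of {x})"
  unfolding irreducible_closed_def
proof (intro conjI allI impI)
  have xc: "x \<in> T closure_of {x}" using x by (simp add: in_closure_of)
  show "closedin T (T closure_of {x})" by simp
  show "T closure_of {x} \<noteq> {}" using xc by blast
  fix A B assume AB: "closedin T A \<and> closedin T B \<and> T closure_of {x} = A \<union> B"
  then consider "x \<in> A" | "x \<in> B" using xc by blast
  then show "T closure_of {x} = A \<or> T closure_of {x} = B"
  proof cases
    case 1
    then have "T closure_of {x} \<subseteq> A" using AB closure_of_minimal[of "{x}" A T] by simp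
    then show ?thesis using AB by blast
  next
    case 2
    then have "T closure_of {x} \<subseteq> B" using AB closure_of_minimal[of "{x}" B T] by simp
    then show ?thesis using AB by blast
  qed
qed

section \<open>Points, closures and height-one primes\<close>

context integral_sch
begin

abbreviation cl where "cl x \<equiv> spc \<XX> closure_of {x}"

interpretation K: field KK by (rule KK_field)

lemma chartD:
  assumes "chart U A \<pp>"
  shows "opn U" "A = gm U ` Oc U" "\<eta> \<in> U" "\<pp> \<eta> = {\<zero>\<^bsub>KK\<^esub>}" "subring A KK"
    "bij_betw \<pp> U {p. sub_prime KK A p}" "\<And>y. y \<in> U \<Longrightarrow> stk y = loc KK A (\<pp> y)"
    "\<And>W y. opn W \<Longrightarrow> y \<in> W \<Longrightarrow> y \<in> U \<Longrightarrow> \<exists>b\<in>A - \<pp> y. \<forall>z\<in>U. b \<notin> \<pp> z \<longrightarrow> z \<in> W"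
    "\<And>b. b \<in> A \<Longrightarrow> opn {z \<in> U. b \<notin> \<pp> z}"
    "\<And>f. f \<in> carrier KK \<Longrightarrow> \<exists>b\<in>A - {\<zero>\<^bsub>KK\<^esub>}. b \<otimes>\<^bsub>KK\<^esub> f \<in> A"
proof -
  note c = assms[unfolded chart_def]
  show "opn U" using c by (elim conjE)
  show "A = gm U ` Oc U" using c by (elim conjE)
  show "\<eta> \<in> U" using c by (elim conjE)
  show "\<pp> \<eta> = {\<zero>\<^bsub>KK\<^esub>}" using c by (elim conjE)
  show "subring A KK" using c by (elim conjE)
  show "bij_betw \<pp> U {p. sub_prime KK A p}" using c by (elim conjE)
  have 1: "\<forall>y\<in>U. stk y = loc KK A (\<pp> y)" using c by (elim conjE)
  have 2: "\<forall>W y. opn W \<and> y \<in> W \<and> y \<in> U \<longrightarrow> (\<exists>b\<in>A - \<pp> y. \<forall>z\<in>U. b \<notin> \<pp> z \<longrightarrow> z \<in> W)"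
    using c by (elim conjE)
  have 3: "\<forall>b\<in>A. opn {z \<in> U. b \<notin> \<pp> z}" using c by (elim conjE)
  have 4: "\<forall>f\<in>carrier KK. \<exists>b\<in>A - {\<zero>\<^bsub>KK\<^esub>}. b \<otimes>\<^bsub>KK\<^esub> f \<in> A" using c by (elim conjE)
  show "\<And>y. y \<in> U \<Longrightarrow> stk y = loc KK A (\<pp> y)" using 1 by (rule bspec)
  show "\<And>W y. opn W \<Longrightarrow> y \<in> W \<Longrightarrow> y \<in> U \<Longrightarrow> \<exists>b\<in>A - \<pp> y. \<forall>z\<in>U. b \<notin> \<pp> z \<longrightarrow> z \<in> W"
    using 2[rule_format] by simp
  show "\<And>b. b \<in> A \<Longrightarrow> opn {z \<in> U. b \<notin> \<pp> z}" using 3 by (rule bspec)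
  show "\<And>f. f \<in> carrier KK \<Longrightarrow> \<exists>b\<in>A - {\<zero>\<^bsub>KK\<^esub>}. b \<otimes>\<^bsub>KK\<^esub> f \<in> A" using 4 by (rule bspec)
qed

lemma chart_prime:
  assumes "chart U A \<pp>" "y \<in> U" shows "sub_prime KK A (\<pp> y)"
  using bij_betw_imp_surj_on[OF chartD(6)[OF assms(1)]] assms(2) by blast

lemma chart_inj:
  assumes "chart U A \<pp>" "y \<in> U" "z \<in> U" "\<pp> y = \<pp> z" shows "y = z"
  using inj_onD[OF bij_betw_imp_inj_on[OF chartD(6)[OF assms(1)]] assms(4,2,3)] .

lemma chart_point:
  assumes "chart U A \<pp>" "sub_prime KK A p" obtains y where "y \<in> U" "\<pp> y = p"
proof -
  have "p \<in> \<pp> ` U" using bij_betw_imp_surj_on[OF chartD(6)[OF assms(1)]] assms(2) by simp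
  then show thesis using that by (elim imageE) simp
qed

lemma chart_at:
  assumes "y \<in> topspace (spc \<XX>)"
  obtains U A \<pp> where "chart U A \<pp>" "y \<in> U"
proof -
  obtain U where U: "y \<in> U" "affine_open \<XX> U" by (rule affine_nbhd[OF assms])
  then show thesis using chart_exists[OF U(2)] that by blast
qed

lemma stk_carrier: "stk y \<subseteq> carrier KK"
proof
  fix g assume "g \<in> stk y"
  then obtain W s where W: "opn W" "y \<in> W" "s \<in> Oc W" "g = gm W s" by (auto simp: stk_def)
  then show "g \<in> carrier KK" using ogerm_closed[OF W(1) eta_in[OF W(1)] W(3)] by blast
qed

lemma subring_stk:
  assumes "y \<in> topspace (spc \<XX>)" shows "subring (stk y) KK"
proof -
  obtain U A \<pp> where c: "chart U A \<pp>" "y \<in> U" by (rule chart_at[OF assms])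
  then show ?thesis using K.subring_loc[OF chartD(5)[OF c(1)] chart_prime[OF c]] chartD(7)[OF c] by simp
qed

lemma stk_frac:
  assumes y: "y \<in> topspace (spc \<XX>)" and f: "f \<in> carrier KK"
  shows "\<exists>b\<in>stk y - {\<zero>\<^bsub>KK\<^esub>}. b \<otimes>\<^bsub>KK\<^esub> f \<in> stk y"
proof -
  obtain U A \<pp> where c: "chart U A \<pp>" "y \<in> U" by (rule chart_at[OF y])
  have "A \<subseteq> stk y" using K.loc_superset[OF chartD(5)[OF c(1)] chart_prime[OF c]] chartD(7)[OF c] by simp
  then show ?thesis using chartD(10)[OF c(1) f] by blast
qed

text \<open>Local sections with generic germ \<open>f\<close> agree on overlaps by
  \<open>gm_inj\<close> and therefore glue.\<close>

lemma sections_iff_stalks: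
  assumes W: "opn W" "W \<noteq> {}"
  shows "f \<in> gm W ` Oc W \<longleftrightarrow> (\<forall>y\<in>W. f \<in> stk y)"
proof
  assume "f \<in> gm W ` Oc W"
  then show "\<forall>y\<in>W. f \<in> stk y" using W(1) by (auto simp: stk_def)
next
  assume all: "\<forall>y\<in>W. f \<in> stk y"
  define F where "F = {N. opn N \<and> N \<subseteq> W \<and> N \<noteq> {} \<and> f \<in> gm N ` Oc N}"
  have "\<exists>N\<in>F. y \<in> N" if y: "y \<in> W" for y
  proof -
    obtain V s where V: "opn V" "y \<in> V" "s \<in> Oc V" "f = gm V s" using all y by (auto simp: stk_def)
    let ?N = "V \<inter> W"
    have N: "opn ?N" "y \<in> ?N" "?N \<subseteq> V" using V(1,2) W(1) y by auto
    have "\<eta> \<in> ?N" using eta_in[OF N(1)] N(2) by blast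
    then have "gm ?N (ores \<XX> V ?N s) = f" using ogerm_res[OF V(1,3) N(1)] V(4) N(3) by simp
    then have "f \<in> gm ?N ` Oc ?N" using ores_closed[OF V(1) N(1,3) V(3)] by blast
    then have "?N \<in> F" unfolding F_def using N by blast
    then show ?thesis using N(2) by blast
  qed
  then have UF: "\<Union>F = W" unfolding F_def by blast
  define s where "s N = (SOME t. t \<in> Oc N \<and> gm N t = f)" for N
  have s: "s N \<in> Oc N" "gm N (s N) = f" if "N \<in> F" for N
  proof -
    have "\<exists>t. t \<in> Oc N \<and> gm N t = f" using that unfolding F_def by blast
    from someI_ex[OF this] show "s N \<in> Oc N" "gm N (s N) = f" unfolding s_def by auto
  qed
  have op: "\<And>N. N \<in> F \<Longrightarrow> opn N" unfolding F_def by blast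
  have comp: "ores \<XX> M (M \<inter> N) (s M) = ores \<XX> N (M \<inter> N) (s N)" if MN: "M \<in> F" "N \<in> F" for M N
  proof (rule gm_inj)
    show o: "opn (M \<inter> N)" using op MN by blast
    show "ores \<XX> M (M \<inter> N) (s M) \<in> Oc (M \<inter> N)" by (rule ores_closed[OF op[OF MN(1)] o Int_lower1 s(1)[OF MN(1)]])
    show "ores \<XX> N (M \<inter> N) (s N) \<in> Oc (M \<inter> N)" by (rule ores_closed[OF op[OF MN(2)] o Int_lower2 s(1)[OF MN(2)]])
    have "\<eta> \<in> M \<inter> N" using MN eta_in unfolding F_def by blast
    then show "gm (M \<inter> N) (ores \<XX> M (M \<inter> N) (s M)) = gm (M \<inter> N) (ores \<XX> N (M \<inter> N) (s N))"
      using ogerm_res[OF op[OF MN(1)] s(1)[OF MN(1)] o _ Int_lower1]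
        ogerm_res[OF op[OF MN(2)] s(1)[OF MN(2)] o _ Int_lower2] s(2) MN by simp
  qed
  have "\<exists>t. t \<in> Oc (\<Union>F) \<and> (\<forall>N\<in>F. ores \<XX> (\<Union>F) N t = s N)"
    by (rule ex1_implies_ex[OF sheaf_gluing[OF osheaf op s(1) comp]])
  then obtain t where t: "t \<in> Oc W" "\<And>N. N \<in> F \<Longrightarrow> ores \<XX> W N t = s N" unfolding UF by blast
  obtain N where N: "N \<in> F" using UF W(2) by blast
  have N': "opn N" "\<eta> \<in> N" "N \<subseteq> W" using N eta_in unfolding F_def by auto
  have "gm W t = f" using ogerm_res[OF W(1) t(1) N'] t(2)[OF N] s(2)[OF N] by simp
  then show "f \<in> gm W ` Oc W" using t(1) by blast
qed

lemma mem_cl_iff: "y \<in> cl z \<longleftrightarrow> y \<in> topspace (spc \<XX>) \<and> (\<forall>W. opn W \<and> y \<in> W \<longrightarrow> z \<in> W)"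
  by (auto simp: in_closure_of)

text \<open>Translates chains of irreducible closed sets into chains of primes, with inclusions
  reversed.\<close>

lemma cl_chart_iff:
  assumes c: "chart U A \<pp>" and y: "y \<in> U" and z: "z \<in> U"
  shows "y \<in> cl z \<longleftrightarrow> \<pp> z \<subseteq> \<pp> y"
proof
  assume yz: "y \<in> cl z"
  show "\<pp> z \<subseteq> \<pp> y"
  proof
    fix b assume b: "b \<in> \<pp> z"
    have bA: "b \<in> A" using b sub_idealD(1)[OF sub_primeD(1)[OF chart_prime[OF c z]]] by blast
    show "b \<in> \<pp> y"
    proof (rule ccontr)
      assume "b \<notin> \<pp> y"
      then have "y \<in> {x \<in> U. b \<notin> \<pp> x}" using y by simp
      then have "z \<in> {x \<in> U. b \<notin> \<pp> x}" using yz chartD(9)[OF c bA] unfolding mem_cl_iff by blast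
      then show False using b by simp
    qed
  qed
next
  assume sub: "\<pp> z \<subseteq> \<pp> y"
  have "z \<in> W" if W: "opn W" "y \<in> W" for W
    using chartD(8)[OF c W y] sub z by blast
  moreover have "y \<in> topspace (spc \<XX>)" using openin_subset[OF chartD(1)[OF c]] y by blast
  ultimately show "y \<in> cl z" unfolding mem_cl_iff by blast
qed

text \<open>Both points lie in one chart, where a point is determined by its prime.\<close>

lemma cl_inj:
  assumes x: "x \<in> topspace (spc \<XX>)" and y: "y \<in> topspace (spc \<XX>)" and eq: "cl x = cl y"
  shows "x = y"
proof -
  obtain U A \<pp> where c: "chart U A \<pp>" "x \<in> U" by (rule chart_at[OF x])
  have xx: "x \<in> cl x" "y \<in> cl y" using x y unfolding mem_cl_iff by auto
  have "x \<in> cl y" using xx(1) eq by simp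
  then have yU: "y \<in> U" using c(2) chartD(1)[OF c(1)] unfolding mem_cl_iff by blast
  have "\<pp> y \<subseteq> \<pp> x" "\<pp> x \<subseteq> \<pp> y"
    using xx eq cl_chart_iff[OF c(1) c(2) yU] cl_chart_iff[OF c(1) yU c(2)] by auto
  then show ?thesis using chart_inj[OF c(1) c(2) yU] by blast
qed

lemma cl_eta: "cl \<eta> = topspace (spc \<XX>)"
proof
  show "cl \<eta> \<subseteq> topspace (spc \<XX>)" by (rule closure_of_subset_topspace)
  show "topspace (spc \<XX>) \<subseteq> cl \<eta>"
  proof
    fix y assume y: "y \<in> topspace (spc \<XX>)"
    have "\<eta> \<in> W" if W: "opn W" "y \<in> W" for W using eta_in[OF W(1)] W(2) by blast
    then show "y \<in> cl \<eta>" unfolding mem_cl_iff using y by blast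
  qed
qed

text \<open>In a chart meeting \<open>Z\<close>, the functions that vanish on \<open>Z\<close> form
  a prime ideal, and the point of this ideal is generic in \<open>Z\<close>. Its closure is all of
  \<open>Z\<close>, because by irreducibility an open set meeting \<open>Z\<close> also meets
  \<open>Z \<inter> U\<close>.\<close>

lemma sober:
  assumes Z: "irreducible_closed (spc \<XX>) Z"
  obtains x where "x \<in> topspace (spc \<XX>)" "cl x = Z" "generic_point_of \<XX> Z = x"
proof -
  have cZ: "closedin (spc \<XX>) Z" using Z by (simp add: irreducible_closed_def)
  obtain z where z: "z \<in> Z" using Z unfolding irreducible_closed_def by blast
  then have "z \<in> topspace (spc \<XX>)" using closedin_subset[OF cZ] by blast
  then obtain U A \<pp> where c: "chart U A \<pp>" "z \<in> U" by (rule chart_at)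
  have oU: "opn U" by (rule chartD(1)[OF c(1)])
  define p where "p = {b \<in> A. \<forall>y\<in>Z \<inter> U. b \<in> \<pp> y}"
  have pr: "y \<in> U \<Longrightarrow> sub_prime KK A (\<pp> y)" for y by (rule chart_prime[OF c(1)])
  have "sub_prime KK A p"
    unfolding sub_prime_def sub_ideal_def
  proof (intro conjI ballI impI)
    note AE = subringE[OF chartD(5)[OF c(1)]]
    show "p \<subseteq> A" by (auto simp: p_def)
    show "\<zero>\<^bsub>KK\<^esub> \<in> p" using AE(2) sub_idealD(2)[OF sub_primeD(1)[OF pr]] by (simp add: p_def)
    show "x \<oplus>\<^bsub>KK\<^esub> y \<in> p" if "x \<in> p" "y \<in> p" for x y
      using that AE(7) sub_idealD(3)[OF sub_primeD(1)[OF pr]] by (simp add: p_def)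
    show "a \<otimes>\<^bsub>KK\<^esub> x \<in> p" if "a \<in> A" "x \<in> p" for a x
      using that AE(6) sub_idealD(4)[OF sub_primeD(1)[OF pr]] by (simp add: p_def)
    show "\<one>\<^bsub>KK\<^esub> \<notin> p" using sub_primeD(2)[OF pr[OF c(2)]] z c(2) by (auto simp: p_def)
    fix a b assume a: "a \<in> A" and b: "b \<in> A" and ab: "a \<otimes>\<^bsub>KK\<^esub> b \<in> p"
    show "a \<in> p \<or> b \<in> p"
    proof (rule ccontr)
      assume n: "\<not> (a \<in> p \<or> b \<in> p)"
      let ?Da = "{x \<in> U. a \<notin> \<pp> x}" and ?Db = "{x \<in> U. b \<notin> \<pp> x}"
      have "?Da \<inter> Z \<noteq> {}" "?Db \<inter> Z \<noteq> {}" using n a b unfolding p_def by auto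
      then have "?Da \<inter> ?Db \<inter> Z \<noteq> {}"
        using irreducible_meet[OF Z chartD(9)[OF c(1) a] _ chartD(9)[OF c(1) b]] by blast
      then obtain y where y: "y \<in> Z" "y \<in> U" "a \<notin> \<pp> y" "b \<notin> \<pp> y" by blast
      then have "a \<otimes>\<^bsub>KK\<^esub> b \<in> \<pp> y" using ab by (simp add: p_def)
      then show False using sub_primeD(3)[OF pr[OF y(2)] a b] y by blast
    qed
  qed
  then obtain x where x: "x \<in> U" "\<pp> x = p" by (rule chart_point[OF c(1)])
  have xt: "x \<in> topspace (spc \<XX>)" using openin_subset[OF oU] x by blast
  \<comment> \<open>Outside \<open>Z\<close> there would be a function that does not vanish at
    \<open>x\<close> but vanishes on \<open>Z \<inter> U\<close>, that is, an element of
    \<open>p\<close> outside \<open>p\<close>.\<close>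
  have xZ: "x \<in> Z"
  proof (rule ccontr)
    assume "x \<notin> Z"
    then have W: "opn (topspace (spc \<XX>) - Z)" "x \<in> topspace (spc \<XX>) - Z"
      using cZ xt by (auto simp: openin_diff)
    obtain b where b: "b \<in> A - \<pp> x" "\<forall>y\<in>U. b \<notin> \<pp> y \<longrightarrow> y \<in> topspace (spc \<XX>) - Z"
      using chartD(8)[OF c(1) W x(1)] by blast
    then have "b \<in> p" unfolding p_def by blast
    then show False using b(1) x(2) by blast
  qed
  have clx: "cl x = Z"
  proof
    show "cl x \<subseteq> Z" by (rule closure_of_minimal) (use xZ cZ in auto)
    show "Z \<subseteq> cl x"
    proof
      fix y assume y: "y \<in> Z"
      have "x \<in> W" if W: "opn W" "y \<in> W" for W
      proof -
        have "W \<inter> U \<inter> Z \<noteq> {}" using irreducible_meet[OF Z W(1) _ oU] W(2) y z c(2) by blast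
        then obtain v where v: "v \<in> W" "v \<in> U" "v \<in> Z" by blast
        have "\<pp> x \<subseteq> \<pp> v" using v x(2) by (auto simp: p_def)
        then have "v \<in> cl x" using cl_chart_iff[OF c(1) v(2) x(1)] by simp
        then show ?thesis using W(1) v(1) unfolding mem_cl_iff by blast
      qed
      moreover have "y \<in> topspace (spc \<XX>)" using closedin_subset[OF cZ] y by blast
      ultimately show "y \<in> cl x" unfolding mem_cl_iff by blast
    qed
  qed
  have "generic_point_of \<XX> Z = x"
    unfolding generic_point_of_def
  proof (rule the_equality)
    show "x \<in> topspace (spc \<XX>) \<and> cl x = Z" using xt clx by simp
    fix y assume "y \<in> topspace (spc \<XX>) \<and> cl y = Z"
    then show "y = x" using cl_inj xt clx by blast
  qed
  then show thesis using that xt clx by blast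
qed

definition gpt :: "'p set \<Rightarrow> 'p" where "gpt P = generic_point_of \<XX> P"

lemma gpt_facts:
  assumes "irreducible_closed (spc \<XX>) P"
  shows "gpt P \<in> topspace (spc \<XX>)" "cl (gpt P) = P"
    "opn W \<Longrightarrow> P \<inter> W \<noteq> {} \<Longrightarrow> gpt P \<in> W" "gpt P \<in> P"
proof -
  obtain x where x: "x \<in> topspace (spc \<XX>)" "cl x = P" "generic_point_of \<XX> P = x" by (rule sober[OF assms])
  then show 1: "gpt P \<in> topspace (spc \<XX>)" "cl (gpt P) = P" by (simp_all add: gpt_def)
  show "opn W \<Longrightarrow> P \<inter> W \<noteq> {} \<Longrightarrow> gpt P \<in> W"
    using 1(2) mem_cl_iff[of _ "gpt P"] by blast
  show "gpt P \<in> P" using 1 mem_cl_iff[of "gpt P" "gpt P"] by blast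
qed

lemma prime_divisor_irreducible: "prime_divisor \<XX> P \<Longrightarrow> irreducible_closed (spc \<XX>) P"
  by (simp add: prime_divisor_def)

lemmas pd_gpt = gpt_facts[OF prime_divisor_irreducible]

text \<open>A prime strictly between zero and the prime of \<open>P\<close> would give a point
  \<open>y\<close> with \<open>P \<subset> cl y \<subset> cl \<eta>\<close>, a chain too long for a
  prime divisor.\<close>

lemma height_one_of_prime_divisor:
  assumes P: "prime_divisor \<XX> P" and c: "chart U A \<pp>" and U: "gpt P \<in> U"
  shows "height_one KK A (\<pp> (gpt P))"
  unfolding height_one_def
proof (intro conjI allI impI)
  let ?x = "gpt P"
  show "sub_prime KK A (\<pp> ?x)" by (rule chart_prime[OF c U])
  have nochain: "\<not> (\<exists>Z Z'. irreducible_closed (spc \<XX>) Z \<and> irreducible_closed (spc \<XX>) Z' \<and> P \<subset> Z \<and> Z \<subset> Z')"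
    using P by (simp add: prime_divisor_def)
  have eU: "\<eta> \<in> U" and pe: "\<pp> \<eta> = {\<zero>\<^bsub>KK\<^esub>}" using chartD(3,4)[OF c] by auto
  show "\<pp> ?x \<noteq> {\<zero>\<^bsub>KK\<^esub>}"
  proof
    assume "\<pp> ?x = {\<zero>\<^bsub>KK\<^esub>}"
    then have "?x = \<eta>" using chart_inj[OF c U eU] pe by simp
    then have PT: "P = topspace (spc \<XX>)" using pd_gpt(2)[OF P] cl_eta by simp
    obtain Z where Z: "irreducible_closed (spc \<XX>) Z" "P \<subset> Z" using P unfolding prime_divisor_def by blast
    have "Z \<subseteq> topspace (spc \<XX>)" using Z(1) closedin_subset unfolding irreducible_closed_def by blast
    then show False using Z(2) PT by blast
  qed
  fix q assume q: "sub_prime KK A q \<and> q \<subseteq> \<pp> ?x"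
  obtain y where y: "y \<in> U" "\<pp> y = q" using chart_point[OF c] q by blast
  have yt: "y \<in> topspace (spc \<XX>)" using y openin_subset[OF chartD(1)[OF c]] by blast
  show "q = {\<zero>\<^bsub>KK\<^esub>} \<or> q = \<pp> ?x"
  proof (rule ccontr)
    assume n: "\<not> (q = {\<zero>\<^bsub>KK\<^esub>} \<or> q = \<pp> ?x)"
    have xy: "?x \<in> cl y" using cl_chart_iff[OF c U y(1)] q y(2) by simp
    have "cl ?x \<subseteq> cl y" by (rule closure_of_minimal) (use xy in auto)
    then have "P \<subseteq> cl y" using pd_gpt(2)[OF P] by simp
    moreover have "P \<noteq> cl y"
    proof
      assume "P = cl y"
      then have "?x = y" using cl_inj[OF pd_gpt(1)[OF P] yt] pd_gpt(2)[OF P] by simp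
      then show False using n y by simp
    qed
    moreover have "cl y \<subset> cl \<eta>"
    proof
      show "cl y \<subseteq> cl \<eta>" unfolding cl_eta by (rule closure_of_subset_topspace)
      show "cl y \<noteq> cl \<eta>"
      proof
        assume "cl y = cl \<eta>"
        then have "y = \<eta>" by (rule cl_inj[OF yt eta_topspace])
        then show False using n y pe by simp
      qed
    qed
    ultimately show False
      using nochain irreducible_closure_point[OF yt] irreducible_closure_point[OF eta_topspace] by blast
  qed
qed

text \<open>An irreducible closed set containing \<open>cl y\<close> meets the chart
  \<open>U\<close> in \<open>y\<close>, so its generic point lies in \<open>U\<close> and gives a
  prime below that of \<open>y\<close>.\<close>

lemma prime_divisor_of_height_one:
  assumes c: "chart U A \<pp>" and y: "y \<in> U" and h: "height_one KK A (\<pp> y)"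
  shows "prime_divisor \<XX> (cl y)" "gpt (cl y) = y"
proof -
  have oU: "opn U" by (rule chartD(1)[OF c])
  have yt: "y \<in> topspace (spc \<XX>)" using y openin_subset[OF oU] by blast
  have irr: "irreducible_closed (spc \<XX>) (cl y)" by (rule irreducible_closure_point[OF yt])
  show "gpt (cl y) = y" by (rule cl_inj[OF gpt_facts(1)[OF irr] yt gpt_facts(2)[OF irr]])
  have pe: "\<pp> \<eta> = {\<zero>\<^bsub>KK\<^esub>}" "\<eta> \<in> U" using chartD(3,4)[OF c] by auto
  have yy: "y \<in> cl y" using yt unfolding mem_cl_iff by blast
  show "prime_divisor \<XX> (cl y)"
    unfolding prime_divisor_def
  proof (intro conjI)
    show "irreducible_closed (spc \<XX>) (cl y)" by (rule irr)
    have "cl y \<noteq> cl \<eta>"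
    proof
      assume "cl y = cl \<eta>"
      then have "y = \<eta>" by (rule cl_inj[OF yt eta_topspace])
      then show False using h pe by (simp add: height_one_def)
    qed
    then have "cl y \<subset> cl \<eta>" unfolding cl_eta using closure_of_subset_topspace[of "spc \<XX>" "{y}"] by blast
    then show "\<exists>Z. irreducible_closed (spc \<XX>) Z \<and> cl y \<subset> Z"
      using irreducible_closure_point[OF eta_topspace] by blast
    show "\<not> (\<exists>Z Z'. irreducible_closed (spc \<XX>) Z \<and> irreducible_closed (spc \<XX>) Z' \<and> cl y \<subset> Z \<and> Z \<subset> Z')"
    proof
      assume "\<exists>Z Z'. irreducible_closed (spc \<XX>) Z \<and> irreducible_closed (spc \<XX>) Z' \<and> cl y \<subset> Z \<and> Z \<subset> Z'"
      then obtain Z Z' where Z: "irreducible_closed (spc \<XX>) Z" "irreducible_closed (spc \<XX>) Z'" "cl y \<subset> Z" "Z \<subset> Z'"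
        by blast
      let ?z = "gpt Z"
      have clz: "cl ?z = Z" by (rule gpt_facts(2)[OF Z(1)])
      have zU: "?z \<in> U" by (rule gpt_facts(3)[OF Z(1) oU]) (use Z(3) yy y in blast)
      have "y \<in> cl ?z" using clz Z(3) yy by blast
      then have "\<pp> ?z \<subseteq> \<pp> y" using cl_chart_iff[OF c y zU] by simp
      then have "\<pp> ?z = {\<zero>\<^bsub>KK\<^esub>} \<or> \<pp> ?z = \<pp> y"
        using h chart_prime[OF c zU] unfolding height_one_def by blast
      then show False
      proof
        assume "\<pp> ?z = {\<zero>\<^bsub>KK\<^esub>}"
        then have "?z = \<eta>" using chart_inj[OF c zU pe(2)] pe(1) by simp
        then have "Z = topspace (spc \<XX>)" using clz cl_eta by simp
        moreover have "Z' \<subseteq> topspace (spc \<XX>)" using Z(2) closedin_subset unfolding irreducible_closed_def by blast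
        ultimately show False using Z(4) by blast
      next
        assume "\<pp> ?z = \<pp> y"
        then have "?z = y" by (rule chart_inj[OF c zU y])
        then show False using clz Z(3) by simp
      qed
    qed
  qed
qed

end

section \<open>Noetherian normal schemes: orders, the Hartogs property and finiteness\<close>

locale normal_sch = integral_sch +
  assumes cover: "\<exists>\<C>. finite \<C> \<and> topspace (spc \<XX>) \<subseteq> \<Union>\<C> \<and>
      (\<forall>U\<in>\<C>. \<exists>\<pp>. chart U (gm U ` Oc U) \<pp> \<and> sub_noetherian KK (gm U ` Oc U))"
    and normal: "x \<in> topspace (spc \<XX>) \<Longrightarrow> integrally_closed_in KK (stk x)"
begin

interpretation K: field KK by (rule KK_field)

lemma noetherian_chart_at:
  assumes "y \<in> topspace (spc \<XX>)"
  obtains U A \<pp> where "chart U A \<pp>" "y \<in> U" "sub_noetherian KK A"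
  using cover assms by blast

text \<open>The prime of \<open>P\<close> has to be recognized as a denominator ideal. For a nonzero
  \<open>b\<close> in it, the denominators of the inverse of \<open>b\<close> are the multiples of
  \<open>b\<close>. They lie in a prime denominator ideal inside the prime of \<open>P\<close>, and
  height one forces equality.\<close>

lemma ord_valuation:
  assumes P: "prime_divisor \<XX> P"
  shows "valuation_in KK (stk (gpt P)) (ord_along \<XX> P)"
proof -
  let ?x = "gpt P"
  obtain U A \<pp> where c: "chart U A \<pp>" "?x \<in> U" "sub_noetherian KK A"
    by (rule noetherian_chart_at[OF pd_gpt(1)[OF P]])
  have A: "subring A KK" by (rule chartD(5)[OF c(1)])
  have h: "height_one KK A (\<pp> ?x)" by (rule height_one_of_prime_divisor[OF P c(1,2)])
  have pr: "sub_prime KK A (\<pp> ?x)" by (rule chart_prime[OF c(1,2)])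
  note pI = sub_idealD[OF sub_primeD(1)[OF pr]]
  obtain b where b: "b \<in> \<pp> ?x" "b \<noteq> \<zero>\<^bsub>KK\<^esub>" using h pI(2) unfolding height_one_def by blast
  have bA: "b \<in> A" using b pI(1) by blast
  have bc: "b \<in> carrier KK" using bA subringE(1)[OF A] by blast
  let ?f = "inv\<^bsub>KK\<^esub> b"
  have ib: "?f \<in> carrier KK" "b \<otimes>\<^bsub>KK\<^esub> ?f = \<one>\<^bsub>KK\<^esub>" "?f \<otimes>\<^bsub>KK\<^esub> b = \<one>\<^bsub>KK\<^esub>" using K.nonzero_inv[OF bc b(2)] by auto
  have "den KK A ?f \<subseteq> \<pp> ?x"
  proof
    fix a assume "a \<in> den KK A ?f"
    then have a: "a \<in> A" "a \<otimes>\<^bsub>KK\<^esub> ?f \<in> A" by (auto simp: den_def)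
    have ac: "a \<in> carrier KK" using a subringE(1)[OF A] by blast
    have "(a \<otimes>\<^bsub>KK\<^esub> ?f) \<otimes>\<^bsub>KK\<^esub> b = a" using ac ib bc by (simp add: K.m_assoc)
    then show "a \<in> \<pp> ?x" using pI(4)[OF a(2) b(1)] by simp
  qed
  then obtain g where g: "g \<in> carrier KK" "sub_prime KK A (den KK A g)" "den KK A ?f \<subseteq> den KK A g"
    "den KK A g \<subseteq> \<pp> ?x" using K.exists_prime_den[OF c(3) pr ib(1)] by blast
  have "b \<in> den KK A ?f" using bA ib(2) subringE(3)[OF A] by (simp add: den_def)
  then have ne: "den KK A g \<noteq> {\<zero>\<^bsub>KK\<^esub>}" using g(3) b(2) by blast
  then have eq: "den KK A g = \<pp> ?x" using h g(2,4) unfolding height_one_def by blast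
  have st: "loc KK A (den KK A g) = stk ?x" using chartD(7)[OF c(1,2)] eq by simp
  have "integrally_closed_in KK (loc KK A (den KK A g))" unfolding st by (rule normal[OF pd_gpt(1)[OF P]])
  from K.dvr_of_prime_den(1)[OF c(3) g(1,2) ne this chartD(10)[OF c(1)]]
  have "dvr_in KK (stk ?x) (inv\<^bsub>KK\<^esub> g)" unfolding st .
  from K.dvr_valuation[OF this] show ?thesis
    unfolding ord_along_def local_subring_def function_field_def Let_def gpt_def[symmetric] stk_def .
qed

text \<open>A failure at \<open>y\<close> produces a prime denominator ideal inside the prime of
  \<open>y\<close>. It has height one, hence belongs to a prime divisor through \<open>y\<close>,
  along which \<open>f\<close> fails to be regular as well.\<close>

lemma hartogs:
  assumes V: "opn V" "V \<noteq> {}" and f: "f \<in> carrier KK"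
    and all: "\<And>P. prime_divisor \<XX> P \<Longrightarrow> P \<inter> V \<noteq> {} \<Longrightarrow> f \<in> stk (gpt P)"
  shows "f \<in> gm V ` Oc V"
  unfolding sections_iff_stalks[OF V]
proof
  fix y assume y: "y \<in> V"
  have yt: "y \<in> topspace (spc \<XX>)" using openin_subset[OF V(1)] y by blast
  obtain U A \<pp> where c: "chart U A \<pp>" "y \<in> U" "sub_noetherian KK A" by (rule noetherian_chart_at[OF yt])
  show "f \<in> stk y"
  proof (rule ccontr)
    assume "f \<notin> stk y"
    then have "den KK A f \<subseteq> \<pp> y" using K.loc_iff_den[OF f] chartD(7)[OF c(1,2)] by blast
    then obtain g where g: "g \<in> carrier KK" "sub_prime KK A (den KK A g)" "den KK A f \<subseteq> den KK A g"
      "den KK A g \<subseteq> \<pp> y" using K.exists_prime_den[OF c(3) chart_prime[OF c(1,2)] f] by blast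
    obtain z where z: "z \<in> U" "\<pp> z = den KK A g" by (rule chart_point[OF c(1) g(2)])
    have zt: "z \<in> topspace (spc \<XX>)" using openin_subset[OF chartD(1)[OF c(1)]] z by blast
    have ne: "den KK A g \<noteq> {\<zero>\<^bsub>KK\<^esub>}" using g(3) chartD(10)[OF c(1) f] unfolding den_def by blast
    have st: "loc KK A (den KK A g) = stk z" using chartD(7)[OF c(1) z(1)] z(2) by simp
    have "integrally_closed_in KK (loc KK A (den KK A g))" unfolding st by (rule normal[OF zt])
    from K.dvr_of_prime_den(2)[OF c(3) g(1,2) ne this chartD(10)[OF c(1)]]
    have h: "height_one KK A (\<pp> z)" unfolding z(2) .
    note P = prime_divisor_of_height_one[OF c(1) z(1) h]
    have "y \<in> cl z" using cl_chart_iff[OF c(1,2) z(1)] z(2) g(4) by simp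
    then have "cl z \<inter> V \<noteq> {}" using y by blast
    then have "f \<in> stk z" using all[OF P(1)] P(2) by simp
    then have "\<not> den KK A f \<subseteq> den KK A g" using K.loc_iff_den[OF f] st by blast
    then show False using g(3) by simp
  qed
qed

text \<open>In each Noetherian chart some nonzero function \<open>b\<close> vanishes at all points
  outside \<open>V\<close>. The prime of a divisor that misses \<open>V\<close> contains
  \<open>b\<close>, and only finitely many height-one primes do.\<close>

lemma finite_prime_divisors_outside:
  assumes V: "opn V" "V \<noteq> {}"
  shows "finite {P. prime_divisor \<XX> P \<and> P \<inter> V = {}}"
proof -
  obtain \<C> where C: "finite \<C>" "topspace (spc \<XX>) \<subseteq> \<Union>\<C>"
    "\<And>U. U \<in> \<C> \<Longrightarrow> \<exists>\<pp>. chart U (gm U ` Oc U) \<pp> \<and> sub_noetherian KK (gm U ` Oc U)"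
    using cover by blast
  have "finite {P. prime_divisor \<XX> P \<and> P \<inter> V = {} \<and> gpt P \<in> U}" if U: "U \<in> \<C>" for U
  proof -
    obtain \<pp> where c: "chart U (gm U ` Oc U) \<pp>" "sub_noetherian KK (gm U ` Oc U)" using C(3)[OF U] by blast
    let ?A = "gm U ` Oc U"
    have A: "subring ?A KK" by (rule chartD(5)[OF c(1)])
    note AE = subringE[OF A]
    have eta: "\<eta> \<in> V" "\<eta> \<in> U" using eta_in[OF V] chartD(3)[OF c(1)] by auto
    obtain b where b: "b \<in> ?A - \<pp> \<eta>" "\<forall>z\<in>U. b \<notin> \<pp> z \<longrightarrow> z \<in> V"
      using chartD(8)[OF c(1) V(1) eta] by blast
    have bn: "b \<noteq> \<zero>\<^bsub>KK\<^esub>" using b(1) chartD(4)[OF c(1)] by blast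
    have bA: "b \<in> ?A" using b by blast
    have bc: "b \<in> carrier KK" using bA AE(1) by blast
    let ?J = "(\<lambda>a. a \<otimes>\<^bsub>KK\<^esub> b) ` ?A"
    have J: "sub_ideal KK ?A ?J"
      unfolding sub_ideal_def
    proof (intro conjI ballI)
      show "?J \<subseteq> ?A" using AE(6) bA by auto
      have "\<zero>\<^bsub>KK\<^esub> = \<zero>\<^bsub>KK\<^esub> \<otimes>\<^bsub>KK\<^esub> b" using bc by simp
      then show "\<zero>\<^bsub>KK\<^esub> \<in> ?J" using AE(2) by (rule image_eqI)
      fix x assume "x \<in> ?J"
      then have "\<exists>a\<in>?A. x = a \<otimes>\<^bsub>KK\<^esub> b" by (simp only: image_iff)
      then obtain a where a: "a \<in> ?A" "x = a \<otimes>\<^bsub>KK\<^esub> b" by (rule bexE)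
      have ac: "a \<in> carrier KK" using a AE(1) by blast
      { fix y assume "y \<in> ?J"
        then have "\<exists>d\<in>?A. y = d \<otimes>\<^bsub>KK\<^esub> b" by (simp only: image_iff)
        then obtain d where d: "d \<in> ?A" "y = d \<otimes>\<^bsub>KK\<^esub> b" by (rule bexE)
        have "d \<in> carrier KK" using d AE(1) by blast
        then have "x \<oplus>\<^bsub>KK\<^esub> y = (a \<oplus>\<^bsub>KK\<^esub> d) \<otimes>\<^bsub>KK\<^esub> b" using a(2) d(2) ac bc by (simp add: K.l_distr)
        then show "x \<oplus>\<^bsub>KK\<^esub> y \<in> ?J" using AE(7)[OF a(1) d(1)] by (rule image_eqI)
      next
        fix d assume d: "d \<in> ?A"
        then have "d \<in> carrier KK" using AE(1) by blast
        then have "d \<otimes>\<^bsub>KK\<^esub> x = (d \<otimes>\<^bsub>KK\<^esub> a) \<otimes>\<^bsub>KK\<^esub> b" using a(2) ac bc by (simp add: K.m_assoc)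
        then show "d \<otimes>\<^bsub>KK\<^esub> x \<in> ?J" using AE(6)[OF d a(1)] by (rule image_eqI)
      }
    qed
    have "b = \<one>\<^bsub>KK\<^esub> \<otimes>\<^bsub>KK\<^esub> b" using bc by simp
    then have "b \<in> ?J" using AE(3) by (rule image_eqI)
    then have Jn: "?J \<noteq> {\<zero>\<^bsub>KK\<^esub>}" using bn by blast
    have fin: "finite {p. height_one KK ?A p \<and> ?J \<subseteq> p}" by (rule K.finite_height_one_above[OF c(2) J Jn])
    let ?S = "{P. prime_divisor \<XX> P \<and> P \<inter> V = {} \<and> gpt P \<in> U}"
    have "(\<lambda>P. \<pp> (gpt P)) ` ?S \<subseteq> {p. height_one KK ?A p \<and> ?J \<subseteq> p}"
    proof (rule image_subsetI)
      fix P assume "P \<in> ?S"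
      then have P: "prime_divisor \<XX> P" "P \<inter> V = {}" "gpt P \<in> U" by auto
      have "gpt P \<notin> V" using pd_gpt(4)[OF P(1)] P(2) by blast
      then have "b \<in> \<pp> (gpt P)" using b(2) P(3) by blast
      then have "?J \<subseteq> \<pp> (gpt P)" using sub_idealD(4)[OF sub_primeD(1)[OF chart_prime[OF c(1) P(3)]]] by blast
      then show "\<pp> (gpt P) \<in> {p. height_one KK ?A p \<and> ?J \<subseteq> p}"
        using height_one_of_prime_divisor[OF P(1) c(1) P(3)] by simp
    qed
    then have "finite ((\<lambda>P. \<pp> (gpt P)) ` ?S)" using fin by (rule finite_subset)
    moreover have "inj_on (\<lambda>P. \<pp> (gpt P)) ?S"
    proof (rule inj_onI)
      fix P Q assume PQ: "P \<in> ?S" "Q \<in> ?S" "\<pp> (gpt P) = \<pp> (gpt Q)"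
      then have "gpt P = gpt Q" using chart_inj[OF c(1)] by blast
      moreover have "prime_divisor \<XX> P" "prime_divisor \<XX> Q" using PQ by auto
      ultimately show "P = Q" by (metis pd_gpt(2))
    qed
    ultimately show ?thesis by (rule finite_imageD)
  qed
  then have "finite (\<Union>U\<in>\<C>. {P. prime_divisor \<XX> P \<and> P \<inter> V = {} \<and> gpt P \<in> U})" using C(1) by blast
  moreover have "{P. prime_divisor \<XX> P \<and> P \<inter> V = {}} \<subseteq> (\<Union>U\<in>\<C>. {P. prime_divisor \<XX> P \<and> P \<inter> V = {} \<and> gpt P \<in> U})"
    using C(2) pd_gpt(1) by blast
  ultimately show ?thesis by (rule rev_finite_subset)
qed

lemma ord_mult:
  assumes "prime_divisor \<XX> P" "f \<in> carrier KK" "f \<noteq> \<zero>\<^bsub>KK\<^esub>" "g \<in> carrier KK" "g \<noteq> \<zero>\<^bsub>KK\<^esub>"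
  shows "ord_along \<XX> P (f \<otimes>\<^bsub>KK\<^esub> g) = ord_along \<XX> P f + ord_along \<XX> P g"
  using ord_valuation[OF assms(1)] assms(2-) unfolding valuation_in_def by blast

lemma ord_nonneg_iff:
  assumes "prime_divisor \<XX> P" "f \<in> carrier KK" "f \<noteq> \<zero>\<^bsub>KK\<^esub>"
  shows "f \<in> stk (gpt P) \<longleftrightarrow> 0 \<le> ord_along \<XX> P f"
  using ord_valuation[OF assms(1)] assms(2-) unfolding valuation_in_def by blast

lemma ord_surj:
  assumes "prime_divisor \<XX> P"
  obtains f where "f \<in> carrier KK" "f \<noteq> \<zero>\<^bsub>KK\<^esub>" "ord_along \<XX> P f = n"
  using ord_valuation[OF assms(1)] unfolding valuation_in_def by blast

lemma ord_inv:
  assumes P: "prime_divisor \<XX> P" and f: "f \<in> carrier KK" "f \<noteq> \<zero>\<^bsub>KK\<^esub>"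
  shows "ord_along \<XX> P (inv\<^bsub>KK\<^esub> f) = - ord_along \<XX> P f"
proof -
  have one: "ord_along \<XX> P \<one>\<^bsub>KK\<^esub> = 0" using ord_mult[OF P, of "\<one>\<^bsub>KK\<^esub>" "\<one>\<^bsub>KK\<^esub>"] by simp
  have i: "inv\<^bsub>KK\<^esub> f \<in> carrier KK" "inv\<^bsub>KK\<^esub> f \<noteq> \<zero>\<^bsub>KK\<^esub>" "f \<otimes>\<^bsub>KK\<^esub> inv\<^bsub>KK\<^esub> f = \<one>\<^bsub>KK\<^esub>" using K.nonzero_inv[OF f] by auto
  show ?thesis using ord_mult[OF P f i(1,2)] i(3) one by simp
qed

text \<open>Both \<open>f\<close> and its inverse are regular on a nonempty open set, and the order
  vanishes along every prime divisor that meets it.\<close>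

lemma finite_ord_nonzero:
  assumes f: "f \<in> carrier KK" "f \<noteq> \<zero>\<^bsub>KK\<^esub>"
  shows "finite {P. prime_divisor \<XX> P \<and> ord_along \<XX> P f \<noteq> 0}"
proof -
  have i: "inv\<^bsub>KK\<^esub> f \<in> carrier KK" "inv\<^bsub>KK\<^esub> f \<noteq> \<zero>\<^bsub>KK\<^esub>" using K.nonzero_inv[OF f] by auto
  obtain U s where U: "opn U" "\<eta> \<in> U" "s \<in> Oc U" "f = gm U s" by (rule stalk_cases[OF f(1)])
  obtain V t where V: "opn V" "\<eta> \<in> V" "t \<in> Oc V" "inv\<^bsub>KK\<^esub> f = gm V t" by (rule stalk_cases[OF i(1)])
  let ?W = "U \<inter> V"
  have W: "opn ?W" "?W \<noteq> {}" using U V by auto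
  have "{P. prime_divisor \<XX> P \<and> ord_along \<XX> P f \<noteq> 0} \<subseteq> {P. prime_divisor \<XX> P \<and> P \<inter> ?W = {}}"
  proof
    fix P assume "P \<in> {P. prime_divisor \<XX> P \<and> ord_along \<XX> P f \<noteq> 0}"
    then have P: "prime_divisor \<XX> P" "ord_along \<XX> P f \<noteq> 0" by auto
    have "P \<inter> ?W = {}"
    proof (rule ccontr)
      assume "P \<inter> ?W \<noteq> {}"
      then have "gpt P \<in> ?W" using pd_gpt(3)[OF P(1) W(1)] by blast
      then have "f \<in> stk (gpt P)" "inv\<^bsub>KK\<^esub> f \<in> stk (gpt P)"
        unfolding stk_def using U V by blast+
      then have "0 \<le> ord_along \<XX> P f" "0 \<le> ord_along \<XX> P (inv\<^bsub>KK\<^esub> f)"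
        using ord_nonneg_iff[OF P(1) f] ord_nonneg_iff[OF P(1) i] by auto
      then show False using ord_inv[OF P(1) f] P(2) by simp
    qed
    then show "P \<in> {P. prime_divisor \<XX> P \<and> P \<inter> ?W = {}}" using P(1) by simp
  qed
  then show ?thesis using finite_prime_divisors_outside[OF W] by (rule finite_subset)
qed

end

section \<open>Modules inside their generic stalk\<close>

lemma omodule_homD:
  assumes "omodule_hom Y F G \<mu>" and U: "openin (spc Y) U"
  shows "s \<in> carrier (msec F U) \<Longrightarrow> \<mu> U s \<in> carrier (msec G U)"
    and "s \<in> carrier (msec F U) \<Longrightarrow> t \<in> carrier (msec F U) \<Longrightarrow>
      \<mu> U (s \<oplus>\<^bsub>msec F U\<^esub> t) = \<mu> U s \<oplus>\<^bsub>msec G U\<^esub> \<mu> U t"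
    and "a \<in> carrier (osec Y U) \<Longrightarrow> s \<in> carrier (msec F U) \<Longrightarrow>
      \<mu> U (a \<odot>\<^bsub>msec F U\<^esub> s) = a \<odot>\<^bsub>msec G U\<^esub> \<mu> U s"
    and "openin (spc Y) V \<Longrightarrow> V \<subseteq> U \<Longrightarrow> s \<in> carrier (msec F U) \<Longrightarrow>
      \<mu> V (mres F U V s) = mres G U V (\<mu> U s)"
  using assms unfolding omodule_hom_def by (simp_all add: Pi_iff)

context ringed
begin

lemma openin_open_sub:
  assumes "opn V" shows "openin (spc (open_sub \<XX> V)) U \<longleftrightarrow> opn U \<and> U \<subseteq> V"
  using openin_open_subtopology[OF assms] by (simp add: open_sub_def)

lemma osec_open_sub: "osec (open_sub \<XX> V) = osec \<XX>" "ores (open_sub \<XX> V) = ores \<XX>"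
  by (simp_all add: open_sub_def)

lemma local_homD:
  assumes V: "opn V" and h: "omodule_hom (open_sub \<XX> V) F G \<mu>" and U: "opn U" "U \<subseteq> V"
  shows "s \<in> carrier (msec F U) \<Longrightarrow> \<mu> U s \<in> carrier (msec G U)"
    and "s \<in> carrier (msec F U) \<Longrightarrow> t \<in> carrier (msec F U) \<Longrightarrow>
      \<mu> U (s \<oplus>\<^bsub>msec F U\<^esub> t) = \<mu> U s \<oplus>\<^bsub>msec G U\<^esub> \<mu> U t"
    and "a \<in> Oc U \<Longrightarrow> s \<in> carrier (msec F U) \<Longrightarrow> \<mu> U (a \<odot>\<^bsub>msec F U\<^esub> s) = a \<odot>\<^bsub>msec G U\<^esub> \<mu> U s"
    and "opn W \<Longrightarrow> W \<subseteq> U \<Longrightarrow> s \<in> carrier (msec F U) \<Longrightarrow>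
      \<mu> W (mres F U W s) = mres G U W (\<mu> U s)"
proof -
  have oU: "openin (spc (open_sub \<XX> V)) U" using openin_open_sub[OF V] U by simp
  note D = omodule_homD[OF h oU, unfolded osec_open_sub openin_open_sub[OF V]]
  show "s \<in> carrier (msec F U) \<Longrightarrow> \<mu> U s \<in> carrier (msec G U)" by (rule D(1))
  show "s \<in> carrier (msec F U) \<Longrightarrow> t \<in> carrier (msec F U) \<Longrightarrow>
      \<mu> U (s \<oplus>\<^bsub>msec F U\<^esub> t) = \<mu> U s \<oplus>\<^bsub>msec G U\<^esub> \<mu> U t" by (rule D(2))
  show "a \<in> Oc U \<Longrightarrow> s \<in> carrier (msec F U) \<Longrightarrow> \<mu> U (a \<odot>\<^bsub>msec F U\<^esub> s) = a \<odot>\<^bsub>msec G U\<^esub> \<mu> U s" by (rule D(3))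
  show "opn W \<Longrightarrow> W \<subseteq> U \<Longrightarrow> s \<in> carrier (msec F U) \<Longrightarrow>
      \<mu> W (mres F U W s) = mres G U W (\<mu> U s)" using D(4) U(2) by blast
qed

lemma local_homI:
  assumes V: "opn V"
    and "\<And>U s. opn U \<Longrightarrow> U \<subseteq> V \<Longrightarrow> s \<in> carrier (msec F U) \<Longrightarrow> \<mu> U s \<in> carrier (msec G U)"
    and "\<And>U s t. opn U \<Longrightarrow> U \<subseteq> V \<Longrightarrow> s \<in> carrier (msec F U) \<Longrightarrow> t \<in> carrier (msec F U) \<Longrightarrow>
      \<mu> U (s \<oplus>\<^bsub>msec F U\<^esub> t) = \<mu> U s \<oplus>\<^bsub>msec G U\<^esub> \<mu> U t"
    and "\<And>U a s. opn U \<Longrightarrow> U \<subseteq> V \<Longrightarrow> a \<in> Oc U \<Longrightarrow> s \<in> carrier (msec F U) \<Longrightarrow>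
      \<mu> U (a \<odot>\<^bsub>msec F U\<^esub> s) = a \<odot>\<^bsub>msec G U\<^esub> \<mu> U s"
    and "\<And>U W s. opn U \<Longrightarrow> U \<subseteq> V \<Longrightarrow> opn W \<Longrightarrow> W \<subseteq> U \<Longrightarrow> s \<in> carrier (msec F U) \<Longrightarrow>
      \<mu> W (mres F U W s) = mres G U W (\<mu> U s)"
  shows "omodule_hom (open_sub \<XX> V) F G \<mu>"
  unfolding omodule_hom_def openin_open_sub[OF V] osec_open_sub
  by (intro conjI allI impI ballI funcsetI) (use assms(2-) in auto)

lemma structure_omodule_simps:
  "carrier (msec (structure_omodule \<XX>) U) = Oc U"
  "x \<oplus>\<^bsub>msec (structure_omodule \<XX>) U\<^esub> y = x \<oplus>\<^bsub>osec \<XX> U\<^esub> y"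
  "a \<odot>\<^bsub>msec (structure_omodule \<XX>) U\<^esub> y = a \<otimes>\<^bsub>osec \<XX> U\<^esub> y"
  "\<zero>\<^bsub>msec (structure_omodule \<XX>) U\<^esub> = \<zero>\<^bsub>osec \<XX> U\<^esub>"
  "mres (structure_omodule \<XX>) = ores \<XX>"
  by (simp_all add: structure_omodule_def)

lemma free_omodule_simps:
  "carrier (msec (free_omodule \<XX> n) U) = (\<Pi>\<^sub>E i\<in>{..<n}. Oc U)"
  "x \<oplus>\<^bsub>msec (free_omodule \<XX> n) U\<^esub> y = (\<lambda>i\<in>{..<n}. x i \<oplus>\<^bsub>osec \<XX> U\<^esub> y i)"
  "a \<odot>\<^bsub>msec (free_omodule \<XX> n) U\<^esub> y = (\<lambda>i\<in>{..<n}. a \<otimes>\<^bsub>osec \<XX> U\<^esub> y i)"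
  "mres (free_omodule \<XX> n) U V x = (\<lambda>i\<in>{..<n}. ores \<XX> U V (x i))"
  by (simp_all add: free_omodule_def)

end

section \<open>The generic stalk of a module\<close>

locale omod = integral_sch \<XX> for \<XX> :: "('p, 'a) ringed_space" +
  fixes F :: "('p, 'a, 'm) omodule"
  assumes omodule: "is_omodule \<XX> F"
begin

abbreviation Mc where "Mc U \<equiv> carrier (msec F U)"
abbreviation mg where "mg \<equiv> mgerm \<XX> F \<eta>"
abbreviation ME where "ME \<equiv> mstalk \<XX> F \<eta>"

interpretation K: field KK by (rule KK_field)

lemma msec_module: "opn U \<Longrightarrow> module (osec \<XX> U) (msec F U)"
  using omodule by (simp add: is_omodule_def)

lemma msheaf: "sheaf_of_sets (spc \<XX>) (\<lambda>U. Mc U) (mres F)"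
  using omodule by (simp add: is_omodule_def)

lemmas mres_closed = sheafD(1)[OF msheaf]
lemmas mres_id = sheafD(2)[OF msheaf]
lemmas mres_trans = sheafD(3)[OF msheaf]

lemma mres_add:
  "opn U \<Longrightarrow> opn V \<Longrightarrow> V \<subseteq> U \<Longrightarrow> s \<in> Mc U \<Longrightarrow> t \<in> Mc U \<Longrightarrow>
    mres F U V (s \<oplus>\<^bsub>msec F U\<^esub> t) = mres F U V s \<oplus>\<^bsub>msec F V\<^esub> mres F U V t"
  using omodule by (simp add: is_omodule_def)

lemma mres_smult:
  "opn U \<Longrightarrow> opn V \<Longrightarrow> V \<subseteq> U \<Longrightarrow> a \<in> Oc U \<Longrightarrow> s \<in> Mc U \<Longrightarrow>
    mres F U V (a \<odot>\<^bsub>msec F U\<^esub> s) = ores \<XX> U V a \<odot>\<^bsub>msec F V\<^esub> mres F U V s"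
  using omodule by (simp add: is_omodule_def)

lemma msmult_closed: "opn U \<Longrightarrow> a \<in> Oc U \<Longrightarrow> s \<in> Mc U \<Longrightarrow> a \<odot>\<^bsub>msec F U\<^esub> s \<in> Mc U"
  using module.smult_closed[OF msec_module] .

lemma mzero_closed: "opn U \<Longrightarrow> \<zero>\<^bsub>msec F U\<^esub> \<in> Mc U"
  by (rule abelian_monoid.zero_closed[OF abelian_group.axioms(1)[OF module.axioms(2)[OF msec_module]]])

lemma madd_closed: "opn U \<Longrightarrow> s \<in> Mc U \<Longrightarrow> t \<in> Mc U \<Longrightarrow> s \<oplus>\<^bsub>msec F U\<^esub> t \<in> Mc U"
  by (rule abelian_monoid.a_closed[OF abelian_group.axioms(1)[OF module.axioms(2)[OF msec_module]]])

lemma msmult_zero: "opn U \<Longrightarrow> s \<in> Mc U \<Longrightarrow> \<zero>\<^bsub>osec \<XX> U\<^esub> \<odot>\<^bsub>msec F U\<^esub> s = \<zero>\<^bsub>msec F U\<^esub>"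
  using module.smult_l_null[OF msec_module] .

text \<open>Restriction is only assumed to respect sums and scalars, so the zero section is written
  as a multiple by zero.\<close>

lemma mres_zero:
  assumes "opn U" "opn V" "V \<subseteq> U" shows "mres F U V \<zero>\<^bsub>msec F U\<^esub> = \<zero>\<^bsub>msec F V\<^esub>"
proof -
  interpret h: ring_hom_cring "osec \<XX> U" "osec \<XX> V" "ores \<XX> U V" by (rule ores_ring_hom_cring[OF assms])
  have z: "\<zero>\<^bsub>msec F U\<^esub> \<in> Mc U" by (rule mzero_closed[OF assms(1)])
  have "mres F U V \<zero>\<^bsub>msec F U\<^esub> = mres F U V (\<zero>\<^bsub>osec \<XX> U\<^esub> \<odot>\<^bsub>msec F U\<^esub> \<zero>\<^bsub>msec F U\<^esub>)"
    using msmult_zero[OF assms(1) z] by simp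
  also have "\<dots> = \<zero>\<^bsub>osec \<XX> V\<^esub> \<odot>\<^bsub>msec F V\<^esub> mres F U V \<zero>\<^bsub>msec F U\<^esub>"
    using mres_smult[OF assms _ z] by simp
  also have "\<dots> = \<zero>\<^bsub>msec F V\<^esub>" by (rule msmult_zero[OF assms(2) mres_closed[OF assms z]])
  finally show ?thesis .
qed

lemma mgerm_eq_iff:
  assumes "opn U" "\<eta> \<in> U" "s \<in> Mc U" "opn V" "\<eta> \<in> V" "t \<in> Mc V"
  shows "mg U s = mg V t \<longleftrightarrow> (\<exists>W. opn W \<and> \<eta> \<in> W \<and> W \<subseteq> U \<inter> V \<and> mres F U W s = mres F V W t)"
  unfolding mgerm_def by (rule germ_eq_iff[OF msheaf]) (use assms in auto)

lemma mgerm_res: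
  assumes "opn U" "s \<in> Mc U" "opn V" "\<eta> \<in> V" "V \<subseteq> U"
  shows "mg V (mres F U V s) = mg U s"
  unfolding mgerm_def by (rule germ_res[OF msheaf]) (use assms in auto)

lemma mgerm_closed: "opn U \<Longrightarrow> \<eta> \<in> U \<Longrightarrow> s \<in> Mc U \<Longrightarrow> mg U s \<in> carrier ME"
  by (auto simp: mstalk_def)

lemma mstalk_cases:
  assumes "v \<in> carrier ME"
  obtains U s where "opn U" "\<eta> \<in> U" "s \<in> Mc U" "v = mg U s"
  using assms by (auto simp: mstalk_def)

lemma mstalk_cases_in:
  assumes v: "v \<in> carrier ME" and V: "opn V" "\<eta> \<in> V"
  obtains U s where "opn U" "\<eta> \<in> U" "U \<subseteq> V" "s \<in> Mc U" "v = mg U s"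
proof -
  obtain U s where U: "opn U" "\<eta> \<in> U" "s \<in> Mc U" "v = mg U s" by (rule mstalk_cases[OF v])
  have W: "opn (U \<inter> V)" "\<eta> \<in> U \<inter> V" using U V by auto
  show thesis
    by (rule that[OF W Int_lower2, of "mres F U (U \<inter> V) s"])
      (use mres_closed[OF U(1) W(1) Int_lower1 U(3)] mgerm_res[OF U(1,3) W Int_lower1] U(4) in auto)
qed

lemma mstalk_cases2:
  assumes f: "f \<in> carrier KK" and v: "v \<in> carrier ME"
  obtains U a s where "opn U" "\<eta> \<in> U" "a \<in> Oc U" "s \<in> Mc U" "f = gm U a" "v = mg U s"
proof -
  obtain V b where V: "opn V" "\<eta> \<in> V" "b \<in> Oc V" "f = gm V b" by (rule stalk_cases[OF f])
  obtain U s where U: "opn U" "\<eta> \<in> U" "U \<subseteq> V" "s \<in> Mc U" "v = mg U s" by (rule mstalk_cases_in[OF v V(1,2)])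
  show thesis
    by (rule that[OF U(1,2) _ U(4) _ U(5), of "ores \<XX> V U b"])
      (use ores_closed[OF V(1) U(1,3) V(3)] ogerm_res[OF V(1,3) U(1,2,3)] V(4) in auto)
qed

text \<open>The scalar multiplication of the stalk is a definite description; representatives of
  both factors are compared on a common open set.\<close>

lemma mgerm_smult:
  assumes U: "opn U" "\<eta> \<in> U" "a \<in> Oc U" "s \<in> Mc U"
  shows "gm U a \<odot>\<^bsub>ME\<^esub> mg U s = mg U (a \<odot>\<^bsub>msec F U\<^esub> s)"
proof -
  have "(THE C. \<exists>V b t. opn V \<and> \<eta> \<in> V \<and> b \<in> Oc V \<and> t \<in> Mc V \<and>
     gm U a = gm V b \<and> mg U s = mg V t \<and> C = mg V (b \<odot>\<^bsub>msec F V\<^esub> t)) = mg U (a \<odot>\<^bsub>msec F U\<^esub> s)"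
  proof (rule the_equality)
    show "\<exists>V b t. opn V \<and> \<eta> \<in> V \<and> b \<in> Oc V \<and> t \<in> Mc V \<and>
     gm U a = gm V b \<and> mg U s = mg V t \<and> mg U (a \<odot>\<^bsub>msec F U\<^esub> s) = mg V (b \<odot>\<^bsub>msec F V\<^esub> t)"
      using U by blast
    fix C assume "\<exists>V b t. opn V \<and> \<eta> \<in> V \<and> b \<in> Oc V \<and> t \<in> Mc V \<and>
     gm U a = gm V b \<and> mg U s = mg V t \<and> C = mg V (b \<odot>\<^bsub>msec F V\<^esub> t)"
    then obtain V b t where V: "opn V" "\<eta> \<in> V" "b \<in> Oc V" "t \<in> Mc V"
      and eq: "gm U a = gm V b" "mg U s = mg V t" and C: "C = mg V (b \<odot>\<^bsub>msec F V\<^esub> t)" by blast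
    obtain W1 where W1: "opn W1" "\<eta> \<in> W1" "W1 \<subseteq> U \<inter> V" "ores \<XX> U W1 a = ores \<XX> V W1 b"
      using eq(1) ogerm_eq_iff[OF U(1,2,3) V(1,2,3)] by blast
    obtain W2 where W2: "opn W2" "\<eta> \<in> W2" "W2 \<subseteq> U \<inter> V" "mres F U W2 s = mres F V W2 t"
      using eq(2) mgerm_eq_iff[OF U(1,2,4) V(1,2,4)] by blast
    let ?W = "W1 \<inter> W2"
    have W: "opn ?W" "\<eta> \<in> ?W" "?W \<subseteq> U" "?W \<subseteq> V" using W1 W2 by auto
    have sub: "W1 \<subseteq> U" "W1 \<subseteq> V" "W2 \<subseteq> U" "W2 \<subseteq> V" using W1 W2 by auto
    have "ores \<XX> U ?W a = ores \<XX> V ?W b"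
      using ores_trans[OF U(1) W1(1) W(1) Int_lower1 sub(1) U(3)]
        ores_trans[OF V(1) W1(1) W(1) Int_lower1 sub(2) V(3)] W1(4) by simp
    moreover have "mres F U ?W s = mres F V ?W t"
      using mres_trans[OF U(1) W2(1) W(1) Int_lower2 sub(3) U(4)]
        mres_trans[OF V(1) W2(1) W(1) Int_lower2 sub(4) V(4)] W2(4) by simp
    ultimately have "mres F U ?W (a \<odot>\<^bsub>msec F U\<^esub> s) = mres F V ?W (b \<odot>\<^bsub>msec F V\<^esub> t)"
      using mres_smult[OF U(1) W(1,3) U(3,4)] mres_smult[OF V(1) W(1,4) V(3,4)] by simp
    then have "mg V (mres F V V (b \<odot>\<^bsub>msec F V\<^esub> t)) = mg U (mres F U U (a \<odot>\<^bsub>msec F U\<^esub> s))"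
      using mgerm_res[OF U(1) msmult_closed[OF U(1,3,4)] W(1,2,3)]
        mgerm_res[OF V(1) msmult_closed[OF V(1,3,4)] W(1,2,4)]
        mres_id[OF U(1) msmult_closed[OF U(1,3,4)]] mres_id[OF V(1) msmult_closed[OF V(1,3,4)]] by simp
    then show "C = mg U (a \<odot>\<^bsub>msec F U\<^esub> s)"
      unfolding C using mres_id[OF U(1) msmult_closed[OF U(1,3,4)]] mres_id[OF V(1) msmult_closed[OF V(1,3,4)]] by simp
  qed
  then show ?thesis by (simp add: mstalk_def)
qed

lemma mgerm_zero: "opn U \<Longrightarrow> \<eta> \<in> U \<Longrightarrow> mg U \<zero>\<^bsub>msec F U\<^esub> = \<zero>\<^bsub>ME\<^esub>"
  using mgerm_res[OF openin_topspace mzero_closed[OF openin_topspace], of U]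
    mres_zero[OF openin_topspace, of U] openin_subset[of "spc \<XX>" U] by (simp add: mstalk_def)

lemma ME_zero_closed: "\<zero>\<^bsub>ME\<^esub> \<in> carrier ME"
  using mgerm_closed[OF openin_topspace eta_topspace mzero_closed[OF openin_topspace]]
    mgerm_zero[OF openin_topspace eta_topspace] by simp

lemma ME_smult_closed:
  assumes "f \<in> carrier KK" "v \<in> carrier ME" shows "f \<odot>\<^bsub>ME\<^esub> v \<in> carrier ME"
proof -
  obtain U a s where U: "opn U" "\<eta> \<in> U" "a \<in> Oc U" "s \<in> Mc U" "f = gm U a" "v = mg U s"
    by (rule mstalk_cases2[OF assms])
  then show ?thesis using mgerm_smult[OF U(1-4)] mgerm_closed[OF U(1,2) msmult_closed[OF U(1,3,4)]] by simp
qed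

lemma ME_smult_assoc:
  assumes "f \<in> carrier KK" "g \<in> carrier KK" "v \<in> carrier ME"
  shows "(f \<otimes>\<^bsub>KK\<^esub> g) \<odot>\<^bsub>ME\<^esub> v = f \<odot>\<^bsub>ME\<^esub> (g \<odot>\<^bsub>ME\<^esub> v)"
proof -
  obtain V a b where V: "opn V" "\<eta> \<in> V" "a \<in> Oc V" "b \<in> Oc V" "f = gm V a" "g = gm V b"
    by (rule stalk_cases2[OF assms(1,2)])
  obtain U s where U: "opn U" "\<eta> \<in> U" "U \<subseteq> V" "s \<in> Mc U" "v = mg U s"
    by (rule mstalk_cases_in[OF assms(3) V(1,2)])
  interpret U: cring "osec \<XX> U" by (rule osec_cring[OF U(1)])
  interpret M: module "osec \<XX> U" "msec F U" by (rule msec_module[OF U(1)])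
  let ?a = "ores \<XX> V U a" and ?b = "ores \<XX> V U b"
  have ab: "?a \<in> Oc U" "?b \<in> Oc U" using ores_closed[OF V(1) U(1,3)] V(3,4) by auto
  have fg: "f = gm U ?a" "g = gm U ?b" using ogerm_res[OF V(1,3) U(1,2,3)] ogerm_res[OF V(1,4) U(1,2,3)] V(5,6) by auto
  have "f \<otimes>\<^bsub>KK\<^esub> g = gm U (?a \<otimes>\<^bsub>osec \<XX> U\<^esub> ?b)" unfolding fg by (rule ogerm_mult[OF U(1,2) ab])
  then have "(f \<otimes>\<^bsub>KK\<^esub> g) \<odot>\<^bsub>ME\<^esub> v = mg U ((?a \<otimes>\<^bsub>osec \<XX> U\<^esub> ?b) \<odot>\<^bsub>msec F U\<^esub> s)"
    using mgerm_smult[OF U(1,2) U.m_closed[OF ab] U(4)] U(5) by simp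
  also have "\<dots> = mg U (?a \<odot>\<^bsub>msec F U\<^esub> (?b \<odot>\<^bsub>msec F U\<^esub> s))" using M.smult_assoc1[OF ab U(4)] by simp
  also have "\<dots> = f \<odot>\<^bsub>ME\<^esub> (g \<odot>\<^bsub>ME\<^esub> v)"
    unfolding fg U(5) mgerm_smult[OF U(1,2) ab(2) U(4)]
      mgerm_smult[OF U(1,2) ab(1) msmult_closed[OF U(1) ab(2) U(4)]] ..
  finally show ?thesis .
qed

lemma ME_smult_one: "v \<in> carrier ME \<Longrightarrow> \<one>\<^bsub>KK\<^esub> \<odot>\<^bsub>ME\<^esub> v = v"
proof -
  assume v: "v \<in> carrier ME"
  obtain U s where U: "opn U" "\<eta> \<in> U" "s \<in> Mc U" "v = mg U s" by (rule mstalk_cases[OF v])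
  interpret U: cring "osec \<XX> U" by (rule osec_cring[OF U(1)])
  interpret M: module "osec \<XX> U" "msec F U" by (rule msec_module[OF U(1)])
  show ?thesis
    unfolding ogerm_one[OF U(1,2), symmetric] U(4) mgerm_smult[OF U(1,2) U.one_closed U(3)]
    using M.smult_one[OF U(3)] by simp
qed

lemma ME_smult_zero: "v \<in> carrier ME \<Longrightarrow> \<zero>\<^bsub>KK\<^esub> \<odot>\<^bsub>ME\<^esub> v = \<zero>\<^bsub>ME\<^esub>"
proof -
  assume v: "v \<in> carrier ME"
  obtain U s where U: "opn U" "\<eta> \<in> U" "s \<in> Mc U" "v = mg U s" by (rule mstalk_cases[OF v])
  interpret U: cring "osec \<XX> U" by (rule osec_cring[OF U(1)])
  show ?thesis
    unfolding ogerm_zero[OF U(1,2), symmetric] U(4) mgerm_smult[OF U(1,2) U.zero_closed U(3)]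
      msmult_zero[OF U(1,3)] by (rule mgerm_zero[OF U(1,2)])
qed

lemma ME_smult_cancel:
  assumes "f \<in> carrier KK" "f \<noteq> \<zero>\<^bsub>KK\<^esub>" "v \<in> carrier ME"
  shows "inv\<^bsub>KK\<^esub> f \<odot>\<^bsub>ME\<^esub> (f \<odot>\<^bsub>ME\<^esub> v) = v" "f \<odot>\<^bsub>ME\<^esub> (inv\<^bsub>KK\<^esub> f \<odot>\<^bsub>ME\<^esub> v) = v"
proof -
  have i: "inv\<^bsub>KK\<^esub> f \<in> carrier KK" "f \<otimes>\<^bsub>KK\<^esub> inv\<^bsub>KK\<^esub> f = \<one>\<^bsub>KK\<^esub>" "inv\<^bsub>KK\<^esub> f \<otimes>\<^bsub>KK\<^esub> f = \<one>\<^bsub>KK\<^esub>"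
    using K.nonzero_inv[OF assms(1,2)] by auto
  show "inv\<^bsub>KK\<^esub> f \<odot>\<^bsub>ME\<^esub> (f \<odot>\<^bsub>ME\<^esub> v) = v" "f \<odot>\<^bsub>ME\<^esub> (inv\<^bsub>KK\<^esub> f \<odot>\<^bsub>ME\<^esub> v) = v"
    using ME_smult_assoc[OF i(1) assms(1,3)] ME_smult_assoc[OF assms(1) i(1) assms(3)] i ME_smult_one[OF assms(3)] by auto
qed

text \<open>The image of the stalk at \<open>y\<close> in the generic stalk, the counterpart of
  \<open>stk\<close>.\<close>

definition mstk :: "'p \<Rightarrow> ('p set \<times> 'm) set set" where
  "mstk y = {mg W s | W s. opn W \<and> y \<in> W \<and> s \<in> Mc W}"

lemma mstkI: "opn W \<Longrightarrow> y \<in> W \<Longrightarrow> s \<in> Mc W \<Longrightarrow> mg W s \<in> mstk y"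
  unfolding mstk_def by blast

lemma mstk_smult:
  assumes "f \<in> stk y" "v \<in> mstk y" shows "f \<odot>\<^bsub>ME\<^esub> v \<in> mstk y"
proof -
  obtain W s where W: "opn W" "y \<in> W" "s \<in> Mc W" "v = mg W s" using assms(2) by (auto simp: mstk_def)
  obtain V a where V: "opn V" "y \<in> V" "a \<in> Oc V" "f = gm V a" using assms(1) by (auto simp: stk_def)
  let ?N = "V \<inter> W"
  have N: "opn ?N" "y \<in> ?N" using V W by auto
  have e: "\<eta> \<in> ?N" using eta_in[OF N(1)] N(2) by blast
  have a: "ores \<XX> V ?N a \<in> Oc ?N" and s: "mres F W ?N s \<in> Mc ?N"
    using ores_closed[OF V(1) N(1) Int_lower1 V(3)] mres_closed[OF W(1) N(1) Int_lower2 W(3)] by auto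
  have "f \<odot>\<^bsub>ME\<^esub> v = mg ?N (ores \<XX> V ?N a \<odot>\<^bsub>msec F ?N\<^esub> mres F W ?N s)"
    using mgerm_smult[OF N(1) e a s] ogerm_res[OF V(1,3) N(1) e Int_lower1] mgerm_res[OF W(1,3) N(1) e Int_lower2] V(4) W(4) by simp
  then show ?thesis using mstkI[OF N msmult_closed[OF N(1) a s]] by simp
qed

section \<open>Denominators from finite local generation\<close>

lemma common_denominator:
  assumes y: "y \<in> topspace (spc \<XX>)" and c: "\<And>i. i < (n::nat) \<Longrightarrow> c i \<in> carrier KK"
  shows "\<exists>h\<in>stk y - {\<zero>\<^bsub>KK\<^esub>}. \<forall>i<n. h \<otimes>\<^bsub>KK\<^esub> c i \<in> stk y"
  using c
proof (induction n)
  case 0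
  have S: "subring (stk y) KK" by (rule subring_stk[OF y])
  show ?case by (intro bexI[of _ "\<one>\<^bsub>KK\<^esub>"]) (use subringE(3)[OF S] K.one_not_zero in auto)
next
  case (Suc n)
  note SE = subringE[OF subring_stk[OF y]]
  obtain h where h: "h \<in> stk y" "h \<noteq> \<zero>\<^bsub>KK\<^esub>" "\<And>i. i < n \<Longrightarrow> h \<otimes>\<^bsub>KK\<^esub> c i \<in> stk y" using Suc by auto
  obtain g where g: "g \<in> stk y" "g \<noteq> \<zero>\<^bsub>KK\<^esub>" "g \<otimes>\<^bsub>KK\<^esub> c n \<in> stk y" using stk_frac[OF y] Suc.prems[of n] by blast
  have hc: "h \<in> carrier KK" "g \<in> carrier KK" using h g stk_carrier by auto
  have "(g \<otimes>\<^bsub>KK\<^esub> h) \<otimes>\<^bsub>KK\<^esub> c i \<in> stk y" if i: "i < Suc n" for i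
  proof (cases "i = n")
    case True
    have "(g \<otimes>\<^bsub>KK\<^esub> h) \<otimes>\<^bsub>KK\<^esub> c n = h \<otimes>\<^bsub>KK\<^esub> (g \<otimes>\<^bsub>KK\<^esub> c n)" using hc Suc.prems[of n] by (simp add: K.m_ac)
    then show ?thesis using True SE(6)[OF h(1) g(3)] by simp
  next
    case False
    have "(g \<otimes>\<^bsub>KK\<^esub> h) \<otimes>\<^bsub>KK\<^esub> c i = g \<otimes>\<^bsub>KK\<^esub> (h \<otimes>\<^bsub>KK\<^esub> c i)" using hc Suc.prems[of i] i by (simp add: K.m_assoc)
    moreover have "i < n" using i False by simp
    ultimately show ?thesis using SE(6)[OF g(1) h(3)] by simp
  qed
  moreover have "g \<otimes>\<^bsub>KK\<^esub> h \<in> stk y - {\<zero>\<^bsub>KK\<^esub>}" using SE(6)[OF g(1) h(1)] h(2) g(2) hc by (simp add: K.integral_iff)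
  ultimately show ?case by blast
qed

lemma common_nbhd:
  assumes U: "opn U" "y \<in> U" and g: "\<And>i. i < (n::nat) \<Longrightarrow> g i \<in> stk y"
  shows "\<exists>W. opn W \<and> y \<in> W \<and> W \<subseteq> U \<and> (\<forall>i<n. g i \<in> gm W ` Oc W)"
  using g
proof (induction n)
  case 0
  then show ?case using U by blast
next
  case (Suc n)
  obtain W where W: "opn W" "y \<in> W" "W \<subseteq> U" "\<And>i. i < n \<Longrightarrow> g i \<in> gm W ` Oc W" using Suc by auto
  obtain V a where V: "opn V" "y \<in> V" "a \<in> Oc V" "g n = gm V a" using Suc.prems[of n] by (auto simp: stk_def)
  let ?N = "W \<inter> V"
  have N: "opn ?N" "y \<in> ?N" "?N \<subseteq> U" using V W by auto
  have e: "\<eta> \<in> ?N" using eta_in[OF N(1)] N(2) by blast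
  have shrink: "gm T b \<in> gm ?N ` Oc ?N" if "opn T" "?N \<subseteq> T" "b \<in> Oc T" for T b
    using ogerm_res[OF that(1,3) N(1) e that(2)] ores_closed[OF that(1) N(1) that(2,3)] by (metis imageI)
  have "g i \<in> gm ?N ` Oc ?N" if i: "i < Suc n" for i
  proof (cases "i = n")
    case True
    then show ?thesis using shrink[OF V(1) Int_lower2 V(3)] V(4) by simp
  next
    case False
    then have "g i \<in> gm W ` Oc W" using W(4)[of i] i by simp
    then obtain b where "b \<in> Oc W" "g i = gm W b" by blast
    then show ?thesis using shrink[OF W(1) Int_lower1] by simp
  qed
  then show ?case using N by blast
qed

lemma finite_typeE:
  assumes "coherent \<XX> F" "y \<in> topspace (spc \<XX>)"
  obtains U n \<mu> where "opn U" "y \<in> U" "omodule_hom (open_sub \<XX> U) (free_omodule \<XX> n) F \<mu>"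
    "\<And>N t x. opn N \<Longrightarrow> N \<subseteq> U \<Longrightarrow> t \<in> Mc N \<Longrightarrow> x \<in> N \<Longrightarrow>
      \<exists>V. opn V \<and> x \<in> V \<and> V \<subseteq> N \<and> (\<exists>s\<in>carrier (msec (free_omodule \<XX> n) V). \<mu> V s = mres F N V t)"
proof -
  obtain U n \<mu> where U: "opn U" "y \<in> U" "omodule_hom (open_sub \<XX> U) (free_omodule \<XX> n) F \<mu>"
    "omodule_surj (open_sub \<XX> U) (free_omodule \<XX> n) F \<mu>"
    using assms unfolding coherent_def finite_type_omodule_def by blast
  have "\<exists>V. opn V \<and> x \<in> V \<and> V \<subseteq> N \<and> (\<exists>s\<in>carrier (msec (free_omodule \<XX> n) V). \<mu> V s = mres F N V t)"
    if N: "opn N" "N \<subseteq> U" "t \<in> Mc N" "x \<in> N" for N t x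
  proof -
    have "\<exists>V. (opn V \<and> V \<subseteq> U) \<and> x \<in> V \<and> V \<subseteq> N \<and>
        (\<exists>s\<in>carrier (msec (free_omodule \<XX> n) V). \<mu> V s = mres F N V t)"
      using U(4)[unfolded omodule_surj_def openin_open_sub[OF U(1)], rule_format, OF conjI[OF N(1,2)] N(3,4)] .
    then show ?thesis by (elim exE conjE) (intro exI conjI; assumption)
  qed
  then show thesis using that U(1-3) by blast
qed

text \<open>Near the generic point \<open>v\<close> is a combination of the local generators at
  \<open>y\<close>. Multiplication by a common denominator from the local ring at \<open>y\<close>
  makes all coefficients regular near \<open>y\<close>.\<close>

lemma denominator:
  assumes coh: "coherent \<XX> F" and y: "y \<in> topspace (spc \<XX>)" and v: "v \<in> carrier ME"
  shows "\<exists>h\<in>stk y - {\<zero>\<^bsub>KK\<^esub>}. h \<odot>\<^bsub>ME\<^esub> v \<in> mstk y"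
proof -
  obtain U n \<mu> where U: "opn U" "y \<in> U" and hom: "omodule_hom (open_sub \<XX> U) (free_omodule \<XX> n) F \<mu>"
    and surj: "\<And>N t x. opn N \<Longrightarrow> N \<subseteq> U \<Longrightarrow> t \<in> Mc N \<Longrightarrow> x \<in> N \<Longrightarrow>
      \<exists>V. opn V \<and> x \<in> V \<and> V \<subseteq> N \<and> (\<exists>s\<in>carrier (msec (free_omodule \<XX> n) V). \<mu> V s = mres F N V t)"
    by (rule finite_typeE[OF coh y]) blast
  have eU: "\<eta> \<in> U" using eta_in[OF U(1)] U(2) by blast
  obtain N t where N: "opn N" "\<eta> \<in> N" "N \<subseteq> U" "t \<in> Mc N" "v = mg N t" by (rule mstalk_cases_in[OF v U(1) eU])
  obtain V c where V: "opn V" "\<eta> \<in> V" "V \<subseteq> N" and c: "c \<in> carrier (msec (free_omodule \<XX> n) V)" "\<mu> V c = mres F N V t"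
    using surj[OF N(1,3,4,2)] by blast
  have ci: "c i \<in> Oc V" if "i < n" for i using c(1) that by (auto simp: free_omodule_simps)
  obtain h where h: "h \<in> stk y" "h \<noteq> \<zero>\<^bsub>KK\<^esub>" "\<And>i. i < n \<Longrightarrow> h \<otimes>\<^bsub>KK\<^esub> gm V (c i) \<in> stk y"
    using common_denominator[OF y, of n "\<lambda>i. gm V (c i)"] ogerm_closed[OF V(1,2) ci] by blast
  have hK: "h \<in> carrier KK" using h(1) stk_carrier by blast
  \<comment> \<open>The extra index \<open>n\<close> stands for \<open>h\<close> itself, so that one
    neighbourhood \<open>W\<close> serves \<open>h\<close> and all of its products with the
    coefficients.\<close>
  have "(if i = n then h else h \<otimes>\<^bsub>KK\<^esub> gm V (c i)) \<in> stk y" if "i < Suc n" for i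
    using h(1) h(3)[of i] that by simp
  from common_nbhd[OF U this]
  obtain W where W0: "opn W \<and> y \<in> W \<and> W \<subseteq> U \<and>
      (\<forall>i<Suc n. (if i = n then h else h \<otimes>\<^bsub>KK\<^esub> gm V (c i)) \<in> gm W ` Oc W)" ..
  note W = W0[THEN conjunct1] W0[THEN conjunct2, THEN conjunct1]
    W0[THEN conjunct2, THEN conjunct2, THEN conjunct1] W0[THEN conjunct2, THEN conjunct2, THEN conjunct2, rule_format]
  have "h \<in> gm W ` Oc W" using W(4)[of n] by simp
  then obtain h0 where h0: "h0 \<in> Oc W" "h = gm W h0" by blast
  \<comment> \<open>Lifts the products of \<open>h\<close> with the coefficients to sections over
    \<open>W\<close>. Restriction to \<open>{..<n}\<close> makes the tuple a member of the
    extensional product.\<close>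
  define d where "d = (\<lambda>i\<in>{..<n}. SOME x. x \<in> Oc W \<and> gm W x = h \<otimes>\<^bsub>KK\<^esub> gm V (c i))"
  have d: "d i \<in> Oc W" "gm W (d i) = h \<otimes>\<^bsub>KK\<^esub> gm V (c i)" if "i < n" for i
  proof -
    have "h \<otimes>\<^bsub>KK\<^esub> gm V (c i) \<in> gm W ` Oc W" using W(4)[of i] that by simp
    then have "\<exists>x. x \<in> Oc W \<and> gm W x = h \<otimes>\<^bsub>KK\<^esub> gm V (c i)" by (metis imageE)
    from someI_ex[OF this] show "d i \<in> Oc W" "gm W (d i) = h \<otimes>\<^bsub>KK\<^esub> gm V (c i)" using that by (auto simp: d_def)
  qed
  have dc: "d \<in> carrier (msec (free_omodule \<XX> n) W)" using d(1) by (auto simp: free_omodule_simps d_def)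
  let ?V = "V \<inter> W"
  have V': "opn ?V" "\<eta> \<in> ?V" "?V \<subseteq> U" "?V \<subseteq> W" "?V \<subseteq> V" "?V \<subseteq> N"
    using V W eta_in[OF W(1)] N(3) by auto
  have VU: "V \<subseteq> U" using V(3) N(3) by blast
  interpret VV: cring "osec \<XX> ?V" by (rule osec_cring[OF V'(1)])
  let ?h = "ores \<XX> W ?V h0"
  have hV: "?h \<in> Oc ?V" "gm ?V ?h = h" using ores_closed[OF W(1) V'(1,4) h0(1)] ogerm_res[OF W(1) h0(1) V'(1,2,4)] h0(2) by auto
  let ?c = "mres (free_omodule \<XX> n) V ?V c"
  have cV: "?c \<in> carrier (msec (free_omodule \<XX> n) ?V)" "\<And>i. i < n \<Longrightarrow> ?c i = ores \<XX> V ?V (c i)"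
    using ci ores_closed[OF V(1) V'(1,5)] by (auto simp: free_omodule_simps)
  \<comment> \<open>Equality of the tuples is checked on generic germs, where it is the choice of
    \<open>d\<close>.\<close>
  have "mres (free_omodule \<XX> n) W ?V d = ?h \<odot>\<^bsub>msec (free_omodule \<XX> n) ?V\<^esub> ?c"
  proof
    fix i
    show "mres (free_omodule \<XX> n) W ?V d i = (?h \<odot>\<^bsub>msec (free_omodule \<XX> n) ?V\<^esub> ?c) i"
    proof (cases "i < n")
      case True
      have cr: "ores \<XX> V ?V (c i) \<in> Oc ?V" by (rule ores_closed[OF V(1) V'(1,5) ci[OF True]])
      have "ores \<XX> W ?V (d i) = ?h \<otimes>\<^bsub>osec \<XX> ?V\<^esub> ores \<XX> V ?V (c i)"
      proof (rule gm_inj[OF V'(1)])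
        show "ores \<XX> W ?V (d i) \<in> Oc ?V" by (rule ores_closed[OF W(1) V'(1,4) d(1)[OF True]])
        show "?h \<otimes>\<^bsub>osec \<XX> ?V\<^esub> ores \<XX> V ?V (c i) \<in> Oc ?V" by (rule VV.m_closed[OF hV(1) cr])
        show "gm ?V (ores \<XX> W ?V (d i)) = gm ?V (?h \<otimes>\<^bsub>osec \<XX> ?V\<^esub> ores \<XX> V ?V (c i))"
          using ogerm_res[OF W(1) d(1)[OF True] V'(1,2,4)] d(2)[OF True] ogerm_mult[OF V'(1,2) hV(1) cr]
            ogerm_res[OF V(1) ci[OF True] V'(1,2,5)] hV(2) by simp
      qed
      then show ?thesis using True by (simp add: free_omodule_simps)
    qed (simp add: free_omodule_simps)
  qed
  then have "mres F W ?V (\<mu> W d) = \<mu> ?V (?h \<odot>\<^bsub>msec (free_omodule \<XX> n) ?V\<^esub> ?c)"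
    using local_homD(4)[OF U(1) hom W(1,3) V'(1,4) dc] by simp
  also have "\<dots> = ?h \<odot>\<^bsub>msec F ?V\<^esub> \<mu> ?V ?c" by (rule local_homD(3)[OF U(1) hom V'(1,3) hV(1) cV(1)])
  also have "\<mu> ?V ?c = mres F V ?V (\<mu> V c)" by (rule local_homD(4)[OF U(1) hom V(1) VU V'(1,5) c(1)])
  also have "\<dots> = mres F N ?V t" unfolding c(2) by (rule mres_trans[OF N(1) V(1) V'(1,5) V(3) N(4)])
  finally have eq: "mres F W ?V (\<mu> W d) = ?h \<odot>\<^bsub>msec F ?V\<^esub> mres F N ?V t" .
  have mW: "\<mu> W d \<in> Mc W" by (rule local_homD(1)[OF U(1) hom W(1,3) dc])
  have "mg W (\<mu> W d) = mg ?V (?h \<odot>\<^bsub>msec F ?V\<^esub> mres F N ?V t)"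
    using mgerm_res[OF W(1) mW V'(1,2,4)] eq by simp
  also have "\<dots> = h \<odot>\<^bsub>ME\<^esub> v"
    using mgerm_smult[OF V'(1,2) hV(1) mres_closed[OF N(1) V'(1,6) N(4)]] hV(2) mgerm_res[OF N(1,4) V'(1,2,6)] N(5) by simp
  finally have "h \<odot>\<^bsub>ME\<^esub> v \<in> mstk y" using mstkI[OF W(1,2) mW] by simp
  then show ?thesis using h(1,2) by blast
qed

section \<open>Functionals extended to the generic stalk\<close>

abbreviation dual_hom where
  "dual_hom V \<alpha> \<equiv> omodule_hom (open_sub \<XX> V) F (structure_omodule \<XX>) \<alpha>"

lemmas dual_homD = local_homD[where G = "structure_omodule \<XX>", unfolded structure_omodule_simps]

text \<open>The value at \<open>v\<close> of the extension of the functional \<open>\<alpha>\<close> to the generic stalk.\<close>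

definition ev :: "'p set \<Rightarrow> ('p set \<Rightarrow> 'm \<Rightarrow> 'a) \<Rightarrow> ('p set \<times> 'm) set \<Rightarrow> ('p set \<times> 'a) set" where
  "ev V \<alpha> v = (SOME c. \<exists>N s. opn N \<and> \<eta> \<in> N \<and> N \<subseteq> V \<and> s \<in> Mc N \<and> v = mg N s \<and> c = gm N (\<alpha> N s))"

text \<open>Two representatives agree on a smaller open set and functionals commute with
  restriction, so the choice in \<open>ev\<close> does not matter.\<close>

lemma ev_germ:
  assumes V: "opn V" and a: "dual_hom V \<alpha>" and N: "opn N" "\<eta> \<in> N" "N \<subseteq> V" "s \<in> Mc N"
  shows "ev V \<alpha> (mg N s) = gm N (\<alpha> N s)"
proof -
  have "\<exists>c. \<exists>M t. opn M \<and> \<eta> \<in> M \<and> M \<subseteq> V \<and> t \<in> Mc M \<and> mg N s = mg M t \<and> c = gm M (\<alpha> M t)" using N by blast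
  from someI_ex[OF this] obtain M t where M: "opn M" "\<eta> \<in> M" "M \<subseteq> V" "t \<in> Mc M" "mg N s = mg M t"
    "ev V \<alpha> (mg N s) = gm M (\<alpha> M t)" unfolding ev_def by blast
  obtain W where W: "opn W" "\<eta> \<in> W" "W \<subseteq> N \<inter> M" "mres F N W s = mres F M W t"
    using M(5) mgerm_eq_iff[OF N(1,2,4) M(1,2,4)] by blast
  have sub: "W \<subseteq> N" "W \<subseteq> M" using W(3) by auto
  have "ores \<XX> N W (\<alpha> N s) = ores \<XX> M W (\<alpha> M t)"
    using dual_homD(4)[OF V a N(1,3) W(1) sub(1) N(4)] dual_homD(4)[OF V a M(1,3) W(1) sub(2) M(4)] W(4) by simp
  then have "gm N (\<alpha> N s) = gm M (\<alpha> M t)"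
    using ogerm_res[OF N(1) dual_homD(1)[OF V a N(1,3,4)] W(1,2) sub(1)]
      ogerm_res[OF M(1) dual_homD(1)[OF V a M(1,3,4)] W(1,2) sub(2)] by simp
  then show ?thesis using M(6) by simp
qed

lemma ev_germ':
  assumes V: "opn V" "V \<noteq> {}" and a: "dual_hom V \<alpha>" and N: "opn N" "\<eta> \<in> N" "s \<in> Mc N"
  shows "ev V \<alpha> (mg N s) = gm (N \<inter> V) (\<alpha> (N \<inter> V) (mres F N (N \<inter> V) s))"
proof -
  have W: "opn (N \<inter> V)" "\<eta> \<in> N \<inter> V" using N V eta_in[OF V] by auto
  show ?thesis
    using ev_germ[OF V(1) a W Int_lower2 mres_closed[OF N(1) W(1) Int_lower1 N(3)]]
      mgerm_res[OF N(1,3) W Int_lower1] by simp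
qed

lemma ev_closed:
  assumes V: "opn V" "V \<noteq> {}" and a: "dual_hom V \<alpha>" and v: "v \<in> carrier ME"
  shows "ev V \<alpha> v \<in> carrier KK"
proof -
  obtain N s where N: "opn N" "\<eta> \<in> N" "N \<subseteq> V" "s \<in> Mc N" "v = mg N s" by (rule mstalk_cases_in[OF v V(1) eta_in[OF V]])
  then show ?thesis using ev_germ[OF V(1) a N(1-4)] ogerm_closed[OF N(1,2) dual_homD(1)[OF V(1) a N(1,3,4)]] by simp
qed

lemma ev_smult:
  assumes V: "opn V" "V \<noteq> {}" and a: "dual_hom V \<alpha>" and f: "f \<in> carrier KK" and v: "v \<in> carrier ME"
  shows "ev V \<alpha> (f \<odot>\<^bsub>ME\<^esub> v) = f \<otimes>\<^bsub>KK\<^esub> ev V \<alpha> v"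
proof -
  obtain U b s where U: "opn U" "\<eta> \<in> U" "b \<in> Oc U" "s \<in> Mc U" "f = gm U b" "v = mg U s" by (rule mstalk_cases2[OF f v])
  let ?N = "U \<inter> V"
  have N: "opn ?N" "\<eta> \<in> ?N" using U V eta_in[OF V] by auto
  have c: "ores \<XX> U ?N b \<in> Oc ?N" "mres F U ?N s \<in> Mc ?N"
    using ores_closed[OF U(1) N(1) Int_lower1 U(3)] mres_closed[OF U(1) N(1) Int_lower1 U(4)] by auto
  have "ev V \<alpha> (f \<odot>\<^bsub>ME\<^esub> v) = gm ?N (\<alpha> ?N (ores \<XX> U ?N b \<odot>\<^bsub>msec F ?N\<^esub> mres F U ?N s))"
    unfolding U(5,6) mgerm_smult[OF U(1-4)] ev_germ'[OF V a U(1,2) msmult_closed[OF U(1,3,4)]]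
      mres_smult[OF U(1) N(1) Int_lower1 U(3,4)] ..
  also have "\<dots> = gm ?N (ores \<XX> U ?N b) \<otimes>\<^bsub>KK\<^esub> gm ?N (\<alpha> ?N (mres F U ?N s))"
    unfolding dual_homD(3)[OF V(1) a N(1) Int_lower2 c]
    using ogerm_mult[OF N c(1) dual_homD(1)[OF V(1) a N(1) Int_lower2 c(2)]] by simp
  also have "\<dots> = f \<otimes>\<^bsub>KK\<^esub> ev V \<alpha> v"
    using ogerm_res[OF U(1,3) N Int_lower1] ev_germ'[OF V a U(1,2,4)] U(5,6) by simp
  finally show ?thesis .
qed

lemma ev_add:
  assumes V: "opn V" "V \<noteq> {}" and a: "dual_hom V \<alpha>" and U: "opn U" "\<eta> \<in> U" "s \<in> Mc U" "t \<in> Mc U"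
  shows "ev V \<alpha> (mg U (s \<oplus>\<^bsub>msec F U\<^esub> t)) = ev V \<alpha> (mg U s) \<oplus>\<^bsub>KK\<^esub> ev V \<alpha> (mg U t)"
proof -
  let ?N = "U \<inter> V"
  have N: "opn ?N" "\<eta> \<in> ?N" using U V eta_in[OF V] by auto
  have c: "mres F U ?N s \<in> Mc ?N" "mres F U ?N t \<in> Mc ?N"
    using mres_closed[OF U(1) N(1) Int_lower1] U(3,4) by auto
  show ?thesis
    unfolding ev_germ'[OF V a U(1,2,3)] ev_germ'[OF V a U(1,2,4)] ev_germ'[OF V a U(1,2) madd_closed[OF U(1,3,4)]]
      mres_add[OF U(1) N(1) Int_lower1 U(3,4)] dual_homD(2)[OF V(1) a N(1) Int_lower2 c]
    using ogerm_add[OF N dual_homD(1)[OF V(1) a N(1) Int_lower2 c(1)] dual_homD(1)[OF V(1) a N(1) Int_lower2 c(2)]] by simp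
qed

lemma ev_stk:
  assumes V: "opn V" and a: "dual_hom V \<alpha>" and y: "y \<in> V" and v: "v \<in> mstk y"
  shows "ev V \<alpha> v \<in> stk y"
proof -
  obtain N s where N: "opn N" "y \<in> N" "s \<in> Mc N" "v = mg N s" using v by (auto simp: mstk_def)
  have Vne: "V \<noteq> {}" using y by blast
  have W: "opn (N \<inter> V)" "y \<in> N \<inter> V" using N V y by auto
  have eN: "\<eta> \<in> N" using eta_in[OF N(1)] N(2) by blast
  have "\<alpha> (N \<inter> V) (mres F N (N \<inter> V) s) \<in> Oc (N \<inter> V)"
    by (rule dual_homD(1)[OF V a W(1) Int_lower2 mres_closed[OF N(1) W(1) Int_lower1 N(3)]])
  then show ?thesis using ev_germ'[OF V Vne a N(1) eN N(3)] N(4) W unfolding stk_def by blast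
qed

lemma ev_zero:
  assumes V: "opn V" "V \<noteq> {}" and a: "dual_hom V \<alpha>"
  shows "ev V \<alpha> \<zero>\<^bsub>ME\<^esub> = \<zero>\<^bsub>KK\<^esub>"
  using ev_smult[OF V a K.zero_closed ME_zero_closed] ME_smult_zero[OF ME_zero_closed] ev_closed[OF V a ME_zero_closed] by simp

text \<open>Near \<open>y\<close> the module is generated by finitely many sections, whose images under the functional
  have a common denominator \<open>h\<close>.\<close>

lemma ev_bound:
  assumes coh: "coherent \<XX> F" and y: "y \<in> topspace (spc \<XX>)" and V: "opn V" "V \<noteq> {}" and a: "dual_hom V \<alpha>"
  shows "\<exists>h\<in>stk y - {\<zero>\<^bsub>KK\<^esub>}. \<forall>v\<in>mstk y. h \<otimes>\<^bsub>KK\<^esub> ev V \<alpha> v \<in> stk y"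
proof -
  obtain U n \<mu> where U: "opn U" "y \<in> U" and hom: "omodule_hom (open_sub \<XX> U) (free_omodule \<XX> n) F \<mu>"
    and surj: "\<And>N t x. opn N \<Longrightarrow> N \<subseteq> U \<Longrightarrow> t \<in> Mc N \<Longrightarrow> x \<in> N \<Longrightarrow>
      \<exists>V. opn V \<and> x \<in> V \<and> V \<subseteq> N \<and> (\<exists>s\<in>carrier (msec (free_omodule \<XX> n) V). \<mu> V s = mres F N V t)"
    by (rule finite_typeE[OF coh y]) blast
  note SE = subringE[OF subring_stk[OF y]]
  have eU: "\<eta> \<in> U" using eta_in[OF U(1)] U(2) by blast
  interpret OU: cring "osec \<XX> U" by (rule osec_cring[OF U(1)])
  \<comment> \<open>The unit vectors, whose images are the local generators.\<close>
  define \<epsilon> where "\<epsilon> i = (\<lambda>j\<in>{..<n}. if j = i then \<one>\<^bsub>osec \<XX> U\<^esub> else \<zero>\<^bsub>osec \<XX> U\<^esub>)" for i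
  have ec: "\<epsilon> i \<in> carrier (msec (free_omodule \<XX> n) U)" for i by (auto simp: free_omodule_simps \<epsilon>_def)
  have mec: "\<mu> U (\<epsilon> i) \<in> Mc U" for i by (rule local_homD(1)[OF U(1) hom U(1) order_refl ec])
  define c where "c i = ev V \<alpha> (mg U (\<mu> U (\<epsilon> i)))" for i
  have cK: "c i \<in> carrier KK" for i unfolding c_def by (rule ev_closed[OF V a mgerm_closed[OF U(1) eU mec]])
  obtain h where h: "h \<in> stk y" "h \<noteq> \<zero>\<^bsub>KK\<^esub>" "\<And>i. i < n \<Longrightarrow> h \<otimes>\<^bsub>KK\<^esub> c i \<in> stk y"
    using common_denominator[OF y, of n c] cK by blast
  have hK: "h \<in> carrier KK" using h(1) stk_carrier by blast
  have "h \<otimes>\<^bsub>KK\<^esub> ev V \<alpha> v \<in> stk y" if v: "v \<in> mstk y" for v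
  proof -
    obtain N s where N: "opn N" "y \<in> N" "s \<in> Mc N" "v = mg N s" using v by (auto simp: mstk_def)
    let ?N = "N \<inter> U"
    have N': "opn ?N" "y \<in> ?N" using N U by auto
    have sN: "mres F N ?N s \<in> Mc ?N" by (rule mres_closed[OF N(1) N'(1) Int_lower1 N(3)])
    obtain W d where W: "opn W" "y \<in> W" "W \<subseteq> ?N" and d: "d \<in> carrier (msec (free_omodule \<XX> n) W)" "\<mu> W d = mres F ?N W (mres F N ?N s)"
      using surj[OF N'(1) Int_lower2 sN N'(2)] by blast
    have WN: "W \<subseteq> N" "W \<subseteq> U" using W(3) by auto
    have eW: "\<eta> \<in> W" using eta_in[OF W(1)] W(2) by blast
    interpret OW: cring "osec \<XX> W" by (rule osec_cring[OF W(1)])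
    interpret UW: ring_hom_cring "osec \<XX> U" "osec \<XX> W" "ores \<XX> U W" by (rule ores_ring_hom_cring[OF U(1) W(1) WN(2)])
    have "\<mu> W d = mres F N W s" unfolding d(2) by (rule mres_trans[OF N(1) N'(1) W(1,3) Int_lower1 N(3)])
    then have vW: "v = mg W (\<mu> W d)" using mgerm_res[OF N(1,3) W(1) eW WN(1)] N(4) by simp
    have muW: "\<mu> W x \<in> Mc W" if "x \<in> carrier (msec (free_omodule \<XX> n) W)" for x
      by (rule local_homD(1)[OF U(1) hom W(1) WN(2) that])
    let ?e = "\<lambda>i. mres (free_omodule \<XX> n) U W (\<epsilon> i)"
    have e': "?e i \<in> carrier (msec (free_omodule \<XX> n) W)" for i
      using ec ores_closed[OF U(1) W(1) WN(2)] by (auto simp: free_omodule_simps)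
    \<comment> \<open>Induction on the number \<open>m\<close> of coordinates that may be nonzero;
      the last of them is split off as a multiple of a unit vector.\<close>
    have "h \<otimes>\<^bsub>KK\<^esub> ev V \<alpha> (mg W (\<mu> W x)) \<in> stk y"
      if "x \<in> carrier (msec (free_omodule \<XX> n) W)" "\<And>j. m \<le> j \<Longrightarrow> j < n \<Longrightarrow> x j = \<zero>\<^bsub>osec \<XX> W\<^esub>" "m \<le> n" for x m
      using that
    proof (induction m arbitrary: x)
      case 0
      \<comment> \<open>The zero vector is its own multiple by zero, so compatibility with scalars
        gives \<open>\<mu> W x\<close> as a multiple by zero.\<close>
      have xe: "x = \<zero>\<^bsub>osec \<XX> W\<^esub> \<odot>\<^bsub>msec (free_omodule \<XX> n) W\<^esub> x"
      proof
        fix j show "x j = (\<zero>\<^bsub>osec \<XX> W\<^esub> \<odot>\<^bsub>msec (free_omodule \<XX> n) W\<^esub> x) j"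
        proof (cases "j < n")
          case True
          then have "x j = \<zero>\<^bsub>osec \<XX> W\<^esub>" using 0(2)[of j] by simp
          then show ?thesis using True by (simp add: free_omodule_simps(3))
        next
          case False
          have "x j = undefined" by (rule PiE_arb[OF 0(1)[unfolded free_omodule_simps]]) (use False in simp)
          then show ?thesis using False by (simp add: free_omodule_simps(3))
        qed
      qed
      have "\<mu> W x = \<zero>\<^bsub>osec \<XX> W\<^esub> \<odot>\<^bsub>msec F W\<^esub> \<mu> W x"
        using local_homD(3)[OF U(1) hom W(1) WN(2) OW.zero_closed 0(1)] unfolding xe[symmetric] .
      then have "\<mu> W x = \<zero>\<^bsub>msec F W\<^esub>" using msmult_zero[OF W(1) muW[OF 0(1)]] by (rule trans)
      then have "h \<otimes>\<^bsub>KK\<^esub> ev V \<alpha> (mg W (\<mu> W x)) = \<zero>\<^bsub>KK\<^esub>"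
        using mgerm_zero[OF W(1) eW] ev_zero[OF V a] hK by simp
      then show ?case using SE(2) by simp
    next
      case (Suc m)
      have m: "m < n" using Suc.prems(3) by simp
      define x' where "x' = x(m := \<zero>\<^bsub>osec \<XX> W\<^esub>)"
      have xi: "x i \<in> Oc W" if "i < n" for i using Suc.prems(1) that by (auto simp: free_omodule_simps)
      have x': "x' \<in> carrier (msec (free_omodule \<XX> n) W)"
        using Suc.prems(1) m by (auto simp: free_omodule_simps x'_def PiE_iff extensional_def)
      have "x' j = \<zero>\<^bsub>osec \<XX> W\<^esub>" if "m \<le> j" "j < n" for j
        using Suc.prems(2)[of j] that by (cases "j = m") (auto simp: x'_def)
      then have IH: "h \<otimes>\<^bsub>KK\<^esub> ev V \<alpha> (mg W (\<mu> W x')) \<in> stk y" using Suc.IH[OF x'] m by simp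
      have em: "x m \<odot>\<^bsub>msec (free_omodule \<XX> n) W\<^esub> ?e m \<in> carrier (msec (free_omodule \<XX> n) W)"
        using e'[of m] xi[OF m] by (auto simp: free_omodule_simps Pi_iff intro!: OW.m_closed)
      have xe: "x = x' \<oplus>\<^bsub>msec (free_omodule \<XX> n) W\<^esub> (x m \<odot>\<^bsub>msec (free_omodule \<XX> n) W\<^esub> ?e m)"
      proof
        fix j
        show "x j = (x' \<oplus>\<^bsub>msec (free_omodule \<XX> n) W\<^esub> (x m \<odot>\<^bsub>msec (free_omodule \<XX> n) W\<^esub> ?e m)) j"
        proof (cases "j < n")
          case True
          then show ?thesis using xi[OF True] xi[OF m] by (simp add: free_omodule_simps x'_def \<epsilon>_def)
        next
          case False
          have "x j = undefined" by (rule PiE_arb[OF Suc.prems(1)[unfolded free_omodule_simps]]) (use False in simp)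
          then show ?thesis using False by (simp add: free_omodule_simps(2))
        qed
      qed
      have "\<mu> W x = \<mu> W x' \<oplus>\<^bsub>msec F W\<^esub> \<mu> W (x m \<odot>\<^bsub>msec (free_omodule \<XX> n) W\<^esub> ?e m)"
        using local_homD(2)[OF U(1) hom W(1) WN(2) x' em] unfolding xe[symmetric] .
      also have "\<mu> W (x m \<odot>\<^bsub>msec (free_omodule \<XX> n) W\<^esub> ?e m) = x m \<odot>\<^bsub>msec F W\<^esub> \<mu> W (?e m)"
        by (rule local_homD(3)[OF U(1) hom W(1) WN(2) xi[OF m] e'])
      finally have mux: "\<mu> W x = \<mu> W x' \<oplus>\<^bsub>msec F W\<^esub> x m \<odot>\<^bsub>msec F W\<^esub> \<mu> W (?e m)" .
      have "\<mu> W (?e m) = mres F U W (\<mu> U (\<epsilon> m))" by (rule local_homD(4)[OF U(1) hom U(1) order_refl W(1) WN(2) ec])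
      then have mge: "mg W (\<mu> W (?e m)) = mg U (\<mu> U (\<epsilon> m))" using mgerm_res[OF U(1) mec W(1) eW WN(2)] by simp
      have xK: "gm W (x m) \<in> carrier KK" "gm W (x m) \<in> stk y"
        using ogerm_closed[OF W(1) eW xi[OF m]] W(1,2) xi[OF m] by (auto simp: stk_def)
      have "ev V \<alpha> (mg W (x m \<odot>\<^bsub>msec F W\<^esub> \<mu> W (?e m))) = gm W (x m) \<otimes>\<^bsub>KK\<^esub> c m"
        unfolding mgerm_smult[OF W(1) eW xi[OF m] muW[OF e'], symmetric] mge c_def
        by (rule ev_smult[OF V a xK(1) mgerm_closed[OF U(1) eU mec]])
      then have "ev V \<alpha> (mg W (\<mu> W x)) = ev V \<alpha> (mg W (\<mu> W x')) \<oplus>\<^bsub>KK\<^esub> gm W (x m) \<otimes>\<^bsub>KK\<^esub> c m"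
        unfolding mux using ev_add[OF V a W(1) eW muW[OF x'] msmult_closed[OF W(1) xi[OF m] muW[OF e']]] by simp
      then have "h \<otimes>\<^bsub>KK\<^esub> ev V \<alpha> (mg W (\<mu> W x)) =
          h \<otimes>\<^bsub>KK\<^esub> ev V \<alpha> (mg W (\<mu> W x')) \<oplus>\<^bsub>KK\<^esub> gm W (x m) \<otimes>\<^bsub>KK\<^esub> (h \<otimes>\<^bsub>KK\<^esub> c m)"
        using hK xK(1) cK ev_closed[OF V a mgerm_closed[OF W(1) eW muW[OF x']]] by (simp add: K.r_distr K.m_lcomm)
      then show ?case using SE(7)[OF IH SE(6)[OF xK(2) h(3)[OF m]]] by simp
    qed
    from this[OF d(1), of n] show ?thesis unfolding vW by simp
  qed
  then show ?thesis using h(1,2) by blast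
qed

end

section \<open>Reflexive modules and their Weil decorations\<close>

context omod
begin

interpretation K: field KK by (rule KK_field)

text \<open>The empty set does not contain the generic point; it is settled by the uniqueness of its
  section.\<close>

lemma osec_eqI:
  assumes "opn V" "x \<in> Oc V" "y \<in> Oc V" "V \<noteq> {} \<Longrightarrow> gm V x = gm V y"
  shows "x = y"
proof (cases "V = {}")
  case True
  show ?thesis by (rule sheaf_empty_section[OF osheaf]) (use assms True in auto)
next
  case False
  then show ?thesis using gm_inj[OF assms(1-3)] assms(4) by blast
qed

lemma dual_carrier:
  "\<alpha> \<in> carrier (msec (dual_omodule \<XX> F) V) \<longleftrightarrow> dual_hom V \<alpha> \<and> cut_hom \<XX> F V \<alpha> = \<alpha>"
  by (simp add: dual_omodule_def)

lemma cut_hom_eq: "opn U \<Longrightarrow> U \<subseteq> V \<Longrightarrow> s \<in> carrier (msec G U) \<Longrightarrow> cut_hom \<XX> G V \<gamma> U s = \<gamma> U s"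
  by (simp add: cut_hom_def)

lemma cut_hom_idem: "cut_hom \<XX> G V (cut_hom \<XX> G V \<gamma>) = cut_hom \<XX> G V \<gamma>"
  by (simp add: cut_hom_def fun_eq_iff)

text \<open>Members of the dual are normalized outside their domain, and cutting normalizes an
  arbitrary functional.\<close>

lemma cut_dual:
  assumes V: "opn V" and h: "dual_hom V \<gamma>"
  shows "cut_hom \<XX> F V \<gamma> \<in> carrier (msec (dual_omodule \<XX> F) V)"
proof -
  note D = dual_homD[OF V h]
  have "dual_hom V (cut_hom \<XX> F V \<gamma>)"
  proof (rule local_homI[OF V], unfold structure_omodule_simps)
    fix U s assume U: "opn U" "U \<subseteq> V" and s: "s \<in> Mc U"
    show "cut_hom \<XX> F V \<gamma> U s \<in> Oc U" using D(1)[OF U s] cut_hom_eq[OF U s, of \<gamma>] by simp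
    { fix t assume t: "t \<in> Mc U"
      show "cut_hom \<XX> F V \<gamma> U (s \<oplus>\<^bsub>msec F U\<^esub> t) = cut_hom \<XX> F V \<gamma> U s \<oplus>\<^bsub>osec \<XX> U\<^esub> cut_hom \<XX> F V \<gamma> U t"
        using D(2)[OF U s t] cut_hom_eq[OF U s, of \<gamma>] cut_hom_eq[OF U t, of \<gamma>] cut_hom_eq[OF U madd_closed[OF U(1) s t], of \<gamma>] by simp }
    { fix a assume a: "a \<in> Oc U"
      show "cut_hom \<XX> F V \<gamma> U (a \<odot>\<^bsub>msec F U\<^esub> s) = a \<otimes>\<^bsub>osec \<XX> U\<^esub> cut_hom \<XX> F V \<gamma> U s"
        using D(3)[OF U a s] cut_hom_eq[OF U s, of \<gamma>] cut_hom_eq[OF U msmult_closed[OF U(1) a s], of \<gamma>] by simp }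
    fix W assume W: "opn W" "W \<subseteq> U"
    show "cut_hom \<XX> F V \<gamma> W (mres F U W s) = ores \<XX> U W (cut_hom \<XX> F V \<gamma> U s)"
      using D(4)[OF U W s] cut_hom_eq[OF U s, of \<gamma>] cut_hom_eq[OF W(1) order_trans[OF W(2) U(2)] mres_closed[OF U(1) W s], of \<gamma>] by simp
  qed
  then show ?thesis unfolding dual_carrier cut_hom_idem by simp
qed

lemma dual_hom_restrict:
  assumes V: "opn V" and h: "dual_hom V \<gamma>" and W: "opn W" "W \<subseteq> V"
  shows "dual_hom W \<gamma>"
proof -
  have sub: "U \<subseteq> V" if "U \<subseteq> W" for U using that W(2) by blast
  show ?thesis
    by (rule local_homI[OF W(1)], unfold structure_omodule_simps)
      (auto intro: dual_homD(1)[OF V h _ sub] dual_homD(2)[OF V h _ sub] dual_homD(3)[OF V h _ sub] dual_homD(4)[OF V h _ sub])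
qed

lemma dual_hom_add:
  assumes V: "opn V" and a: "dual_hom V \<alpha>" and b: "dual_hom V \<beta>"
  shows "dual_hom V (\<lambda>N s. \<alpha> N s \<oplus>\<^bsub>osec \<XX> N\<^esub> \<beta> N s)"
proof (rule local_homI[OF V], unfold structure_omodule_simps)
  note A = dual_homD[OF V a] and B = dual_homD[OF V b]
  fix U s assume U: "opn U" "U \<subseteq> V" and s: "s \<in> Mc U"
  interpret O: cring "osec \<XX> U" by (rule osec_cring[OF U(1)])
  note c = A(1)[OF U s] B(1)[OF U s]
  show "\<alpha> U s \<oplus>\<^bsub>osec \<XX> U\<^esub> \<beta> U s \<in> Oc U" using c by simp
  { fix t assume t: "t \<in> Mc U"
    show "\<alpha> U (s \<oplus>\<^bsub>msec F U\<^esub> t) \<oplus>\<^bsub>osec \<XX> U\<^esub> \<beta> U (s \<oplus>\<^bsub>msec F U\<^esub> t) =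
        (\<alpha> U s \<oplus>\<^bsub>osec \<XX> U\<^esub> \<beta> U s) \<oplus>\<^bsub>osec \<XX> U\<^esub> (\<alpha> U t \<oplus>\<^bsub>osec \<XX> U\<^esub> \<beta> U t)"
      unfolding A(2)[OF U s t] B(2)[OF U s t] using c A(1)[OF U t] B(1)[OF U t] by (simp add: O.a_ac) }
  { fix x assume x: "x \<in> Oc U"
    show "\<alpha> U (x \<odot>\<^bsub>msec F U\<^esub> s) \<oplus>\<^bsub>osec \<XX> U\<^esub> \<beta> U (x \<odot>\<^bsub>msec F U\<^esub> s) = x \<otimes>\<^bsub>osec \<XX> U\<^esub> (\<alpha> U s \<oplus>\<^bsub>osec \<XX> U\<^esub> \<beta> U s)"
      unfolding A(3)[OF U x s] B(3)[OF U x s] using c x by (simp add: O.r_distr) }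
  fix W assume W: "opn W" "W \<subseteq> U"
  show "\<alpha> W (mres F U W s) \<oplus>\<^bsub>osec \<XX> W\<^esub> \<beta> W (mres F U W s) = ores \<XX> U W (\<alpha> U s \<oplus>\<^bsub>osec \<XX> U\<^esub> \<beta> U s)"
    unfolding A(4)[OF U W s] B(4)[OF U W s] using ring_hom_add[OF ores_hom[OF U(1) W] c] by simp
qed

lemma dual_hom_smult:
  assumes V: "opn V" and a: "dual_hom V \<alpha>" and r: "r \<in> Oc V"
  shows "dual_hom V (\<lambda>N s. ores \<XX> V N r \<otimes>\<^bsub>osec \<XX> N\<^esub> \<alpha> N s)"
proof (rule local_homI[OF V], unfold structure_omodule_simps)
  note A = dual_homD[OF V a]
  fix U s assume U: "opn U" "U \<subseteq> V" and s: "s \<in> Mc U"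
  interpret O: cring "osec \<XX> U" by (rule osec_cring[OF U(1)])
  have rU: "ores \<XX> V U r \<in> Oc U" by (rule ores_closed[OF V U r])
  note c = A(1)[OF U s]
  show "ores \<XX> V U r \<otimes>\<^bsub>osec \<XX> U\<^esub> \<alpha> U s \<in> Oc U" using c rU by simp
  { fix t assume t: "t \<in> Mc U"
    show "ores \<XX> V U r \<otimes>\<^bsub>osec \<XX> U\<^esub> \<alpha> U (s \<oplus>\<^bsub>msec F U\<^esub> t) =
        ores \<XX> V U r \<otimes>\<^bsub>osec \<XX> U\<^esub> \<alpha> U s \<oplus>\<^bsub>osec \<XX> U\<^esub> ores \<XX> V U r \<otimes>\<^bsub>osec \<XX> U\<^esub> \<alpha> U t"
      unfolding A(2)[OF U s t] using c rU A(1)[OF U t] by (simp add: O.r_distr) }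
  { fix x assume x: "x \<in> Oc U"
    show "ores \<XX> V U r \<otimes>\<^bsub>osec \<XX> U\<^esub> \<alpha> U (x \<odot>\<^bsub>msec F U\<^esub> s) = x \<otimes>\<^bsub>osec \<XX> U\<^esub> (ores \<XX> V U r \<otimes>\<^bsub>osec \<XX> U\<^esub> \<alpha> U s)"
      unfolding A(3)[OF U x s] using c x rU by (simp add: O.m_lcomm) }
  fix W assume W: "opn W" "W \<subseteq> U"
  show "ores \<XX> V W r \<otimes>\<^bsub>osec \<XX> W\<^esub> \<alpha> W (mres F U W s) = ores \<XX> U W (ores \<XX> V U r \<otimes>\<^bsub>osec \<XX> U\<^esub> \<alpha> U s)"
    unfolding A(4)[OF U W s] using ring_hom_mult[OF ores_hom[OF U(1) W] rU c]
      ores_trans[OF V U(1) W(1,2) U(2) r] by simp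
qed

lemma ev_cong:
  assumes V: "opn V" "V \<noteq> {}" and a: "dual_hom V \<alpha>" and W: "opn W" "W \<noteq> {}" "W \<subseteq> V" and b: "dual_hom W \<beta>"
    and v: "v \<in> carrier ME" and eq: "\<And>N s. opn N \<Longrightarrow> N \<subseteq> W \<Longrightarrow> s \<in> Mc N \<Longrightarrow> \<beta> N s = \<alpha> N s"
  shows "ev W \<beta> v = ev V \<alpha> v"
proof -
  obtain N s where N: "opn N" "\<eta> \<in> N" "N \<subseteq> W" "s \<in> Mc N" "v = mg N s" by (rule mstalk_cases_in[OF v W(1) eta_in[OF W(1,2)]])
  show ?thesis unfolding N(5) ev_germ[OF W(1) b N(1-4)] ev_germ[OF V(1) a N(1,2) order_trans[OF N(3) W(3)] N(4)]
    using eq[OF N(1,3,4)] by simp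
qed

end

locale reflexive_mod = omod +
  assumes reflexive: "reflexive \<XX> F"
begin

interpretation K: field KK by (rule KK_field)

lemma coherent: "coherent \<XX> F" using reflexive by (simp add: reflexive_def)

lemma bidual_bij:
  assumes "opn U"
  shows "bij_betw (bidual_map \<XX> F U) (Mc U) (carrier (msec (dual_omodule \<XX> (dual_omodule \<XX> F)) U))"
  using reflexive assms by (simp add: reflexive_def)

text \<open>Injectivity of the bidual map. By \<open>osec_eqI\<close>, only the germs of values over
  nonempty open sets are left to compare.\<close>

lemma bidual_eqI:
  assumes W: "opn W" "s \<in> Mc W" "t \<in> Mc W"
    and eq: "\<And>V \<alpha>. opn V \<Longrightarrow> V \<noteq> {} \<Longrightarrow> V \<subseteq> W \<Longrightarrow> dual_hom V \<alpha> \<Longrightarrow> cut_hom \<XX> F V \<alpha> = \<alpha> \<Longrightarrow>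
      gm V (\<alpha> V (mres F W V s)) = gm V (\<alpha> V (mres F W V t))"
  shows "s = t"
proof -
  have "bidual_map \<XX> F W s = bidual_map \<XX> F W t"
  proof (rule ext, rule ext)
    fix V \<alpha>
    show "bidual_map \<XX> F W s V \<alpha> = bidual_map \<XX> F W t V \<alpha>"
    proof (cases "opn V \<and> V \<subseteq> W \<and> \<alpha> \<in> carrier (msec (dual_omodule \<XX> F) V)")
      case True
      then have V: "opn V" "V \<subseteq> W" and a: "dual_hom V \<alpha>" "cut_hom \<XX> F V \<alpha> = \<alpha>" by (simp_all add: dual_carrier)
      have "\<alpha> V (mres F W V s) = \<alpha> V (mres F W V t)"
        by (rule osec_eqI[OF V(1) dual_homD(1)[OF V(1) a(1) V(1) order_refl mres_closed[OF W(1) V W(2)]]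
              dual_homD(1)[OF V(1) a(1) V(1) order_refl mres_closed[OF W(1) V W(3)]] eq[OF V(1) _ V(2) a]])
      then show ?thesis using True by (simp add: bidual_map_def cut_hom_def)
    qed (auto simp: bidual_map_def cut_hom_def)
  qed
  then show ?thesis using inj_onD[OF bij_betw_imp_inj_on[OF bidual_bij[OF W(1)]]] W(2,3) by blast
qed

lemma dual_germ:
  assumes W: "opn W" "s \<in> Mc W" and V: "opn V" "V \<noteq> {}" "V \<subseteq> W" and a: "dual_hom V \<alpha>"
  shows "gm V (\<alpha> V (mres F W V s)) = ev V \<alpha> (mg W s)"
  using ev_germ[OF V(1) a V(1) eta_in[OF V(1,2)] order_refl mres_closed[OF W(1) V(1,3) W(2)]]
    mgerm_res[OF W V(1) eta_in[OF V(1,2)] V(3)] by simp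

text \<open>Values of functionals depend only on the generic germ (\<open>dual_germ\<close>), so
  sections with equal germs have the same image in the bidual.\<close>

lemma mg_inj:
  assumes W: "opn W" "s \<in> Mc W" "t \<in> Mc W" and eq: "mg W s = mg W t"
  shows "s = t"
  by (rule bidual_eqI[OF W]) (simp add: dual_germ[OF W(1,2)] dual_germ[OF W(1,3)] eq)

text \<open>Otherwise a section representing \<open>e\<close> has the same image in the bidual as
  zero.\<close>

lemma detecting_functional:
  assumes e: "e \<in> carrier ME" "e \<noteq> \<zero>\<^bsub>ME\<^esub>"
  obtains V \<alpha> where "opn V" "V \<noteq> {}" "dual_hom V \<alpha>" "ev V \<alpha> e \<noteq> \<zero>\<^bsub>KK\<^esub>"
proof (rule ccontr)
  assume "\<not> thesis"
  then have no: "\<And>V \<alpha>. opn V \<Longrightarrow> V \<noteq> {} \<Longrightarrow> dual_hom V \<alpha> \<Longrightarrow> ev V \<alpha> e = \<zero>\<^bsub>KK\<^esub>" using that by blast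
  obtain N s where N: "opn N" "\<eta> \<in> N" "s \<in> Mc N" "e = mg N s" by (rule mstalk_cases[OF e(1)])
  have "s = \<zero>\<^bsub>msec F N\<^esub>"
  proof (rule bidual_eqI[OF N(1,3) mzero_closed[OF N(1)]])
    fix V \<alpha> assume V: "opn V" "V \<noteq> {}" "V \<subseteq> N" and a: "dual_hom V \<alpha>"
    show "gm V (\<alpha> V (mres F N V s)) = gm V (\<alpha> V (mres F N V \<zero>\<^bsub>msec F N\<^esub>))"
      unfolding dual_germ[OF N(1,3) V a] dual_germ[OF N(1) mzero_closed[OF N(1)] V a] mgerm_zero[OF N(1,2)]
        ev_zero[OF V(1,2) a] using no[OF V(1,2) a] N(4) by simp
  qed
  then show False using mgerm_zero[OF N(1,2)] N(4) e(2) by simp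
qed

end

section \<open>Sections from stalks, existence and uniqueness of the decoration\<close>

locale normal_reflexive = reflexive_mod \<XX> F + normal_sch \<XX>
  for \<XX> :: "('p, 'a) ringed_space" and F :: "('p, 'a, 'm) omodule"
begin

interpretation K: field KK by (rule KK_field)

text \<open>By Hartogs, evaluation at \<open>v\<close> is an element of the bidual, hence comes from a section.\<close>

lemma section_of_stalks:
  assumes U: "opn U" "U \<noteq> {}" and v: "v \<in> carrier ME"
    and all: "\<And>P. prime_divisor \<XX> P \<Longrightarrow> P \<inter> U \<noteq> {} \<Longrightarrow> v \<in> mstk (gpt P)"
  shows "v \<in> mg U ` Mc U"
proof -
  let ?D = "dual_omodule \<XX> F"
  have ev_sec: "ev V \<alpha> v \<in> gm V ` Oc V" if V: "opn V" "V \<noteq> {}" "V \<subseteq> U" and a: "dual_hom V \<alpha>" for V \<alpha>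
  proof (rule hartogs[OF V(1,2) ev_closed[OF V(1,2) a v]])
    fix P assume P: "prime_divisor \<XX> P" "P \<inter> V \<noteq> {}"
    show "ev V \<alpha> v \<in> stk (gpt P)"
      by (rule ev_stk[OF V(1) a pd_gpt(3)[OF P(1) V(1) P(2)] all[OF P(1)]]) (use P(2) V(3) in blast)
  qed
  \<comment> \<open>Over a nonempty \<open>V\<close> the section is determined by its germ
    \<open>ev V \<alpha> v\<close>. Over the empty set, which does not contain the generic point,
    zero is the default.\<close>
  define \<beta> where "\<beta> V \<alpha> = (if V = {} then \<zero>\<^bsub>osec \<XX> V\<^esub> else SOME t. t \<in> Oc V \<and> gm V t = ev V \<alpha> v)" for V \<alpha>
  have b: "\<beta> V \<alpha> \<in> Oc V" "V \<noteq> {} \<Longrightarrow> gm V (\<beta> V \<alpha>) = ev V \<alpha> v"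
    if V: "opn V" "V \<subseteq> U" and a: "dual_hom V \<alpha>" for V \<alpha>
  proof -
    interpret O: cring "osec \<XX> V" by (rule osec_cring[OF V(1)])
    have *: "\<beta> V \<alpha> \<in> Oc V \<and> gm V (\<beta> V \<alpha>) = ev V \<alpha> v" if ne: "V \<noteq> {}"
    proof -
      have "\<exists>t. t \<in> Oc V \<and> gm V t = ev V \<alpha> v" using ev_sec[OF V(1) ne V(2) a] by (metis imageE)
      from someI_ex[OF this] show ?thesis using ne by (simp add: \<beta>_def)
    qed
    show "V \<noteq> {} \<Longrightarrow> gm V (\<beta> V \<alpha>) = ev V \<alpha> v" using * by blast
    show "\<beta> V \<alpha> \<in> Oc V"
    proof (cases "V = {}")
      case True
      then show ?thesis using O.zero_closed by (simp add: \<beta>_def)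
    qed (use * in blast)
  qed
  define B where "B = cut_hom \<XX> ?D U \<beta>"
  have Bb: "B V \<alpha> = \<beta> V \<alpha>" if "opn V" "V \<subseteq> U" "\<alpha> \<in> carrier (msec ?D V)" for V \<alpha>
    unfolding B_def by (rule cut_hom_eq[OF that])
  have Bc: "B V \<alpha> \<in> Oc V" "V \<noteq> {} \<Longrightarrow> gm V (B V \<alpha>) = ev V \<alpha> v"
    if V: "opn V" "V \<subseteq> U" and a: "\<alpha> \<in> carrier (msec ?D V)" for V \<alpha>
    using b[OF V] Bb[OF V a] a by (auto simp: dual_carrier)
  \<comment> \<open>Linearity and compatibility with restriction are identities between sections;
    they are checked on generic germs, where \<open>ev\<close> satisfies them.\<close>
  have "omodule_hom (open_sub \<XX> U) ?D (structure_omodule \<XX>) B"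
  proof (rule local_homI[OF U(1)], unfold structure_omodule_simps)
    fix V \<alpha> assume V: "opn V" "V \<subseteq> U" and a: "\<alpha> \<in> carrier (msec ?D V)"
    interpret O: cring "osec \<XX> V" by (rule osec_cring[OF V(1)])
    have ah: "dual_hom V \<alpha>" using a by (simp add: dual_carrier)
    show "B V \<alpha> \<in> Oc V" by (rule Bc(1)[OF V a])
    { fix \<alpha>' assume a': "\<alpha>' \<in> carrier (msec ?D V)"
      then have ah': "dual_hom V \<alpha>'" by (simp add: dual_carrier)
      let ?s = "\<lambda>N s. \<alpha> N s \<oplus>\<^bsub>osec \<XX> N\<^esub> \<alpha>' N s"
      have sum: "\<alpha> \<oplus>\<^bsub>msec ?D V\<^esub> \<alpha>' = cut_hom \<XX> F V ?s" by (simp add: dual_omodule_def)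
      have sc: "\<alpha> \<oplus>\<^bsub>msec ?D V\<^esub> \<alpha>' \<in> carrier (msec ?D V)"
        unfolding sum by (rule cut_dual[OF V(1) dual_hom_add[OF V(1) ah ah']])
      then have sh: "dual_hom V (\<alpha> \<oplus>\<^bsub>msec ?D V\<^esub> \<alpha>')" by (simp add: dual_carrier)
      show "B V (\<alpha> \<oplus>\<^bsub>msec ?D V\<^esub> \<alpha>') = B V \<alpha> \<oplus>\<^bsub>osec \<XX> V\<^esub> B V \<alpha>'"
      proof (rule osec_eqI[OF V(1) Bc(1)[OF V sc] O.a_closed[OF Bc(1)[OF V a] Bc(1)[OF V a']]])
        assume ne: "V \<noteq> {}"
        obtain N s where N: "opn N" "\<eta> \<in> N" "N \<subseteq> V" "s \<in> Mc N" "v = mg N s"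
          by (rule mstalk_cases_in[OF v V(1) eta_in[OF V(1) ne]])
        have "ev V (\<alpha> \<oplus>\<^bsub>msec ?D V\<^esub> \<alpha>') v = gm N (\<alpha> N s \<oplus>\<^bsub>osec \<XX> N\<^esub> \<alpha>' N s)"
          using ev_germ[OF V(1) sh N(1-4)] cut_hom_eq[OF N(1,3,4), of ?s] N(5) by (simp add: sum)
        also have "\<dots> = ev V \<alpha> v \<oplus>\<^bsub>KK\<^esub> ev V \<alpha>' v"
          unfolding N(5) ev_germ[OF V(1) ah N(1-4)] ev_germ[OF V(1) ah' N(1-4)]
          by (rule ogerm_add[symmetric, OF N(1,2) dual_homD(1)[OF V(1) ah N(1,3,4)] dual_homD(1)[OF V(1) ah' N(1,3,4)]])
        finally show "gm V (B V (\<alpha> \<oplus>\<^bsub>msec ?D V\<^esub> \<alpha>')) = gm V (B V \<alpha> \<oplus>\<^bsub>osec \<XX> V\<^esub> B V \<alpha>')"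
          using ogerm_add[OF V(1) eta_in[OF V(1) ne] Bc(1)[OF V a] Bc(1)[OF V a']]
            Bc(2)[OF V a ne] Bc(2)[OF V a' ne] Bc(2)[OF V sc ne] by simp
      qed }
    { fix r assume r: "r \<in> Oc V"
      let ?s = "\<lambda>N s. ores \<XX> V N r \<otimes>\<^bsub>osec \<XX> N\<^esub> \<alpha> N s"
      have sum: "r \<odot>\<^bsub>msec ?D V\<^esub> \<alpha> = cut_hom \<XX> F V ?s" by (simp add: dual_omodule_def)
      have sc: "r \<odot>\<^bsub>msec ?D V\<^esub> \<alpha> \<in> carrier (msec ?D V)"
        unfolding sum by (rule cut_dual[OF V(1) dual_hom_smult[OF V(1) ah r]])
      then have sh: "dual_hom V (r \<odot>\<^bsub>msec ?D V\<^esub> \<alpha>)" by (simp add: dual_carrier)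
      show "B V (r \<odot>\<^bsub>msec ?D V\<^esub> \<alpha>) = r \<otimes>\<^bsub>osec \<XX> V\<^esub> B V \<alpha>"
      proof (rule osec_eqI[OF V(1) Bc(1)[OF V sc] O.m_closed[OF r Bc(1)[OF V a]]])
        assume ne: "V \<noteq> {}"
        obtain N s where N: "opn N" "\<eta> \<in> N" "N \<subseteq> V" "s \<in> Mc N" "v = mg N s"
          by (rule mstalk_cases_in[OF v V(1) eta_in[OF V(1) ne]])
        have "ev V (r \<odot>\<^bsub>msec ?D V\<^esub> \<alpha>) v = gm N (ores \<XX> V N r \<otimes>\<^bsub>osec \<XX> N\<^esub> \<alpha> N s)"
          using ev_germ[OF V(1) sh N(1-4)] cut_hom_eq[OF N(1,3,4), of ?s] N(5) by (simp add: sum)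
        also have "\<dots> = gm V r \<otimes>\<^bsub>KK\<^esub> ev V \<alpha> v"
          unfolding N(5) ev_germ[OF V(1) ah N(1-4)] ogerm_res[OF V(1) r N(1-3), symmetric]
          by (rule ogerm_mult[symmetric, OF N(1,2) ores_closed[OF V(1) N(1,3) r] dual_homD(1)[OF V(1) ah N(1,3,4)]])
        finally show "gm V (B V (r \<odot>\<^bsub>msec ?D V\<^esub> \<alpha>)) = gm V (r \<otimes>\<^bsub>osec \<XX> V\<^esub> B V \<alpha>)"
          using ogerm_mult[OF V(1) eta_in[OF V(1) ne] r Bc(1)[OF V a]] Bc(2)[OF V a ne] Bc(2)[OF V sc ne] by simp
      qed }
    fix W assume W: "opn W" "W \<subseteq> V"
    have WU: "W \<subseteq> U" using W V by blast
    have res: "mres ?D V W \<alpha> = cut_hom \<XX> F W \<alpha>" by (simp add: dual_omodule_def)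
    have rc: "mres ?D V W \<alpha> \<in> carrier (msec ?D W)"
      unfolding res by (rule cut_dual[OF W(1) dual_hom_restrict[OF V(1) ah W]])
    then have rh: "dual_hom W (mres ?D V W \<alpha>)" by (simp add: dual_carrier)
    show "B W (mres ?D V W \<alpha>) = ores \<XX> V W (B V \<alpha>)"
    proof (rule osec_eqI[OF W(1) Bc(1)[OF W(1) WU rc] ores_closed[OF V(1) W Bc(1)[OF V a]]])
      assume ne: "W \<noteq> {}"
      then have neV: "V \<noteq> {}" using W by blast
      have "ev W (mres ?D V W \<alpha>) v = ev V \<alpha> v"
        by (rule ev_cong[OF V(1) neV ah W(1) ne W(2) rh v]) (simp add: res cut_hom_eq)
      then show "gm W (B W (mres ?D V W \<alpha>)) = gm W (ores \<XX> V W (B V \<alpha>))"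
        using Bc(2)[OF W(1) WU rc ne] Bc(2)[OF V a neV] ogerm_res[OF V(1) Bc(1)[OF V a] W(1) eta_in[OF W(1) ne] W(2)] by simp
    qed
  qed
  then have "B \<in> carrier (msec (dual_omodule \<XX> ?D) U)"
    by (simp add: dual_omodule_def[of \<XX> ?D] B_def cut_hom_idem)
  then have "B \<in> bidual_map \<XX> F U ` Mc U" using bij_betw_imp_surj_on[OF bidual_bij[OF U(1)]] by simp
  then obtain s where s: "s \<in> Mc U" "bidual_map \<XX> F U s = B" by blast
  \<comment> \<open>It remains to identify the germ of \<open>s\<close> with \<open>v\<close>. Over
    a smaller open set \<open>N\<close> both come from sections, and these have the same values
    under all functionals.\<close>
  obtain N t where N: "opn N" "\<eta> \<in> N" "N \<subseteq> U" "t \<in> Mc N" "v = mg N t" by (rule mstalk_cases_in[OF v U(1) eta_in[OF U]])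
  have "mres F U N s = t"
  proof (rule bidual_eqI[OF N(1) mres_closed[OF U(1) N(1,3) s(1)] N(4)])
    fix V \<alpha> assume V: "opn V" "V \<noteq> {}" "V \<subseteq> N" and a: "dual_hom V \<alpha>" "cut_hom \<XX> F V \<alpha> = \<alpha>"
    have VU: "V \<subseteq> U" using V N by blast
    have ac: "\<alpha> \<in> carrier (msec ?D V)" using a by (simp add: dual_carrier)
    have "\<alpha> V (mres F U V s) = B V \<alpha>"
      unfolding s(2)[symmetric] bidual_map_def by (rule cut_hom_eq[symmetric, OF V(1) VU ac])
    then have "gm V (\<alpha> V (mres F N V (mres F U N s))) = ev V \<alpha> v"
      using Bc(2)[OF V(1) VU ac V(2)] mres_trans[OF U(1) N(1) V(1,3) N(3) s(1)] by simp
    then show "gm V (\<alpha> V (mres F N V (mres F U N s))) = gm V (\<alpha> V (mres F N V t))"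
      using dual_germ[OF N(1,4) V a(1)] N(5) by simp
  qed
  then have "v = mg U s" using mgerm_res[OF U(1) s(1) N(1-3)] N(5) by simp
  then show ?thesis using s(1) by blast
qed

text \<open>The orders of those \<open>f\<close> with \<open>f e\<close> in the stalk are bounded
  below, because a functional detects \<open>e\<close> and is bounded on the stalk. There are such
  \<open>f\<close>, because \<open>e\<close> has a denominator. Multiplication by elements of the
  local ring reaches every order above the least one.\<close>

lemma decoration_local:
  assumes e: "e \<in> carrier ME" "e \<noteq> \<zero>\<^bsub>ME\<^esub>" and P: "prime_divisor \<XX> P"
  shows "\<exists>n. \<forall>f\<in>carrier KK. f \<noteq> \<zero>\<^bsub>KK\<^esub> \<longrightarrow> (f \<odot>\<^bsub>ME\<^esub> e \<in> mstk (gpt P) \<longleftrightarrow> 0 \<le> n + ord_along \<XX> P f)"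
proof -
  let ?y = "gpt P" and ?v = "ord_along \<XX> P"
  have y: "?y \<in> topspace (spc \<XX>)" by (rule pd_gpt(1)[OF P])
  define S where "S f \<longleftrightarrow> f \<in> carrier KK \<and> f \<noteq> \<zero>\<^bsub>KK\<^esub> \<and> f \<odot>\<^bsub>ME\<^esub> e \<in> mstk ?y" for f
  obtain V \<alpha> where V: "opn V" "V \<noteq> {}" "dual_hom V \<alpha>" "ev V \<alpha> e \<noteq> \<zero>\<^bsub>KK\<^esub>" by (rule detecting_functional[OF e])
  have evc: "ev V \<alpha> e \<in> carrier KK" by (rule ev_closed[OF V(1-3) e(1)])
  obtain h where h: "h \<in> stk ?y" "h \<noteq> \<zero>\<^bsub>KK\<^esub>" "\<And>v. v \<in> mstk ?y \<Longrightarrow> h \<otimes>\<^bsub>KK\<^esub> ev V \<alpha> v \<in> stk ?y"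
    using ev_bound[OF coherent y V(1-3)] by blast
  have hK: "h \<in> carrier KK" using h(1) stk_carrier by blast
  \<comment> \<open>By \<open>ev_bound\<close> the product of \<open>h\<close>, \<open>f\<close> and
    the value at \<open>e\<close> lies in the valuation ring, and its order is
    \<open>?v f + ?c\<close>.\<close>
  let ?c = "?v h + ?v (ev V \<alpha> e)"
  have bound: "0 \<le> ?v f + ?c" if "S f" for f
  proof -
    have f: "f \<in> carrier KK" "f \<noteq> \<zero>\<^bsub>KK\<^esub>" "f \<odot>\<^bsub>ME\<^esub> e \<in> mstk ?y" using that by (auto simp: S_def)
    have "h \<otimes>\<^bsub>KK\<^esub> (f \<otimes>\<^bsub>KK\<^esub> ev V \<alpha> e) \<in> stk ?y"
      using h(3)[OF f(3)] ev_smult[OF V(1-3) f(1) e(1)] by simp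
    moreover have fe: "f \<otimes>\<^bsub>KK\<^esub> ev V \<alpha> e \<in> carrier KK" "f \<otimes>\<^bsub>KK\<^esub> ev V \<alpha> e \<noteq> \<zero>\<^bsub>KK\<^esub>"
      using f evc V(4) by (auto simp: K.integral_iff)
    moreover have "h \<otimes>\<^bsub>KK\<^esub> (f \<otimes>\<^bsub>KK\<^esub> ev V \<alpha> e) \<noteq> \<zero>\<^bsub>KK\<^esub>" using hK h(2) fe by (simp add: K.integral_iff)
    ultimately have "0 \<le> ?v (h \<otimes>\<^bsub>KK\<^esub> (f \<otimes>\<^bsub>KK\<^esub> ev V \<alpha> e))"
      using ord_nonneg_iff[OF P K.m_closed[OF hK fe(1)]] by blast
    then show ?thesis using ord_mult[OF P hK h(2) fe] ord_mult[OF P f(1,2) evc V(4)] by simp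
  qed
  obtain g where "g \<in> stk ?y" "g \<noteq> \<zero>\<^bsub>KK\<^esub>" "g \<odot>\<^bsub>ME\<^esub> e \<in> mstk ?y" using denominator[OF coherent y e(1)] by blast
  then have "S g" using stk_carrier by (auto simp: S_def)
  \<comment> \<open>The shift by \<open>?c\<close> turns the orders into natural numbers, among
    which there is a least one.\<close>
  then obtain f0 where f0: "S f0" "\<And>f. S f \<Longrightarrow> nat (?v f0 + ?c) \<le> nat (?v f + ?c)"
    using ex_has_least_nat[of S g "\<lambda>f. nat (?v f + ?c)"] by blast
  have least: "?v f0 \<le> ?v f" if "S f" for f
    using f0(2)[OF that] bound[OF that] bound[OF f0(1)] by simp
  have f0': "f0 \<in> carrier KK" "f0 \<noteq> \<zero>\<^bsub>KK\<^esub>" "f0 \<odot>\<^bsub>ME\<^esub> e \<in> mstk ?y" using f0(1) by (auto simp: S_def)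
  note i0 = K.nonzero_inv[OF f0'(1,2)]
  have "f \<odot>\<^bsub>ME\<^esub> e \<in> mstk ?y \<longleftrightarrow> 0 \<le> - ?v f0 + ?v f" if f: "f \<in> carrier KK" "f \<noteq> \<zero>\<^bsub>KK\<^esub>" for f
  proof
    assume "f \<odot>\<^bsub>ME\<^esub> e \<in> mstk ?y"
    then have "S f" using f by (simp add: S_def)
    then show "0 \<le> - ?v f0 + ?v f" using least by simp
  next
    assume le: "0 \<le> - ?v f0 + ?v f"
    let ?q = "f \<otimes>\<^bsub>KK\<^esub> inv\<^bsub>KK\<^esub> f0"
    have q: "?q \<in> carrier KK" "?q \<noteq> \<zero>\<^bsub>KK\<^esub>" using f i0 by (auto simp: K.integral_iff)
    have "?v ?q = ?v f - ?v f0" using ord_mult[OF P f i0(1,2)] ord_inv[OF P f0'(1,2)] by simp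
    then have "?q \<in> stk ?y" using ord_nonneg_iff[OF P q] le by simp
    then have "?q \<odot>\<^bsub>ME\<^esub> (f0 \<odot>\<^bsub>ME\<^esub> e) \<in> mstk ?y" by (rule mstk_smult[OF _ f0'(3)])
    moreover have "?q \<otimes>\<^bsub>KK\<^esub> f0 = f" using f(1) f0'(1) i0 by (simp add: K.m_assoc)
    ultimately show "f \<odot>\<^bsub>ME\<^esub> e \<in> mstk ?y" using ME_smult_assoc[OF q(1) f0'(1) e(1)] by simp
  qed
  then show ?thesis by blast
qed

text \<open>On \<open>W\<close> the element \<open>e\<close> comes from a section, and the inverse
  of the value of a detecting functional at \<open>e\<close> is regular. Applying the functional to
  \<open>f e\<close> then shows that \<open>f\<close> is regular.\<close>

lemma decoration_generic:
  assumes e: "e \<in> carrier ME" "e \<noteq> \<zero>\<^bsub>ME\<^esub>"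
  shows "\<exists>W. opn W \<and> W \<noteq> {} \<and> (\<forall>P. prime_divisor \<XX> P \<and> P \<inter> W \<noteq> {} \<longrightarrow>
    (\<forall>f\<in>carrier KK. f \<noteq> \<zero>\<^bsub>KK\<^esub> \<longrightarrow> (f \<odot>\<^bsub>ME\<^esub> e \<in> mstk (gpt P) \<longleftrightarrow> 0 \<le> ord_along \<XX> P f)))"
proof -
  obtain V \<alpha> where V: "opn V" "V \<noteq> {}" "dual_hom V \<alpha>" "ev V \<alpha> e \<noteq> \<zero>\<^bsub>KK\<^esub>" by (rule detecting_functional[OF e])
  let ?c = "ev V \<alpha> e"
  have c: "?c \<in> carrier KK" by (rule ev_closed[OF V(1-3) e(1)])
  note ic = K.nonzero_inv[OF c V(4)]
  obtain N s where N: "opn N" "\<eta> \<in> N" "N \<subseteq> V" "s \<in> Mc N" "e = mg N s" by (rule mstalk_cases_in[OF e(1) V(1) eta_in[OF V(1,2)]])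
  obtain M t where M: "opn M" "\<eta> \<in> M" "t \<in> Oc M" "inv\<^bsub>KK\<^esub> ?c = gm M t" by (rule stalk_cases[OF ic(1)])
  let ?W = "N \<inter> M"
  have W: "opn ?W" "?W \<noteq> {}" using N M by auto
  have "f \<odot>\<^bsub>ME\<^esub> e \<in> mstk (gpt P) \<longleftrightarrow> 0 \<le> ord_along \<XX> P f"
    if P: "prime_divisor \<XX> P" "P \<inter> ?W \<noteq> {}" and f: "f \<in> carrier KK" "f \<noteq> \<zero>\<^bsub>KK\<^esub>" for P f
  proof -
    let ?y = "gpt P"
    have y: "?y \<in> N" "?y \<in> M" "?y \<in> V" using pd_gpt(3)[OF P(1) W(1) P(2)] N(3) by auto
    have em: "e \<in> mstk ?y" using mstkI[OF N(1) y(1) N(4)] N(5) by simp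
    have ics: "inv\<^bsub>KK\<^esub> ?c \<in> stk ?y" using M y(2) unfolding stk_def by blast
    have "f \<odot>\<^bsub>ME\<^esub> e \<in> mstk ?y \<longleftrightarrow> f \<in> stk ?y"
    proof
      assume "f \<in> stk ?y" then show "f \<odot>\<^bsub>ME\<^esub> e \<in> mstk ?y" using mstk_smult em by blast
    next
      assume "f \<odot>\<^bsub>ME\<^esub> e \<in> mstk ?y"
      then have "f \<otimes>\<^bsub>KK\<^esub> ?c \<in> stk ?y" using ev_stk[OF V(1,3) y(3)] ev_smult[OF V(1-3) f(1) e(1)] by metis
      then have "(f \<otimes>\<^bsub>KK\<^esub> ?c) \<otimes>\<^bsub>KK\<^esub> inv\<^bsub>KK\<^esub> ?c \<in> stk ?y" by (rule subringE(6)[OF subring_stk[OF pd_gpt(1)[OF P(1)]] _ ics])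
      moreover have "(f \<otimes>\<^bsub>KK\<^esub> ?c) \<otimes>\<^bsub>KK\<^esub> inv\<^bsub>KK\<^esub> ?c = f" using f(1) c ic by (simp add: K.m_assoc)
      ultimately show "f \<in> stk ?y" by simp
    qed
    then show ?thesis using ord_nonneg_iff[OF P(1) f] by simp
  qed
  then show ?thesis using W by blast
qed

text \<open>The predicate whose unique solution \<open>weil_decoration\<close> selects for nonzero
  \<open>e\<close>.\<close>

definition is_decoration :: "('p set \<times> 'm) set \<Rightarrow> ('p set \<Rightarrow> int) \<Rightarrow> bool" where
  "is_decoration e D \<longleftrightarrow> D \<in> weil_divisors \<XX> \<and>
     (\<forall>U. openin (spc \<XX>) U \<and> U \<noteq> {} \<longrightarrow> divisor_sheaf \<XX> D U =
        {f \<in> carrier (function_field \<XX>). f \<odot>\<^bsub>generic_stalk \<XX> F\<^esub> e \<in> line_subsheaf \<XX> F e U})"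

lemma line_sections:
  assumes "e \<in> carrier ME" "f \<in> carrier KK"
  shows "f \<odot>\<^bsub>generic_stalk \<XX> F\<^esub> e \<in> line_subsheaf \<XX> F e U \<longleftrightarrow> f \<odot>\<^bsub>ME\<^esub> e \<in> mg U ` Mc U"
  using assms(2) unfolding line_subsheaf_def generic_stalk_def function_field_def by blast

text \<open>Coefficients are chosen one prime divisor at a time. \<open>decoration_generic\<close>
  leaves only finitely many nonzero ones, and \<open>section_of_stalks\<close> turns the conditions
  along the divisors into membership in the sections. The local description is part of the
  conclusion because it is what computes coefficients later.\<close>

lemma decoration_exists:
  assumes e: "e \<in> carrier ME" "e \<noteq> \<zero>\<^bsub>ME\<^esub>"
  shows "\<exists>D. is_decoration e D \<and> (\<forall>P. prime_divisor \<XX> P \<longrightarrow> (\<forall>f\<in>carrier KK. f \<noteq> \<zero>\<^bsub>KK\<^esub> \<longrightarrow>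
      (f \<odot>\<^bsub>ME\<^esub> e \<in> mstk (gpt P) \<longleftrightarrow> 0 \<le> D P + ord_along \<XX> P f)))"
proof -
  define good where "good P n \<longleftrightarrow> (\<forall>f\<in>carrier KK. f \<noteq> \<zero>\<^bsub>KK\<^esub> \<longrightarrow>
      (f \<odot>\<^bsub>ME\<^esub> e \<in> mstk (gpt P) \<longleftrightarrow> 0 \<le> n + ord_along \<XX> P f))" for P n
  define D where "D P = (if prime_divisor \<XX> P then SOME n. good P n else 0)" for P
  have good: "good P (D P)" if P: "prime_divisor \<XX> P" for P
  proof -
    have "\<exists>n. good P n" unfolding good_def by (rule decoration_local[OF e P])
    from someI_ex[OF this] show ?thesis using P by (simp add: D_def)
  qed
  \<comment> \<open>Elements of order \<open>- n\<close> and \<open>- m\<close> separate the two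
    candidates. It follows that the chosen coefficient is zero along the divisors meeting the open
    set of \<open>decoration_generic\<close>.\<close>
  have uniq: "n = m" if P: "prime_divisor \<XX> P" and nm: "good P n" "good P m" for P n m
  proof -
    obtain f where f: "f \<in> carrier KK" "f \<noteq> \<zero>\<^bsub>KK\<^esub>" "ord_along \<XX> P f = - n" by (rule ord_surj[OF P])
    obtain g where g: "g \<in> carrier KK" "g \<noteq> \<zero>\<^bsub>KK\<^esub>" "ord_along \<XX> P g = - m" by (rule ord_surj[OF P])
    have "0 \<le> m - n" using nm f unfolding good_def by force
    moreover have "0 \<le> n - m" using nm g unfolding good_def by force
    ultimately show ?thesis by simp
  qed
  have "\<exists>W. opn W \<and> W \<noteq> {} \<and> (\<forall>P. prime_divisor \<XX> P \<and> P \<inter> W \<noteq> {} \<longrightarrow> good P 0)"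
    using decoration_generic[OF e] unfolding good_def add_0 .
  then obtain W where W: "opn W" "W \<noteq> {}" "\<And>P. prime_divisor \<XX> P \<Longrightarrow> P \<inter> W \<noteq> {} \<Longrightarrow> good P 0" by blast
  have "{P. D P \<noteq> 0} \<subseteq> {P. prime_divisor \<XX> P \<and> P \<inter> W = {}}"
  proof
    fix P assume "P \<in> {P. D P \<noteq> 0}"
    then have DP: "D P \<noteq> 0" by simp
    then have P: "prime_divisor \<XX> P" unfolding D_def by metis
    then have "P \<inter> W = {}" using uniq[OF P good[OF P] W(3)[OF P]] DP by blast
    then show "P \<in> {P. prime_divisor \<XX> P \<and> P \<inter> W = {}}" using P by simp
  qed
  then have fin: "finite {P. D P \<noteq> 0}" using finite_prime_divisors_outside[OF W(1,2)] by (rule finite_subset)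
  have "D \<in> weil_divisors \<XX>" unfolding weil_divisors_def using fin by (auto simp: D_def)
  moreover have "divisor_sheaf \<XX> D U =
        {f \<in> carrier (function_field \<XX>). f \<odot>\<^bsub>generic_stalk \<XX> F\<^esub> e \<in> line_subsheaf \<XX> F e U}"
    if U: "opn U" "U \<noteq> {}" for U
  proof -
    \<comment> \<open>Zero belongs to both sides and is treated apart, since orders refer to nonzero
      elements.\<close>
    have key: "f \<in> divisor_sheaf \<XX> D U \<longleftrightarrow> f \<odot>\<^bsub>ME\<^esub> e \<in> mg U ` Mc U" if f: "f \<in> carrier KK" for f
    proof (cases "f = \<zero>\<^bsub>KK\<^esub>")
      case True
      have "\<zero>\<^bsub>ME\<^esub> \<in> mg U ` Mc U" using mgerm_zero[OF U(1) eta_in[OF U]] mzero_closed[OF U(1)] by (metis imageI)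
      then show ?thesis using True ME_smult_zero[OF e(1)] by (simp add: divisor_sheaf_def function_field_def)
    next
      case False
      have "f \<in> divisor_sheaf \<XX> D U \<longleftrightarrow> effective_on \<XX> U (\<lambda>P. D P + principal_divisor \<XX> f P)"
        unfolding divisor_sheaf_def function_field_def using f False by blast
      also have "\<dots> \<longleftrightarrow> (\<forall>P. prime_divisor \<XX> P \<and> P \<inter> U \<noteq> {} \<longrightarrow> 0 \<le> D P + ord_along \<XX> P f)"
        by (auto simp: effective_on_def principal_divisor_def)
      also have "\<dots> \<longleftrightarrow> (\<forall>P. prime_divisor \<XX> P \<and> P \<inter> U \<noteq> {} \<longrightarrow> f \<odot>\<^bsub>ME\<^esub> e \<in> mstk (gpt P))"
        using good f False unfolding good_def by blast
      also have "\<dots> \<longleftrightarrow> f \<odot>\<^bsub>ME\<^esub> e \<in> mg U ` Mc U"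
      proof
        assume "\<forall>P. prime_divisor \<XX> P \<and> P \<inter> U \<noteq> {} \<longrightarrow> f \<odot>\<^bsub>ME\<^esub> e \<in> mstk (gpt P)"
        then show "f \<odot>\<^bsub>ME\<^esub> e \<in> mg U ` Mc U" using section_of_stalks[OF U ME_smult_closed[OF f e(1)]] by blast
      next
        assume "f \<odot>\<^bsub>ME\<^esub> e \<in> mg U ` Mc U"
        then obtain s where s: "s \<in> Mc U" "f \<odot>\<^bsub>ME\<^esub> e = mg U s" by blast
        show "\<forall>P. prime_divisor \<XX> P \<and> P \<inter> U \<noteq> {} \<longrightarrow> f \<odot>\<^bsub>ME\<^esub> e \<in> mstk (gpt P)"
        proof (intro allI impI)
          fix P assume "prime_divisor \<XX> P \<and> P \<inter> U \<noteq> {}"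
          then have "gpt P \<in> U" using pd_gpt(3)[OF _ U(1)] by blast
          then show "f \<odot>\<^bsub>ME\<^esub> e \<in> mstk (gpt P)" using mstkI[OF U(1) _ s(1)] s(2) by simp
        qed
      qed
      finally show ?thesis .
    qed
    have sub: "divisor_sheaf \<XX> D U \<subseteq> carrier KK" unfolding divisor_sheaf_def function_field_def by auto
    show ?thesis
      unfolding function_field_def
    proof (intro equalityI subsetI)
      fix f assume f: "f \<in> divisor_sheaf \<XX> D U"
      then have fK: "f \<in> carrier KK" using sub by blast
      show "f \<in> {f \<in> carrier KK. f \<odot>\<^bsub>generic_stalk \<XX> F\<^esub> e \<in> line_subsheaf \<XX> F e U}"
        using iffD1[OF key[OF fK] f] line_sections[OF e(1) fK] fK by simp
    next
      fix f assume "f \<in> {f \<in> carrier KK. f \<odot>\<^bsub>generic_stalk \<XX> F\<^esub> e \<in> line_subsheaf \<XX> F e U}"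
      then have fK: "f \<in> carrier KK" and fl: "f \<odot>\<^bsub>generic_stalk \<XX> F\<^esub> e \<in> line_subsheaf \<XX> F e U" by auto
      show "f \<in> divisor_sheaf \<XX> D U" by (rule iffD2[OF key[OF fK] iffD1[OF line_sections[OF e(1) fK] fl]])
    qed
  qed
  ultimately have "is_decoration e D" unfolding is_decoration_def by blast
  then show ?thesis using good unfolding good_def by blast
qed

text \<open>An \<open>f\<close> of order \<open>- D P\<close> along \<open>P\<close> is a section of
  the sheaf of \<open>D\<close> away from the finitely many other prime divisors where it violates
  the condition. Membership in the sheaf of \<open>D'\<close> there gives the inequality at
  \<open>P\<close>.\<close>

lemma decoration_le:
  assumes e: "e \<in> carrier ME" and D: "is_decoration e D" and D': "is_decoration e D'" and P: "prime_divisor \<XX> P"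
  shows "D P \<le> D' P"
proof -
  obtain f where f: "f \<in> carrier KK" "f \<noteq> \<zero>\<^bsub>KK\<^esub>" "ord_along \<XX> P f = - D P" by (rule ord_surj[OF P])
  \<comment> \<open>A bad divisor lies in the support of \<open>D\<close> or of the divisor of
    \<open>f\<close>, so there are finitely many and their union is closed.\<close>
  define bad where "bad = {Q. prime_divisor \<XX> Q \<and> Q \<noteq> P \<and> D Q + ord_along \<XX> Q f < 0}"
  have "finite {Q. D Q \<noteq> 0}" using D unfolding is_decoration_def weil_divisors_def by blast
  then have "finite ({Q. D Q \<noteq> 0} \<union> {Q. prime_divisor \<XX> Q \<and> ord_along \<XX> Q f \<noteq> 0})"
    using finite_ord_nonzero[OF f(1,2)] by simp
  moreover have "bad \<subseteq> {Q. D Q \<noteq> 0} \<union> {Q. prime_divisor \<XX> Q \<and> ord_along \<XX> Q f \<noteq> 0}"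
    unfolding bad_def by auto
  ultimately have fin: "finite bad" by (rule rev_finite_subset)
  let ?U = "topspace (spc \<XX>) - \<Union>bad"
  have "closedin (spc \<XX>) (\<Union>bad)"
    by (rule closedin_Union[OF fin]) (auto simp: bad_def prime_divisor_def irreducible_closed_def)
  then have oU: "opn ?U" by (simp add: openin_diff)
  \<comment> \<open>Removing the other divisors keeps the generic point of \<open>P\<close>: a
    proper inclusion of \<open>P\<close> in a prime divisor would extend to a chain that is too
    long.\<close>
  have "gpt P \<notin> Q" if Q: "Q \<in> bad" for Q
  proof
    assume pQ: "gpt P \<in> Q"
    have Q': "prime_divisor \<XX> Q" "Q \<noteq> P" using Q by (auto simp: bad_def)
    have "closedin (spc \<XX>) Q" using Q'(1) by (simp add: prime_divisor_def irreducible_closed_def)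
    then have "P \<subseteq> Q" using pd_gpt(2)[OF P] closure_of_minimal[of "{gpt P}" Q "spc \<XX>"] pQ by simp
    then have "P \<subset> Q" using Q'(2) by blast
    moreover obtain Z where "irreducible_closed (spc \<XX>) Z" "Q \<subset> Z" using Q'(1) unfolding prime_divisor_def by blast
    ultimately show False using P prime_divisor_irreducible[OF Q'(1)] unfolding prime_divisor_def by blast
  qed
  then have pU: "gpt P \<in> ?U" using pd_gpt(1)[OF P] by blast
  have une: "?U \<noteq> {}" using pU by blast
  have "f \<in> divisor_sheaf \<XX> D ?U"
  proof -
    have "0 \<le> D Q + principal_divisor \<XX> f Q" if Q: "prime_divisor \<XX> Q" "Q \<inter> ?U \<noteq> {}" for Q
    proof (cases "Q = P")
      case True
      then show ?thesis using P f(3) by (simp add: principal_divisor_def)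
    next
      case False
      have "Q \<notin> bad" using Q(2) by blast
      then show ?thesis using Q(1) False by (simp add: bad_def principal_divisor_def)
    qed
    then show ?thesis unfolding divisor_sheaf_def function_field_def effective_on_def using f(1,2) by blast
  qed
  then have "f \<in> divisor_sheaf \<XX> D' ?U"
    using D D' oU une unfolding is_decoration_def by blast
  then have "effective_on \<XX> ?U (\<lambda>P. D' P + principal_divisor \<XX> f P)"
    unfolding divisor_sheaf_def function_field_def using f(2) by blast
  moreover have "P \<inter> ?U \<noteq> {}" using pU pd_gpt(4)[OF P] by blast
  ultimately have "0 \<le> D' P + principal_divisor \<XX> f P" using P unfolding effective_on_def by blast
  then show ?thesis using P f(3) by (simp add: principal_divisor_def)
qed

text \<open>Uniqueness comes from \<open>decoration_le\<close> in both directions, together with the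
  vanishing of Weil divisors off the prime divisors.\<close>

lemma weil_decoration_cases:
  assumes e: "e \<in> carrier ME" "e \<noteq> \<zero>\<^bsub>ME\<^esub>"
  obtains D where "weil_decoration \<XX> F e = Fin D"
    "\<And>P f. prime_divisor \<XX> P \<Longrightarrow> f \<in> carrier KK \<Longrightarrow> f \<noteq> \<zero>\<^bsub>KK\<^esub> \<Longrightarrow>
      f \<odot>\<^bsub>ME\<^esub> e \<in> mstk (gpt P) \<longleftrightarrow> 0 \<le> D P + ord_along \<XX> P f"
proof -
  obtain D where D: "is_decoration e D" and loc: "\<forall>P. prime_divisor \<XX> P \<longrightarrow> (\<forall>f\<in>carrier KK. f \<noteq> \<zero>\<^bsub>KK\<^esub> \<longrightarrow>
      (f \<odot>\<^bsub>ME\<^esub> e \<in> mstk (gpt P) \<longleftrightarrow> 0 \<le> D P + ord_along \<XX> P f))"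
    using decoration_exists[OF e] by blast
  have "(THE D. is_decoration e D) = D"
  proof (rule the_equality)
    show "is_decoration e D" by (rule D)
    fix D' assume D': "is_decoration e D'"
    show "D' = D"
    proof
      fix P show "D' P = D P"
      proof (cases "prime_divisor \<XX> P")
        case True
        then show ?thesis using decoration_le[OF e(1) D D' True] decoration_le[OF e(1) D' D True] by simp
      next
        case False
        have "D \<in> weil_divisors \<XX>" "D' \<in> weil_divisors \<XX>"
          by (rule D[unfolded is_decoration_def, THEN conjunct1], rule D'[unfolded is_decoration_def, THEN conjunct1])
        then have "D P = 0" "D' P = 0" using False unfolding weil_divisors_def by auto
        then show ?thesis by simp
      qed
    qed
  qed
  then have "weil_decoration \<XX> F e = Fin D"
    using e(2) unfolding weil_decoration_def is_decoration_def generic_stalk_def by simp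
  then show thesis using that loc by blast
qed

end

section \<open>Homomorphisms on generic stalks and the comparison of decorations\<close>

locale omod_hom = F: omod \<XX> F + G: omod \<XX> G
  for \<XX> :: "('p, 'a) ringed_space" and F :: "('p, 'a, 'm) omodule" and G :: "('p, 'a, 'n) omodule" +
  fixes \<mu> :: "'p set \<Rightarrow> 'm \<Rightarrow> 'n"
  assumes hom: "omodule_hom \<XX> F G \<mu>"
begin

abbreviation gmap where "gmap \<equiv> generic_map \<XX> F G \<mu>"

text \<open>\<open>\<mu>\<close> commutes with restriction, so the definite description in
  \<open>stalk_map\<close> does not depend on the representative.\<close>

lemma gmap_germ:
  assumes U: "openin (spc \<XX>) U" "F.\<eta> \<in> U" "s \<in> F.Mc U"
  shows "gmap (F.mg U s) = G.mg U (\<mu> U s)"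
  unfolding generic_map_def stalk_map_def
proof (rule the_equality)
  show "\<exists>V t. openin (spc \<XX>) V \<and> F.\<eta> \<in> V \<and> t \<in> F.Mc V \<and> F.mg U s = F.mg V t \<and> G.mg U (\<mu> U s) = G.mg V (\<mu> V t)"
    using U by blast
  fix B assume "\<exists>V t. openin (spc \<XX>) V \<and> F.\<eta> \<in> V \<and> t \<in> F.Mc V \<and> F.mg U s = F.mg V t \<and> B = G.mg V (\<mu> V t)"
  then obtain V t where V: "openin (spc \<XX>) V" "F.\<eta> \<in> V" "t \<in> F.Mc V" "F.mg U s = F.mg V t" "B = G.mg V (\<mu> V t)" by blast
  obtain W where W: "openin (spc \<XX>) W" "F.\<eta> \<in> W" "W \<subseteq> U \<inter> V" "mres F U W s = mres F V W t"
    using V(4) F.mgerm_eq_iff[OF U V(1-3)] by blast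
  have sub: "W \<subseteq> U" "W \<subseteq> V" using W(3) by auto
  have "mres G U W (\<mu> U s) = mres G V W (\<mu> V t)"
    using omodule_homD(4)[OF hom U(1) W(1) sub(1) U(3)] omodule_homD(4)[OF hom V(1) W(1) sub(2) V(3)] W(4) by simp
  then show "B = G.mg U (\<mu> U s)"
    using V(5) G.mgerm_res[OF U(1) omodule_homD(1)[OF hom U(1,3)] W(1,2) sub(1)]
      G.mgerm_res[OF V(1) omodule_homD(1)[OF hom V(1,3)] W(1,2) sub(2)] by simp
qed

lemma gmap_closed:
  assumes "v \<in> carrier F.ME" shows "gmap v \<in> carrier G.ME"
proof -
  obtain U s where U: "openin (spc \<XX>) U" "F.\<eta> \<in> U" "s \<in> F.Mc U" "v = F.mg U s" by (rule F.mstalk_cases[OF assms])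
  then show ?thesis using gmap_germ[OF U(1-3)] G.mgerm_closed[OF U(1,2) omodule_homD(1)[OF hom U(1,3)]] by simp
qed

lemma gmap_smult:
  assumes "f \<in> carrier F.KK" "v \<in> carrier F.ME" shows "gmap (f \<odot>\<^bsub>F.ME\<^esub> v) = f \<odot>\<^bsub>G.ME\<^esub> gmap v"
proof -
  obtain U a s where U: "openin (spc \<XX>) U" "F.\<eta> \<in> U" "a \<in> F.Oc U" "s \<in> F.Mc U" "f = F.gm U a" "v = F.mg U s"
    by (rule F.mstalk_cases2[OF assms])
  show ?thesis
    unfolding U(5,6) F.mgerm_smult[OF U(1-4)] gmap_germ[OF U(1,2) F.msmult_closed[OF U(1,3,4)]] gmap_germ[OF U(1,2,4)]
      omodule_homD(3)[OF hom U(1,3,4)] G.mgerm_smult[OF U(1,2,3) omodule_homD(1)[OF hom U(1,4)]] ..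
qed

lemma gmap_zero: "gmap \<zero>\<^bsub>F.ME\<^esub> = \<zero>\<^bsub>G.ME\<^esub>"
proof -
  interpret K: field F.KK by (rule F.KK_field)
  show ?thesis
    using gmap_smult[OF K.zero_closed F.ME_zero_closed] F.ME_smult_zero[OF F.ME_zero_closed]
      G.ME_smult_zero[OF gmap_closed[OF F.ME_zero_closed]] by simp
qed

lemma gmap_mstk:
  assumes "v \<in> F.mstk y" shows "gmap v \<in> G.mstk y"
proof -
  obtain W s where W: "openin (spc \<XX>) W" "y \<in> W" "s \<in> F.Mc W" "v = F.mg W s" using assms by (auto simp: F.mstk_def)
  have "F.\<eta> \<in> W" using F.eta_in[OF W(1)] W(2) by blast
  then show ?thesis using gmap_germ[OF W(1) _ W(3)] G.mstkI[OF W(1,2) omodule_homD(1)[OF hom W(1,3)]] W(4) by simp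
qed

end

locale reflexive_hom = F: normal_reflexive \<XX> F + G: normal_reflexive \<XX> G + omod_hom \<XX> F G \<mu>
  for \<XX> :: "('p, 'a) ringed_space" and F :: "('p, 'a, 'm) omodule" and G :: "('p, 'a, 'n) omodule"
    and \<mu> :: "'p set \<Rightarrow> 'm \<Rightarrow> 'n"
begin

interpretation K: field F.KK by (rule F.KK_field)

text \<open>If \<open>D\<close> is the decoration of a preimage \<open>e\<close>, an
  \<open>f\<close> of order \<open>- D P\<close> carries \<open>e\<close> into the stalk at
  \<open>P\<close>, and hence also its image \<open>e'\<close>; this bounds the coefficient. For an
  \<open>f\<close> of order \<open>- D' P\<close> the element \<open>f e'\<close> lifts through the
  surjection, and dividing the lift by \<open>f\<close> attains the bound.\<close>

lemma decoration_surj: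
  assumes surj: "omodule_surj \<XX> F G \<mu>" and e': "e' \<in> carrier G.ME" and P: "prime_divisor \<XX> P"
  shows "is_maximum (coeff_at (weil_decoration \<XX> G e') P)
           {coeff_at (weil_decoration \<XX> F e) P | e. e \<in> carrier F.ME \<and> gmap e = e'}"
proof (cases "e' = \<zero>\<^bsub>G.ME\<^esub>")
  case True
  \<comment> \<open>The value infinity at zero is attained by the zero element of the
    source.\<close>
  have inf: "weil_decoration \<XX> G e' = Pinf" "weil_decoration \<XX> F \<zero>\<^bsub>F.ME\<^esub> = Pinf"
    using True by (simp_all add: weil_decoration_def generic_stalk_def)
  have "x \<le> (Pinf :: int extended)" for x by (cases x) auto
  moreover have "coeff_at (weil_decoration \<XX> G e') P = coeff_at (weil_decoration \<XX> F \<zero>\<^bsub>F.ME\<^esub>) P" using inf by simp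
  ultimately show ?thesis
    using gmap_zero F.ME_zero_closed True inf(1) unfolding is_maximum_def by (auto simp: coeff_at_def)
next
  case False
  let ?y = "F.gpt P"
  obtain D' where D': "weil_decoration \<XX> G e' = Fin D'"
    and loc': "\<And>P f. prime_divisor \<XX> P \<Longrightarrow> f \<in> carrier F.KK \<Longrightarrow> f \<noteq> \<zero>\<^bsub>F.KK\<^esub> \<Longrightarrow>
      f \<odot>\<^bsub>G.ME\<^esub> e' \<in> G.mstk (F.gpt P) \<longleftrightarrow> 0 \<le> D' P + ord_along \<XX> P f"
    by (rule G.weil_decoration_cases[OF e' False]) blast
  have upper: "\<exists>n. coeff_at (weil_decoration \<XX> F e) P = Fin n \<and> n \<le> D' P \<and>
      (\<forall>f\<in>carrier F.KK. f \<noteq> \<zero>\<^bsub>F.KK\<^esub> \<longrightarrow> (f \<odot>\<^bsub>F.ME\<^esub> e \<in> F.mstk ?y \<longleftrightarrow> 0 \<le> n + ord_along \<XX> P f))"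
    if e: "e \<in> carrier F.ME" "gmap e = e'" for e
  proof -
    have "e \<noteq> \<zero>\<^bsub>F.ME\<^esub>" using e(2) gmap_zero False by blast
    then obtain D where D: "weil_decoration \<XX> F e = Fin D"
      and loc: "\<And>P f. prime_divisor \<XX> P \<Longrightarrow> f \<in> carrier F.KK \<Longrightarrow> f \<noteq> \<zero>\<^bsub>F.KK\<^esub> \<Longrightarrow>
        f \<odot>\<^bsub>F.ME\<^esub> e \<in> F.mstk (F.gpt P) \<longleftrightarrow> 0 \<le> D P + ord_along \<XX> P f"
      by (rule F.weil_decoration_cases[OF e(1)]) blast
    obtain f where f: "f \<in> carrier F.KK" "f \<noteq> \<zero>\<^bsub>F.KK\<^esub>" "ord_along \<XX> P f = - D P" by (rule F.ord_surj[OF P])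
    have "f \<odot>\<^bsub>F.ME\<^esub> e \<in> F.mstk ?y" using loc[OF P f(1,2)] f(3) by simp
    then have "f \<odot>\<^bsub>G.ME\<^esub> e' \<in> G.mstk ?y" using gmap_mstk gmap_smult[OF f(1) e(1)] e(2) by metis
    then have "D P \<le> D' P" using loc'[OF P f(1,2)] f(3) by simp
    then show ?thesis using loc[OF P] D by (auto simp: coeff_at_def)
  qed
  obtain f where f: "f \<in> carrier F.KK" "f \<noteq> \<zero>\<^bsub>F.KK\<^esub>" "ord_along \<XX> P f = - D' P" by (rule F.ord_surj[OF P])
  have "f \<odot>\<^bsub>G.ME\<^esub> e' \<in> G.mstk ?y" using loc'[OF P f(1,2)] f(3) by simp
  then obtain N t where N: "openin (spc \<XX>) N" "?y \<in> N" "t \<in> G.Mc N" "f \<odot>\<^bsub>G.ME\<^esub> e' = G.mg N t" by (auto simp: G.mstk_def)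
  from surj[unfolded omodule_surj_def, rule_format, OF N(1,3,2)]
  obtain V where "openin (spc \<XX>) V \<and> ?y \<in> V \<and> V \<subseteq> N \<and> (\<exists>s\<in>F.Mc V. \<mu> V s = mres G N V t)" ..
  then obtain s where V: "openin (spc \<XX>) V" "?y \<in> V" "V \<subseteq> N" and s: "s \<in> F.Mc V" "\<mu> V s = mres G N V t" by blast
  have eV: "F.\<eta> \<in> V" using F.eta_in[OF V(1)] V(2) by blast
  have vV: "F.mg V s \<in> carrier F.ME" by (rule F.mgerm_closed[OF V(1) eV s(1)])
  have gv: "gmap (F.mg V s) = f \<odot>\<^bsub>G.ME\<^esub> e'"
    unfolding gmap_germ[OF V(1) eV s(1)] s(2) N(4) by (rule G.mgerm_res[OF N(1,3) V(1) eV V(3)])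
  note i = K.nonzero_inv[OF f(1,2)]
  define e where "e = inv\<^bsub>F.KK\<^esub> f \<odot>\<^bsub>F.ME\<^esub> F.mg V s"
  have e: "e \<in> carrier F.ME" unfolding e_def by (rule F.ME_smult_closed[OF i(1) vV])
  have ge: "gmap e = e'"
    unfolding e_def gmap_smult[OF i(1) vV] gv by (rule G.ME_smult_cancel(1)[OF f(1,2) e'])
  have "f \<odot>\<^bsub>F.ME\<^esub> e = F.mg V s" unfolding e_def by (rule F.ME_smult_cancel(2)[OF f(1,2) vV])
  then have fe: "f \<odot>\<^bsub>F.ME\<^esub> e \<in> F.mstk ?y" using F.mstkI[OF V(1,2) s(1)] by simp
  obtain n where n: "coeff_at (weil_decoration \<XX> F e) P = Fin n" "n \<le> D' P"
    "\<forall>f\<in>carrier F.KK. f \<noteq> \<zero>\<^bsub>F.KK\<^esub> \<longrightarrow> (f \<odot>\<^bsub>F.ME\<^esub> e \<in> F.mstk ?y \<longleftrightarrow> 0 \<le> n + ord_along \<XX> P f)"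
    using upper[OF e ge] by blast
  have "0 \<le> n + ord_along \<XX> P f" using n(3) f(1,2) fe by blast
  then have "n = D' P" using f(3) n(2) by simp
  then have att: "coeff_at (weil_decoration \<XX> G e') P = coeff_at (weil_decoration \<XX> F e) P"
    using n(1) D' by (simp add: coeff_at_def)
  show ?thesis
    unfolding is_maximum_def
  proof (intro conjI ballI)
    show "coeff_at (weil_decoration \<XX> G e') P \<in> {coeff_at (weil_decoration \<XX> F e) P | e. e \<in> carrier F.ME \<and> gmap e = e'}"
      using att e ge by blast
    fix x assume "x \<in> {coeff_at (weil_decoration \<XX> F e) P | e. e \<in> carrier F.ME \<and> gmap e = e'}"
    then obtain e1 where e1: "x = coeff_at (weil_decoration \<XX> F e1) P" "e1 \<in> carrier F.ME" "gmap e1 = e'" by blast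
    obtain m where "x = Fin m" "m \<le> D' P" using upper[OF e1(2,3)] e1(1) by auto
    then show "x \<le> coeff_at (weil_decoration \<XX> G e') P" using D' by (simp add: coeff_at_def)
  qed
qed

text \<open>The torsion-free module \<open>H\<close> need not be quasi-coherent; what makes sections of \<open>G\<close> with germ in
  the generic stalk of \<open>F\<close> lie in the kernel is that \<open>F\<close> is of finite type.\<close>

lemma decoration_kernel:
  assumes H: "is_omodule \<XX> H" and tf: "torsion_free \<XX> H" and phi: "omodule_hom \<XX> G H \<phi>"
    and ker: "is_kernel \<XX> F \<mu> G H \<phi>" and e: "e \<in> carrier F.ME"
  shows "weil_decoration \<XX> F e = weil_decoration \<XX> G (gmap e)"
proof -
  interpret H: omod \<XX> H by unfold_locales (rule H)
  have bij: "bij_betw (\<mu> U) (F.Mc U) {s \<in> G.Mc U. \<phi> U s = \<zero>\<^bsub>msec H U\<^esub>}" if "openin (spc \<XX>) U" for U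
    using ker that by (simp add: is_kernel_def kernel_omodule_def)
  \<comment> \<open>Germs of \<open>G\<close> determine sections (\<open>mg_inj\<close>), so
    injectivity of \<open>\<mu>\<close> on sections passes to the generic stalk.\<close>
  have inj: "v = w" if v: "v \<in> carrier F.ME" and w: "w \<in> carrier F.ME" and eq: "gmap v = gmap w" for v w
  proof -
    obtain U s where U: "openin (spc \<XX>) U" "F.\<eta> \<in> U" "s \<in> F.Mc U" "v = F.mg U s" by (rule F.mstalk_cases[OF v])
    obtain V t where V: "openin (spc \<XX>) V" "F.\<eta> \<in> V" "V \<subseteq> U" "t \<in> F.Mc V" "w = F.mg V t" by (rule F.mstalk_cases_in[OF w U(1,2)])
    let ?s = "mres F U V s"
    have s: "?s \<in> F.Mc V" "v = F.mg V ?s" using F.mres_closed[OF U(1) V(1,3) U(3)] F.mgerm_res[OF U(1,3) V(1,2,3)] U(4) by auto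
    have "G.mg V (\<mu> V ?s) = G.mg V (\<mu> V t)" using eq gmap_germ[OF V(1,2) s(1)] gmap_germ[OF V(1,2,4)] s(2) V(5) by simp
    then have "\<mu> V ?s = \<mu> V t" by (rule G.mg_inj[OF V(1) omodule_homD(1)[OF hom V(1) s(1)] omodule_homD(1)[OF hom V(1,4)]])
    then have "?s = t" using inj_onD[OF bij_betw_imp_inj_on[OF bij[OF V(1)]]] s(1) V(4) by blast
    then show ?thesis using s(2) V(5) by simp
  qed
  have sat: "v \<in> F.mg U ` F.Mc U \<longleftrightarrow> gmap v \<in> G.mg U ` G.Mc U"
    if U: "openin (spc \<XX>) U" "U \<noteq> {}" and v: "v \<in> carrier F.ME" for U v
  proof
    assume "v \<in> F.mg U ` F.Mc U"
    then obtain s where "s \<in> F.Mc U" "v = F.mg U s" by blast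
    then show "gmap v \<in> G.mg U ` G.Mc U" using gmap_germ[OF U(1) F.eta_in[OF U]] omodule_homD(1)[OF hom U(1)] by auto
  next
    assume "gmap v \<in> G.mg U ` G.Mc U"
    then obtain t where t: "t \<in> G.Mc U" "gmap v = G.mg U t" by blast
    have phit: "\<phi> U t \<in> H.Mc U" by (rule omodule_homD(1)[OF phi U(1) t(1)])
    have loc: "\<exists>W. openin (spc \<XX>) W \<and> y \<in> W \<and> W \<subseteq> U \<and> mres H U W (\<phi> U t) = mres H U W \<zero>\<^bsub>msec H U\<^esub>" if y: "y \<in> U" for y
    proof -
      have yt: "y \<in> topspace (spc \<XX>)" using openin_subset[OF U(1)] y by blast
      obtain h where h: "h \<in> F.stk y" "h \<noteq> \<zero>\<^bsub>F.KK\<^esub>" "h \<odot>\<^bsub>F.ME\<^esub> v \<in> F.mstk y" using F.denominator[OF F.coherent yt v] by blast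
      have hK: "h \<in> carrier F.KK" using h(1) F.stk_carrier by blast
      obtain A a where A: "openin (spc \<XX>) A" "y \<in> A" "a \<in> F.Oc A" "h = F.gm A a" using h(1) by (auto simp: F.stk_def)
      obtain B s where B: "openin (spc \<XX>) B" "y \<in> B" "s \<in> F.Mc B" "h \<odot>\<^bsub>F.ME\<^esub> v = F.mg B s" using h(3) by (auto simp: F.mstk_def)
      let ?W = "A \<inter> B \<inter> U"
      have W: "openin (spc \<XX>) ?W" "y \<in> ?W" using A B U(1) y by auto
      have sub: "?W \<subseteq> A" "?W \<subseteq> B" "?W \<subseteq> U" by auto
      have eW: "F.\<eta> \<in> ?W" using F.eta_in[OF W(1)] W(2) by blast
      interpret OW: cring "osec \<XX> ?W" by (rule F.osec_cring[OF W(1)])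
      let ?a = "ores \<XX> A ?W a" and ?s = "mres F B ?W s" and ?t = "mres G U ?W t"
      have a: "?a \<in> F.Oc ?W" "F.gm ?W ?a = h" using F.ores_closed[OF A(1) W(1) sub(1) A(3)] F.ogerm_res[OF A(1,3) W(1) eW sub(1)] A(4) by auto
      have s: "?s \<in> F.Mc ?W" "F.mg ?W ?s = h \<odot>\<^bsub>F.ME\<^esub> v" using F.mres_closed[OF B(1) W(1) sub(2) B(3)] F.mgerm_res[OF B(1,3) W(1) eW sub(2)] B(4) by auto
      have t': "?t \<in> G.Mc ?W" "G.mg ?W ?t = gmap v" using G.mres_closed[OF U(1) W(1) sub(3) t(1)] G.mgerm_res[OF U(1) t(1) W(1) eW sub(3)] t(2) by auto
      have "G.mg ?W (\<mu> ?W ?s) = h \<odot>\<^bsub>G.ME\<^esub> gmap v" using gmap_germ[OF W(1) eW s(1)] s(2) gmap_smult[OF hK v] by simp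
      also have "\<dots> = G.mg ?W (?a \<odot>\<^bsub>msec G ?W\<^esub> ?t)" using G.mgerm_smult[OF W(1) eW a(1) t'(1)] a(2) t'(2) by simp
      finally have "\<mu> ?W ?s = ?a \<odot>\<^bsub>msec G ?W\<^esub> ?t"
        by (rule G.mg_inj[OF W(1) omodule_homD(1)[OF hom W(1) s(1)] G.msmult_closed[OF W(1) a(1) t'(1)]])
      moreover have "\<mu> ?W ?s \<in> {s \<in> G.Mc ?W. \<phi> ?W s = \<zero>\<^bsub>msec H ?W\<^esub>}"
        using bij_betw_imp_surj_on[OF bij[OF W(1)]] s(1) by blast
      ultimately have "?a \<odot>\<^bsub>msec H ?W\<^esub> \<phi> ?W ?t = \<zero>\<^bsub>msec H ?W\<^esub>"
        using omodule_homD(3)[OF phi W(1) a(1) t'(1)] by simp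
      moreover have "?a \<noteq> \<zero>\<^bsub>osec \<XX> ?W\<^esub>" using a(2) h(2) F.ogerm_zero[OF W(1) eW] by metis
      ultimately have "\<phi> ?W ?t = \<zero>\<^bsub>msec H ?W\<^esub>"
        using tf W(1) a(1) omodule_homD(1)[OF phi W(1) t'(1)] unfolding torsion_free_def by blast
      then have "mres H U ?W (\<phi> U t) = mres H U ?W \<zero>\<^bsub>msec H U\<^esub>"
        using omodule_homD(4)[OF phi U(1) W(1) sub(3) t(1)] H.mres_zero[OF U(1) W(1) sub(3)] by simp
      then show ?thesis using W sub(3) by blast
    qed
    have "\<phi> U t = \<zero>\<^bsub>msec H U\<^esub>"
    proof -
      let ?C = "{W. openin (spc \<XX>) W \<and> W \<subseteq> U \<and> mres H U W (\<phi> U t) = mres H U W \<zero>\<^bsub>msec H U\<^esub>}"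
      have C: "\<Union>?C = U" using loc by blast
      show ?thesis
        by (rule sheaf_separated[OF H.msheaf, of ?C]) (use C phit H.mzero_closed[OF U(1)] in auto)
    qed
    then have "t \<in> \<mu> U ` F.Mc U" using bij_betw_imp_surj_on[OF bij[OF U(1)]] t(1) by blast
    then obtain s where s: "s \<in> F.Mc U" "t = \<mu> U s" by blast
    have "gmap v = gmap (F.mg U s)" using gmap_germ[OF U(1) F.eta_in[OF U] s(1)] t(2) s(2) by simp
    then have "v = F.mg U s" by (rule inj[OF v F.mgerm_closed[OF U(1) F.eta_in[OF U] s(1)]])
    then show "v \<in> F.mg U ` F.Mc U" using s(1) by blast
  qed
  have zero: "e = \<zero>\<^bsub>F.ME\<^esub> \<longleftrightarrow> gmap e = \<zero>\<^bsub>G.ME\<^esub>"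
    using inj[OF e F.ME_zero_closed] gmap_zero by metis
  have "{f \<in> carrier (function_field \<XX>). f \<odot>\<^bsub>generic_stalk \<XX> F\<^esub> e \<in> line_subsheaf \<XX> F e U} =
      {f \<in> carrier (function_field \<XX>). f \<odot>\<^bsub>generic_stalk \<XX> G\<^esub> gmap e \<in> line_subsheaf \<XX> G (gmap e) U}"
    if U: "openin (spc \<XX>) U" "U \<noteq> {}" for U
  proof (rule Collect_cong)
    fix f
    have "f \<odot>\<^bsub>generic_stalk \<XX> F\<^esub> e \<in> line_subsheaf \<XX> F e U \<longleftrightarrow> f \<odot>\<^bsub>generic_stalk \<XX> G\<^esub> gmap e \<in> line_subsheaf \<XX> G (gmap e) U"
      if f: "f \<in> carrier F.KK"
      unfolding F.line_sections[OF e f] G.line_sections[OF gmap_closed[OF e] f]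
        sat[OF U F.ME_smult_closed[OF f e]] gmap_smult[OF f e] ..
    then show "(f \<in> carrier (function_field \<XX>) \<and> f \<odot>\<^bsub>generic_stalk \<XX> F\<^esub> e \<in> line_subsheaf \<XX> F e U) =
        (f \<in> carrier (function_field \<XX>) \<and> f \<odot>\<^bsub>generic_stalk \<XX> G\<^esub> gmap e \<in> line_subsheaf \<XX> G (gmap e) U)"
      unfolding function_field_def by blast
  qed
  \<comment> \<open>The conditions under the two definite descriptions are equivalent for every
    \<open>D\<close>, so the descriptions coincide.\<close>
  then have "(\<forall>U. openin (spc \<XX>) U \<and> U \<noteq> {} \<longrightarrow> divisor_sheaf \<XX> D U =
        {f \<in> carrier (function_field \<XX>). f \<odot>\<^bsub>generic_stalk \<XX> F\<^esub> e \<in> line_subsheaf \<XX> F e U}) \<longleftrightarrow>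
      (\<forall>U. openin (spc \<XX>) U \<and> U \<noteq> {} \<longrightarrow> divisor_sheaf \<XX> D U =
        {f \<in> carrier (function_field \<XX>). f \<odot>\<^bsub>generic_stalk \<XX> G\<^esub> gmap e \<in> line_subsheaf \<XX> G (gmap e) U})" for D
    by simp
  then show ?thesis unfolding weil_decoration_def using zero by (simp add: generic_stalk_def)
qed

end

section \<open>Normal varieties\<close>

context integral_sch
begin

interpretation K: field KK by (rule KK_field)

text \<open>The map from the abstract local ring at \<open>x\<close> to the function field that
  sends the germ of a section at \<open>x\<close> to its generic germ. By \<open>to_K_hom\<close> it
  identifies the local ring with \<open>stk x\<close>.\<close>

definition to_K :: "'p \<Rightarrow> ('p set \<times> 'a) set \<Rightarrow> ('p set \<times> 'a) set" where
  "to_K x g = (SOME c. \<exists>U s. opn U \<and> x \<in> U \<and> s \<in> Oc U \<and> g = ogerm \<XX> x U s \<and> c = gm U s)"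

lemma to_K_germ:
  assumes U: "opn U" "x \<in> U" "s \<in> Oc U"
  shows "to_K x (ogerm \<XX> x U s) = gm U s"
proof -
  have "\<exists>c. \<exists>V t. opn V \<and> x \<in> V \<and> t \<in> Oc V \<and> ogerm \<XX> x U s = ogerm \<XX> x V t \<and> c = gm V t" using U by blast
  from someI_ex[OF this] obtain V t where V: "opn V" "x \<in> V" "t \<in> Oc V" "ogerm \<XX> x U s = ogerm \<XX> x V t"
    "to_K x (ogerm \<XX> x U s) = gm V t" unfolding to_K_def by blast
  obtain W where W: "opn W" "x \<in> W" "W \<subseteq> U \<inter> V" "ores \<XX> U W s = ores \<XX> V W t"
    using V(4) ogerm_eq_iff[OF U V(1-3)] by blast
  have sub: "W \<subseteq> U" "W \<subseteq> V" using W(3) by auto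
  have eW: "\<eta> \<in> W" using eta_in[OF W(1)] W(2) by blast
  have "gm U s = gm V t" using ogerm_res[OF U(1,3) W(1) eW sub(1)] ogerm_res[OF V(1,3) W(1) eW sub(2)] W(4) by simp
  then show ?thesis using V(5) by simp
qed

lemma to_K_hom:
  assumes x: "x \<in> topspace (spc \<XX>)"
  shows "to_K x \<in> ring_hom (stalk \<XX> x) KK" "inj_on (to_K x) (carrier (stalk \<XX> x))" "to_K x ` carrier (stalk \<XX> x) = stk x"
proof -
  let ?S = "stalk \<XX> x"
  show "to_K x \<in> ring_hom ?S KK"
  proof (rule ring_hom_memI)
    fix g assume g: "g \<in> carrier ?S"
    obtain U s where U: "opn U" "x \<in> U" "s \<in> Oc U" "g = ogerm \<XX> x U s" by (rule stalk_cases[OF g])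
    have "\<eta> \<in> U" using eta_in[OF U(1)] U(2) by blast
    then show "to_K x g \<in> carrier KK" using to_K_germ[OF U(1-3)] ogerm_closed[OF U(1) _ U(3)] U(4) by simp
    fix h assume h: "h \<in> carrier ?S"
    obtain V a b where V: "opn V" "x \<in> V" "a \<in> Oc V" "b \<in> Oc V" "g = ogerm \<XX> x V a" "h = ogerm \<XX> x V b"
      by (rule stalk_cases2[OF g h])
    interpret V: cring "osec \<XX> V" by (rule osec_cring[OF V(1)])
    have eV: "\<eta> \<in> V" using eta_in[OF V(1)] V(2) by blast
    show "to_K x (g \<otimes>\<^bsub>?S\<^esub> h) = to_K x g \<otimes>\<^bsub>KK\<^esub> to_K x h"
      unfolding V(5,6) ogerm_mult[OF V(1-4)] to_K_germ[OF V(1-3)] to_K_germ[OF V(1,2,4)]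
        to_K_germ[OF V(1,2) V.m_closed[OF V(3,4)]] ogerm_mult[OF V(1) eV V(3,4)] ..
    show "to_K x (g \<oplus>\<^bsub>?S\<^esub> h) = to_K x g \<oplus>\<^bsub>KK\<^esub> to_K x h"
      unfolding V(5,6) ogerm_add[OF V(1-4)] to_K_germ[OF V(1-3)] to_K_germ[OF V(1,2,4)]
        to_K_germ[OF V(1,2) V.a_closed[OF V(3,4)]] ogerm_add[OF V(1) eV V(3,4)] ..
  next
    let ?T = "topspace (spc \<XX>)"
    interpret T: cring "osec \<XX> ?T" by (rule osec_cring[OF openin_topspace])
    show "to_K x \<one>\<^bsub>?S\<^esub> = \<one>\<^bsub>KK\<^esub>"
      unfolding ogerm_one[OF openin_topspace x, symmetric] to_K_germ[OF openin_topspace x T.one_closed]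
      by (rule ogerm_one[OF openin_topspace eta_topspace])
  qed
  show "inj_on (to_K x) (carrier ?S)"
  proof (rule inj_onI)
    fix g h assume g: "g \<in> carrier ?S" and h: "h \<in> carrier ?S" and eq: "to_K x g = to_K x h"
    obtain V a b where V: "opn V" "x \<in> V" "a \<in> Oc V" "b \<in> Oc V" "g = ogerm \<XX> x V a" "h = ogerm \<XX> x V b"
      by (rule stalk_cases2[OF g h])
    have "gm V a = gm V b" using eq to_K_germ[OF V(1-3)] to_K_germ[OF V(1,2,4)] V(5,6) by simp
    then show "g = h" using gm_inj[OF V(1,3,4)] V(5,6) by simp
  qed
  show "to_K x ` carrier ?S = stk x"
  proof (intro equalityI subsetI)
    fix c assume "c \<in> to_K x ` carrier ?S"
    then obtain g where g: "g \<in> carrier ?S" "c = to_K x g" by blast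
    obtain U s where U: "opn U" "x \<in> U" "s \<in> Oc U" "g = ogerm \<XX> x U s" by (rule stalk_cases[OF g(1)])
    then show "c \<in> stk x" using to_K_germ[OF U(1-3)] g(2) unfolding stk_def by blast
  next
    fix c assume "c \<in> stk x"
    then obtain U s where U: "opn U" "x \<in> U" "s \<in> Oc U" "c = gm U s" by (auto simp: stk_def)
    then have "c = to_K x (ogerm \<XX> x U s)" using to_K_germ[OF U(1-3)] by simp
    then show "c \<in> to_K x ` carrier ?S" using ogerm_closed[OF U(1-3)] by (rule image_eqI)
  qed
qed

text \<open>Normality is stated in the abstract fraction field of the abstract stalk. An isomorphism
  from the function field to that fraction field carries integral equations over
  \<open>stk x\<close> to integral equations over the stalk.\<close>

lemma integrally_closed_stk:
  assumes x: "x \<in> topspace (spc \<XX>)" and ic: "integrally_closed_domain (stalk \<XX> x)"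
  shows "integrally_closed_in KK (stk x)"
proof -
  let ?S = "stalk \<XX> x" and ?j = "to_K x"
  interpret S: domain ?S using ic by (simp add: integrally_closed_domain_def)
  note j = to_K_hom[OF x]
  interpret j: ring_hom_cring ?S KK ?j
    by (intro ring_hom_cring.intro ring_hom_cring_axioms.intro S.is_cring K.is_cring j(1))
  let ?Z = "{\<zero>\<^bsub>?S\<^esub>}"
  let ?Q = "localization ?S ?Z"
  have Z: "primeideal ?Z ?S" by (rule S.zeroprimeideal)
  have jnz: "?j b \<noteq> \<zero>\<^bsub>KK\<^esub>" if "b \<in> carrier ?S - ?Z" for b
    using inj_onD[OF j(2), of b "\<zero>\<^bsub>?S\<^esub>"] that j.hom_zero by auto
  txt \<open>\<open>\<Psi> f\<close> is the element of the abstract fraction field of the stalk that corresponds to \<open>f\<close>.\<close>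
  define \<Psi> where "\<Psi> f = {(c, d). c \<in> carrier ?S \<and> d \<in> carrier ?S - ?Z \<and> f \<otimes>\<^bsub>KK\<^esub> ?j d = ?j c}" for f
  have Psi: "\<Psi> f = fraction ?S ?Z a b"
    if a: "a \<in> carrier ?S" and b: "b \<in> carrier ?S - ?Z" and f: "f \<in> carrier KK" and eq: "f \<otimes>\<^bsub>KK\<^esub> ?j b = ?j a" for f a b
  proof -
    have "f \<otimes>\<^bsub>KK\<^esub> ?j d = ?j c \<longleftrightarrow> (\<exists>u\<in>carrier ?S - ?Z. u \<otimes>\<^bsub>?S\<^esub> (a \<otimes>\<^bsub>?S\<^esub> d) = u \<otimes>\<^bsub>?S\<^esub> (c \<otimes>\<^bsub>?S\<^esub> b))"
      if c: "c \<in> carrier ?S" and d: "d \<in> carrier ?S - ?Z" for c d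
    proof -
      have bd: "b \<in> carrier ?S" "d \<in> carrier ?S" using b d by auto
      have fjd: "f \<otimes>\<^bsub>KK\<^esub> ?j d \<in> carrier KK" using f bd by simp
      have "f \<otimes>\<^bsub>KK\<^esub> ?j d = ?j c \<longleftrightarrow> ?j b \<otimes>\<^bsub>KK\<^esub> (f \<otimes>\<^bsub>KK\<^esub> ?j d) = ?j b \<otimes>\<^bsub>KK\<^esub> ?j c"
        using K.m_lcancel[OF jnz[OF b] j.hom_closed[OF bd(1)] fjd j.hom_closed[OF c]] by simp
      also have "?j b \<otimes>\<^bsub>KK\<^esub> (f \<otimes>\<^bsub>KK\<^esub> ?j d) = (f \<otimes>\<^bsub>KK\<^esub> ?j b) \<otimes>\<^bsub>KK\<^esub> ?j d" using f bd by (simp add: K.m_ac)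
      also have "\<dots> = ?j (a \<otimes>\<^bsub>?S\<^esub> d)" using eq a bd by simp
      also have "?j b \<otimes>\<^bsub>KK\<^esub> ?j c = ?j (c \<otimes>\<^bsub>?S\<^esub> b)" using bd c by (simp add: K.m_comm)
      also have "?j (a \<otimes>\<^bsub>?S\<^esub> d) = ?j (c \<otimes>\<^bsub>?S\<^esub> b) \<longleftrightarrow> a \<otimes>\<^bsub>?S\<^esub> d = c \<otimes>\<^bsub>?S\<^esub> b"
        by (rule inj_on_eq_iff[OF j(2) S.m_closed[OF a bd(2)] S.m_closed[OF c bd(1)]])
      also have "\<dots> \<longleftrightarrow> (\<exists>u\<in>carrier ?S - ?Z. u \<otimes>\<^bsub>?S\<^esub> (a \<otimes>\<^bsub>?S\<^esub> d) = u \<otimes>\<^bsub>?S\<^esub> (c \<otimes>\<^bsub>?S\<^esub> b))"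
      proof
        assume "a \<otimes>\<^bsub>?S\<^esub> d = c \<otimes>\<^bsub>?S\<^esub> b"
        then show "\<exists>u\<in>carrier ?S - ?Z. u \<otimes>\<^bsub>?S\<^esub> (a \<otimes>\<^bsub>?S\<^esub> d) = u \<otimes>\<^bsub>?S\<^esub> (c \<otimes>\<^bsub>?S\<^esub> b)"
          by (intro bexI[of _ "\<one>\<^bsub>?S\<^esub>"]) auto
      next
        assume "\<exists>u\<in>carrier ?S - ?Z. u \<otimes>\<^bsub>?S\<^esub> (a \<otimes>\<^bsub>?S\<^esub> d) = u \<otimes>\<^bsub>?S\<^esub> (c \<otimes>\<^bsub>?S\<^esub> b)"
        then show "a \<otimes>\<^bsub>?S\<^esub> d = c \<otimes>\<^bsub>?S\<^esub> b" using S.m_lcancel a bd c by auto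
      qed
      finally show ?thesis .
    qed
    then show ?thesis unfolding \<Psi>_def using fraction_alt[OF S.is_cring Z a, of b] b by auto
  qed
  have rep: "\<exists>a\<in>carrier ?S. \<exists>b\<in>carrier ?S - ?Z. f \<otimes>\<^bsub>KK\<^esub> ?j b = ?j a" if f: "f \<in> carrier KK" for f
  proof -
    obtain d where d: "d \<in> stk x" "d \<noteq> \<zero>\<^bsub>KK\<^esub>" "d \<otimes>\<^bsub>KK\<^esub> f \<in> stk x" using stk_frac[OF x f] by blast
    obtain b where b: "b \<in> carrier ?S" "d = ?j b" using d(1) j(3) by blast
    obtain a where a: "a \<in> carrier ?S" "d \<otimes>\<^bsub>KK\<^esub> f = ?j a" using d(3) j(3) by blast
    have "b \<noteq> \<zero>\<^bsub>?S\<^esub>" using b(2) d(2) j.hom_zero by auto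
    moreover have "f \<otimes>\<^bsub>KK\<^esub> ?j b = ?j a" using a(2) b f K.m_comm[of f "?j b"] by simp
    ultimately show ?thesis using a(1) b(1) by blast
  qed
  have Psi_j: "\<Psi> (?j a) = fraction ?S ?Z a \<one>\<^bsub>?S\<^esub>" if "a \<in> carrier ?S" for a
    by (rule Psi) (use that in auto)
  have Psi_hom: "\<Psi> \<in> ring_hom KK ?Q"
  proof (rule ring_hom_memI)
    fix f assume f: "f \<in> carrier KK"
    obtain a b where ab: "a \<in> carrier ?S" "b \<in> carrier ?S - ?Z" "f \<otimes>\<^bsub>KK\<^esub> ?j b = ?j a" using rep[OF f] by blast
    have Pf: "\<Psi> f = fraction ?S ?Z a b" by (rule Psi[OF ab(1,2) f ab(3)])
    show "\<Psi> f \<in> carrier ?Q" unfolding Pf localization_def using ab(1,2) by auto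
    fix g assume g: "g \<in> carrier KK"
    obtain c d where cd: "c \<in> carrier ?S" "d \<in> carrier ?S - ?Z" "g \<otimes>\<^bsub>KK\<^esub> ?j d = ?j c" using rep[OF g] by blast
    have Pg: "\<Psi> g = fraction ?S ?Z c d" by (rule Psi[OF cd(1,2) g cd(3)])
    have bc: "b \<in> carrier ?S" "d \<in> carrier ?S" using ab(2) cd(2) by auto
    have bd: "b \<otimes>\<^bsub>?S\<^esub> d \<in> carrier ?S - ?Z" using ab(2) cd(2) by (auto simp: S.integral_iff)
    have "(f \<otimes>\<^bsub>KK\<^esub> g) \<otimes>\<^bsub>KK\<^esub> ?j (b \<otimes>\<^bsub>?S\<^esub> d) = (f \<otimes>\<^bsub>KK\<^esub> ?j b) \<otimes>\<^bsub>KK\<^esub> (g \<otimes>\<^bsub>KK\<^esub> ?j d)"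
      using f g bc by (simp add: K.m_ac)
    also have "\<dots> = ?j (a \<otimes>\<^bsub>?S\<^esub> c)" using ab cd by simp
    finally have m: "(f \<otimes>\<^bsub>KK\<^esub> g) \<otimes>\<^bsub>KK\<^esub> ?j (b \<otimes>\<^bsub>?S\<^esub> d) = ?j (a \<otimes>\<^bsub>?S\<^esub> c)" .
    show "\<Psi> (f \<otimes>\<^bsub>KK\<^esub> g) = \<Psi> f \<otimes>\<^bsub>?Q\<^esub> \<Psi> g"
      unfolding Pf Pg fraction_mult[OF S.is_cring Z ab(1,2) cd(1,2)]
      by (rule Psi[OF S.m_closed[OF ab(1) cd(1)] bd K.m_closed[OF f g] m])
    have "(f \<oplus>\<^bsub>KK\<^esub> g) \<otimes>\<^bsub>KK\<^esub> ?j (b \<otimes>\<^bsub>?S\<^esub> d) = (f \<otimes>\<^bsub>KK\<^esub> ?j b) \<otimes>\<^bsub>KK\<^esub> ?j d \<oplus>\<^bsub>KK\<^esub> (g \<otimes>\<^bsub>KK\<^esub> ?j d) \<otimes>\<^bsub>KK\<^esub> ?j b"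
      using f g bc by (simp add: K.l_distr K.r_distr K.m_ac)
    also have "\<dots> = ?j (a \<otimes>\<^bsub>?S\<^esub> d \<oplus>\<^bsub>?S\<^esub> c \<otimes>\<^bsub>?S\<^esub> b)" using ab cd bc by simp
    finally have p: "(f \<oplus>\<^bsub>KK\<^esub> g) \<otimes>\<^bsub>KK\<^esub> ?j (b \<otimes>\<^bsub>?S\<^esub> d) = ?j (a \<otimes>\<^bsub>?S\<^esub> d \<oplus>\<^bsub>?S\<^esub> c \<otimes>\<^bsub>?S\<^esub> b)" .
    show "\<Psi> (f \<oplus>\<^bsub>KK\<^esub> g) = \<Psi> f \<oplus>\<^bsub>?Q\<^esub> \<Psi> g"
      unfolding Pf Pg fraction_add[OF S.is_cring Z ab(1,2) cd(1,2)]
      by (rule Psi[OF _ bd K.a_closed[OF f g] p]) (use ab cd bc in simp)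
  next
    show "\<Psi> \<one>\<^bsub>KK\<^esub> = \<one>\<^bsub>?Q\<^esub>" using Psi_j[OF S.one_closed] j.hom_one by (simp add: localization_def)
  qed
  have zeroQ: "\<zero>\<^bsub>?Q\<^esub> = \<Psi> \<zero>\<^bsub>KK\<^esub>" using Psi_j[OF S.zero_closed] j.hom_zero by (simp add: localization_def)
  have Psi_inj: "inj_on \<Psi> (carrier KK)"
  proof (rule inj_onI)
    fix f g assume f: "f \<in> carrier KK" and g: "g \<in> carrier KK" and eq: "\<Psi> f = \<Psi> g"
    obtain a b where ab: "a \<in> carrier ?S" "b \<in> carrier ?S - ?Z" "f \<otimes>\<^bsub>KK\<^esub> ?j b = ?j a" using rep[OF f] by blast
    have "(a, b) \<in> \<Psi> f" using ab by (simp add: \<Psi>_def)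
    then have "(a, b) \<in> \<Psi> g" using eq by simp
    then have "g \<otimes>\<^bsub>KK\<^esub> ?j b = ?j a" by (simp add: \<Psi>_def)
    then have "f \<otimes>\<^bsub>KK\<^esub> ?j b = g \<otimes>\<^bsub>KK\<^esub> ?j b" using ab(3) by simp
    then show "f = g" using K.m_rcancel[OF jnz[OF ab(2)] _ f g] ab(2) by simp
  qed
  have "\<Psi> ` carrier KK = carrier ?Q"
  proof
    show "\<Psi> ` carrier KK \<subseteq> carrier ?Q" using ring_hom_closed[OF Psi_hom] by blast
    show "carrier ?Q \<subseteq> \<Psi> ` carrier KK"
    proof
      fix q assume "q \<in> carrier ?Q"
      then obtain a b where ab: "a \<in> carrier ?S" "b \<in> carrier ?S - ?Z" "q = fraction ?S ?Z a b" by (auto simp: localization_def)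
      have jb: "?j b \<in> carrier KK" "?j a \<in> carrier KK" using ab by auto
      note i = K.nonzero_inv[OF jb(1) jnz[OF ab(2)]]
      let ?f = "?j a \<otimes>\<^bsub>KK\<^esub> inv\<^bsub>KK\<^esub> ?j b"
      have f: "?f \<in> carrier KK" "?f \<otimes>\<^bsub>KK\<^esub> ?j b = ?j a" using i jb by (auto simp: K.m_assoc)
      have "q = \<Psi> ?f" using Psi[OF ab(1,2) f] ab(3) by simp
      then show "q \<in> \<Psi> ` carrier KK" using f(1) by (rule image_eqI)
    qed
  qed
  then have "\<Psi> \<in> ring_iso KK ?Q" unfolding ring_iso_def using Psi_hom Psi_inj by (simp add: bij_betw_def)
  \<comment> \<open>The ring structure of the localization is transported along
    \<open>\<Psi>\<close>; the zero produced by the transport is then recognized as the zero of the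
    record.\<close>
  then have "cring (?Q\<lparr>zero := \<Psi> \<zero>\<^bsub>KK\<^esub>\<rparr>)" by (rule K.ring_iso_imp_img_cring)
  then have Q: "cring ?Q" unfolding zeroQ[symmetric] by simp
  interpret Psi: ring_hom_cring KK ?Q \<Psi>
    by (intro ring_hom_cring.intro ring_hom_cring_axioms.intro K.is_cring Q Psi_hom)
  have icS: "\<And>q. q \<in> carrier ?Q \<Longrightarrow>
      (\<exists>(n::nat) c. n > 0 \<and> c \<in> {..<n} \<rightarrow> carrier ?S \<and>
         q [^]\<^bsub>?Q\<^esub> n \<oplus>\<^bsub>?Q\<^esub> (\<Oplus>\<^bsub>?Q\<^esub>i\<in>{..<n}. fraction ?S ?Z (c i) \<one>\<^bsub>?S\<^esub> \<otimes>\<^bsub>?Q\<^esub> q [^]\<^bsub>?Q\<^esub> i) = \<zero>\<^bsub>?Q\<^esub>) \<Longrightarrow>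
      q \<in> (\<lambda>a. fraction ?S ?Z a \<one>\<^bsub>?S\<^esub>) ` carrier ?S"
    using ic unfolding integrally_closed_domain_def Let_def by blast
  show ?thesis
    unfolding integrally_closed_in_def
  proof (intro ballI impI)
    fix f assume f: "f \<in> carrier KK"
      and "\<exists>(n::nat) c. n > 0 \<and> c \<in> {..<n} \<rightarrow> stk x \<and>
         f [^]\<^bsub>KK\<^esub> n \<oplus>\<^bsub>KK\<^esub> (\<Oplus>\<^bsub>KK\<^esub>i\<in>{..<n}. c i \<otimes>\<^bsub>KK\<^esub> f [^]\<^bsub>KK\<^esub> i) = \<zero>\<^bsub>KK\<^esub>"
    then obtain n :: nat and c where n: "n > 0" and c: "c \<in> {..<n} \<rightarrow> stk x"
      and eq: "f [^]\<^bsub>KK\<^esub> n \<oplus>\<^bsub>KK\<^esub> (\<Oplus>\<^bsub>KK\<^esub>i\<in>{..<n}. c i \<otimes>\<^bsub>KK\<^esub> f [^]\<^bsub>KK\<^esub> i) = \<zero>\<^bsub>KK\<^esub>" by blast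
    \<comment> \<open>The coefficients, pulled back to the abstract stalk.\<close>
    define d where "d i = inv_into (carrier ?S) ?j (c i)" for i
    have d: "d i \<in> carrier ?S" "?j (d i) = c i" if "i < n" for i
      using c that j(3) inv_into_into[of "c i" ?j "carrier ?S"] f_inv_into_f[of "c i" ?j "carrier ?S"]
      by (auto simp: d_def)
    have cK: "c i \<in> carrier KK" if "i < n" for i using c that stk_carrier by blast
    have fin: "(\<lambda>i. c i \<otimes>\<^bsub>KK\<^esub> f [^]\<^bsub>KK\<^esub> i) \<in> {..<n} \<rightarrow> carrier KK" using cK f by auto
    have "\<Psi> (\<Oplus>\<^bsub>KK\<^esub>i\<in>{..<n}. c i \<otimes>\<^bsub>KK\<^esub> f [^]\<^bsub>KK\<^esub> i) = (\<Oplus>\<^bsub>?Q\<^esub>i\<in>{..<n}. (\<Psi> \<circ> (\<lambda>i. c i \<otimes>\<^bsub>KK\<^esub> f [^]\<^bsub>KK\<^esub> i)) i)"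
      by (rule Psi.hom_finsum[OF fin])
    also have "\<dots> = (\<Oplus>\<^bsub>?Q\<^esub>i\<in>{..<n}. fraction ?S ?Z (d i) \<one>\<^bsub>?S\<^esub> \<otimes>\<^bsub>?Q\<^esub> \<Psi> f [^]\<^bsub>?Q\<^esub> i)"
    proof (rule Psi.S.finsum_cong')
      have t: "\<Psi> (c i \<otimes>\<^bsub>KK\<^esub> f [^]\<^bsub>KK\<^esub> i) = fraction ?S ?Z (d i) \<one>\<^bsub>?S\<^esub> \<otimes>\<^bsub>?Q\<^esub> \<Psi> f [^]\<^bsub>?Q\<^esub> i" if "i < n" for i
        using Psi.hom_mult[OF cK[OF that] K.nat_pow_closed[OF f]] Psi.hom_pow[OF f] Psi_j[OF d(1)[OF that]] d(2)[OF that] by simp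
      show "\<And>i. i \<in> {..<n} \<Longrightarrow> (\<Psi> \<circ> (\<lambda>i. c i \<otimes>\<^bsub>KK\<^esub> f [^]\<^bsub>KK\<^esub> i)) i = fraction ?S ?Z (d i) \<one>\<^bsub>?S\<^esub> \<otimes>\<^bsub>?Q\<^esub> \<Psi> f [^]\<^bsub>?Q\<^esub> i"
        using t by simp
      show "(\<lambda>i. fraction ?S ?Z (d i) \<one>\<^bsub>?S\<^esub> \<otimes>\<^bsub>?Q\<^esub> \<Psi> f [^]\<^bsub>?Q\<^esub> i) \<in> {..<n} \<rightarrow> carrier ?Q"
      proof (rule funcsetI)
        fix i assume "i \<in> {..<n}"
        then have i: "i < n" by simp
        show "fraction ?S ?Z (d i) \<one>\<^bsub>?S\<^esub> \<otimes>\<^bsub>?Q\<^esub> \<Psi> f [^]\<^bsub>?Q\<^esub> i \<in> carrier ?Q"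
          unfolding t[OF i, symmetric]
          by (rule Psi.hom_closed[OF K.m_closed[OF cK[OF i] K.nat_pow_closed[OF f]]])
      qed
    qed simp
    finally have sum: "\<Psi> (\<Oplus>\<^bsub>KK\<^esub>i\<in>{..<n}. c i \<otimes>\<^bsub>KK\<^esub> f [^]\<^bsub>KK\<^esub> i) =
      (\<Oplus>\<^bsub>?Q\<^esub>i\<in>{..<n}. fraction ?S ?Z (d i) \<one>\<^bsub>?S\<^esub> \<otimes>\<^bsub>?Q\<^esub> \<Psi> f [^]\<^bsub>?Q\<^esub> i)" .
    have "\<Psi> f [^]\<^bsub>?Q\<^esub> n \<oplus>\<^bsub>?Q\<^esub> (\<Oplus>\<^bsub>?Q\<^esub>i\<in>{..<n}. fraction ?S ?Z (d i) \<one>\<^bsub>?S\<^esub> \<otimes>\<^bsub>?Q\<^esub> \<Psi> f [^]\<^bsub>?Q\<^esub> i) = \<zero>\<^bsub>?Q\<^esub>"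
    proof -
      have "\<Psi> (f [^]\<^bsub>KK\<^esub> n) \<oplus>\<^bsub>?Q\<^esub> \<Psi> (\<Oplus>\<^bsub>KK\<^esub>i\<in>{..<n}. c i \<otimes>\<^bsub>KK\<^esub> f [^]\<^bsub>KK\<^esub> i) = \<zero>\<^bsub>?Q\<^esub>"
        unfolding Psi.hom_add[OF K.nat_pow_closed[OF f] K.finsum_closed[OF fin], symmetric] eq zeroQ by (rule refl)
      then show ?thesis unfolding sum Psi.hom_pow[OF f] .
    qed
    moreover have "d \<in> {..<n} \<rightarrow> carrier ?S" using d(1) by auto
    ultimately have "\<Psi> f \<in> (\<lambda>a. fraction ?S ?Z a \<one>\<^bsub>?S\<^esub>) ` carrier ?S"
      by (intro icS[OF Psi.hom_closed[OF f]]) (use n in blast)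
    then obtain a where a: "a \<in> carrier ?S" "\<Psi> f = fraction ?S ?Z a \<one>\<^bsub>?S\<^esub>" by blast
    then have "\<Psi> f = \<Psi> (?j a)" using Psi_j by simp
    then have "f = ?j a" using inj_onD[OF Psi_inj] f a(1) j.hom_closed by blast
    then show "f \<in> stk x" using a(1) j(3) by blast
  qed
qed

end

section \<open>From varieties over a field to Noetherian normal schemes\<close>

lemma (in field) primeideal_eq_zero:
  assumes "primeideal q R" shows "q = {\<zero>}"
proof -
  have "q \<in> {I. ideal I R}" using primeideal.axioms(1)[OF assms] by simp
  then have "q = {\<zero>} \<or> q = carrier R" unfolding all_ideals by simp
  then show ?thesis using primeideal.I_notcarr[OF assms] by blast
qed

text \<open>The spectrum of a field is one point, so a section is one fraction \<open>a/c\<close>,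
  and \<open>c\<close> is invertible.\<close>

lemma field_spec_sections:
  assumes k: "field k" and V: "openin (zariski k) V" "{\<zero>\<^bsub>k\<^esub>} \<in> V" and b: "b \<in> carrier (osec (Spec k) V)"
  shows "\<exists>a\<in>carrier k. b = frac_section k V a \<one>\<^bsub>k\<^esub>"
proof -
  interpret k: field k by (rule k)
  have kc: "cring k" by (rule k.is_cring)
  have Vs: "V = {{\<zero>\<^bsub>k\<^esub>}}" using V(2) zariski_prime[OF kc V(1)] k.primeideal_eq_zero by blast
  obtain W a c where W: "openin (zariski k) W" "{\<zero>\<^bsub>k\<^esub>} \<in> W" "W \<subseteq> V" "a \<in> carrier k" "c \<in> carrier k"
    "\<And>q. q \<in> W \<Longrightarrow> c \<notin> q" "ores (Spec k) V W b = frac_section k W a c"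
    by (rule spec_section_local[OF kc b V(2)]) blast
  have WV: "W = V" using W(2,3) Vs by blast
  have "b \<in> extensional V" using b by (simp add: Spec_def spec_sections_def PiE_def)
  then have bb: "b = frac_section k V a c" using W(7) unfolding WV by (simp add: Spec_def extensional_restrict)
  have c0: "c \<noteq> \<zero>\<^bsub>k\<^esub>" using W(6)[OF W(2)] by blast
  have ic: "inv\<^bsub>k\<^esub> c \<in> carrier k" "inv\<^bsub>k\<^esub> c \<otimes>\<^bsub>k\<^esub> c = \<one>\<^bsub>k\<^esub>" using k.nonzero_inv[OF W(5) c0] by auto
  have one: "\<one>\<^bsub>k\<^esub> \<notin> q" if "q \<in> V" for q using k.primeideal_compl(1)[OF zariski_prime[OF kc V(1) that]] .
  have "frac_section k V a c = frac_section k V (a \<otimes>\<^bsub>k\<^esub> inv\<^bsub>k\<^esub> c) \<one>\<^bsub>k\<^esub>"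
    by (rule frac_section_cong[OF kc V(1) W(4,5) W(6)[unfolded WV] _ _ one])
      (use W(4,5) ic in \<open>auto simp: k.m_assoc\<close>)
  then show ?thesis using bb W(4) ic(1) by blast
qed

text \<open>Finite type provides a finite affine cover whose coordinate rings are generated by
  finitely many elements over the image of \<open>k\<close>, and the Hilbert basis theorem makes
  them Noetherian.\<close>

lemma normal_variety_sch:
  fixes k :: "'k ring" and \<XX> :: "('p, 'a) ringed_space"
  assumes k: "field k" and X: "normal_variety k \<XX> \<pi>"
  shows "normal_sch \<XX>"
proof -
  have int: "integral_scheme \<XX>" and nor: "normal_scheme \<XX>" and ft: "finite_type_morphism \<XX> (Spec k) \<pi>"
    using X by (simp_all add: normal_variety_def)
  interpret k: field k by (rule k)
  have kc: "cring k" by (rule k.is_cring)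
  interpret I: integral_sch \<XX> by unfold_locales (rule int)
  show ?thesis
  proof (unfold_locales)
    fix x assume x: "x \<in> topspace (spc \<XX>)"
    then have "integrally_closed_domain (stalk \<XX> x)" using nor by (simp add: normal_scheme_def)
    then show "integrally_closed_in I.KK (I.stk x)" by (rule I.integrally_closed_stk[OF x])
  next
    have mor: "is_morphism \<XX> (Spec k) \<pi>" using ft by (simp add: finite_type_morphism_def)
    have sp: "spc (Spec k) = zariski k" by (simp add: Spec_def)
    from ft[unfolded finite_type_morphism_def, THEN conjunct2]
    obtain \<V> where A: "(\<forall>V\<in>\<V>. affine_open (Spec k) V) \<and> \<Union>\<V> = topspace (spc (Spec k)) \<and>
        (\<forall>V\<in>\<V>. \<exists>\<U>. finite \<U> \<and> (\<forall>U\<in>\<U>. affine_open \<XX> U) \<and> \<Union>\<U> = preim \<XX> \<pi> V \<and>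
           (\<forall>U\<in>\<U>. \<exists>S. finite S \<and> S \<subseteq> carrier (osec \<XX> U) \<and>
              generate_ring (osec \<XX> U)
                ((\<lambda>b. ores \<XX> (preim \<XX> \<pi> V) U (comorph \<pi> V b)) ` carrier (osec (Spec k) V) \<union> S)
              = carrier (osec \<XX> U)))" ..
    note \<V> = A[THEN conjunct1, rule_format] A[THEN conjunct2, THEN conjunct1]
      and fin = A[THEN conjunct2, THEN conjunct2, rule_format]
    have top: "topspace (spc (Spec k)) = {{\<zero>\<^bsub>k\<^esub>}}"
      unfolding sp topspace_zariski[OF kc] using k.zeroprimeideal k.primeideal_eq_zero by blast
    \<comment> \<open>A member of the cover that contains the only point of the spectrum has the
      whole space as preimage, so the finite affine cover of this preimage covers
      everything.\<close>
    then obtain V where V: "V \<in> \<V>" "{\<zero>\<^bsub>k\<^esub>} \<in> V" using \<V>(2) by blast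
    have oV: "openin (zariski k) V" using \<V>(1)[OF V(1)] unfolding affine_open_def sp by blast
    have cont: "continuous_map (spc \<XX>) (spc (Spec k)) (pmap \<pi>)" using mor unfolding is_morphism_def by blast
    have "pmap \<pi> x \<in> topspace (spc (Spec k))" if "x \<in> topspace (spc \<XX>)" for x
      using continuous_map_image_subset_topspace[OF cont] that by blast
    then have preV: "preim \<XX> \<pi> V = topspace (spc \<XX>)" unfolding preim_def using V(2) top by auto
    from fin[OF V(1), unfolded preV]
    obtain \<U> where B: "finite \<U> \<and> (\<forall>U\<in>\<U>. affine_open \<XX> U) \<and> \<Union>\<U> = topspace (spc \<XX>) \<and>
      (\<forall>U\<in>\<U>. \<exists>S. finite S \<and> S \<subseteq> carrier (osec \<XX> U) \<and>
              generate_ring (osec \<XX> U)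
                ((\<lambda>b. ores \<XX> (topspace (spc \<XX>)) U (comorph \<pi> V b)) ` carrier (osec (Spec k) V) \<union> S)
              = carrier (osec \<XX> U))" ..
    note U = B[THEN conjunct1] B[THEN conjunct2, THEN conjunct1, rule_format]
        B[THEN conjunct2, THEN conjunct2, THEN conjunct1]
      and gen = B[THEN conjunct2, THEN conjunct2, THEN conjunct2, rule_format]
    have com: "comorph \<pi> V \<in> ring_hom (osec (Spec k) V) (osec \<XX> (topspace (spc \<XX>)))"
    proof -
      have "\<forall>V. openin (spc (Spec k)) V \<longrightarrow> comorph \<pi> V \<in> ring_hom (osec (Spec k) V) (osec \<XX> (preim \<XX> \<pi> V))"
        using mor unfolding is_morphism_def by (elim conjE)
      then show ?thesis using oV unfolding sp by (metis preV)
    qed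
    have noeth: "sub_noetherian I.KK (I.gm U ` I.Oc U)" if Uin: "U \<in> \<U>" and ne: "U \<noteq> {}" for U
    proof -
      have oU: "openin (spc \<XX>) U" using U(2)[OF Uin] by (simp add: affine_open_def)
      interpret O: cring "osec \<XX> U" by (rule I.osec_cring[OF oU])
      interpret K: field I.KK by (rule I.KK_field)
      interpret T: cring "osec \<XX> (topspace (spc \<XX>))" by (rule I.osec_cring[OF openin_topspace])
      obtain S where S: "finite S" "S \<subseteq> carrier (osec \<XX> U)" "generate_ring (osec \<XX> U)
                ((\<lambda>b. ores \<XX> (topspace (spc \<XX>)) U (comorph \<pi> V b)) ` carrier (osec (Spec k) V) \<union> S)
              = carrier (osec \<XX> U)" using gen[OF Uin] by blast
      have res: "ores \<XX> (topspace (spc \<XX>)) U \<in> ring_hom (osec \<XX> (topspace (spc \<XX>))) (osec \<XX> U)"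
        by (rule I.ores_hom[OF openin_topspace oU openin_subset[OF oU]])
      have hV: "(\<lambda>b. ores \<XX> (topspace (spc \<XX>)) U (comorph \<pi> V b)) \<in> ring_hom (osec (Spec k) V) (osec \<XX> U)"
        using ring_hom_trans[OF com res] by (simp add: comp_def)
      let ?\<kappa> = "\<lambda>a. ores \<XX> (topspace (spc \<XX>)) U (comorph \<pi> V (frac_section k V a \<one>\<^bsub>k\<^esub>))"
      have kap: "?\<kappa> \<in> ring_hom k (osec \<XX> U)" by (rule frac_section_hom[OF kc oV O.ring_axioms hV])
      have one: "\<one>\<^bsub>k\<^esub> \<notin> q" if "q \<in> V" for q using k.primeideal_compl(1)[OF zariski_prime[OF kc oV that]] .
      \<comment> \<open>By \<open>field_spec_sections\<close>, the scalars coming from sections over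
        \<open>V\<close> are those coming from \<open>k\<close>.\<close>
      have "(\<lambda>b. ores \<XX> (topspace (spc \<XX>)) U (comorph \<pi> V b)) ` carrier (osec (Spec k) V) = ?\<kappa> ` carrier k"
      proof (intro equalityI subsetI)
        fix y assume "y \<in> (\<lambda>b. ores \<XX> (topspace (spc \<XX>)) U (comorph \<pi> V b)) ` carrier (osec (Spec k) V)"
        then obtain b where b: "b \<in> carrier (osec (Spec k) V)" "y = ores \<XX> (topspace (spc \<XX>)) U (comorph \<pi> V b)" by blast
        then show "y \<in> ?\<kappa> ` carrier k" using field_spec_sections[OF k oV V(2) b(1)] by blast
      next
        fix y assume "y \<in> ?\<kappa> ` carrier k"
        then obtain a where "a \<in> carrier k" "y = ?\<kappa> a" by blast
        then show "y \<in> (\<lambda>b. ores \<XX> (topspace (spc \<XX>)) U (comorph \<pi> V b)) ` carrier (osec (Spec k) V)"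
          using frac_section_closed[OF kc oV _ k.one_closed one] by blast
      qed
      then have gen': "generate_ring (osec \<XX> U) (?\<kappa> ` carrier k \<union> S) = carrier (osec \<XX> U)" using S(3) by simp
      have "sub_noetherian k (carrier k)"
        by (rule k.sub_noetherian_division[OF k.carrier_is_subring]) (use k.nonzero_inv in blast)
      then have "sub_noetherian (osec \<XX> U) (?\<kappa> ` carrier k)"
        by (rule sub_noetherian_image[OF k.ring_axioms O.ring_axioms kap])
      then have "sub_noetherian (osec \<XX> U) (carrier (osec \<XX> U))"
        by (rule O.sub_noetherian_generate[OF _ S(1,2) gen'])
      then show ?thesis
        by (rule sub_noetherian_image[OF O.ring_axioms K.ring_axioms I.ogerm_hom[OF oU I.eta_in[OF oU ne]]])
    qed
    \<comment> \<open>Empty members of the cover are dropped, since a chart contains the generic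
      point.\<close>
    show "\<exists>\<C>. finite \<C> \<and> topspace (spc \<XX>) \<subseteq> \<Union>\<C> \<and>
      (\<forall>U\<in>\<C>. \<exists>\<pp>. I.chart U (I.gm U ` I.Oc U) \<pp> \<and> sub_noetherian I.KK (I.gm U ` I.Oc U))"
    proof (intro exI[of _ "\<U> - {{}}"] conjI ballI)
      show "finite (\<U> - {{}})" using U(1) by simp
      show "topspace (spc \<XX>) \<subseteq> \<Union>(\<U> - {{}})" using U(3) by blast
      fix W assume "W \<in> \<U> - {{}}"
      then have W: "W \<in> \<U>" "W \<noteq> {}" by auto
      show "\<exists>\<pp>. I.chart W (I.gm W ` I.Oc W) \<pp> \<and> sub_noetherian I.KK (I.gm W ` I.Oc W)"
        using I.chart_exists[OF U(2)[OF W(1)] W(2)] noeth[OF W] by blast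
    qed
  qed
qed

theorem theoremB:
  fixes k :: "'k ring"
    and \<XX> :: "('p, 'a) ringed_space"
    and \<pi> :: "('p, 'a, 'k set, 'k set \<Rightarrow> ('k \<times> 'k) set) morphism"
    and E :: "('p, 'a, 'm) omodule"
    and E' :: "('p, 'a, 'n) omodule"
  assumes "algebraically_closed k" and "char_zero k"
    and "normal_variety k \<XX> \<pi>"
    and "reflexive \<XX> E" and "reflexive \<XX> E'"
  shows "(\<forall>(E'' :: ('p, 'a, 'l) omodule) \<phi> \<iota>.
            is_omodule \<XX> E'' \<and> torsion_free \<XX> E'' \<and> omodule_hom \<XX> E E'' \<phi> \<and>
            is_kernel \<XX> E' \<iota> E E'' \<phi> \<longrightarrow>
            (\<forall>e\<in>carrier (generic_stalk \<XX> E').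
               weil_decoration \<XX> E' e = weil_decoration \<XX> E (generic_map \<XX> E' E \<iota> e)))
       \<and> (\<forall>\<mu>. omodule_hom \<XX> E E' \<mu> \<and> omodule_surj \<XX> E E' \<mu> \<longrightarrow>
            (\<forall>e'\<in>carrier (generic_stalk \<XX> E'). \<forall>P. prime_divisor \<XX> P \<longrightarrow>
               is_maximum (coeff_at (weil_decoration \<XX> E' e') P)
                 {coeff_at (weil_decoration \<XX> E e) P | e.
                    e \<in> carrier (generic_stalk \<XX> E) \<and> generic_map \<XX> E E' \<mu> e = e'}))"
proof -
  have "field k" using assms(1) by (rule algebraically_closed.axioms(1))
  then have N: "normal_sch \<XX>" by (rule normal_variety_sch[OF _ assms(3)])
  interpret N: normal_sch \<XX> by (rule N)
  have omE: "is_omodule \<XX> E" "is_omodule \<XX> E'" using assms(4,5) by (simp_all add: reflexive_def coherent_def)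
  interpret E: normal_reflexive \<XX> E by unfold_locales (rule omE(1), rule assms(4))
  interpret E': normal_reflexive \<XX> E' by unfold_locales (rule omE(2), rule assms(5))
  show ?thesis
    unfolding generic_stalk_def
  proof (intro conjI allI impI ballI)
    fix E'' :: "('p, 'a, 'l) omodule" and \<phi> \<iota> e
    assume a: "is_omodule \<XX> E'' \<and> torsion_free \<XX> E'' \<and> omodule_hom \<XX> E E'' \<phi> \<and> is_kernel \<XX> E' \<iota> E E'' \<phi>"
      and e: "e \<in> carrier (mstalk \<XX> E' (generic_point \<XX>))"
    then have "omodule_hom \<XX> E' E \<iota>" by (simp add: is_kernel_def)
    \<comment> \<open>The kernel is the source of its inclusion, so \<open>E'\<close> takes the
      place of \<open>F\<close> here.\<close>
    then interpret h: reflexive_hom \<XX> E' E \<iota> by unfold_locales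
    show "weil_decoration \<XX> E' e = weil_decoration \<XX> E (generic_map \<XX> E' E \<iota> e)"
      using h.decoration_kernel a e by blast
  next
    fix \<mu> e' P
    assume a: "omodule_hom \<XX> E E' \<mu> \<and> omodule_surj \<XX> E E' \<mu>"
      and e': "e' \<in> carrier (mstalk \<XX> E' (generic_point \<XX>))" and P: "prime_divisor \<XX> P"
    then interpret h: reflexive_hom \<XX> E E' \<mu> by unfold_locales simp
    show "is_maximum (coeff_at (weil_decoration \<XX> E' e') P)
       {coeff_at (weil_decoration \<XX> E e) P | e. e \<in> carrier (mstalk \<XX> E (generic_point \<XX>)) \<and> generic_map \<XX> E E' \<mu> e = e'}"
      using h.decoration_surj a e' P by blast
  qed
qed

end
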